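(* Let $\Lambda=\begin{pmatrix} A & N\\ M & B\end{pmatrix}$ be a null-square projective algebra where $A$ and $B$ are basic finite dimensional algebras over a perfect field $k$, and where $M$ and $N$ are finitely generated projective bimodules given by $$M=\bigoplus_{(g,e)\in F\times E}{}_gm_e\,(Bg\otimes eA),\qquad N=\bigoplus_{(f,h)\in E\times F}{}_fn_h\,(Af\otimes hB),$$ with $E$ and $F$ complete sets of primitive orthogonal idempotents of $A$ and $B$ respectively, and ${}_gm_e$, ${}_fn_h$ non-negative integers. If $HH_n(\Lambda)=0$ for $n$ large enough, then $H_0\left(A,(N\otimes_BM)^{\otimes_A n}\right)=0$ for all $n>0$, and $(N\otimes_BM)^{\otimes_A n}=0$ for $n$ large enough.
   Context: Here $\otimes=\otimes_k$, and ${}_gm_e\,(Bg\otimes eA)$ denotes the direct sum of ${}_gm_e$ copies of the bimodule $Bg\otimes eA$. Given $k$-algebras $A$, $B$, a $B$-$A$-bimodule $M$ and an $A$-$B$-bimodule $N$, the null-square algebra $\begin{pmatrix} A & N\\ M & B\end{pmatrix}$ is the algebra of such matrices with matrix multiplication given by the products of $A$ and $B$, the bimodule structures, and $mn=0$, $nm=0$ for all $m\in M$, $n\in N$. It is null-square projective if $M$ and $N$ are projective bimodules. Basic means Morita reduced (the quotient by the Jacobson radical is a product of division algebras). $HH_n(\Lambda)=\mathrm{Tor}_n^{\Lambda\otimes\Lambda^{\mathrm{op}}}(\Lambda,\Lambda)$ is Hochschild homology, and for an $A$-bimodule $Z$, $H_0(A,Z)=Z/\langle az-za\mid a\in A,z\in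 Z\rangle$. *)

theory Defs
  imports
    "HOL-Algebra.Free_Abelian_Groups"
    "HOL-Algebra.QuotRing"
    "HOL-Algebra.Chinese_Remainder"
    "HOL-Algebra.Module"
    "HOL-Algebra.Elementary_Groups"
    "HOL-Computational_Algebra.Primes"
begin

text \<open>
  Rings and algebras are records with explicit carriers, not necessarily commutative, and possibly
  zero. Modules and bimodules follow the convention of \<^theory>\<open>HOL-Algebra.Module\<close>: the record
  extends \<^typ>\<open>'m ring\<close>, but only the additive structure is meaningful; where a module or bimodule
  is constructed, the fields \<^const>\<open>monoid.mult\<close> and \<^const>\<open>one\<close> carry no information.
\<close>


section \<open>Fields, algebras, modules and bimodules\<close>

text \<open>The Frobenius endomorphism is surjective in every positive characteristic; the condition is
  empty in characteristic zero.\<close>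

definition perfect_field :: "('k, 'u) ring_scheme \<Rightarrow> bool" where
  "perfect_field K \<longleftrightarrow> field K \<and>
     (\<forall>p::nat. Factorial_Ring.prime p \<longrightarrow> add_pow K p \<one>\<^bsub>K\<^esub> = \<zero>\<^bsub>K\<^esub> \<longrightarrow>
        (\<forall>x\<in>carrier K. \<exists>y\<in>carrier K. y [^]\<^bsub>K\<^esub> p = x))"

definition k_algebra :: "('k, 'u) ring_scheme \<Rightarrow> ('k, 'a, 'v) module_scheme \<Rightarrow> bool" where
  "k_algebra K A \<longleftrightarrow> field K \<and> ring A \<and> module K A \<and>
     (\<forall>c\<in>carrier K. \<forall>x\<in>carrier A. \<forall>y\<in>carrier A.
        (c \<odot>\<^bsub>A\<^esub> x) \<otimes>\<^bsub>A\<^esub> y = c \<odot>\<^bsub>A\<^esub> (x \<otimes>\<^bsub>A\<^esub> y) \<and>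
        x \<otimes>\<^bsub>A\<^esub> (c \<odot>\<^bsub>A\<^esub> y) = c \<odot>\<^bsub>A\<^esub> (x \<otimes>\<^bsub>A\<^esub> y))"

definition finite_dimensional_algebra ::
    "('k, 'u) ring_scheme \<Rightarrow> ('k, 'a, 'v) module_scheme \<Rightarrow> bool" where
  "finite_dimensional_algebra K A \<longleftrightarrow> k_algebra K A \<and>
     (\<exists>S. finite S \<and> S \<subseteq> carrier A \<and>
        (\<forall>x\<in>carrier A. \<exists>c\<in>S \<rightarrow> carrier K. x = (\<Oplus>\<^bsub>A\<^esub>s\<in>S. c s \<odot>\<^bsub>A\<^esub> s)))"

definition op_ring :: "('a, 'v) ring_scheme \<Rightarrow> ('a, 'v) ring_scheme" where
  "op_ring A = A\<lparr>monoid.mult := \<lambda>x y. y \<otimes>\<^bsub>A\<^esub> x\<rparr>"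

text \<open>The library locale \<^locale>\<open>module\<close> requires a commutative ring of scalars. A right module over
  \<open>R\<close> is a left module over \<open>op_ring R\<close>.\<close>

locale left_module = R?: ring R + M?: abelian_group M for R (structure) and M (structure) +
  assumes smult_closed:
      "\<lbrakk>a \<in> carrier R; x \<in> carrier M\<rbrakk> \<Longrightarrow> a \<odot>\<^bsub>M\<^esub> x \<in> carrier M"
    and smult_l_distr:
      "\<lbrakk>a \<in> carrier R; b \<in> carrier R; x \<in> carrier M\<rbrakk> \<Longrightarrow>
       (a \<oplus> b) \<odot>\<^bsub>M\<^esub> x = a \<odot>\<^bsub>M\<^esub> x \<oplus>\<^bsub>M\<^esub> b \<odot>\<^bsub>M\<^esub> x"
    and smult_r_distr:
      "\<lbrakk>a \<in> carrier R; x \<in> carrier M; y \<in> carrier M\<rbrakk> \<Longrightarrow>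
       a \<odot>\<^bsub>M\<^esub> (x \<oplus>\<^bsub>M\<^esub> y) = a \<odot>\<^bsub>M\<^esub> x \<oplus>\<^bsub>M\<^esub> a \<odot>\<^bsub>M\<^esub> y"
    and smult_assoc:
      "\<lbrakk>a \<in> carrier R; b \<in> carrier R; x \<in> carrier M\<rbrakk> \<Longrightarrow>
       (a \<otimes> b) \<odot>\<^bsub>M\<^esub> x = a \<odot>\<^bsub>M\<^esub> (b \<odot>\<^bsub>M\<^esub> x)"
    and smult_one:
      "x \<in> carrier M \<Longrightarrow> \<one> \<odot>\<^bsub>M\<^esub> x = x"

record ('b, 'a, 'm) bimodule = "'m ring" +
  lact :: "'b \<Rightarrow> 'm \<Rightarrow> 'm"
  ract :: "'m \<Rightarrow> 'a \<Rightarrow> 'm"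

definition left_part :: "('b, 'a, 'm, 'w) bimodule_scheme \<Rightarrow> ('b, 'm) module" where
  "left_part M = \<lparr>carrier = carrier M, monoid.mult = monoid.mult M, one = one M, zero = zero M, add = add M,
                  smult = lact M\<rparr>"

definition right_part :: "('b, 'a, 'm, 'w) bimodule_scheme \<Rightarrow> ('a, 'm) module" where
  "right_part M = \<lparr>carrier = carrier M, monoid.mult = monoid.mult M, one = one M, zero = zero M, add = add M,
                   smult = (\<lambda>a x. ract M x a)\<rparr>"

text \<open>\<open>B\<close>-\<open>A\<close>-bimodules over \<open>K\<close>, on which \<open>K\<close> acts in the same way from both sides; these are the
  same as left modules over \<open>B \<otimes>\<^sub>K A\<^sup>o\<^sup>p\<close>.\<close>

definition is_bimodule :: "('k, 'u) ring_scheme \<Rightarrow> ('k, 'b, 'v) module_scheme \<Rightarrow>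
    ('k, 'a, 'w) module_scheme \<Rightarrow> ('b, 'a, 'm, 'z) bimodule_scheme \<Rightarrow> bool" where
  "is_bimodule K B A M \<longleftrightarrow>
     left_module B (left_part M) \<and> left_module (op_ring A) (right_part M) \<and>
     (\<forall>b\<in>carrier B. \<forall>x\<in>carrier M. \<forall>a\<in>carrier A. ract M (lact M b x) a = lact M b (ract M x a)) \<and>
     (\<forall>c\<in>carrier K. \<forall>x\<in>carrier M. lact M (c \<odot>\<^bsub>B\<^esub> \<one>\<^bsub>B\<^esub>) x = ract M x (c \<odot>\<^bsub>A\<^esub> \<one>\<^bsub>A\<^esub>))"

definition regular_bimodule :: "('a, 'v) ring_scheme \<Rightarrow> ('a, 'a, 'a) bimodule" where
  "regular_bimodule A = \<lparr>carrier = carrier A, monoid.mult = monoid.mult A, one = one A, zero = zero A,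
                         add = add A, lact = monoid.mult A, ract = monoid.mult A\<rparr>"

definition bimodule_isomorphic :: "('k, 'b, 'v) module_scheme \<Rightarrow> ('k, 'a, 'w) module_scheme \<Rightarrow>
    ('b, 'a, 'm, 'y) bimodule_scheme \<Rightarrow> ('b, 'a, 'n, 'z) bimodule_scheme \<Rightarrow> bool" where
  "bimodule_isomorphic B A M N \<longleftrightarrow>
     (\<exists>\<phi>. bij_betw \<phi> (carrier M) (carrier N) \<and>
        (\<forall>x\<in>carrier M. \<forall>y\<in>carrier M. \<phi> (x \<oplus>\<^bsub>M\<^esub> y) = \<phi> x \<oplus>\<^bsub>N\<^esub> \<phi> y) \<and>
        (\<forall>b\<in>carrier B. \<forall>x\<in>carrier M. \<phi> (lact M b x) = lact N b (\<phi> x)) \<and>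
        (\<forall>x\<in>carrier M. \<forall>a\<in>carrier A. \<phi> (ract M x a) = ract N (\<phi> x) a))"

text \<open>Used for finite index sets only, where the direct sum is the product.\<close>

definition bimodule_sum :: "'i set \<Rightarrow> ('i \<Rightarrow> ('b, 'a, 'm) bimodule) \<Rightarrow> ('b, 'a, 'i \<Rightarrow> 'm) bimodule" where
  "bimodule_sum I X = \<lparr>carrier = (\<Pi>\<^sub>E i\<in>I. carrier (X i)), monoid.mult = undefined, one = undefined,
     zero = (\<lambda>i\<in>I. \<zero>\<^bsub>X i\<^esub>), add = (\<lambda>u v. \<lambda>i\<in>I. u i \<oplus>\<^bsub>X i\<^esub> v i),
     lact = (\<lambda>b u. \<lambda>i\<in>I. lact (X i) b (u i)), ract = (\<lambda>u a. \<lambda>i\<in>I. ract (X i) (u i) a)\<rparr>"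


section \<open>Basic algebras and idempotents\<close>

definition left_ideal :: "('a, 'v) ring_scheme \<Rightarrow> 'a set \<Rightarrow> bool" where
  "left_ideal A I \<longleftrightarrow> additive_subgroup I A \<and> (\<forall>a\<in>carrier A. \<forall>x\<in>I. a \<otimes>\<^bsub>A\<^esub> x \<in> I)"

definition maximal_left_ideal :: "('a, 'v) ring_scheme \<Rightarrow> 'a set \<Rightarrow> bool" where
  "maximal_left_ideal A I \<longleftrightarrow> left_ideal A I \<and> I \<noteq> carrier A \<and>
     (\<forall>J. left_ideal A J \<longrightarrow> I \<subseteq> J \<longrightarrow> J = I \<or> J = carrier A)"

definition jacobson_radical :: "('a, 'v) ring_scheme \<Rightarrow> 'a set" where
  "jacobson_radical A = carrier A \<inter> \<Inter>{I. maximal_left_ideal A I}"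

definition division_ring :: "('a, 'v) ring_scheme \<Rightarrow> bool" where
  "division_ring D \<longleftrightarrow> ring D \<and> \<one>\<^bsub>D\<^esub> \<noteq> \<zero>\<^bsub>D\<^esub> \<and> Units D = carrier D - {\<zero>\<^bsub>D\<^esub>}"

text \<open>An isomorphism of rings suffices: it transports the structure of an algebra over the ground
  field to the factors. Each factor is a quotient of \<open>A\<close>, so that its elements can be taken to be
  subsets of \<open>A\<close>.\<close>

definition basic_algebra :: "('a, 'v) ring_scheme \<Rightarrow> bool" where
  "basic_algebra A \<longleftrightarrow>
     (\<exists>Ds :: 'a set ring list. (\<forall>D\<in>set Ds. division_ring D) \<and>
        A Quot jacobson_radical A \<simeq> RDirProd_list Ds)"

definition idempotent :: "('a, 'v) ring_scheme \<Rightarrow> 'a \<Rightarrow> bool" where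
  "idempotent A e \<longleftrightarrow> e \<in> carrier A \<and> e \<otimes>\<^bsub>A\<^esub> e = e"

definition orthogonal :: "('a, 'v) ring_scheme \<Rightarrow> 'a \<Rightarrow> 'a \<Rightarrow> bool" where
  "orthogonal A e f \<longleftrightarrow> e \<otimes>\<^bsub>A\<^esub> f = \<zero>\<^bsub>A\<^esub> \<and> f \<otimes>\<^bsub>A\<^esub> e = \<zero>\<^bsub>A\<^esub>"

definition primitive_idempotent :: "('a, 'v) ring_scheme \<Rightarrow> 'a \<Rightarrow> bool" where
  "primitive_idempotent A e \<longleftrightarrow> idempotent A e \<and> e \<noteq> \<zero>\<^bsub>A\<^esub> \<and>
     \<not> (\<exists>x y. idempotent A x \<and> idempotent A y \<and> x \<noteq> \<zero>\<^bsub>A\<^esub> \<and> y \<noteq> \<zero>\<^bsub>A\<^esub> \<and>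
              orthogonal A x y \<and> e = x \<oplus>\<^bsub>A\<^esub> y)"

definition complete_primitive_orthogonal_idempotents ::
    "('a, 'v) ring_scheme \<Rightarrow> 'a set \<Rightarrow> bool" where
  "complete_primitive_orthogonal_idempotents A E \<longleftrightarrow>
     finite E \<and> (\<forall>e\<in>E. primitive_idempotent A e) \<and>
     (\<forall>e\<in>E. \<forall>f\<in>E. e \<noteq> f \<longrightarrow> orthogonal A e f) \<and> (\<Oplus>\<^bsub>A\<^esub>e\<in>E. e) = \<one>\<^bsub>A\<^esub>"


section \<open>Tensor products\<close>

text \<open>Abelian groups by generators and relations, written multiplicatively as in
  \<^const>\<open>free_Abelian_group\<close>; elements are cosets. \<open>presented_map\<close> is the homomorphism into
  \<open>presented_group S Rel\<close> induced by a map \<open>f\<close> of generators that respects the relations.\<close>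

definition rel_subgroup :: "'s set \<Rightarrow> ('s \<Rightarrow>\<^sub>0 int) set \<Rightarrow> ('s \<Rightarrow>\<^sub>0 int) set" where
  "rel_subgroup S Rel = generate (free_Abelian_group S) Rel"

definition presented_group :: "'s set \<Rightarrow> ('s \<Rightarrow>\<^sub>0 int) set \<Rightarrow> ('s \<Rightarrow>\<^sub>0 int) set monoid" where
  "presented_group S Rel = free_Abelian_group S Mod rel_subgroup S Rel"

definition presented_class :: "'s set \<Rightarrow> ('s \<Rightarrow>\<^sub>0 int) set \<Rightarrow> ('s \<Rightarrow>\<^sub>0 int) \<Rightarrow> ('s \<Rightarrow>\<^sub>0 int) set" where
  "presented_class S Rel c = rel_subgroup S Rel #>\<^bsub>free_Abelian_group S\<^esub> c"

definition presented_map ::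
    "'s set \<Rightarrow> ('s \<Rightarrow>\<^sub>0 int) set \<Rightarrow> ('t \<Rightarrow> 's) \<Rightarrow> ('t \<Rightarrow>\<^sub>0 int) set \<Rightarrow> ('s \<Rightarrow>\<^sub>0 int) set" where
  "presented_map S Rel f U = (\<Union>c\<in>U. presented_class S Rel (frag_extend (frag_of \<circ> f) c))"

text \<open>\<open>X \<otimes>\<^sub>R Y\<close> for a right action \<open>xr\<close> of \<open>R\<close> on \<open>X\<close> and a left action \<open>yl\<close> of \<open>R\<close> on \<open>Y\<close>.\<close>

definition tensor_rels :: "('r, 'u) ring_scheme \<Rightarrow> ('x, 'v) ring_scheme \<Rightarrow> ('x \<Rightarrow> 'r \<Rightarrow> 'x) \<Rightarrow>
    ('y, 'w) ring_scheme \<Rightarrow> ('r \<Rightarrow> 'y \<Rightarrow> 'y) \<Rightarrow> ('x \<times> 'y \<Rightarrow>\<^sub>0 int) set" where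
  "tensor_rels R X xr Y yl =
     {frag_of (x \<oplus>\<^bsub>X\<^esub> x', y) - frag_of (x, y) - frag_of (x', y) | x x' y.
        x \<in> carrier X \<and> x' \<in> carrier X \<and> y \<in> carrier Y} \<union>
     {frag_of (x, y \<oplus>\<^bsub>Y\<^esub> y') - frag_of (x, y) - frag_of (x, y') | x y y'.
        x \<in> carrier X \<and> y \<in> carrier Y \<and> y' \<in> carrier Y} \<union>
     {frag_of (xr x r, y) - frag_of (x, yl r y) | x r y.
        x \<in> carrier X \<and> r \<in> carrier R \<and> y \<in> carrier Y}"

definition tensor_group :: "('r, 'u) ring_scheme \<Rightarrow> ('x, 'v) ring_scheme \<Rightarrow> ('x \<Rightarrow> 'r \<Rightarrow> 'x) \<Rightarrow>
    ('y, 'w) ring_scheme \<Rightarrow> ('r \<Rightarrow> 'y \<Rightarrow> 'y) \<Rightarrow> ('x \<times> 'y \<Rightarrow>\<^sub>0 int) set monoid" where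
  "tensor_group R X xr Y yl = presented_group (carrier X \<times> carrier Y) (tensor_rels R X xr Y yl)"

definition tensor_bimodule :: "('r, 'u) ring_scheme \<Rightarrow> ('b, 'r, 'x) bimodule \<Rightarrow>
    ('r, 'a, 'y) bimodule \<Rightarrow> ('b, 'a, ('x \<times> 'y \<Rightarrow>\<^sub>0 int) set) bimodule" where
  "tensor_bimodule R X Y =
     (let Q = tensor_group R X (ract X) Y (lact Y);
          S = carrier X \<times> carrier Y;
          Rel = tensor_rels R X (ract X) Y (lact Y)
      in \<lparr>carrier = carrier Q, monoid.mult = undefined, one = undefined,
          zero = \<one>\<^bsub>Q\<^esub>, add = monoid.mult Q,
          lact = (\<lambda>b. presented_map S Rel (\<lambda>(x, y). (lact X b x, y))),
          ract = (\<lambda>U a. presented_map S Rel (\<lambda>(x, y). (x, ract Y y a)) U)\<rparr>)"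

text \<open>The \<open>n\<close>-fold tensor product of an \<open>A\<close>-bimodule over \<open>A\<close>, for \<open>n > 0\<close>. An iteration of
  \<^const>\<open>tensor_bimodule\<close> would change the type at each step, so all factors are treated at once:
  the generator \<open>[x\<^sub>1, \<dots>, x\<^sub>n]\<close> stands for \<open>x\<^sub>1 \<otimes> \<dots> \<otimes> x\<^sub>n\<close>, and the relations are additivity in
  each entry and balancedness between consecutive entries. The value at \<open>n = 0\<close>, which should be
  \<open>A\<close>, is not meaningful here.\<close>

definition tensor_power_gens :: "('a, 'a, 't) bimodule \<Rightarrow> nat \<Rightarrow> 't list set" where
  "tensor_power_gens T n = {xs. length xs = n \<and> set xs \<subseteq> carrier T}"

definition tensor_power_rels ::
    "('a, 'v) ring_scheme \<Rightarrow> ('a, 'a, 't) bimodule \<Rightarrow> nat \<Rightarrow> ('t list \<Rightarrow>\<^sub>0 int) set" where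
  "tensor_power_rels A T n =
     {frag_of (us @ [x \<oplus>\<^bsub>T\<^esub> y] @ vs) - frag_of (us @ [x] @ vs) - frag_of (us @ [y] @ vs) | us x y vs.
        us @ [x] @ vs \<in> tensor_power_gens T n \<and> y \<in> carrier T} \<union>
     {frag_of (us @ [ract T x a, y] @ vs) - frag_of (us @ [x, lact T a y] @ vs) | us x a y vs.
        us @ [x, y] @ vs \<in> tensor_power_gens T n \<and> a \<in> carrier A}"

definition tensor_power :: "('a, 'v) ring_scheme \<Rightarrow> ('a, 'a, 't) bimodule \<Rightarrow> nat \<Rightarrow>
    ('a, 'a, ('t list \<Rightarrow>\<^sub>0 int) set) bimodule" where
  "tensor_power A T n =
     (let S = tensor_power_gens T n;
          Rel = tensor_power_rels A T n;
          Q = presented_group S Rel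
      in \<lparr>carrier = carrier Q, monoid.mult = undefined, one = undefined,
          zero = \<one>\<^bsub>Q\<^esub>, add = monoid.mult Q,
          lact = (\<lambda>a. presented_map S Rel (\<lambda>xs. lact T a (hd xs) # tl xs)),
          ract = (\<lambda>U a. presented_map S Rel (\<lambda>xs. butlast xs @ [ract T (last xs) a]) U)\<rparr>)"

definition H_zero :: "('a, 'v) ring_scheme \<Rightarrow> ('a, 'a, 'z, 'w) bimodule_scheme \<Rightarrow> 'z set monoid" where
  "H_zero A Z = add_monoid Z Mod generate (add_monoid Z)
     {lact Z a z \<ominus>\<^bsub>Z\<^esub> ract Z z a | a z. a \<in> carrier A \<and> z \<in> carrier Z}"

definition left_ideal_bimodule :: "('k, 'b, 'v) module_scheme \<Rightarrow> 'b \<Rightarrow> ('b, 'k, 'b) bimodule" where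
  "left_ideal_bimodule B g = \<lparr>carrier = {b \<otimes>\<^bsub>B\<^esub> g | b. b \<in> carrier B}, monoid.mult = monoid.mult B, one = one B,
     zero = zero B, add = add B, lact = monoid.mult B, ract = (\<lambda>x c. c \<odot>\<^bsub>B\<^esub> x)\<rparr>"

definition right_ideal_bimodule :: "('k, 'a, 'v) module_scheme \<Rightarrow> 'a \<Rightarrow> ('k, 'a, 'a) bimodule" where
  "right_ideal_bimodule A e = \<lparr>carrier = {e \<otimes>\<^bsub>A\<^esub> a | a. a \<in> carrier A}, monoid.mult = monoid.mult A, one = one A,
     zero = zero A, add = add A, lact = smult A, ract = monoid.mult A\<rparr>"

text \<open>The direct sum over \<open>(g, e) \<in> F \<times> E\<close> of \<open>m g e\<close> copies of \<open>B g \<otimes>\<^sub>K e A\<close>.\<close>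

definition standard_projective_bimodule :: "('k, 'u) ring_scheme \<Rightarrow> ('k, 'b, 'v) module_scheme \<Rightarrow>
    ('k, 'a, 'w) module_scheme \<Rightarrow> 'b set \<Rightarrow> 'a set \<Rightarrow> ('b \<Rightarrow> 'a \<Rightarrow> nat) \<Rightarrow>
    ('b, 'a, 'b \<times> 'a \<times> nat \<Rightarrow> ('b \<times> 'a \<Rightarrow>\<^sub>0 int) set) bimodule" where
  "standard_projective_bimodule K B A F E m =
     bimodule_sum {(g, e, i). g \<in> F \<and> e \<in> E \<and> i < m g e}
       (\<lambda>(g, e, i). tensor_bimodule K (left_ideal_bimodule B g) (right_ideal_bimodule A e))"


section \<open>Tensor products of algebras, and bimodules as modules\<close>

definition tensor_algebra_mult :: "('b, 'v) ring_scheme \<Rightarrow> ('a, 'w) ring_scheme \<Rightarrow>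
    ('b \<times> 'a \<Rightarrow>\<^sub>0 int) \<Rightarrow> ('b \<times> 'a \<Rightarrow>\<^sub>0 int) \<Rightarrow> ('b \<times> 'a \<Rightarrow>\<^sub>0 int)" where
  "tensor_algebra_mult B A c d =
     frag_extend (\<lambda>(b, a). frag_extend (\<lambda>(b', a'). frag_of (b \<otimes>\<^bsub>B\<^esub> b', a \<otimes>\<^bsub>A\<^esub> a')) d) c"

text \<open>The ring \<open>B \<otimes>\<^sub>K A\<close> with \<open>(b \<otimes> a)(b' \<otimes> a') = bb' \<otimes> aa'\<close>.\<close>

definition tensor_algebra :: "('k, 'u) ring_scheme \<Rightarrow> ('k, 'b, 'v) module_scheme \<Rightarrow>
    ('k, 'a, 'w) module_scheme \<Rightarrow> ('b \<times> 'a \<Rightarrow>\<^sub>0 int) set ring" where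
  "tensor_algebra K B A =
     (let S = carrier B \<times> carrier A;
          Rel = tensor_rels K B (\<lambda>b k. k \<odot>\<^bsub>B\<^esub> b) A (smult A);
          Q = presented_group S Rel
      in \<lparr>carrier = carrier Q,
          monoid.mult = (\<lambda>U V. \<Union>c\<in>U. \<Union>d\<in>V. presented_class S Rel (tensor_algebra_mult B A c d)),
          one = presented_class S Rel (frag_of (\<one>\<^bsub>B\<^esub>, \<one>\<^bsub>A\<^esub>)),
          zero = \<one>\<^bsub>Q\<^esub>, add = monoid.mult Q\<rparr>)"

text \<open>The value at a coset \<open>U\<close> of the additive map into \<open>X\<close> induced by a balanced map \<open>\<phi>\<close>: the sum
  below has the same value for all representatives \<open>c\<close> of \<open>U\<close>.\<close>

definition tensor_eval :: "('m, 'w) ring_scheme \<Rightarrow> ('s \<Rightarrow> 'm) \<Rightarrow> ('s \<Rightarrow>\<^sub>0 int) set \<Rightarrow> 'm" where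
  "tensor_eval X \<phi> U =
     the_elem ((\<lambda>c. \<Oplus>\<^bsub>X\<^esub>s\<in>Poly_Mapping.keys c. add_pow X (Poly_Mapping.lookup c s) (\<phi> s)) ` U)"

text \<open>A \<open>B\<close>-\<open>A\<close>-bimodule as a left \<open>B \<otimes> A\<^sup>o\<^sup>p\<close>-module by \<open>(b \<otimes> a) x = b x a\<close>, and an
  \<open>A\<close>-\<open>B\<close>-bimodule as a right \<open>B \<otimes> A\<^sup>o\<^sup>p\<close>-module by \<open>x (b \<otimes> a) = a x b\<close>. The latter is represented
  as a left module over the opposite ring of \<open>B \<otimes> A\<^sup>o\<^sup>p\<close>.\<close>

definition bimodule_as_left_module ::
    "('b, 'a, 'm, 'w) bimodule_scheme \<Rightarrow> (('b \<times> 'a \<Rightarrow>\<^sub>0 int) set, 'm) module" where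
  "bimodule_as_left_module X = \<lparr>carrier = carrier X, monoid.mult = monoid.mult X, one = one X, zero = zero X,
     add = add X, smult = (\<lambda>U x. tensor_eval X (\<lambda>(b, a). ract X (lact X b x) a) U)\<rparr>"

definition bimodule_as_right_module ::
    "('a, 'b, 'm, 'w) bimodule_scheme \<Rightarrow> (('b \<times> 'a \<Rightarrow>\<^sub>0 int) set, 'm) module" where
  "bimodule_as_right_module X = \<lparr>carrier = carrier X, monoid.mult = monoid.mult X, one = one X, zero = zero X,
     add = add X, smult = (\<lambda>U x. tensor_eval X (\<lambda>(b, a). ract X (lact X a x) b) U)\<rparr>"


section \<open>Projective modules, Tor and Hochschild homology\<close>

definition linear_map :: "('r, 'u) ring_scheme \<Rightarrow> ('r, 'x, 'v) module_scheme \<Rightarrow>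
    ('r, 'y, 'w) module_scheme \<Rightarrow> ('x \<Rightarrow> 'y) \<Rightarrow> bool" where
  "linear_map R X Y f \<longleftrightarrow> f \<in> carrier X \<rightarrow> carrier Y \<and>
     (\<forall>x\<in>carrier X. \<forall>y\<in>carrier X. f (x \<oplus>\<^bsub>X\<^esub> y) = f x \<oplus>\<^bsub>Y\<^esub> f y) \<and>
     (\<forall>r\<in>carrier R. \<forall>x\<in>carrier X. f (r \<odot>\<^bsub>X\<^esub> x) = r \<odot>\<^bsub>Y\<^esub> f x)"

definition free_module :: "('r, 'u) ring_scheme \<Rightarrow> 's set \<Rightarrow> ('r, 's \<Rightarrow> 'r) module" where
  "free_module R S = \<lparr>carrier = {f. range f \<subseteq> carrier R \<and> (\<forall>s. s \<notin> S \<longrightarrow> f s = \<zero>\<^bsub>R\<^esub>) \<and>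
                                   finite {s. f s \<noteq> \<zero>\<^bsub>R\<^esub>}},
     monoid.mult = undefined, one = undefined, zero = (\<lambda>s. \<zero>\<^bsub>R\<^esub>), add = (\<lambda>f g s. f s \<oplus>\<^bsub>R\<^esub> g s),
     smult = (\<lambda>r f s. r \<otimes>\<^bsub>R\<^esub> f s)\<rparr>"

text \<open>Projective means direct summand of a free module. A basis inside the type of \<open>P\<close> is no
  restriction, since every module is a quotient of the free module on its own carrier.\<close>

definition projective_module :: "('r, 'u) ring_scheme \<Rightarrow> ('r, 'p) module \<Rightarrow> bool" where
  "projective_module R P \<longleftrightarrow> left_module R P \<and>
     (\<exists>(S :: 'p set) i q. linear_map R P (free_module R S) i \<and> linear_map R (free_module R S) P q \<and>
        (\<forall>x\<in>carrier P. q (i x) = x))"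

text \<open>The sequence \<open>\<dots> \<rightarrow> P 2 \<rightarrow> P 1 \<rightarrow> P 0 \<rightarrow> Y \<rightarrow> 0\<close> is exact, with \<open>d n : P (n + 1) \<rightarrow> P n\<close> and
  \<open>\<epsilon> : P 0 \<rightarrow> Y\<close>.\<close>

definition projective_resolution :: "('r, 'u) ring_scheme \<Rightarrow> ('r, 'y) module \<Rightarrow>
    (nat \<Rightarrow> ('r, 'p) module) \<Rightarrow> (nat \<Rightarrow> 'p \<Rightarrow> 'p) \<Rightarrow> ('p \<Rightarrow> 'y) \<Rightarrow> bool" where
  "projective_resolution R Y P d \<epsilon> \<longleftrightarrow>
     left_module R Y \<and> (\<forall>n. projective_module R (P n)) \<and>
     (\<forall>n. linear_map R (P (Suc n)) (P n) (d n)) \<and> linear_map R (P 0) Y \<epsilon> \<and>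
     \<epsilon> ` carrier (P 0) = carrier Y \<and>
     {x \<in> carrier (P 0). \<epsilon> x = \<zero>\<^bsub>Y\<^esub>} = d 0 ` carrier (P 1) \<and>
     (\<forall>n. {x \<in> carrier (P (Suc n)). d n x = \<zero>\<^bsub>P n\<^esub>} = d (Suc n) ` carrier (P (Suc (Suc n))))"

text \<open>For a right \<open>R\<close>-module \<open>X\<close> (a left \<open>op_ring R\<close>-module) and a projective resolution \<open>P, d\<close> of a
  left \<open>R\<close>-module \<open>Y\<close>, \<open>Tor R X P d n\<close> is the \<open>n\<close>-th homology of the complex \<open>X \<otimes>\<^sub>R P\<close>, that is
  \<open>Tor\<^sub>n\<^sup>R(X, Y)\<close> computed from that resolution. By the comparison theorem it does not depend on the
  resolution, up to isomorphism.\<close>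

definition Tor_chain :: "('r, 'u) ring_scheme \<Rightarrow> ('r, 'x) module \<Rightarrow> (nat \<Rightarrow> ('r, 'p) module) \<Rightarrow>
    nat \<Rightarrow> ('x \<times> 'p \<Rightarrow>\<^sub>0 int) set monoid" where
  "Tor_chain R X P n = tensor_group R X (\<lambda>x r. r \<odot>\<^bsub>X\<^esub> x) (P n) (smult (P n))"

definition Tor_boundary :: "('r, 'u) ring_scheme \<Rightarrow> ('r, 'x) module \<Rightarrow> (nat \<Rightarrow> ('r, 'p) module) \<Rightarrow>
    (nat \<Rightarrow> 'p \<Rightarrow> 'p) \<Rightarrow> nat \<Rightarrow> ('x \<times> 'p \<Rightarrow>\<^sub>0 int) set \<Rightarrow> ('x \<times> 'p \<Rightarrow>\<^sub>0 int) set" where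
  "Tor_boundary R X P d n =
     presented_map (carrier X \<times> carrier (P n)) (tensor_rels R X (\<lambda>x r. r \<odot>\<^bsub>X\<^esub> x) (P n) (smult (P n)))
       (\<lambda>(x, p). (x, d n p))"

fun Tor_cycles :: "('r, 'u) ring_scheme \<Rightarrow> ('r, 'x) module \<Rightarrow> (nat \<Rightarrow> ('r, 'p) module) \<Rightarrow>
    (nat \<Rightarrow> 'p \<Rightarrow> 'p) \<Rightarrow> nat \<Rightarrow> ('x \<times> 'p \<Rightarrow>\<^sub>0 int) set set" where
  "Tor_cycles R X P d 0 = carrier (Tor_chain R X P 0)"
| "Tor_cycles R X P d (Suc n) =
     kernel (Tor_chain R X P (Suc n)) (Tor_chain R X P n) (Tor_boundary R X P d n)"

definition Tor :: "('r, 'u) ring_scheme \<Rightarrow> ('r, 'x) module \<Rightarrow> (nat \<Rightarrow> ('r, 'p) module) \<Rightarrow>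
    (nat \<Rightarrow> 'p \<Rightarrow> 'p) \<Rightarrow> nat \<Rightarrow> ('x \<times> 'p \<Rightarrow>\<^sub>0 int) set set monoid" where
  "Tor R X P d n = (Tor_chain R X P n)\<lparr>carrier := Tor_cycles R X P d n\<rparr> Mod
                   Tor_boundary R X P d n ` carrier (Tor_chain R X P (Suc n))"

definition enveloping_algebra ::
    "('k, 'u) ring_scheme \<Rightarrow> ('k, 'l) module \<Rightarrow> ('l \<times> 'l \<Rightarrow>\<^sub>0 int) set ring" where
  "enveloping_algebra K L = tensor_algebra K L (op_ring L)"

definition hochschild_resolution :: "('k, 'u) ring_scheme \<Rightarrow> ('k, 'l) module \<Rightarrow>
    (nat \<Rightarrow> (('l \<times> 'l \<Rightarrow>\<^sub>0 int) set, 'p) module) \<Rightarrow> (nat \<Rightarrow> 'p \<Rightarrow> 'p) \<Rightarrow> ('p \<Rightarrow> 'l) \<Rightarrow> bool" where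
  "hochschild_resolution K L P d \<epsilon> \<longleftrightarrow>
     projective_resolution (enveloping_algebra K L)
       (bimodule_as_left_module (regular_bimodule L)) P d \<epsilon>"

text \<open>\<open>HH\<^sub>n(L) = Tor\<^sub>n(L, L)\<close> over \<open>L \<otimes> L\<^sup>o\<^sup>p\<close>, computed from a projective resolution \<open>P, d\<close> of \<open>L\<close>.\<close>

definition HH :: "('k, 'u) ring_scheme \<Rightarrow> ('k, 'l) module \<Rightarrow>
    (nat \<Rightarrow> (('l \<times> 'l \<Rightarrow>\<^sub>0 int) set, 'p) module) \<Rightarrow> (nat \<Rightarrow> 'p \<Rightarrow> 'p) \<Rightarrow> nat \<Rightarrow>
    ('l \<times> 'p \<Rightarrow>\<^sub>0 int) set set monoid" where
  "HH K L P d n =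
     Tor (enveloping_algebra K L) (bimodule_as_right_module (regular_bimodule L)) P d n"


section \<open>Null-square algebras\<close>

text \<open>The quadruple \<open>(a, n, m, b)\<close> is the matrix with rows \<open>(a, n)\<close> and \<open>(m, b)\<close>.\<close>

definition null_square_algebra :: "('k, 'a) module \<Rightarrow> ('k, 'b) module \<Rightarrow> ('b, 'a, 'm) bimodule \<Rightarrow>
    ('a, 'b, 'n) bimodule \<Rightarrow> ('k, 'a \<times> 'n \<times> 'm \<times> 'b) module" where
  "null_square_algebra A B M N =
     \<lparr>carrier = carrier A \<times> carrier N \<times> carrier M \<times> carrier B,
      monoid.mult = (\<lambda>(a, n, m, b) (a', n', m', b').
        (a \<otimes>\<^bsub>A\<^esub> a', lact N a n' \<oplus>\<^bsub>N\<^esub> ract N n b', ract M m a' \<oplus>\<^bsub>M\<^esub> lact M b m', b \<otimes>\<^bsub>B\<^esub> b')),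
      one = (\<one>\<^bsub>A\<^esub>, \<zero>\<^bsub>N\<^esub>, \<zero>\<^bsub>M\<^esub>, \<one>\<^bsub>B\<^esub>),
      zero = (\<zero>\<^bsub>A\<^esub>, \<zero>\<^bsub>N\<^esub>, \<zero>\<^bsub>M\<^esub>, \<zero>\<^bsub>B\<^esub>),
      add = (\<lambda>(a, n, m, b) (a', n', m', b').
        (a \<oplus>\<^bsub>A\<^esub> a', n \<oplus>\<^bsub>N\<^esub> n', m \<oplus>\<^bsub>M\<^esub> m', b \<oplus>\<^bsub>B\<^esub> b')),
      smult = (\<lambda>c (a, n, m, b).
        (c \<odot>\<^bsub>A\<^esub> a, lact N (c \<odot>\<^bsub>A\<^esub> \<one>\<^bsub>A\<^esub>) n, lact M (c \<odot>\<^bsub>B\<^esub> \<one>\<^bsub>B\<^esub>) m, c \<odot>\<^bsub>B\<^esub> b))\<rparr>"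

definition projective_bimodule :: "('k, 'u) ring_scheme \<Rightarrow> ('k, 'b, 'v) module_scheme \<Rightarrow>
    ('k, 'a, 'w) module_scheme \<Rightarrow> ('b, 'a, 'm) bimodule \<Rightarrow> bool" where
  "projective_bimodule K B A M \<longleftrightarrow>
     is_bimodule K B A M \<and>
     projective_module (tensor_algebra K B (op_ring A)) (bimodule_as_left_module M)"

text \<open>The data of a null-square projective algebra.\<close>

definition null_square_projective :: "('k, 'u) ring_scheme \<Rightarrow> ('k, 'a) module \<Rightarrow> ('k, 'b) module \<Rightarrow>
    ('b, 'a, 'm) bimodule \<Rightarrow> ('a, 'b, 'n) bimodule \<Rightarrow> bool" where
  "null_square_projective K A B M N \<longleftrightarrow> k_algebra K A \<and> k_algebra K B \<and>
     projective_bimodule K B A M \<and> projective_bimodule K A B N"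

end

theory Submission
  imports Defs
begin

text \<open>
  The summands of \<open>N\<close> are the vertices of a quiver: there is an edge from \<open>A f \<otimes> h B\<close> to
  \<open>A f' \<otimes> h' B\<close> if \<open>h B g\<close> and \<open>e A f'\<close> are nonzero for some summand \<open>B g \<otimes> e A\<close> of \<open>M\<close>. The tensor
  powers of \<open>N \<otimes> M\<close> are generated by words that follow paths in this quiver. If it is acyclic, long
  words vanish, and every word is a commutator, because moving its last coefficient to the front
  gives zero. It remains to see that a loop makes \<open>HH\<^sub>n(\<Lambda>)\<close> nonzero for infinitely many \<open>n\<close>.

  A shortest loop through a vertex gives elements \<open>j\<^sub>k\<close> of \<open>N \<oplus> M\<close>, periodic in \<open>k\<close> with an even
  period \<open>l\<close>, whose products all vanish. By exactness, a projective resolution \<open>P\<close> of \<open>\<Lambda>\<close> contains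
  elements with \<open>d w(n,k) = j\<^sub>k w(n-1,k+1) + (-1)\<^sup>n w(n-1,k) j\<^sub>k\<^sub>+\<^sub>n\<^sub>-\<^sub>1\<close>, and for \<open>n\<close> a multiple of \<open>l\<close> the
  alternating sum of the \<open>1 \<otimes> w(n,k)\<close> over \<open>k < l\<close> is a cycle of \<open>\<Lambda> \<otimes> P\<close>.

  To see that it is not a boundary, let \<open>C = A \<times> B\<close>, regarded as a quotient of \<open>\<Lambda>\<close>. If \<open>N \<oplus> M\<close> maps
  \<open>V\<close> to \<open>W\<close>, for \<open>C\<close>-bimodules \<open>V\<close> and \<open>W\<close>, then \<open>V \<oplus> W\<close> becomes an extension of \<open>V\<close> by \<open>W\<close> over \<open>\<Lambda>\<close>,
  and a bimodule map \<open>P\<^sub>n \<rightarrow> V\<close> that vanishes on boundaries shifts to such a map \<open>P\<^sub>n\<^sub>+\<^sub>1 \<rightarrow> W\<close>.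
  Starting from bilinear forms on \<open>\<Lambda>\<close>, contracting with one letter of the loop in each step and closing
  up the cyclic word in the last one, one arrives at a functional on \<open>\<Lambda> \<otimes> P\<^sub>n\<close> that vanishes on
  boundaries and takes the value \<open>1\<close> on the cycle. Only the summand \<open>k = 0\<close> contributes, as the loop
  returns to its first vertex only at its end.
\<close>

section \<open>Presented abelian groups\<close>

text \<open>The resolution is arbitrary, so there is no explicit complex to compute in. The guide is
  the bar resolution: \<open>w n k\<close> stands for the chain
  \<open>1[j_k|...|j_(k+n-1)]1\<close>, whose boundary keeps only its two outer terms because the
  letters multiply to zero. The cycle is the sum over the rotations of a cyclic word. Rotating a
  word of length \<open>n\<close> carries the sign \<open>(-1)^(n-1)\<close>, which is
  \<open>-1\<close> here since letters from \<open>N\<close> and \<open>M\<close> alternate and the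
  period is even; this is why the sum alternates and closes up.

  For the functional, a comparison map to another resolution would bring in choices up to homotopy.
  Shifting through one extension at a time avoids them: letters act as zero on
  \<open>C\<close>-bimodules, so the value of the shifted map at \<open>w\<close> is forced by the
  twist of the extension, whatever lift was chosen. Each contraction pairs the tail of one letter
  with the head of the next by a linear form normalized to \<open>1\<close>; such forms exist
  because a link of the quiver is witnessed by a nonzero vector.\<close>

lemma presented_class_alt:
  "presented_class S Rel c = {x. x - c \<in> rel_subgroup S Rel}"
  unfolding presented_class_def r_coset_def by force

lemma carrier_presented_group:
  "carrier (presented_group S Rel) = presented_class S Rel ` carrier (free_Abelian_group S)"
  unfolding presented_group_def presented_class_def FactGroup_def RCOSETS_def by auto

lemma one_presented_group: "\<one>\<^bsub>presented_group S Rel\<^esub> = rel_subgroup S Rel"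
  by (simp add: presented_group_def FactGroup_def)

lemma presented_class_zero: "presented_class S Rel 0 = rel_subgroup S Rel"
  by (simp add: presented_class_alt)

locale presentation =
  fixes S :: "'s set" and Rel :: "('s \<Rightarrow>\<^sub>0 int) set"
  assumes Rel_sub: "Rel \<subseteq> carrier (free_Abelian_group S)"
begin

abbreviation "H \<equiv> rel_subgroup S Rel"
abbreviation "cls \<equiv> presented_class S Rel"
abbreviation "Q \<equiv> presented_group S Rel"

lemma subgroup_H: "subgroup H (free_Abelian_group S)"
  unfolding rel_subgroup_def by (rule group.generate_is_subgroup[OF group_free_Abelian_group Rel_sub])

lemma H_closed:
  shows H_zero: "0 \<in> H" and H_add: "x \<in> H \<Longrightarrow> y \<in> H \<Longrightarrow> x + y \<in> H"
    and H_keys: "x \<in> H \<Longrightarrow> Poly_Mapping.keys x \<subseteq> S"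
    and H_uminus: "x \<in> H \<Longrightarrow> - x \<in> H" and H_diff: "x \<in> H \<Longrightarrow> y \<in> H \<Longrightarrow> x - y \<in> H"
proof -
  show 0: "0 \<in> H" using subgroup.one_closed[OF subgroup_H] by simp
  show a: "x \<in> H \<Longrightarrow> y \<in> H \<Longrightarrow> x + y \<in> H" for x y using subgroup.m_closed[OF subgroup_H] by simp
  show k: "x \<in> H \<Longrightarrow> Poly_Mapping.keys x \<subseteq> S" for x
    using subsetD[OF subgroup.subset[OF subgroup_H], of x] by simp
  show u: "x \<in> H \<Longrightarrow> - x \<in> H" for x
    using subgroup.m_inv_closed[OF subgroup_H, of x] k[of x] by simp
  show "x \<in> H \<Longrightarrow> y \<in> H \<Longrightarrow> x - y \<in> H" using a[of x "- y"] u[of y] by simp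
qed

lemma Rel_keys: "r \<in> Rel \<Longrightarrow> Poly_Mapping.keys r \<subseteq> S"
  using subsetD[OF Rel_sub] by simp

lemma Rel_in_H: "r \<in> Rel \<Longrightarrow> r \<in> H"
  unfolding rel_subgroup_def by (rule generate.incl)

lemma H_frag_cmul: "x \<in> H \<Longrightarrow> frag_cmul k x \<in> H"
  by (rule frag_closure_minus_cmul) (auto intro: H_zero H_diff)

lemma cls_eq_iff: "cls c = cls d \<longleftrightarrow> c - d \<in> H"
proof
  assume "cls c = cls d"
  moreover have "c \<in> cls c" by (simp add: presented_class_alt H_zero)
  ultimately show "c - d \<in> H" by (simp add: presented_class_alt)
next
  assume cd: "c - d \<in> H"
  have "x - c \<in> H \<longleftrightarrow> x - d \<in> H" for x
    using H_add[OF _ cd, of "x - c"] H_diff[OF _ cd, of "x - d"] by (auto simp: algebra_simps)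
  then show "cls c = cls d" by (simp add: presented_class_alt)
qed

lemma cls_self: "c \<in> cls c" by (simp add: presented_class_alt H_zero)

lemma cls_memD: "x \<in> cls c \<Longrightarrow> cls x = cls c"
  unfolding cls_eq_iff by (simp add: presented_class_alt)

lemma cls_keys: "x \<in> cls c \<Longrightarrow> Poly_Mapping.keys c \<subseteq> S \<Longrightarrow> Poly_Mapping.keys x \<subseteq> S"
proof -
  assume "x \<in> cls c" and c: "Poly_Mapping.keys c \<subseteq> S"
  then have "Poly_Mapping.keys (x - c) \<subseteq> S" by (simp add: presented_class_alt H_keys)
  with c show ?thesis using keys_add[of "x - c" c] by auto
qed

lemma comm_group_Q: "comm_group Q"
  unfolding presented_group_def by (rule comm_group.abelian_FactGroup[OF abelian_free_Abelian_group subgroup_H])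

lemma group_Q: "group Q" using comm_group_Q comm_group.axioms(2) by blast

lemma cls_closed: "Poly_Mapping.keys c \<subseteq> S \<Longrightarrow> cls c \<in> carrier Q"
  by (auto simp: carrier_presented_group)

lemma cls_of_closed: "s \<in> S \<Longrightarrow> cls (frag_of s) \<in> carrier Q"
  by (rule cls_closed) simp

lemma Q_cases: "U \<in> carrier Q \<Longrightarrow> (\<And>c. Poly_Mapping.keys c \<subseteq> S \<Longrightarrow> U = cls c \<Longrightarrow> thesis) \<Longrightarrow> thesis"
  by (auto simp: carrier_presented_group)

lemma cls_add:
  assumes "Poly_Mapping.keys c \<subseteq> S" "Poly_Mapping.keys d \<subseteq> S"
  shows "cls (c + d) = cls c \<otimes>\<^bsub>Q\<^esub> cls d"
proof -
  interpret comm_group "free_Abelian_group S" by (rule abelian_free_Abelian_group)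
  have "H \<lhd> free_Abelian_group S" by (rule subgroup_imp_normal[OF subgroup_H])
  from normal.rcos_sum[OF this, of c d] assms show ?thesis
    by (simp add: presented_group_def presented_class_def FactGroup_def)
qed

lemma cls_zero: "cls 0 = \<one>\<^bsub>Q\<^esub>" by (simp add: presented_class_zero one_presented_group)

lemma cls_uminus:
  assumes "Poly_Mapping.keys c \<subseteq> S" shows "cls (- c) = inv\<^bsub>Q\<^esub> cls c"
proof -
  interpret group Q by (rule group_Q)
  have "cls (- c) \<otimes>\<^bsub>Q\<^esub> cls c = \<one>\<^bsub>Q\<^esub>" using cls_add[of "- c" c] assms by (simp add: cls_zero)
  then show ?thesis using assms by (intro inv_equality[symmetric]) (simp_all add: cls_closed)
qed

lemma cls_one_iff: "cls c = \<one>\<^bsub>Q\<^esub> \<longleftrightarrow> c \<in> H"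
  unfolding cls_zero[symmetric] cls_eq_iff by simp

lemma Q_generated:
  assumes "subgroup X Q" and "\<And>s. s \<in> S \<Longrightarrow> cls (frag_of s) \<in> X"
  shows "carrier Q \<subseteq> X"
proof
  fix U assume "U \<in> carrier Q"
  then obtain c where c: "Poly_Mapping.keys c \<subseteq> S" and U: "U = cls c" by (rule Q_cases)
  interpret X: subgroup X Q by fact
  interpret group Q by (rule group_Q)
  have "cls (x - y) \<in> X" if "Poly_Mapping.keys x \<subseteq> S" "Poly_Mapping.keys y \<subseteq> S" "cls x \<in> X" "cls y \<in> X" for x y
    using cls_add[of x "- y"] that by (simp add: cls_uminus X.m_closed X.m_inv_closed)
  then have "cls c \<in> X"
    by (intro free_Abelian_group_induct[OF c, of "\<lambda>c. cls c \<in> X"]) (use assms(2) X.one_closed in \<open>auto simp: cls_zero\<close>)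
  with U show "U \<in> X" by simp
qed

lemma Q_induct [consumes 1, case_names gen one mult inverse]:
  assumes "U \<in> carrier Q"
    and "\<And>s. s \<in> S \<Longrightarrow> Pr (cls (frag_of s))" "Pr \<one>\<^bsub>Q\<^esub>"
    and "\<And>x y. x \<in> carrier Q \<Longrightarrow> y \<in> carrier Q \<Longrightarrow> Pr x \<Longrightarrow> Pr y \<Longrightarrow> Pr (x \<otimes>\<^bsub>Q\<^esub> y)"
    and "\<And>x. x \<in> carrier Q \<Longrightarrow> Pr x \<Longrightarrow> Pr (inv\<^bsub>Q\<^esub> x)"
  shows "Pr U"
proof -
  interpret group Q by (rule group_Q)
  have "subgroup {x \<in> carrier Q. Pr x} Q" by unfold_locales (use assms in auto)
  from Q_generated[OF this] show ?thesis using assms(1,2) by (auto simp: cls_of_closed)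
qed

lemma Q_hom_eq:
  assumes f: "f \<in> hom Q G" and g: "g \<in> hom Q G" and G: "group G"
    and eq: "\<And>s. s \<in> S \<Longrightarrow> f (cls (frag_of s)) = g (cls (frag_of s))" and U: "U \<in> carrier Q"
  shows "f U = g U"
proof -
  interpret f: group_hom Q G f using f G group_Q by (simp add: group_hom_def group_hom_axioms_def)
  interpret g: group_hom Q G g using g G group_Q by (simp add: group_hom_def group_hom_axioms_def)
  from U show ?thesis by (induction rule: Q_induct) (auto simp: eq)
qed

end

subsection \<open>Evaluation of cosets\<close>

text \<open>This is the sum inside \<open>tensor_eval\<close>, isolated so that it can be shown to
  be a homomorphism before it is evaluated on cosets.\<close>

definition frag_eval :: "('m, 'w) ring_scheme \<Rightarrow> ('s \<Rightarrow> 'm) \<Rightarrow> ('s \<Rightarrow>\<^sub>0 int) \<Rightarrow> 'm" where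
  "frag_eval X \<phi> c = (\<Oplus>\<^bsub>X\<^esub>s\<in>Poly_Mapping.keys c. add_pow X (Poly_Mapping.lookup c s) (\<phi> s))"

context abelian_group begin

lemma add_pow_int_closed: "x \<in> carrier G \<Longrightarrow> add_pow G (k::int) x \<in> carrier G"
  using add.int_pow_closed[of x k] by (simp add: add_pow_def)

text \<open>Two elements with different supports must be summed over one common index set before
  additivity can be checked term by term.\<close>

lemma frag_eval_superset:
  assumes "\<phi> ` S \<subseteq> carrier G" "finite T" "Poly_Mapping.keys c \<subseteq> T" "T \<subseteq> S"
  shows "frag_eval G \<phi> c = (\<Oplus>\<^bsub>G\<^esub>s\<in>T. add_pow G (Poly_Mapping.lookup c s) (\<phi> s))"
  unfolding frag_eval_def
proof (rule add.finprod_mono_neutral_cong_left[OF assms(2,3)])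
  show "[Poly_Mapping.lookup c i] \<cdot> \<phi> i = \<zero>" if "i \<in> T - Poly_Mapping.keys c" for i
    using that by (simp add: in_keys_iff add_pow_def)
  show "(\<lambda>s. [Poly_Mapping.lookup c s] \<cdot>\<^bsub>G\<^esub> \<phi> s) \<in> T \<rightarrow> carrier G"
    using assms by (auto intro!: add_pow_int_closed)
qed simp

lemma frag_eval_hom:
  assumes "\<phi> ` S \<subseteq> carrier G"
  shows "frag_eval G \<phi> \<in> hom (free_Abelian_group S) (add_monoid G)"
proof (rule homI)
  fix c assume "c \<in> carrier (free_Abelian_group S)"
  then show "frag_eval G \<phi> c \<in> carrier (add_monoid G)"
    unfolding frag_eval_def using assms by (auto intro!: add.finprod_closed add_pow_int_closed)
next
  fix c d assume cd: "c \<in> carrier (free_Abelian_group S)" "d \<in> carrier (free_Abelian_group S)"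
  let ?T = "Poly_Mapping.keys c \<union> Poly_Mapping.keys d"
  have T: "finite ?T" "?T \<subseteq> S" using cd by auto
  note e = frag_eval_superset[OF assms T(1) _ T(2)]
  have cl: "s \<in> ?T \<Longrightarrow> \<phi> s \<in> carrier G" for s using T assms by auto
  have "frag_eval G \<phi> (c + d) = (\<Oplus>s\<in>?T. [Poly_Mapping.lookup c s] \<cdot> \<phi> s \<oplus> [Poly_Mapping.lookup d s] \<cdot> \<phi> s)"
    unfolding e[OF keys_add] using cl add.int_pow_mult
    by (intro add.finprod_cong') (auto simp: lookup_add add_pow_def add_pow_int_closed[unfolded add_pow_def])
  also have "\<dots> = (\<Oplus>s\<in>?T. [Poly_Mapping.lookup c s] \<cdot> \<phi> s) \<oplus> (\<Oplus>s\<in>?T. [Poly_Mapping.lookup d s] \<cdot> \<phi> s)"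
    using cl by (intro add.finprod_multf) (auto intro!: add_pow_int_closed)
  finally show "frag_eval G \<phi> (c \<otimes>\<^bsub>free_Abelian_group S\<^esub> d) = frag_eval G \<phi> c \<otimes>\<^bsub>add_monoid G\<^esub> frag_eval G \<phi> d"
    by (simp add: e)
qed

lemma frag_eval_of: "\<phi> s \<in> carrier G \<Longrightarrow> frag_eval G \<phi> (frag_of s) = \<phi> s"
proof -
  assume s: "\<phi> s \<in> carrier G"
  have "frag_eval G \<phi> (frag_of s) = (\<Oplus>u\<in>{s}. \<phi> u)"
    unfolding frag_eval_def keys_frag_of
    by (rule add.finprod_cong') (use s in \<open>simp_all add: add_pow_def int_pow_def nat_pow_def\<close>)
  then show ?thesis using s by simp
qed

lemma minus_eq_zeroD: "x \<ominus> y = \<zero> \<Longrightarrow> x \<in> carrier G \<Longrightarrow> y \<in> carrier G \<Longrightarrow> x = y"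
proof -
  assume e: "x \<ominus> y = \<zero>" and c: "x \<in> carrier G" "y \<in> carrier G"
  have "(x \<ominus> y) \<oplus> y = x" unfolding a_minus_def using c by (simp only: a_assoc l_neg a_inv_closed r_zero)
  with e c show "x = y" by simp
qed

lemma frag_eval_diff:
  assumes "\<phi> ` S \<subseteq> carrier G" "Poly_Mapping.keys c \<subseteq> S" "Poly_Mapping.keys d \<subseteq> S"
  shows "frag_eval G \<phi> (c - d) = frag_eval G \<phi> c \<ominus> frag_eval G \<phi> d"
proof -
  interpret h: group_hom "free_Abelian_group S" "add_monoid G" "frag_eval G \<phi>"
    using frag_eval_hom[OF assms(1)] add.is_group by (simp add: group_hom_def group_hom_axioms_def)
  show ?thesis using h.hom_mult[of c "- d"] h.hom_inv[of d] assms by (simp add: a_minus_def a_inv_def)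
qed

end

locale balanced_map = presentation S Rel + G: abelian_group G
  for S :: "'s set" and Rel and G (structure) +
  fixes \<phi> :: "'s \<Rightarrow> 'g"
  assumes map_closed: "s \<in> S \<Longrightarrow> \<phi> s \<in> carrier G"
    and respects: "r \<in> Rel \<Longrightarrow> frag_eval G \<phi> r = \<zero>\<^bsub>G\<^esub>"
begin

lemma img: "\<phi> ` S \<subseteq> carrier G" using map_closed by auto

lemma frag_eval_H: "r \<in> H \<Longrightarrow> frag_eval G \<phi> r = \<zero>"
proof -
  assume r: "r \<in> H"
  interpret h: group_hom "free_Abelian_group S" "add_monoid G" "frag_eval G \<phi>"
    using G.frag_eval_hom[OF img] G.add.is_group by (simp add: group_hom_def group_hom_axioms_def)
  have "Rel \<subseteq> kernel (free_Abelian_group S) (add_monoid G) (frag_eval G \<phi>)"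
    using respects Rel_keys by (simp add: kernel_def subset_iff)
  then have "H \<subseteq> kernel (free_Abelian_group S) (add_monoid G) (frag_eval G \<phi>)"
    unfolding rel_subgroup_def by (rule h.G.generate_subgroup_incl) (rule h.subgroup_kernel)
  with r show ?thesis by (auto simp: kernel_def)
qed

text \<open>\<open>tensor_eval\<close> applies \<open>the_elem\<close> to the set of values on a
  coset. That set is a singleton because two representatives differ by an element of
  \<open>H\<close>, on which the homomorphism \<open>frag_eval\<close> vanishes.\<close>

lemma tensor_eval_cls:
  assumes c: "Poly_Mapping.keys c \<subseteq> S"
  shows "tensor_eval G \<phi> (cls c) = frag_eval G \<phi> c"
proof -
  have "frag_eval G \<phi> x = frag_eval G \<phi> c" if x: "x \<in> cls c" for x
  proof -
    have "x - c \<in> H" using x by (simp add: presented_class_alt)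
    then have "frag_eval G \<phi> x \<ominus> frag_eval G \<phi> c = \<zero>"
      using G.frag_eval_diff[OF img cls_keys[OF x c] c] frag_eval_H by simp
    moreover have "frag_eval G \<phi> x \<in> carrier G" "frag_eval G \<phi> c \<in> carrier G"
      using hom_in_carrier[OF G.frag_eval_hom[OF img]] cls_keys[OF x c] c by auto
    ultimately show ?thesis by (rule G.minus_eq_zeroD)
  qed
  then have "frag_eval G \<phi> ` cls c = (\<lambda>_. frag_eval G \<phi> c) ` cls c" by (intro image_cong refl)
  also have "\<dots> = {frag_eval G \<phi> c}" using cls_self[of c] by auto
  finally have "the_elem (frag_eval G \<phi> ` cls c) = frag_eval G \<phi> c" by (simp only: the_elem_eq)
  moreover have "tensor_eval G \<phi> (cls c) = the_elem (frag_eval G \<phi> ` cls c)"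
    unfolding tensor_eval_def frag_eval_def[abs_def] ..
  ultimately show ?thesis by simp
qed

lemma tensor_eval_of: "s \<in> S \<Longrightarrow> tensor_eval G \<phi> (cls (frag_of s)) = \<phi> s"
  by (simp add: tensor_eval_cls G.frag_eval_of map_closed)

lemma tensor_eval_hom: "tensor_eval G \<phi> \<in> hom Q (add_monoid G)"
proof (rule homI)
  fix U assume "U \<in> carrier Q"
  then show "tensor_eval G \<phi> U \<in> carrier (add_monoid G)"
    using G.frag_eval_hom[OF img] by (auto elim!: Q_cases simp: tensor_eval_cls hom_def Pi_def)
next
  fix U V assume "U \<in> carrier Q" "V \<in> carrier Q"
  then show "tensor_eval G \<phi> (U \<otimes>\<^bsub>Q\<^esub> V) = tensor_eval G \<phi> U \<otimes>\<^bsub>add_monoid G\<^esub> tensor_eval G \<phi> V"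
    using hom_mult[OF G.frag_eval_hom[OF img]] keys_add
    by (auto elim!: Q_cases simp: tensor_eval_cls cls_add[symmetric] order_trans[OF keys_add])
qed

end

text \<open>The union defining \<open>presented_map\<close> runs over all representatives of a
  coset. All its terms are the same coset as soon as the relations of the source are sent into
  \<open>H\<close>.\<close>

lemma (in presentation) presented_map_cls:
  assumes "presentation S' Rel'" and f: "\<And>s. s \<in> S' \<Longrightarrow> f s \<in> S"
    and rel: "\<And>r. r \<in> Rel' \<Longrightarrow> frag_extend (frag_of \<circ> f) r \<in> H"
    and c: "Poly_Mapping.keys c \<subseteq> S'"
  shows "presented_map S Rel f (presented_class S' Rel' c) = cls (frag_extend (frag_of \<circ> f) c)"
proof -
  interpret p': presentation S' Rel' by fact
  have k: "Poly_Mapping.keys (frag_extend (frag_of \<circ> f) x) \<subseteq> S" if "Poly_Mapping.keys x \<subseteq> S'" for x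
    using keys_frag_extend[of "frag_of \<circ> f" x] that f by fastforce
  let ?D = "frag_extend (frag_of \<circ> f)"
  have hom: "group_hom (free_Abelian_group S') (free_Abelian_group S) ?D"
    by (simp add: group_hom_def group_hom_axioms_def hom_def frag_extend_add k)
  interpret h: group_hom "free_Abelian_group S'" "free_Abelian_group S" ?D by (rule hom)
  \<comment> \<open>The elements sent into \<open>H\<close> form a subgroup; containing the
    relations, it contains everything they generate.\<close>
  have "subgroup {x \<in> carrier (free_Abelian_group S'). ?D x \<in> H} (free_Abelian_group S')"
    by unfold_locales
      (auto simp: frag_extend_add frag_extend_minus H_zero H_add H_uminus dest!: subsetD[OF keys_add])
  then have H': "p'.H \<subseteq> {x \<in> carrier (free_Abelian_group S'). ?D x \<in> H}"
    unfolding rel_subgroup_def[of S' Rel'] using p'.Rel_keys rel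
    by (intro h.G.generate_subgroup_incl) (simp_all add: subset_iff)
  have "cls (?D x) = cls (?D c)" if "x \<in> p'.cls c" for x
  proof -
    have "x - c \<in> p'.H" using that by (simp add: presented_class_alt)
    then show ?thesis unfolding cls_eq_iff frag_extend_diff[symmetric] using H' by auto
  qed
  then have "presented_map S Rel f (p'.cls c) = (\<Union>x\<in>p'.cls c. cls (?D c))"
    unfolding presented_map_def by (intro SUP_cong refl)
  also have "\<dots> = cls (?D c)" using p'.cls_self[of c] by (simp only: UN_constant) auto
  finally show ?thesis .
qed

lemma (in presentation) presented_map_of:
  assumes "presentation S' Rel'" and "\<And>s. s \<in> S' \<Longrightarrow> f s \<in> S"
    and "\<And>r. r \<in> Rel' \<Longrightarrow> frag_extend (frag_of \<circ> f) r \<in> H" and "s \<in> S'"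
  shows "presented_map S Rel f (presented_class S' Rel' (frag_of s)) = cls (frag_of (f s))"
  using presented_map_cls[OF assms(1-3), of "frag_of s"] assms(4) by simp

lemma (in presentation) presented_map_hom:
  assumes "presentation S' Rel'" and f: "\<And>s. s \<in> S' \<Longrightarrow> f s \<in> S"
    and "\<And>r. r \<in> Rel' \<Longrightarrow> frag_extend (frag_of \<circ> f) r \<in> H"
  shows "presented_map S Rel f \<in> hom (presented_group S' Rel') Q"
proof -
  interpret p': presentation S' Rel' by fact
  have k: "Poly_Mapping.keys (frag_extend (frag_of \<circ> f) x) \<subseteq> S" if "Poly_Mapping.keys x \<subseteq> S'" for x
    using keys_frag_extend[of "frag_of \<circ> f" x] that f by fastforce
  note m = presented_map_cls[OF assms]
  show ?thesis
  proof (rule homI)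
    fix U assume "U \<in> carrier (presented_group S' Rel')"
    then show "presented_map S Rel f U \<in> carrier Q"
      by (auto elim!: p'.Q_cases simp: m intro!: cls_closed k)
  next
    fix U V assume "U \<in> carrier (presented_group S' Rel')" "V \<in> carrier (presented_group S' Rel')"
    then show "presented_map S Rel f (U \<otimes>\<^bsub>p'.Q\<^esub> V) = presented_map S Rel f U \<otimes>\<^bsub>Q\<^esub> presented_map S Rel f V"
      by (elim p'.Q_cases)
         (simp add: m p'.cls_add[symmetric] order_trans[OF keys_add] frag_extend_add cls_add k)
  qed
qed

section \<open>Bimodules as modules over the enveloping algebra\<close>

lemma op_ring_simps [simp]:
  "carrier (op_ring A) = carrier A" "\<one>\<^bsub>op_ring A\<^esub> = \<one>\<^bsub>A\<^esub>" "\<zero>\<^bsub>op_ring A\<^esub> = \<zero>\<^bsub>A\<^esub>"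
  "x \<oplus>\<^bsub>op_ring A\<^esub> y = x \<oplus>\<^bsub>A\<^esub> y" "x \<otimes>\<^bsub>op_ring A\<^esub> y = y \<otimes>\<^bsub>A\<^esub> x"
  by (simp_all add: op_ring_def)

lemma op_ring_smult [simp]: "smult (op_ring A) = smult A"
  by (simp add: op_ring_def)

lemma op_ring_ring: "ring A \<Longrightarrow> ring (op_ring A)"
proof -
  assume "ring A"
  then interpret ring A .
  show ?thesis
    by (intro ringI abelian_groupI monoidI)
      (auto simp: a_ac m_assoc r_distr l_distr intro: l_neg)
qed

lemma part_simps [simp]:
  "carrier (left_part X) = carrier X" "\<zero>\<^bsub>left_part X\<^esub> = \<zero>\<^bsub>X\<^esub>" "x \<oplus>\<^bsub>left_part X\<^esub> y = x \<oplus>\<^bsub>X\<^esub> y"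
  "b \<odot>\<^bsub>left_part X\<^esub> x = lact X b x"
  "carrier (right_part X) = carrier X" "\<zero>\<^bsub>right_part X\<^esub> = \<zero>\<^bsub>X\<^esub>" "x \<oplus>\<^bsub>right_part X\<^esub> y = x \<oplus>\<^bsub>X\<^esub> y"
  "a \<odot>\<^bsub>right_part X\<^esub> x = ract X x a"
  by (simp_all add: left_part_def right_part_def)

lemma abelian_group_transfer:
  assumes "abelian_group X" "carrier Y = carrier X" "\<zero>\<^bsub>Y\<^esub> = \<zero>\<^bsub>X\<^esub>" "\<And>x y. x \<oplus>\<^bsub>Y\<^esub> y = x \<oplus>\<^bsub>X\<^esub> y"
  shows "abelian_group Y"
proof -
  interpret abelian_group X by fact
  show ?thesis by (rule abelian_groupI) (auto simp: assms a_ac intro: l_neg)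
qed

lemma k_algebraD:
  assumes "k_algebra K A"
  shows "field K" "ring A" "module K A"
    "\<And>c x y. c \<in> carrier K \<Longrightarrow> x \<in> carrier A \<Longrightarrow> y \<in> carrier A \<Longrightarrow>
        (c \<odot>\<^bsub>A\<^esub> x) \<otimes>\<^bsub>A\<^esub> y = c \<odot>\<^bsub>A\<^esub> (x \<otimes>\<^bsub>A\<^esub> y)"
    "\<And>c x y. c \<in> carrier K \<Longrightarrow> x \<in> carrier A \<Longrightarrow> y \<in> carrier A \<Longrightarrow>
        x \<otimes>\<^bsub>A\<^esub> (c \<odot>\<^bsub>A\<^esub> y) = c \<odot>\<^bsub>A\<^esub> (x \<otimes>\<^bsub>A\<^esub> y)"
  using assms by (auto simp: k_algebra_def)

locale two_algebras =
  fixes K :: "('k, 'u) ring_scheme" and B :: "('k, 'b, 'v) module_scheme" and A :: "('k, 'a, 'w) module_scheme"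
  assumes alg_B: "k_algebra K B" and alg_A: "k_algebra K A"
begin
sublocale K: field K by (rule k_algebraD(1)[OF alg_A])
sublocale B: ring B by (rule k_algebraD(2)[OF alg_B])
sublocale A: ring A by (rule k_algebraD(2)[OF alg_A])
sublocale KB: module K B by (rule k_algebraD(3)[OF alg_B])
sublocale KA: module K A by (rule k_algebraD(3)[OF alg_A])
end

locale bimod = two_algebras K B A
  for K :: "('k, 'u) ring_scheme" and B :: "('k, 'b, 'v) module_scheme" and A :: "('k, 'a, 'w) module_scheme" +
  fixes X :: "('b, 'a, 'm, 'y) bimodule_scheme"
  assumes bimod: "is_bimodule K B A X"
begin

sublocale l: left_module B "left_part X" using bimod by (simp add: is_bimodule_def)
sublocale r: left_module "op_ring A" "right_part X" using bimod by (simp add: is_bimodule_def)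

sublocale X: abelian_group X
  by (rule abelian_group_transfer[OF l.M.abelian_group_axioms]) simp_all

lemma lact_closed [simp, intro]: "b \<in> carrier B \<Longrightarrow> x \<in> carrier X \<Longrightarrow> lact X b x \<in> carrier X"
  using l.smult_closed by simp
lemma ract_closed [simp, intro]: "a \<in> carrier A \<Longrightarrow> x \<in> carrier X \<Longrightarrow> ract X x a \<in> carrier X"
  using r.smult_closed by simp
lemma lact_add_l: "\<lbrakk>b \<in> carrier B; b' \<in> carrier B; x \<in> carrier X\<rbrakk> \<Longrightarrow>
    lact X (b \<oplus>\<^bsub>B\<^esub> b') x = lact X b x \<oplus>\<^bsub>X\<^esub> lact X b' x"
  using l.smult_l_distr by simp
lemma lact_add_r: "\<lbrakk>b \<in> carrier B; x \<in> carrier X; y \<in> carrier X\<rbrakk> \<Longrightarrow>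
    lact X b (x \<oplus>\<^bsub>X\<^esub> y) = lact X b x \<oplus>\<^bsub>X\<^esub> lact X b y"
  using l.smult_r_distr by simp
lemma ract_add_r: "\<lbrakk>a \<in> carrier A; a' \<in> carrier A; x \<in> carrier X\<rbrakk> \<Longrightarrow>
    ract X x (a \<oplus>\<^bsub>A\<^esub> a') = ract X x a \<oplus>\<^bsub>X\<^esub> ract X x a'"
  using r.smult_l_distr by simp
lemma ract_add_l: "\<lbrakk>a \<in> carrier A; x \<in> carrier X; y \<in> carrier X\<rbrakk> \<Longrightarrow>
    ract X (x \<oplus>\<^bsub>X\<^esub> y) a = ract X x a \<oplus>\<^bsub>X\<^esub> ract X y a"
  using r.smult_r_distr by simp
lemma lact_mult: "\<lbrakk>b \<in> carrier B; b' \<in> carrier B; x \<in> carrier X\<rbrakk> \<Longrightarrow>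
    lact X (b \<otimes>\<^bsub>B\<^esub> b') x = lact X b (lact X b' x)"
  using l.smult_assoc by simp
lemma ract_mult: "\<lbrakk>a \<in> carrier A; a' \<in> carrier A; x \<in> carrier X\<rbrakk> \<Longrightarrow>
    ract X x (a \<otimes>\<^bsub>A\<^esub> a') = ract X (ract X x a) a'"
  using r.smult_assoc[of a' a x] by simp
lemma lact_one [simp]: "x \<in> carrier X \<Longrightarrow> lact X \<one>\<^bsub>B\<^esub> x = x"
  using l.smult_one by simp
lemma ract_one [simp]: "x \<in> carrier X \<Longrightarrow> ract X x \<one>\<^bsub>A\<^esub> = x"
  using r.smult_one by simp
lemma lact_ract: "\<lbrakk>b \<in> carrier B; a \<in> carrier A; x \<in> carrier X\<rbrakk> \<Longrightarrow>
    ract X (lact X b x) a = lact X b (ract X x a)"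
  using bimod by (simp add: is_bimodule_def)
lemma lact_ground: "\<lbrakk>c \<in> carrier K; x \<in> carrier X\<rbrakk> \<Longrightarrow>
    lact X (c \<odot>\<^bsub>B\<^esub> \<one>\<^bsub>B\<^esub>) x = ract X x (c \<odot>\<^bsub>A\<^esub> \<one>\<^bsub>A\<^esub>)"
  using bimod by (simp add: is_bimodule_def)

text \<open>Here and in \<open>ract_smult\<close> a scalar is turned into the right action of a
  multiple of the unit, so that both sides of the balancing relation over \<open>K\<close> reach the
  same normal form.\<close>

lemma lact_smult: "\<lbrakk>c \<in> carrier K; b \<in> carrier B; x \<in> carrier X\<rbrakk> \<Longrightarrow>
    lact X (c \<odot>\<^bsub>B\<^esub> b) x = lact X b (ract X x (c \<odot>\<^bsub>A\<^esub> \<one>\<^bsub>A\<^esub>))"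
proof -
  assume a: "c \<in> carrier K" "b \<in> carrier B" "x \<in> carrier X"
  have "c \<odot>\<^bsub>B\<^esub> b = b \<otimes>\<^bsub>B\<^esub> (c \<odot>\<^bsub>B\<^esub> \<one>\<^bsub>B\<^esub>)" using k_algebraD(5)[OF alg_B] a by simp
  then show ?thesis using a by (simp add: lact_mult lact_ground)
qed

lemma ract_smult: "\<lbrakk>c \<in> carrier K; a \<in> carrier A; x \<in> carrier X\<rbrakk> \<Longrightarrow>
    ract X x (c \<odot>\<^bsub>A\<^esub> a) = ract X (ract X x (c \<odot>\<^bsub>A\<^esub> \<one>\<^bsub>A\<^esub>)) a"
proof -
  assume a: "c \<in> carrier K" "a \<in> carrier A" "x \<in> carrier X"
  have "c \<odot>\<^bsub>A\<^esub> a = (c \<odot>\<^bsub>A\<^esub> \<one>\<^bsub>A\<^esub>) \<otimes>\<^bsub>A\<^esub> a" using k_algebraD(4)[OF alg_A] a by simp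
  then show ?thesis using a by (simp add: ract_mult)
qed

lemma lact_zero: "b \<in> carrier B \<Longrightarrow> lact X b \<zero>\<^bsub>X\<^esub> = \<zero>\<^bsub>X\<^esub>"
  by (metis lact_add_r X.add.l_cancel_one' X.r_zero X.zero_closed lact_closed)
lemma ract_zero: "a \<in> carrier A \<Longrightarrow> ract X \<zero>\<^bsub>X\<^esub> a = \<zero>\<^bsub>X\<^esub>"
  by (metis ract_add_l X.add.l_cancel_one' X.r_zero X.zero_closed ract_closed)
lemma zero_lact: "x \<in> carrier X \<Longrightarrow> lact X \<zero>\<^bsub>B\<^esub> x = \<zero>\<^bsub>X\<^esub>"
  by (metis lact_add_l X.add.l_cancel_one' B.r_zero B.zero_closed lact_closed)
lemma zero_ract: "x \<in> carrier X \<Longrightarrow> ract X x \<zero>\<^bsub>A\<^esub> = \<zero>\<^bsub>X\<^esub>"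
  by (metis ract_add_r X.add.l_cancel_one' A.r_zero A.zero_closed ract_closed)

end

lemma is_bimoduleI:
  fixes X :: "('b, 'a, 'm, 'y) bimodule_scheme"
  assumes "ring B" "ring A" "abelian_group X"
    and "\<And>b x. b \<in> carrier B \<Longrightarrow> x \<in> carrier X \<Longrightarrow> lact X b x \<in> carrier X"
    and "\<And>a x. a \<in> carrier A \<Longrightarrow> x \<in> carrier X \<Longrightarrow> ract X x a \<in> carrier X"
    and "\<And>b b' x. \<lbrakk>b \<in> carrier B; b' \<in> carrier B; x \<in> carrier X\<rbrakk> \<Longrightarrow>
        lact X (b \<oplus>\<^bsub>B\<^esub> b') x = lact X b x \<oplus>\<^bsub>X\<^esub> lact X b' x"
    and "\<And>b x y. \<lbrakk>b \<in> carrier B; x \<in> carrier X; y \<in> carrier X\<rbrakk> \<Longrightarrow>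
        lact X b (x \<oplus>\<^bsub>X\<^esub> y) = lact X b x \<oplus>\<^bsub>X\<^esub> lact X b y"
    and "\<And>a a' x. \<lbrakk>a \<in> carrier A; a' \<in> carrier A; x \<in> carrier X\<rbrakk> \<Longrightarrow>
        ract X x (a \<oplus>\<^bsub>A\<^esub> a') = ract X x a \<oplus>\<^bsub>X\<^esub> ract X x a'"
    and "\<And>a x y. \<lbrakk>a \<in> carrier A; x \<in> carrier X; y \<in> carrier X\<rbrakk> \<Longrightarrow>
        ract X (x \<oplus>\<^bsub>X\<^esub> y) a = ract X x a \<oplus>\<^bsub>X\<^esub> ract X y a"
    and "\<And>b b' x. \<lbrakk>b \<in> carrier B; b' \<in> carrier B; x \<in> carrier X\<rbrakk> \<Longrightarrow>
        lact X (b \<otimes>\<^bsub>B\<^esub> b') x = lact X b (lact X b' x)"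
    and "\<And>a a' x. \<lbrakk>a \<in> carrier A; a' \<in> carrier A; x \<in> carrier X\<rbrakk> \<Longrightarrow>
        ract X x (a \<otimes>\<^bsub>A\<^esub> a') = ract X (ract X x a) a'"
    and "\<And>x. x \<in> carrier X \<Longrightarrow> lact X \<one>\<^bsub>B\<^esub> x = x"
    and "\<And>x. x \<in> carrier X \<Longrightarrow> ract X x \<one>\<^bsub>A\<^esub> = x"
    and "\<And>b a x. \<lbrakk>b \<in> carrier B; a \<in> carrier A; x \<in> carrier X\<rbrakk> \<Longrightarrow>
        ract X (lact X b x) a = lact X b (ract X x a)"
    and "\<And>c x. \<lbrakk>c \<in> carrier K; x \<in> carrier X\<rbrakk> \<Longrightarrow>
        lact X (c \<odot>\<^bsub>B\<^esub> \<one>\<^bsub>B\<^esub>) x = ract X x (c \<odot>\<^bsub>A\<^esub> \<one>\<^bsub>A\<^esub>)"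
  shows "is_bimodule K B A X"
proof -
  have "left_module B (left_part X)"
    unfolding left_module_def left_module_axioms_def
    using assms abelian_group_transfer[OF assms(3), of "left_part X"] by simp
  moreover have "left_module (op_ring A) (right_part X)"
    unfolding left_module_def left_module_axioms_def
    using assms op_ring_ring abelian_group_transfer[OF assms(3), of "right_part X"] by simp
  ultimately show ?thesis using assms by (simp add: is_bimodule_def)
qed

subsection \<open>Tensor products over a ring\<close>

locale tensor_data = X: abelian_group X + Y: abelian_group Y
  for R :: "('r, 'u) ring_scheme" and X :: "('x, 'v) ring_scheme" and xr :: "'x \<Rightarrow> 'r \<Rightarrow> 'x"
    and Y :: "('y, 'w) ring_scheme" and yl :: "'r \<Rightarrow> 'y \<Rightarrow> 'y" +
  assumes xr_closed: "x \<in> carrier X \<Longrightarrow> r \<in> carrier R \<Longrightarrow> xr x r \<in> carrier X"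
    and yl_closed: "y \<in> carrier Y \<Longrightarrow> r \<in> carrier R \<Longrightarrow> yl r y \<in> carrier Y"
begin

sublocale presentation "carrier X \<times> carrier Y" "tensor_rels R X xr Y yl"
proof
  have k: "Poly_Mapping.keys (frag_of a - frag_of b - frag_of c) \<subseteq> T" if "a \<in> T" "b \<in> T" "c \<in> T"
    for a b c :: "'x \<times> 'y" and T
    using that keys_diff[of "frag_of a - frag_of b" "frag_of c"] keys_diff[of "frag_of a" "frag_of b"] by auto
  have k': "Poly_Mapping.keys (frag_of a - frag_of b) \<subseteq> T" if "a \<in> T" "b \<in> T"
    for a b :: "'x \<times> 'y" and T
    using that keys_diff[of "frag_of a" "frag_of b"] by auto
  show "tensor_rels R X xr Y yl \<subseteq> carrier (free_Abelian_group (carrier X \<times> carrier Y))"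
    unfolding tensor_rels_def
    by (intro Un_least subsetI; unfold mem_Collect_eq; elim exE conjE; hypsubst;
        unfold carrier_free_Abelian_group_iff) (intro k k'; simp add: xr_closed yl_closed)+
qed

abbreviation "pure x y \<equiv> cls (frag_of (x, y))"

lemma pure_closed: "x \<in> carrier X \<Longrightarrow> y \<in> carrier Y \<Longrightarrow> pure x y \<in> carrier Q"
  by (rule cls_of_closed) simp

lemma pure_add_l:
  assumes "x \<in> carrier X" "x' \<in> carrier X" "y \<in> carrier Y"
  shows "pure (x \<oplus>\<^bsub>X\<^esub> x') y = pure x y \<otimes>\<^bsub>Q\<^esub> pure x' y"
proof -
  have "frag_of (x \<oplus>\<^bsub>X\<^esub> x', y) - frag_of (x, y) - frag_of (x', y) \<in> H"
    using assms by (intro Rel_in_H) (auto simp: tensor_rels_def)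
  then have "pure (x \<oplus>\<^bsub>X\<^esub> x') y = cls (frag_of (x, y) + frag_of (x', y))"
    by (simp add: cls_eq_iff algebra_simps)
  then show ?thesis using assms by (simp add: cls_add)
qed

lemma pure_add_r:
  assumes "x \<in> carrier X" "y \<in> carrier Y" "y' \<in> carrier Y"
  shows "pure x (y \<oplus>\<^bsub>Y\<^esub> y') = pure x y \<otimes>\<^bsub>Q\<^esub> pure x y'"
proof -
  have "frag_of (x, y \<oplus>\<^bsub>Y\<^esub> y') - frag_of (x, y) - frag_of (x, y') \<in> H"
    using assms by (intro Rel_in_H) (auto simp: tensor_rels_def)
  then have "pure x (y \<oplus>\<^bsub>Y\<^esub> y') = cls (frag_of (x, y) + frag_of (x, y'))"
    by (simp add: cls_eq_iff algebra_simps)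
  then show ?thesis using assms by (simp add: cls_add)
qed

lemma pure_balanced:
  assumes "x \<in> carrier X" "r \<in> carrier R" "y \<in> carrier Y"
  shows "pure (xr x r) y = pure x (yl r y)"
  unfolding cls_eq_iff using assms by (intro Rel_in_H) (auto simp: tensor_rels_def)

lemma pure_zero_l: "y \<in> carrier Y \<Longrightarrow> pure \<zero>\<^bsub>X\<^esub> y = \<one>\<^bsub>Q\<^esub>"
  using pure_add_l[of "\<zero>\<^bsub>X\<^esub>" "\<zero>\<^bsub>X\<^esub>" y] pure_closed[of "\<zero>\<^bsub>X\<^esub>" y] group.l_cancel_one'[OF group_Q] by fastforce

lemma pure_zero_r: "x \<in> carrier X \<Longrightarrow> pure x \<zero>\<^bsub>Y\<^esub> = \<one>\<^bsub>Q\<^esub>"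
  using pure_add_r[of x "\<zero>\<^bsub>Y\<^esub>" "\<zero>\<^bsub>Y\<^esub>"] pure_closed[of x "\<zero>\<^bsub>Y\<^esub>"] group.l_cancel_one'[OF group_Q] by fastforce

lemma tensor_balanced_map:
  assumes "abelian_group G"
    and cl: "\<And>x y. x \<in> carrier X \<Longrightarrow> y \<in> carrier Y \<Longrightarrow> \<beta> x y \<in> carrier G"
    and addl: "\<And>x x' y. x \<in> carrier X \<Longrightarrow> x' \<in> carrier X \<Longrightarrow> y \<in> carrier Y \<Longrightarrow>
        \<beta> (x \<oplus>\<^bsub>X\<^esub> x') y = \<beta> x y \<oplus>\<^bsub>G\<^esub> \<beta> x' y"
    and addr: "\<And>x y y'. x \<in> carrier X \<Longrightarrow> y \<in> carrier Y \<Longrightarrow> y' \<in> carrier Y \<Longrightarrow>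
        \<beta> x (y \<oplus>\<^bsub>Y\<^esub> y') = \<beta> x y \<oplus>\<^bsub>G\<^esub> \<beta> x y'"
    and bal: "\<And>x r y. x \<in> carrier X \<Longrightarrow> r \<in> carrier R \<Longrightarrow> y \<in> carrier Y \<Longrightarrow> \<beta> (xr x r) y = \<beta> x (yl r y)"
  shows "balanced_map (carrier X \<times> carrier Y) (tensor_rels R X xr Y yl) G (\<lambda>(x, y). \<beta> x y)"
proof -
  interpret G: abelian_group G by fact
  let ?S = "carrier X \<times> carrier Y" and ?ev = "frag_eval G (\<lambda>(x, y). \<beta> x y)"
  have img: "(\<lambda>(x, y). \<beta> x y) ` ?S \<subseteq> carrier G" using cl by auto
  have of: "?ev (frag_of (x, y)) = \<beta> x y" if "x \<in> carrier X" "y \<in> carrier Y" for x y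
    using G.frag_eval_of[of "\<lambda>(x, y). \<beta> x y" "(x, y)"] cl that by simp
  have d2: "?ev (frag_of a - frag_of b) = ?ev (frag_of a) \<ominus>\<^bsub>G\<^esub> ?ev (frag_of b)"
    if "a \<in> ?S" "b \<in> ?S" for a b
    by (rule G.frag_eval_diff[OF img]) (use that in auto)
  have d3: "?ev (frag_of a - frag_of b - frag_of c) = ?ev (frag_of a) \<ominus>\<^bsub>G\<^esub> ?ev (frag_of b) \<ominus>\<^bsub>G\<^esub> ?ev (frag_of c)"
    if "a \<in> ?S" "b \<in> ?S" "c \<in> ?S" for a b c
    unfolding d2[OF that(1,2), symmetric]
    by (rule G.frag_eval_diff[OF img]) (use that keys_diff[of "frag_of a" "frag_of b"] in auto)
  have z: "(u \<oplus>\<^bsub>G\<^esub> v) \<ominus>\<^bsub>G\<^esub> u \<ominus>\<^bsub>G\<^esub> v = \<zero>\<^bsub>G\<^esub>" "u \<ominus>\<^bsub>G\<^esub> u = \<zero>\<^bsub>G\<^esub>"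
    if "u \<in> carrier G" "v \<in> carrier G" for u v
  proof -
    have "(u \<oplus>\<^bsub>G\<^esub> v) \<ominus>\<^bsub>G\<^esub> u \<ominus>\<^bsub>G\<^esub> v = (u \<oplus>\<^bsub>G\<^esub> v) \<oplus>\<^bsub>G\<^esub> \<ominus>\<^bsub>G\<^esub> (u \<oplus>\<^bsub>G\<^esub> v)"
      using that by (simp add: G.minus_eq G.minus_add G.a_assoc)
    then show "(u \<oplus>\<^bsub>G\<^esub> v) \<ominus>\<^bsub>G\<^esub> u \<ominus>\<^bsub>G\<^esub> v = \<zero>\<^bsub>G\<^esub>" using that by (simp add: G.r_neg)
    show "u \<ominus>\<^bsub>G\<^esub> u = \<zero>\<^bsub>G\<^esub>" using that by (simp add: G.minus_eq G.r_neg)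
  qed
  show ?thesis
  proof
    fix r assume "r \<in> tensor_rels R X xr Y yl"
    then show "?ev r = \<zero>\<^bsub>G\<^esub>"
      unfolding tensor_rels_def Un_iff mem_Collect_eq
      by (elim disjE exE conjE; hypsubst)
         (simp_all add: d2 d3 of cl addl addr bal z(1) z(2)[OF _ G.zero_closed] xr_closed yl_closed)
  qed (use cl in auto)
qed

end

text \<open>A left module over \<open>R\<close> presupposes that \<open>R\<close> is a ring, so
  \<open>ring_R\<close> can be read off from any resolution over \<open>R\<close>. Assuming it
  avoids verifying the ring axioms for a multiplication defined by unions of cosets.\<close>

locale enveloping =
  fixes K :: "('k, 'u) ring_scheme" and L :: "('k, 'l) module"
  assumes alg: "k_algebra K L" and ring_R: "ring (enveloping_algebra K L)"
begin

abbreviation "R \<equiv> enveloping_algebra K L"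

sublocale K: field K by (rule k_algebraD(1)[OF alg])
sublocale L: ring L by (rule k_algebraD(2)[OF alg])
sublocale KL: module K L by (rule k_algebraD(3)[OF alg])
sublocale R: ring R by (rule ring_R)

sublocale E: tensor_data K L "\<lambda>b k. k \<odot>\<^bsub>L\<^esub> b" "op_ring L" "smult L"
proof -
  have "abelian_group (op_ring L)" using op_ring_ring[OF L.ring_axioms] ring.is_abelian_group by blast
  then show "tensor_data K L (\<lambda>b k. k \<odot>\<^bsub>L\<^esub> b) (op_ring L) (smult L)"
    unfolding tensor_data_def tensor_data_axioms_def using L.is_abelian_group by simp
qed

definition env :: "'l \<Rightarrow> 'l \<Rightarrow> ('l \<times> 'l \<Rightarrow>\<^sub>0 int) set" where
  "env l l' = E.pure l l'"

lemma R_simps: "carrier R = carrier E.Q" "\<zero>\<^bsub>R\<^esub> = \<one>\<^bsub>E.Q\<^esub>" "U \<oplus>\<^bsub>R\<^esub> V = U \<otimes>\<^bsub>E.Q\<^esub> V"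
  "\<one>\<^bsub>R\<^esub> = env \<one>\<^bsub>L\<^esub> \<one>\<^bsub>L\<^esub>"
  by (simp_all add: enveloping_algebra_def tensor_algebra_def Let_def env_def)

lemma env_closed [simp, intro]: "l \<in> carrier L \<Longrightarrow> l' \<in> carrier L \<Longrightarrow> env l l' \<in> carrier R"
  unfolding env_def R_simps by (rule E.pure_closed) simp_all

lemma env_add_r: "\<lbrakk>x \<in> carrier L; y \<in> carrier L; y' \<in> carrier L\<rbrakk> \<Longrightarrow>
    env x (y \<oplus>\<^bsub>L\<^esub> y') = env x y \<oplus>\<^bsub>R\<^esub> env x y'"
  unfolding env_def R_simps using E.pure_add_r[of x y y'] by simp

lemma env_zero: "x \<in> carrier L \<Longrightarrow> env x \<zero>\<^bsub>L\<^esub> = \<zero>\<^bsub>R\<^esub>" "x \<in> carrier L \<Longrightarrow> env \<zero>\<^bsub>L\<^esub> x = \<zero>\<^bsub>R\<^esub>"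
  unfolding env_def R_simps using E.pure_zero_r[of x] E.pure_zero_l[of x] by simp_all

text \<open>The product in \<open>tensor_algebra\<close> is a union over all pairs of
  representatives. As \<open>R\<close> is a ring, this union is again a single coset, and one pair
  of representatives already determines it.\<close>

lemma env_mult:
  assumes "a \<in> carrier L" "b \<in> carrier L" "c \<in> carrier L" "d \<in> carrier L"
  shows "env a b \<otimes>\<^bsub>R\<^esub> env c d = env (a \<otimes>\<^bsub>L\<^esub> c) (d \<otimes>\<^bsub>L\<^esub> b)"
proof -
  let ?m = "tensor_algebra_mult L (op_ring L)"
  have eq: "env a b \<otimes>\<^bsub>R\<^esub> env c d = (\<Union>x\<in>env a b. \<Union>y\<in>env c d. E.cls (?m x y))"
    by (simp add: enveloping_algebra_def tensor_algebra_def Let_def)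
  have "env a b \<otimes>\<^bsub>R\<^esub> env c d \<in> carrier E.Q"
    unfolding R_simps(1)[symmetric] using R.m_closed[of "env a b" "env c d"] assms by blast
  then obtain z where z: "env a b \<otimes>\<^bsub>R\<^esub> env c d = E.cls z" by (rule E.Q_cases)
  have "frag_of (a, b) \<in> env a b" "frag_of (c, d) \<in> env c d" unfolding env_def by (rule E.cls_self)+
  then have "E.cls (?m (frag_of (a, b)) (frag_of (c, d))) \<subseteq> env a b \<otimes>\<^bsub>R\<^esub> env c d" unfolding eq by blast
  then have "?m (frag_of (a, b)) (frag_of (c, d)) \<in> E.cls z" using E.cls_self z by blast
  then have "E.cls (?m (frag_of (a, b)) (frag_of (c, d))) = E.cls z" by (rule E.cls_memD)
  then show ?thesis unfolding z by (simp add: tensor_algebra_mult_def env_def)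
qed

lemma R_induct [consumes 1, case_names env zero add uminus]:
  assumes "U \<in> carrier R"
    and "\<And>l l'. l \<in> carrier L \<Longrightarrow> l' \<in> carrier L \<Longrightarrow> Pr (env l l')" "Pr \<zero>\<^bsub>R\<^esub>"
    and "\<And>x y. x \<in> carrier R \<Longrightarrow> y \<in> carrier R \<Longrightarrow> Pr x \<Longrightarrow> Pr y \<Longrightarrow> Pr (x \<oplus>\<^bsub>R\<^esub> y)"
    and "\<And>x. x \<in> carrier R \<Longrightarrow> Pr x \<Longrightarrow> Pr (\<ominus>\<^bsub>R\<^esub> x)"
  shows "Pr U"
proof -
  interpret Q: group E.Q by (rule E.group_Q)
  have inv: "\<ominus>\<^bsub>R\<^esub> x = inv\<^bsub>E.Q\<^esub> x" if "x \<in> carrier R" for x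
    using R.l_neg[OF that] that R.a_inv_closed[OF that]
    by (intro Q.inv_equality[symmetric]) (auto simp: R_simps)
  from assms(1)[unfolded R_simps] show ?thesis
    by (induction rule: E.Q_induct) (use assms inv in \<open>auto simp: R_simps env_def\<close>)
qed

end

lemma balm_simps [simp]:
  "carrier (bimodule_as_left_module X) = carrier X" "\<zero>\<^bsub>bimodule_as_left_module X\<^esub> = \<zero>\<^bsub>X\<^esub>"
  "x \<oplus>\<^bsub>bimodule_as_left_module X\<^esub> y = x \<oplus>\<^bsub>X\<^esub> y"
  by (simp_all add: bimodule_as_left_module_def)

context enveloping begin

lemma balanced_action:
  assumes "bimod K L L X" and x: "x \<in> carrier X"
  shows "balanced_map (carrier L \<times> carrier (op_ring L)) (tensor_rels K L (\<lambda>b k. k \<odot>\<^bsub>L\<^esub> b) (op_ring L) (smult L))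
      X (\<lambda>(b, a). ract X (lact X b x) a)"
proof -
  interpret X: bimod K L L X by fact
  have "ract X (lact X (r \<odot>\<^bsub>L\<^esub> xa) x) y = ract X (lact X xa x) (r \<odot>\<^bsub>L\<^esub> y)"
    if "xa \<in> carrier L" "r \<in> carrier K" "y \<in> carrier L" for xa r y
    using that x by (subst X.ract_smult) (simp_all add: X.lact_smult X.lact_ract)
  then show ?thesis
    by (intro E.tensor_balanced_map)
      (use x X.X.abelian_group_axioms in \<open>simp_all add: X.lact_add_l X.ract_add_l X.ract_add_r\<close>)
qed

lemma action_env:
  assumes "bimod K L L X" "x \<in> carrier X" "l \<in> carrier L" "l' \<in> carrier L"
  shows "env l l' \<odot>\<^bsub>bimodule_as_left_module X\<^esub> x = ract X (lact X l x) l'"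
proof -
  interpret balanced_map "carrier L \<times> carrier (op_ring L)" "tensor_rels K L (\<lambda>b k. k \<odot>\<^bsub>L\<^esub> b) (op_ring L) (smult L)"
    X "\<lambda>(b, a). ract X (lact X b x) a"
    by (rule balanced_action[OF assms(1,2)])
  show ?thesis using tensor_eval_of[of "(l, l')"] assms(3,4)
    by (simp add: bimodule_as_left_module_def env_def)
qed

text \<open>Additivity in the scalar holds because \<open>tensor_eval\<close> is a homomorphism. The
  other laws are checked on the generators \<open>env l l'\<close> and extended by
  \<open>R_induct\<close>; associativity needs this once for each of the two scalars.\<close>

lemma left_module_of_bimodule:
  assumes "bimod K L L X"
  shows "left_module R (bimodule_as_left_module X)"
proof -
  interpret X: bimod K L L X by fact
  let ?W = "bimodule_as_left_module X"
  have hom: "(\<lambda>U. U \<odot>\<^bsub>?W\<^esub> x) \<in> hom E.Q (add_monoid X)" if "x \<in> carrier X" for x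
    using balanced_map.tensor_eval_hom[OF balanced_action[OF assms that]]
    by (simp add: bimodule_as_left_module_def)
  have cl: "U \<odot>\<^bsub>?W\<^esub> x \<in> carrier X" if "U \<in> carrier R" "x \<in> carrier X" for U x
    using hom_in_carrier[OF hom[OF that(2)]] that(1) unfolding R_simps by simp
  have addU: "(U \<oplus>\<^bsub>R\<^esub> V) \<odot>\<^bsub>?W\<^esub> x = U \<odot>\<^bsub>?W\<^esub> x \<oplus>\<^bsub>X\<^esub> V \<odot>\<^bsub>?W\<^esub> x"
    if "U \<in> carrier R" "V \<in> carrier R" "x \<in> carrier X" for U V x
    using hom_mult[OF hom[OF that(3)]] that(1,2) unfolding R_simps by simp
  have zero: "\<zero>\<^bsub>R\<^esub> \<odot>\<^bsub>?W\<^esub> x = \<zero>\<^bsub>X\<^esub>" if "x \<in> carrier X" for x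
    using addU[of "\<zero>\<^bsub>R\<^esub>" "\<zero>\<^bsub>R\<^esub>" x] cl[of "\<zero>\<^bsub>R\<^esub>" x] that X.X.add.l_cancel_one' by fastforce
  have um: "(\<ominus>\<^bsub>R\<^esub> U) \<odot>\<^bsub>?W\<^esub> x = \<ominus>\<^bsub>X\<^esub> (U \<odot>\<^bsub>?W\<^esub> x)"
    if "U \<in> carrier R" "x \<in> carrier X" for U x
    using addU[of "\<ominus>\<^bsub>R\<^esub> U" U x] that cl zero[OF that(2)] R.l_neg[OF that(1)]
    by (intro X.X.minus_equality[symmetric]) auto
  note env = action_env[OF assms]
  have distr: "U \<odot>\<^bsub>?W\<^esub> (x \<oplus>\<^bsub>X\<^esub> y) = U \<odot>\<^bsub>?W\<^esub> x \<oplus>\<^bsub>X\<^esub> U \<odot>\<^bsub>?W\<^esub> y"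
    if "U \<in> carrier R" "x \<in> carrier X" "y \<in> carrier X" for U x y
    using that(1)
  proof (induction rule: R_induct)
    case (add U1 U2)
    then show ?case using that by (simp add: addU cl X.X.a_ac)
  qed (use that in \<open>auto simp: env zero um cl X.lact_add_r X.ract_add_l X.X.minus_add\<close>)
  have zeror: "U \<odot>\<^bsub>?W\<^esub> \<zero>\<^bsub>X\<^esub> = \<zero>\<^bsub>X\<^esub>" if "U \<in> carrier R" for U
    using distr[OF that, of "\<zero>\<^bsub>X\<^esub>" "\<zero>\<^bsub>X\<^esub>"] cl[OF that, of "\<zero>\<^bsub>X\<^esub>"] X.X.add.l_cancel_one' by fastforce
  have umr: "U \<odot>\<^bsub>?W\<^esub> (\<ominus>\<^bsub>X\<^esub> x) = \<ominus>\<^bsub>X\<^esub> (U \<odot>\<^bsub>?W\<^esub> x)"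
    if "U \<in> carrier R" "x \<in> carrier X" for U x
    using distr[OF that(1), of "\<ominus>\<^bsub>X\<^esub> x" x] that cl zeror[OF that(1)] X.X.l_neg[OF that(2)]
    by (intro X.X.minus_equality[symmetric]) auto
  have assoc1: "(env l l' \<otimes>\<^bsub>R\<^esub> V) \<odot>\<^bsub>?W\<^esub> x = env l l' \<odot>\<^bsub>?W\<^esub> (V \<odot>\<^bsub>?W\<^esub> x)"
    if "V \<in> carrier R" "x \<in> carrier X" "l \<in> carrier L" "l' \<in> carrier L" for V x l l'
    using that(1)
  proof (induction rule: R_induct)
    case (env m m')
    then show ?case using that
      by (simp add: env_mult action_env[OF assms] X.lact_mult X.ract_mult X.lact_ract)
  next
    case (add U1 U2)
    then show ?case using that by (simp add: R.r_distr addU distr cl)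
  next
    case (uminus U1)
    then show ?case using that by (simp add: R.r_minus um umr cl)
  qed (use that in \<open>simp add: zero zeror\<close>)
  have assoc: "(U \<otimes>\<^bsub>R\<^esub> V) \<odot>\<^bsub>?W\<^esub> x = U \<odot>\<^bsub>?W\<^esub> (V \<odot>\<^bsub>?W\<^esub> x)"
    if "U \<in> carrier R" "V \<in> carrier R" "x \<in> carrier X" for U V x
    using that(1)
  proof (induction rule: R_induct)
    case (env m m')
    then show ?case using that assoc1 by simp
  next
    case (add U1 U2)
    then show ?case using that by (simp add: R.l_distr addU cl)
  next
    case (uminus U1)
    then show ?case using that by (simp add: R.l_minus um cl)
  qed (use that in \<open>simp add: zero cl\<close>)
  have one: "\<one>\<^bsub>R\<^esub> \<odot>\<^bsub>?W\<^esub> x = x" if "x \<in> carrier X" for x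
    unfolding R_simps using that by (simp add: env)
  have "abelian_group ?W" by (rule abelian_group_transfer[OF X.X.abelian_group_axioms]) simp_all
  then show ?thesis unfolding left_module_def left_module_axioms_def
    using R.ring_axioms cl addU distr assoc one by simp
qed

text \<open>For fixed \<open>x\<close> both sides of linearity are homomorphisms in the scalar, so
  they need only be compared on the generators \<open>env a b\<close>.\<close>

lemma linear_map_of_bimodule_map:
  assumes X: "bimod K L L X" and Y: "bimod K L L Y"
    and f: "\<And>x. x \<in> carrier X \<Longrightarrow> f x \<in> carrier Y"
    and add: "\<And>x y. x \<in> carrier X \<Longrightarrow> y \<in> carrier X \<Longrightarrow> f (x \<oplus>\<^bsub>X\<^esub> y) = f x \<oplus>\<^bsub>Y\<^esub> f y"
    and l: "\<And>x l. x \<in> carrier X \<Longrightarrow> l \<in> carrier L \<Longrightarrow> f (lact X l x) = lact Y l (f x)"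
    and r: "\<And>x l. x \<in> carrier X \<Longrightarrow> l \<in> carrier L \<Longrightarrow> f (ract X x l) = ract Y (f x) l"
  shows "linear_map R (bimodule_as_left_module X) (bimodule_as_left_module Y) f"
proof -
  interpret X: bimod K L L X by fact
  interpret Y: bimod K L L Y by fact
  let ?X = "bimodule_as_left_module X" and ?Y = "bimodule_as_left_module Y"
  interpret WX: left_module R ?X by (rule left_module_of_bimodule[OF X])
  interpret WY: left_module R ?Y by (rule left_module_of_bimodule[OF Y])
  have "f (U \<odot>\<^bsub>?X\<^esub> x) = U \<odot>\<^bsub>?Y\<^esub> f x" if x: "x \<in> carrier X" and U: "U \<in> carrier R" for U x
  proof -
    have hX: "(\<lambda>U. U \<odot>\<^bsub>?X\<^esub> x) \<in> hom E.Q (add_monoid X)"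
      using WX.smult_closed WX.smult_l_distr x unfolding R_simps by (auto simp: hom_def)
    have hY: "(\<lambda>U. U \<odot>\<^bsub>?Y\<^esub> f x) \<in> hom E.Q (add_monoid Y)"
      using WY.smult_closed WY.smult_l_distr f[OF x] unfolding R_simps by (auto simp: hom_def)
    have "f \<in> hom (add_monoid X) (add_monoid Y)" using f add by (auto simp: hom_def)
    from hom_compose[OF hX this] have "(\<lambda>U. f (U \<odot>\<^bsub>?X\<^esub> x)) \<in> hom E.Q (add_monoid Y)" by (simp add: o_def)
    then show ?thesis
    proof (rule E.Q_hom_eq[OF _ hY Y.X.add.is_group])
      show "U \<in> carrier E.Q" using U unfolding R_simps .
      fix s assume "s \<in> carrier L \<times> carrier (op_ring L)"
      then obtain a b where s: "s = (a, b)" and ab: "a \<in> carrier L" "b \<in> carrier L" by auto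
      show "f (E.cls (frag_of s) \<odot>\<^bsub>?X\<^esub> x) = E.cls (frag_of s) \<odot>\<^bsub>?Y\<^esub> f x"
        unfolding s env_def[symmetric] using ab x f l r
        by (simp only: action_env[OF X] action_env[OF Y] X.lact_closed)
    qed
  qed
  then show ?thesis unfolding linear_map_def using f add by simp
qed

end

subsection \<open>Lifting through projective modules\<close>

lemma linear_mapD:
  assumes "linear_map R X Y f"
  shows "x \<in> carrier X \<Longrightarrow> f x \<in> carrier Y"
    "x \<in> carrier X \<Longrightarrow> y \<in> carrier X \<Longrightarrow> f (x \<oplus>\<^bsub>X\<^esub> y) = f x \<oplus>\<^bsub>Y\<^esub> f y"
    "r \<in> carrier R \<Longrightarrow> x \<in> carrier X \<Longrightarrow> f (r \<odot>\<^bsub>X\<^esub> x) = r \<odot>\<^bsub>Y\<^esub> f x"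
  using assms by (auto simp: linear_map_def)

lemma linear_map_comp:
  "linear_map R X Y f \<Longrightarrow> linear_map R Y Z g \<Longrightarrow> linear_map R X Z (\<lambda>x. g (f x))"
  unfolding linear_map_def by (auto simp: Pi_iff)

lemma additive_zero:
  assumes "abelian_group X" "abelian_group Y" "f \<zero>\<^bsub>X\<^esub> \<in> carrier Y"
    "\<And>x y. x \<in> carrier X \<Longrightarrow> y \<in> carrier X \<Longrightarrow> f (x \<oplus>\<^bsub>X\<^esub> y) = f x \<oplus>\<^bsub>Y\<^esub> f y"
  shows "f \<zero>\<^bsub>X\<^esub> = \<zero>\<^bsub>Y\<^esub>"
proof -
  interpret X: abelian_group X by fact
  interpret Y: abelian_group Y by fact
  show ?thesis using assms(4)[of "\<zero>\<^bsub>X\<^esub>" "\<zero>\<^bsub>X\<^esub>"] assms(3) Y.add.l_cancel_one' by fastforce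
qed

lemma linear_map_zero:
  assumes "left_module R X" "left_module R Y" "linear_map R X Y f"
  shows "f \<zero>\<^bsub>X\<^esub> = \<zero>\<^bsub>Y\<^esub>"
  using assms by (intro additive_zero) (auto simp: left_module_def linear_map_def abelian_group.axioms abelian_monoid.zero_closed)

lemma free_module_decompose:
  assumes "ring R" and f: "f \<in> carrier (free_module R S)" and s: "s \<in> S"
  defines "\<delta> \<equiv> \<lambda>t. if t = s then \<one>\<^bsub>R\<^esub> else \<zero>\<^bsub>R\<^esub>"
  shows "f = f s \<odot>\<^bsub>free_module R S\<^esub> \<delta> \<oplus>\<^bsub>free_module R S\<^esub> f(s := \<zero>\<^bsub>R\<^esub>)"
    "\<delta> \<in> carrier (free_module R S)" "f(s := \<zero>\<^bsub>R\<^esub>) \<in> carrier (free_module R S)" "f s \<in> carrier R"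
    "f s \<odot>\<^bsub>free_module R S\<^esub> \<delta> \<in> carrier (free_module R S)"
proof -
  interpret ring R by fact
  have fc: "f t \<in> carrier R" for t using f by (auto simp: free_module_def)
  show "f s \<in> carrier R" by (rule fc)
  show "f = f s \<odot>\<^bsub>free_module R S\<^esub> \<delta> \<oplus>\<^bsub>free_module R S\<^esub> f(s := \<zero>\<^bsub>R\<^esub>)"
    using fc by (auto simp: free_module_def \<delta>_def)
  show "\<delta> \<in> carrier (free_module R S)"
    using s by (auto simp: free_module_def \<delta>_def intro: finite_subset[of _ "{s}"])
  show "f s \<odot>\<^bsub>free_module R S\<^esub> \<delta> \<in> carrier (free_module R S)"
    using s fc by (auto simp: free_module_def \<delta>_def intro: finite_subset[of _ "{s}"])
  show "f(s := \<zero>\<^bsub>R\<^esub>) \<in> carrier (free_module R S)"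
    using f by (auto simp: free_module_def intro: finite_subset[of _ "{s. f s \<noteq> \<zero>\<^bsub>R\<^esub>}"])
qed

text \<open>A finitely supported function is built up one coordinate at a time, hence the induction
  over finite sets containing its support.\<close>

lemma free_linear_map_eq:
  assumes "ring R" "left_module R Y"
    and u: "linear_map R (free_module R S) Y u" and v: "linear_map R (free_module R S) Y v"
    and eq: "\<And>s. s \<in> S \<Longrightarrow> u (\<lambda>t. if t = s then \<one>\<^bsub>R\<^esub> else \<zero>\<^bsub>R\<^esub>) = v (\<lambda>t. if t = s then \<one>\<^bsub>R\<^esub> else \<zero>\<^bsub>R\<^esub>)"
    and f: "f \<in> carrier (free_module R S)"
  shows "u f = v f"
proof -
  interpret R: ring R by fact
  interpret Y: left_module R Y by fact
  let ?F = "free_module R S"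
  have z: "w (\<lambda>s. \<zero>\<^bsub>R\<^esub>) = \<zero>\<^bsub>Y\<^esub>" if "linear_map R ?F Y w" for w
  proof -
    let ?z = "\<lambda>s. \<zero>\<^bsub>R\<^esub>"
    have "?z \<in> carrier ?F" "?z \<oplus>\<^bsub>?F\<^esub> ?z = ?z" by (auto simp: free_module_def)
    then have "w ?z \<oplus>\<^bsub>Y\<^esub> w ?z = w ?z" "w ?z \<in> carrier Y"
      using linear_mapD[OF that] by metis+
    then show ?thesis using Y.M.add.l_cancel_one' by fastforce
  qed
  have "\<forall>f\<in>carrier ?F. {s. f s \<noteq> \<zero>\<^bsub>R\<^esub>} \<subseteq> T \<longrightarrow> u f = v f" if "finite T" "T \<subseteq> S" for T
    using that
  proof (induction T rule: finite_induct)
    case empty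
    show ?case
    proof (intro ballI impI)
      fix f assume "f \<in> carrier ?F" "{s. f s \<noteq> \<zero>\<^bsub>R\<^esub>} \<subseteq> {}"
      then have f: "f = (\<lambda>s. \<zero>\<^bsub>R\<^esub>)" by auto
      show "u f = v f" unfolding f z[OF u] z[OF v] ..
    qed
  next
    case (insert s T)
    show ?case
    proof (intro ballI impI)
      fix f assume f: "f \<in> carrier ?F" and sup: "{s. f s \<noteq> \<zero>\<^bsub>R\<^esub>} \<subseteq> insert s T"
      have s: "s \<in> S" using insert by simp
      note d = free_module_decompose[OF assms(1) f s]
      have "{t. (f(s := \<zero>\<^bsub>R\<^esub>)) t \<noteq> \<zero>\<^bsub>R\<^esub>} \<subseteq> T" using sup by auto
      then have upd: "u (f(s := \<zero>\<^bsub>R\<^esub>)) = v (f(s := \<zero>\<^bsub>R\<^esub>))" using insert.IH insert.prems d(3) by blast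
      have "w f = f s \<odot>\<^bsub>Y\<^esub> w (\<lambda>t. if t = s then \<one>\<^bsub>R\<^esub> else \<zero>\<^bsub>R\<^esub>) \<oplus>\<^bsub>Y\<^esub> w (f(s := \<zero>\<^bsub>R\<^esub>))"
        if w: "linear_map R ?F Y w" for w
        using arg_cong[OF d(1), of w] linear_mapD(2)[OF w d(5,3)] linear_mapD(3)[OF w d(4,2)] by simp
      from this[OF u] this[OF v] show "u f = v f" using eq[OF s] upd by (simp only:)
    qed
  qed
  from this[of "{s. f s \<noteq> \<zero>\<^bsub>R\<^esub>}"] f show ?thesis by (auto simp: free_module_def)
qed

lemma free_module_universal:
  assumes "ring R" "left_module R Y" and t: "\<And>s. s \<in> S \<Longrightarrow> t s \<in> carrier Y"
  obtains h where "linear_map R (free_module R S) Y h"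
    "\<And>s. s \<in> S \<Longrightarrow> h (\<lambda>t. if t = s then \<one>\<^bsub>R\<^esub> else \<zero>\<^bsub>R\<^esub>) = t s"
proof -
  interpret R: ring R by fact
  interpret Y: left_module R Y by fact
  let ?F = "free_module R S"
  define h where "h f = (\<Oplus>\<^bsub>Y\<^esub>s\<in>{s. f s \<noteq> \<zero>\<^bsub>R\<^esub>}. f s \<odot>\<^bsub>Y\<^esub> t s)" for f
  have z: "\<zero>\<^bsub>R\<^esub> \<odot>\<^bsub>Y\<^esub> y = \<zero>\<^bsub>Y\<^esub>" if "y \<in> carrier Y" for y
    using Y.smult_l_distr[of "\<zero>\<^bsub>R\<^esub>" "\<zero>\<^bsub>R\<^esub>" y] Y.smult_closed[of "\<zero>\<^bsub>R\<^esub>" y] that Y.M.add.l_cancel_one' by fastforce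
  have zr: "r \<odot>\<^bsub>Y\<^esub> \<zero>\<^bsub>Y\<^esub> = \<zero>\<^bsub>Y\<^esub>" if "r \<in> carrier R" for r
    using Y.smult_r_distr[of r "\<zero>\<^bsub>Y\<^esub>" "\<zero>\<^bsub>Y\<^esub>"] Y.smult_closed[of r "\<zero>\<^bsub>Y\<^esub>"] that Y.M.add.l_cancel_one' by fastforce
  have fc: "f s \<in> carrier R" "f s \<noteq> \<zero>\<^bsub>R\<^esub> \<Longrightarrow> s \<in> S" "finite {s. f s \<noteq> \<zero>\<^bsub>R\<^esub>}" if "f \<in> carrier ?F" for f s
    using that by (auto simp: free_module_def)
  have cl: "f s \<odot>\<^bsub>Y\<^esub> t s \<in> carrier Y" if "f \<in> carrier ?F" "s \<in> S" for f s
    using fc[OF that(1)] t that(2) by (intro Y.smult_closed)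
  have sup: "h f = (\<Oplus>\<^bsub>Y\<^esub>s\<in>T. f s \<odot>\<^bsub>Y\<^esub> t s)"
    if "f \<in> carrier ?F" "finite T" "T \<subseteq> S" "{s. f s \<noteq> \<zero>\<^bsub>R\<^esub>} \<subseteq> T" for f T
    unfolding h_def
  proof (rule Y.M.add.finprod_mono_neutral_cong_left[OF that(2,4)])
    show "f i \<odot>\<^bsub>Y\<^esub> t i = \<zero>\<^bsub>Y\<^esub>" if "i \<in> T - {s. f s \<noteq> \<zero>\<^bsub>R\<^esub>}" for i
      using that \<open>T \<subseteq> S\<close> z[OF t[of i]] by auto
    show "(\<lambda>s. f s \<odot>\<^bsub>Y\<^esub> t s) \<in> T \<rightarrow> carrier Y" using cl that by auto
  qed simp
  have smult_sum: "r \<odot>\<^bsub>Y\<^esub> (\<Oplus>\<^bsub>Y\<^esub>s\<in>T. g s) = (\<Oplus>\<^bsub>Y\<^esub>s\<in>T. r \<odot>\<^bsub>Y\<^esub> g s)"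
    if "finite T" "g \<in> T \<rightarrow> carrier Y" "r \<in> carrier R" for r T g
    using that
  proof (induction T rule: finite_induct)
    case (insert x F)
    then have g: "g \<in> F \<rightarrow> carrier Y" "g x \<in> carrier Y" by auto
    then have "(\<lambda>s. r \<odot>\<^bsub>Y\<^esub> g s) \<in> F \<rightarrow> carrier Y" using insert.prems Y.smult_closed by auto
    then show ?case using insert g Y.smult_closed Y.smult_r_distr by simp
  qed (simp add: zr)
  have lin: "linear_map R ?F Y h"
    unfolding linear_map_def
  proof (intro conjI ballI funcsetI)
    fix f assume f: "f \<in> carrier ?F"
    show "h f \<in> carrier Y" unfolding h_def using cl[OF f] fc[OF f] by (intro Y.M.finsum_closed) auto
  next
    fix f g assume f: "f \<in> carrier ?F" and g: "g \<in> carrier ?F"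
    let ?T = "{s. f s \<noteq> \<zero>\<^bsub>R\<^esub>} \<union> {s. g s \<noteq> \<zero>\<^bsub>R\<^esub>}"
    have T: "finite ?T" "?T \<subseteq> S" using fc[OF f] fc[OF g] by auto
    have supp: "{s. (f \<oplus>\<^bsub>?F\<^esub> g) s \<noteq> \<zero>\<^bsub>R\<^esub>} \<subseteq> ?T" by (auto simp: free_module_def)
    have fg: "f \<oplus>\<^bsub>?F\<^esub> g \<in> carrier ?F"
      using f g finite_subset[OF supp T(1)] by (auto simp: free_module_def)
    have "h (f \<oplus>\<^bsub>?F\<^esub> g) = (\<Oplus>\<^bsub>Y\<^esub>s\<in>?T. f s \<odot>\<^bsub>Y\<^esub> t s \<oplus>\<^bsub>Y\<^esub> g s \<odot>\<^bsub>Y\<^esub> t s)"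
      unfolding sup[OF fg T supp]
    proof (rule Y.M.add.finprod_cong'[OF refl])
      show "(\<lambda>s. f s \<odot>\<^bsub>Y\<^esub> t s \<oplus>\<^bsub>Y\<^esub> g s \<odot>\<^bsub>Y\<^esub> t s) \<in> ?T \<rightarrow> carrier Y"
        using cl[OF f] cl[OF g] T(2) by (intro Pi_I Y.M.add.m_closed) blast+
      show "(f \<oplus>\<^bsub>?F\<^esub> g) s \<odot>\<^bsub>Y\<^esub> t s = f s \<odot>\<^bsub>Y\<^esub> t s \<oplus>\<^bsub>Y\<^esub> g s \<odot>\<^bsub>Y\<^esub> t s" if "s \<in> ?T" for s
        using Y.smult_l_distr[OF fc(1)[OF f] fc(1)[OF g] t[of s], of s s] that T(2)
        by (simp add: free_module_def subset_iff)
    qed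
    also have "\<dots> = h f \<oplus>\<^bsub>Y\<^esub> h g"
      unfolding sup[OF f T Un_upper1] sup[OF g T Un_upper2]
      by (rule Y.M.add.finprod_multf) (use cl f g T in auto)
    finally show "h (f \<oplus>\<^bsub>?F\<^esub> g) = h f \<oplus>\<^bsub>Y\<^esub> h g" .
  next
    fix r f assume r: "r \<in> carrier R" and f: "f \<in> carrier ?F"
    let ?T = "{s. f s \<noteq> \<zero>\<^bsub>R\<^esub>}"
    have T: "finite ?T" "?T \<subseteq> S" using fc[OF f] by auto
    have supp: "{s. (r \<odot>\<^bsub>?F\<^esub> f) s \<noteq> \<zero>\<^bsub>R\<^esub>} \<subseteq> ?T" using r by (auto simp: free_module_def)
    have rf: "r \<odot>\<^bsub>?F\<^esub> f \<in> carrier ?F"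
      using f r finite_subset[OF supp T(1)] by (auto simp: free_module_def)
    have "h (r \<odot>\<^bsub>?F\<^esub> f) = (\<Oplus>\<^bsub>Y\<^esub>s\<in>?T. r \<odot>\<^bsub>Y\<^esub> (f s \<odot>\<^bsub>Y\<^esub> t s))"
      unfolding sup[OF rf T supp]
    proof (rule Y.M.add.finprod_cong'[OF refl])
      show "(\<lambda>s. r \<odot>\<^bsub>Y\<^esub> (f s \<odot>\<^bsub>Y\<^esub> t s)) \<in> ?T \<rightarrow> carrier Y"
        using Y.smult_closed[OF r cl[OF f]] T(2) by (intro Pi_I) blast
      show "(r \<odot>\<^bsub>?F\<^esub> f) s \<odot>\<^bsub>Y\<^esub> t s = r \<odot>\<^bsub>Y\<^esub> (f s \<odot>\<^bsub>Y\<^esub> t s)" if "s \<in> ?T" for s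
        using Y.smult_assoc[OF r fc(1)[OF f] t[of s], of s] that T(2)
        by (simp add: free_module_def subset_iff)
    qed
    also have "\<dots> = r \<odot>\<^bsub>Y\<^esub> h f"
      unfolding h_def using T(2) cl[OF f] by (intro smult_sum[symmetric] T(1) r Pi_I) blast
    finally show "h (r \<odot>\<^bsub>?F\<^esub> f) = r \<odot>\<^bsub>Y\<^esub> h f" .
  qed
  have "h (\<lambda>t. if t = s then \<one>\<^bsub>R\<^esub> else \<zero>\<^bsub>R\<^esub>) = t s" if s: "s \<in> S" for s
  proof -
    let ?d = "\<lambda>t. if t = s then \<one>\<^bsub>R\<^esub> else \<zero>\<^bsub>R\<^esub>"
    have d: "?d \<in> carrier ?F"
      using s by (auto simp: free_module_def intro: finite_subset[of _ "{s}"])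
    have "h ?d = (\<Oplus>\<^bsub>Y\<^esub>u\<in>{s}. t u)"
      by (subst sup[OF d, of "{s}"]) (use s t Y.smult_one in \<open>auto intro!: Y.M.add.finprod_cong'[OF refl]\<close>)
    then show ?thesis using t[OF s] by simp
  qed
  with lin show ?thesis by (rule that)
qed

text \<open>The images of the basis of the free module are lifted first; restricting along the
  section \<open>i\<close> gives the lift on \<open>P\<close>.\<close>

lemma projective_lift:
  assumes P: "projective_module R P" and Q: "left_module R Q" and Y: "left_module R Y"
    and p: "linear_map R Q Y p" and surj: "\<And>y. y \<in> carrier Y \<Longrightarrow> \<exists>x\<in>carrier Q. p x = y"
    and g: "linear_map R P Y g"
  obtains h where "linear_map R P Q h" "\<And>x. x \<in> carrier P \<Longrightarrow> p (h x) = g x"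
proof -
  have R: "ring R" using Q by (simp add: left_module_def)
  obtain S :: "'c set" and i q where i: "linear_map R P (free_module R S) i"
    and q: "linear_map R (free_module R S) P q" and qi: "\<And>x. x \<in> carrier P \<Longrightarrow> q (i x) = x"
    using P unfolding projective_module_def by blast
  let ?d = "\<lambda>s t. if t = s then \<one>\<^bsub>R\<^esub> else \<zero>\<^bsub>R\<^esub>"
  have d: "?d s \<in> carrier (free_module R S)" if "s \<in> S" for s
    using that ring.ring_simprules(2,6)[OF R] by (auto simp: free_module_def intro: finite_subset[of _ "{s}"])
  have "\<exists>x. x \<in> carrier Q \<and> p x = g (q (?d s))" if "s \<in> S" for s
    using surj linear_mapD(1)[OF g] linear_mapD(1)[OF q] d[OF that] by blast
  then obtain t where t: "\<And>s. s \<in> S \<Longrightarrow> t s \<in> carrier Q \<and> p (t s) = g (q (?d s))" by metis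
  obtain h where h: "linear_map R (free_module R S) Q h" "\<And>s. s \<in> S \<Longrightarrow> h (?d s) = t s"
    using free_module_universal[OF R Q, of S t] t by metis
  have "p (h f) = g (q f)" if "f \<in> carrier (free_module R S)" for f
    by (rule free_linear_map_eq[OF R Y linear_map_comp[OF h(1) p] linear_map_comp[OF q g] _ that])
       (simp add: h(2) t)
  then have "p (h (i x)) = g x" if "x \<in> carrier P" for x
    using linear_mapD(1)[OF i that] qi[OF that] by simp
  with linear_map_comp[OF i h(1)] show ?thesis by (rule that)
qed

subsection \<open>One step of dimension shifting\<close>

text \<open>\<open>W\<close> is a subbimodule and \<open>V\<close> the quotient. The twist
  \<open>\<theta>\<close> plays the part of a 1-cocycle: a derivation of \<open>L\<close> with
  values in the right linear maps from \<open>V\<close> to \<open>W\<close>, the derivation rule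
  being associativity of the left action.\<close>

definition twisted_sum :: "('l, 'l, 'v) bimodule \<Rightarrow> ('l, 'l, 'w) bimodule \<Rightarrow> ('l \<Rightarrow> 'v \<Rightarrow> 'w) \<Rightarrow>
    ('l, 'l, 'v \<times> 'w) bimodule" where
  "twisted_sum V W \<theta> = \<lparr>carrier = carrier V \<times> carrier W, monoid.mult = undefined, one = undefined,
     zero = (\<zero>\<^bsub>V\<^esub>, \<zero>\<^bsub>W\<^esub>), add = (\<lambda>(v, w) (v', w'). (v \<oplus>\<^bsub>V\<^esub> v', w \<oplus>\<^bsub>W\<^esub> w')),
     lact = (\<lambda>l (v, w). (lact V l v, lact W l w \<oplus>\<^bsub>W\<^esub> \<theta> l v)), ract = (\<lambda>(v, w) l. (ract V v l, ract W w l))\<rparr>"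

locale bimodule_extension = enveloping K L + V: bimod K L L V + W: bimod K L L W
  for K :: "('k, 'u) ring_scheme" and L :: "('k, 'l) module"
    and V :: "('l, 'l, 'v) bimodule" and W :: "('l, 'l, 'w) bimodule" +
  fixes \<theta> :: "'l \<Rightarrow> 'v \<Rightarrow> 'w"
  assumes \<theta>_closed: "l \<in> carrier L \<Longrightarrow> v \<in> carrier V \<Longrightarrow> \<theta> l v \<in> carrier W"
    and \<theta>_add_l: "l \<in> carrier L \<Longrightarrow> l' \<in> carrier L \<Longrightarrow> v \<in> carrier V \<Longrightarrow> \<theta> (l \<oplus>\<^bsub>L\<^esub> l') v = \<theta> l v \<oplus>\<^bsub>W\<^esub> \<theta> l' v"
    and \<theta>_add_r: "l \<in> carrier L \<Longrightarrow> v \<in> carrier V \<Longrightarrow> v' \<in> carrier V \<Longrightarrow> \<theta> l (v \<oplus>\<^bsub>V\<^esub> v') = \<theta> l v \<oplus>\<^bsub>W\<^esub> \<theta> l v'"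
    and \<theta>_mult: "l \<in> carrier L \<Longrightarrow> l' \<in> carrier L \<Longrightarrow> v \<in> carrier V \<Longrightarrow>
        \<theta> (l \<otimes>\<^bsub>L\<^esub> l') v = lact W l (\<theta> l' v) \<oplus>\<^bsub>W\<^esub> \<theta> l (lact V l' v)"
    and \<theta>_ract: "l \<in> carrier L \<Longrightarrow> l' \<in> carrier L \<Longrightarrow> v \<in> carrier V \<Longrightarrow> \<theta> l (ract V v l') = ract W (\<theta> l v) l'"
    and \<theta>_ground: "c \<in> carrier K \<Longrightarrow> v \<in> carrier V \<Longrightarrow> \<theta> (c \<odot>\<^bsub>L\<^esub> \<one>\<^bsub>L\<^esub>) v = \<zero>\<^bsub>W\<^esub>"
begin

abbreviation "X \<equiv> twisted_sum V W \<theta>"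

lemma \<theta>_one: "v \<in> carrier V \<Longrightarrow> \<theta> \<one>\<^bsub>L\<^esub> v = \<zero>\<^bsub>W\<^esub>"
  using \<theta>_ground[of "\<one>\<^bsub>K\<^esub>" v] by simp

lemma \<theta>_zero: "l \<in> carrier L \<Longrightarrow> \<theta> l \<zero>\<^bsub>V\<^esub> = \<zero>\<^bsub>W\<^esub>"
  by (intro additive_zero[OF V.X.abelian_group_axioms W.X.abelian_group_axioms]) (auto intro: \<theta>_closed \<theta>_add_r)

lemma twisted_sum_bimod: "bimod K L L X"
proof -
  have "abelian_group X"
  proof (rule abelian_groupI)
    fix x assume "x \<in> carrier X"
    then show "\<exists>y\<in>carrier X. y \<oplus>\<^bsub>X\<^esub> x = \<zero>\<^bsub>X\<^esub>"
      by (intro bexI[of _ "(\<ominus>\<^bsub>V\<^esub> fst x, \<ominus>\<^bsub>W\<^esub> snd x)"]) (auto simp: twisted_sum_def V.X.l_neg W.X.l_neg)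
  qed (auto simp: twisted_sum_def V.X.a_ac W.X.a_ac)
  then have "is_bimodule K L L X"
    by (intro is_bimoduleI)
      (auto simp: twisted_sum_def L.ring_axioms V.lact_add_l V.lact_add_r V.ract_add_l V.ract_add_r V.lact_mult V.ract_mult
        V.lact_ract V.lact_ground W.lact_add_l W.lact_add_r W.ract_add_l W.ract_add_r W.lact_mult W.ract_mult
        W.lact_ract W.lact_ground \<theta>_closed \<theta>_add_l \<theta>_add_r \<theta>_mult \<theta>_ract \<theta>_ground \<theta>_one W.X.a_ac)
  then show ?thesis by unfold_locales
qed

text \<open>The lift of \<open>\<alpha>\<close> to the twisted sum restricts on boundaries to a map into the second summand;
  its value there depends only on \<open>\<theta>\<close>, not on the choice of the lift.\<close>

lemma shift:
  assumes P: "projective_module R P" and P': "left_module R P'"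
    and d: "linear_map R P' P d"
    and \<alpha>: "linear_map R P (bimodule_as_left_module V) \<alpha>"
    and \<alpha>d: "\<And>p. p \<in> carrier P' \<Longrightarrow> \<alpha> (d p) = \<zero>\<^bsub>V\<^esub>"
  obtains \<alpha>' where "linear_map R P' (bimodule_as_left_module W) \<alpha>'"
    "\<And>p. p \<in> carrier P' \<Longrightarrow> d p = \<zero>\<^bsub>P\<^esub> \<Longrightarrow> \<alpha>' p = \<zero>\<^bsub>W\<^esub>"
    "\<And>p l l' w w'. \<lbrakk>p \<in> carrier P'; w \<in> carrier P; w' \<in> carrier P; l \<in> carrier L; l' \<in> carrier L;
        \<And>u. u \<in> carrier W \<Longrightarrow> lact W l u = \<zero>\<^bsub>W\<^esub>; \<And>u. u \<in> carrier W \<Longrightarrow> ract W u l' = \<zero>\<^bsub>W\<^esub>;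
        d p = env l \<one>\<^bsub>L\<^esub> \<odot>\<^bsub>P\<^esub> w \<oplus>\<^bsub>P\<^esub> env \<one>\<^bsub>L\<^esub> l' \<odot>\<^bsub>P\<^esub> w'\<rbrakk> \<Longrightarrow> \<alpha>' p = \<theta> l (\<alpha> w)"
proof -
  interpret P: left_module R P using P by (simp add: projective_module_def)
  interpret P': left_module R P' by (rule P')
  interpret X: bimod K L L X by (rule twisted_sum_bimod)
  have bV: "bimod K L L V" and bW: "bimod K L L W" by unfold_locales
  note Vm = left_module_of_bimodule[OF bV] and Xm = left_module_of_bimodule[OF twisted_sum_bimod]
  interpret WX: left_module R "bimodule_as_left_module X" by (rule Xm)
  have fst_lin: "linear_map R (bimodule_as_left_module X) (bimodule_as_left_module V) fst"
    by (rule linear_map_of_bimodule_map[OF twisted_sum_bimod bV]) (auto simp: twisted_sum_def)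
  have surj: "\<exists>x\<in>carrier (bimodule_as_left_module X). fst x = y"
    if "y \<in> carrier (bimodule_as_left_module V)" for y
    using that by (intro bexI[of _ "(y, \<zero>\<^bsub>W\<^esub>)"]) (auto simp: twisted_sum_def)
  obtain h where h: "linear_map R P (bimodule_as_left_module X) h"
    and fh: "\<And>x. x \<in> carrier P \<Longrightarrow> fst (h x) = \<alpha> x"
    using projective_lift[OF P Xm Vm fst_lin surj \<alpha>] by blast
  have incl: "linear_map R (bimodule_as_left_module W) (bimodule_as_left_module X) (\<lambda>w. (\<zero>\<^bsub>V\<^esub>, w))"
    by (rule linear_map_of_bimodule_map[OF bW twisted_sum_bimod])
      (auto simp: twisted_sum_def V.lact_zero V.ract_zero \<theta>_zero)
  define a where "a p = snd (h (d p))" for p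
  have dc: "d p \<in> carrier P" if "p \<in> carrier P'" for p using linear_mapD(1)[OF d that] .
  have hc: "h p \<in> carrier V \<times> carrier W" if "p \<in> carrier P" for p
    using linear_mapD(1)[OF h that] by (simp add: twisted_sum_def)
  \<comment> \<open>As \<open>\<alpha>\<close> vanishes on boundaries, the lift sends them into the
    copy of \<open>W\<close>; the second component there is the shifted map.\<close>
  have hd: "h (d p) = (\<zero>\<^bsub>V\<^esub>, a p)" if "p \<in> carrier P'" for p
    using fh[OF dc[OF that]] \<alpha>d[OF that] by (simp add: a_def prod_eq_iff)
  have ac: "a p \<in> carrier W" if "p \<in> carrier P'" for p using hc[OF dc[OF that]] by (auto simp: a_def)
  have "linear_map R P' (bimodule_as_left_module W) a"
    unfolding linear_map_def
  proof (intro conjI ballI funcsetI)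
    fix p q assume pq: "p \<in> carrier P'" "q \<in> carrier P'"
    have "h (d (p \<oplus>\<^bsub>P'\<^esub> q)) = h (d p) \<oplus>\<^bsub>X\<^esub> h (d q)"
      using pq linear_mapD(2)[OF d] linear_mapD(2)[OF h] dc by simp
    then show "a (p \<oplus>\<^bsub>P'\<^esub> q) = a p \<oplus>\<^bsub>bimodule_as_left_module W\<^esub> a q"
      using pq by (simp add: hd P'.M.add.m_closed) (simp add: twisted_sum_def)
  next
    fix r p assume r: "r \<in> carrier R" and p: "p \<in> carrier P'"
    have "h (d (r \<odot>\<^bsub>P'\<^esub> p)) = r \<odot>\<^bsub>bimodule_as_left_module X\<^esub> h (d p)"
      using r p linear_mapD(3)[OF d] linear_mapD(3)[OF h] dc by simp
    also have "\<dots> = (\<zero>\<^bsub>V\<^esub>, r \<odot>\<^bsub>bimodule_as_left_module W\<^esub> a p)"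
      using linear_mapD(3)[OF incl r, of "a p"] ac[OF p] hd[OF p] by simp
    finally show "a (r \<odot>\<^bsub>P'\<^esub> p) = r \<odot>\<^bsub>bimodule_as_left_module W\<^esub> a p"
      using hd[OF P'.smult_closed[OF r p]] by simp
  qed (simp add: ac)
  moreover have "a p = \<zero>\<^bsub>W\<^esub>" if "p \<in> carrier P'" "d p = \<zero>\<^bsub>P\<^esub>" for p
    using linear_map_zero[OF P.left_module_axioms Xm h] that by (simp add: a_def twisted_sum_def)
  moreover have "a p = \<theta> l (\<alpha> w)"
    if p: "p \<in> carrier P'" "w \<in> carrier P" "w' \<in> carrier P" "l \<in> carrier L" "l' \<in> carrier L"
      and l: "\<And>u. u \<in> carrier W \<Longrightarrow> lact W l u = \<zero>\<^bsub>W\<^esub>" and r: "\<And>u. u \<in> carrier W \<Longrightarrow> ract W u l' = \<zero>\<^bsub>W\<^esub>"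
      and dp: "d p = env l \<one>\<^bsub>L\<^esub> \<odot>\<^bsub>P\<^esub> w \<oplus>\<^bsub>P\<^esub> env \<one>\<^bsub>L\<^esub> l' \<odot>\<^bsub>P\<^esub> w'" for p l l' w w'
  proof -
    obtain y where y: "h w = (\<alpha> w, y)" "y \<in> carrier W" using fh[OF p(2)] hc[OF p(2)] by (metis SigmaE fst_conv)
    obtain y' where y': "h w' = (\<alpha> w', y')" "y' \<in> carrier W" using fh[OF p(3)] hc[OF p(3)] by (metis SigmaE fst_conv)
    have \<alpha>c: "\<alpha> w \<in> carrier V" "\<alpha> w' \<in> carrier V" using hc[OF p(2)] hc[OF p(3)] y y' by auto
    have hX: "h w \<in> carrier X" "h w' \<in> carrier X" using linear_mapD(1)[OF h] p by simp_all
    have "h (d p) = env l \<one>\<^bsub>L\<^esub> \<odot>\<^bsub>bimodule_as_left_module X\<^esub> h w \<oplus>\<^bsub>X\<^esub> env \<one>\<^bsub>L\<^esub> l' \<odot>\<^bsub>bimodule_as_left_module X\<^esub> h w'"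
      unfolding dp using p linear_mapD(2)[OF h] linear_mapD(3)[OF h] by (simp add: P.smult_closed)
    also have "\<dots> = lact X l (h w) \<oplus>\<^bsub>X\<^esub> ract X (h w') l'"
      using action_env[OF twisted_sum_bimod hX(1), of l "\<one>\<^bsub>L\<^esub>"] action_env[OF twisted_sum_bimod hX(2), of "\<one>\<^bsub>L\<^esub>" l']
        p hX by simp
    \<comment> \<open>The right action on the twisted sum has no twist, and \<open>l\<close> and
      \<open>l'\<close> annihilate \<open>W\<close>. So the components \<open>y\<close> and
      \<open>y'\<close>, which depend on the lift, drop out and only \<open>\<theta>\<close>
      remains.\<close>
    finally have "a p = lact W l y \<oplus>\<^bsub>W\<^esub> \<theta> l (\<alpha> w) \<oplus>\<^bsub>W\<^esub> ract W y' l'"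
      unfolding a_def y y' by (simp add: twisted_sum_def)
    then show ?thesis using l[OF y(2)] r[OF y'(2)] \<theta>_closed[OF p(4) \<alpha>c(1)] by simp
  qed
  ultimately show ?thesis by (rule that)
qed

end

subsection \<open>Nontrivial classes in Tor\<close>

lemma tensor_data_Tor:
  assumes "abelian_group X" "\<And>r x. r \<in> carrier R \<Longrightarrow> x \<in> carrier X \<Longrightarrow> r \<odot>\<^bsub>X\<^esub> x \<in> carrier X" "left_module R P"
  shows "tensor_data R X (\<lambda>x r. r \<odot>\<^bsub>X\<^esub> x) P (smult P)"
proof -
  interpret P: left_module R P by fact
  show ?thesis unfolding tensor_data_def tensor_data_axioms_def
    using assms(1,2) P.M.abelian_group_axioms P.smult_closed by simp
qed

text \<open>A functional on chains that kills boundaries but not a given cycle separates the class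
  of the cycle from zero. The degree is a successor because only there is \<open>Tor_cycles\<close>
  the kernel of a boundary map.\<close>

lemma Tor_nontrivial:
  assumes X: "abelian_group X" "\<And>r x. r \<in> carrier R \<Longrightarrow> x \<in> carrier X \<Longrightarrow> r \<odot>\<^bsub>X\<^esub> x \<in> carrier X"
    and P: "\<And>n. left_module R (P n)" and d: "\<And>n. linear_map R (P (Suc n)) (P n) (d n)"
    and G: "abelian_group G"
    and \<Theta>: "\<And>x p. x \<in> carrier X \<Longrightarrow> p \<in> carrier (P (Suc n)) \<Longrightarrow> \<Theta> x p \<in> carrier G"
      "\<And>x x' p. x \<in> carrier X \<Longrightarrow> x' \<in> carrier X \<Longrightarrow> p \<in> carrier (P (Suc n)) \<Longrightarrow> \<Theta> (x \<oplus>\<^bsub>X\<^esub> x') p = \<Theta> x p \<oplus>\<^bsub>G\<^esub> \<Theta> x' p"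
      "\<And>x p p'. x \<in> carrier X \<Longrightarrow> p \<in> carrier (P (Suc n)) \<Longrightarrow> p' \<in> carrier (P (Suc n)) \<Longrightarrow> \<Theta> x (p \<oplus>\<^bsub>P (Suc n)\<^esub> p') = \<Theta> x p \<oplus>\<^bsub>G\<^esub> \<Theta> x p'"
      "\<And>x r p. x \<in> carrier X \<Longrightarrow> r \<in> carrier R \<Longrightarrow> p \<in> carrier (P (Suc n)) \<Longrightarrow> \<Theta> (r \<odot>\<^bsub>X\<^esub> x) p = \<Theta> x (r \<odot>\<^bsub>P (Suc n)\<^esub> p)"
      "\<And>x p. x \<in> carrier X \<Longrightarrow> p \<in> carrier (P (Suc (Suc n))) \<Longrightarrow> \<Theta> x (d (Suc n) p) = \<zero>\<^bsub>G\<^esub>"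
    and z: "Poly_Mapping.keys z \<subseteq> carrier X \<times> carrier (P (Suc n))"
    and cycle: "frag_extend (\<lambda>(x, p). frag_of (x, d n p)) z
        \<in> rel_subgroup (carrier X \<times> carrier (P n)) (tensor_rels R X (\<lambda>x r. r \<odot>\<^bsub>X\<^esub> x) (P n) (smult (P n)))"
    and nz: "frag_eval G (\<lambda>(x, p). \<Theta> x p) z \<noteq> \<zero>\<^bsub>G\<^esub>"
  shows "\<not> trivial_group (Tor R X P d (Suc n))"
proof
  assume triv: "trivial_group (Tor R X P d (Suc n))"
  interpret T: tensor_data R X "\<lambda>x r. r \<odot>\<^bsub>X\<^esub> x" "P m" "smult (P m)" for m
    using X P by (rule tensor_data_Tor)
  interpret G: abelian_group G by (rule G)
  interpret ev: balanced_map "carrier X \<times> carrier (P (Suc n))"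
    "tensor_rels R X (\<lambda>x r. r \<odot>\<^bsub>X\<^esub> x) (P (Suc n)) (smult (P (Suc n)))" G "\<lambda>(x, p). \<Theta> x p"
    by (rule T.tensor_balanced_map[OF G \<Theta>(1-4)])
  have chain: "Tor_chain R X P m = T.Q m" for m by (simp add: Tor_chain_def tensor_group_def)
  have comp: "frag_of \<circ> (\<lambda>(x, p). (x, d m p)) = (\<lambda>(x, p). frag_of (x, d m p))" for m by auto
  have bd: "Tor_boundary R X P d m (T.cls (Suc m) c) = T.cls m (frag_extend (\<lambda>(x, p). frag_of (x, d m p)) c)"
    if c: "Poly_Mapping.keys c \<subseteq> carrier X \<times> carrier (P (Suc m))" for m c
    unfolding Tor_boundary_def comp[symmetric]
  proof (rule T.presented_map_cls[OF T.presentation_axioms _ _ c])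
    fix s assume "s \<in> carrier X \<times> carrier (P (Suc m))"
    then show "(case s of (x, p) \<Rightarrow> (x, d m p)) \<in> carrier X \<times> carrier (P m)"
      using linear_mapD(1)[OF d] by auto
  next
    fix r assume "r \<in> tensor_rels R X (\<lambda>x r. r \<odot>\<^bsub>X\<^esub> x) (P (Suc m)) (smult (P (Suc m)))"
    then have "frag_extend (frag_of \<circ> (\<lambda>(x, p). (x, d m p))) r \<in> tensor_rels R X (\<lambda>x r. r \<odot>\<^bsub>X\<^esub> x) (P m) (smult (P m))"
      unfolding tensor_rels_def Un_iff mem_Collect_eq
    proof (elim disjE exE conjE, goal_cases)
      case (1 x x' y)
      then show ?case using linear_mapD(1)[OF d] by (intro disjI1 exI[of _ x] exI[of _ x'] exI[of _ "d m y"]) (simp add: frag_extend_diff)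
    next
      case (2 x y y')
      then show ?case using linear_mapD(1,2)[OF d]
        by (intro disjI2 disjI1 exI[of _ x] exI[of _ "d m y'"] exI[of _ "d m y"]) (simp add: frag_extend_diff)
    next
      case (3 x r' y)
      then show ?case using linear_mapD(1,3)[OF d]
        by (intro disjI2 exI[of _ x] exI[of _ "d m y"] exI[of _ r']) (simp add: frag_extend_diff)
    qed
    then show "frag_extend (frag_of \<circ> (\<lambda>(x, p). (x, d m p))) r \<in> T.H m" by (rule T.Rel_in_H)
  qed
  have Z: "T.cls (Suc n) z \<in> Tor_cycles R X P d (Suc n)"
    using bd[OF z] cycle z by (simp add: kernel_def chain T.cls_closed T.cls_one_iff)
  let ?B = "Tor_boundary R X P d (Suc n) ` carrier (Tor_chain R X P (Suc (Suc n)))"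
  let ?M = "(Tor_chain R X P (Suc n))\<lparr>carrier := Tor_cycles R X P d (Suc n)\<rparr>"
  \<comment> \<open>Triviality of the quotient says that the coset of the cycle equals
    \<open>?B\<close>. The cycle itself belongs to its coset as a product with the unit, for which
    the unit must lie in \<open>?B\<close>.\<close>
  have one: "\<one>\<^bsub>T.Q (Suc n)\<^esub> \<in> ?B"
  proof (rule image_eqI)
    show "\<one>\<^bsub>T.Q (Suc n)\<^esub> = Tor_boundary R X P d (Suc n) (T.cls (Suc (Suc n)) 0)"
      by (subst bd) (simp_all add: T.cls_zero)
    show "T.cls (Suc (Suc n)) 0 \<in> carrier (Tor_chain R X P (Suc (Suc n)))"
      unfolding chain by (rule T.cls_closed) simp
  qed
  have "?B #>\<^bsub>?M\<^esub> T.cls (Suc n) z \<in> carrier (?M Mod ?B)"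
    using Z by (auto simp: FactGroup_def RCOSETS_def)
  also have "carrier (?M Mod ?B) = {?B}"
    using triv unfolding Tor_def trivial_group_def by (simp add: FactGroup_def)
  finally have "?B #>\<^bsub>?M\<^esub> T.cls (Suc n) z = ?B" by simp
  moreover have "\<one>\<^bsub>T.Q (Suc n)\<^esub> \<otimes>\<^bsub>T.Q (Suc n)\<^esub> T.cls (Suc n) z \<in> ?B #>\<^bsub>?M\<^esub> T.cls (Suc n) z"
    using one by (auto simp: r_coset_def chain)
  moreover have "\<one>\<^bsub>T.Q (Suc n)\<^esub> \<otimes>\<^bsub>T.Q (Suc n)\<^esub> T.cls (Suc n) z = T.cls (Suc n) z"
    using T.group_Q T.cls_closed[OF z] by (simp add: group.is_monoid)
  ultimately have "T.cls (Suc n) z \<in> ?B" by metis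
  then obtain U where U: "U \<in> carrier (T.Q (Suc (Suc n)))" "T.cls (Suc n) z = Tor_boundary R X P d (Suc n) U"
    unfolding chain by blast
  from U(1) obtain c where c: "Poly_Mapping.keys c \<subseteq> carrier X \<times> carrier (P (Suc (Suc n)))" "U = T.cls (Suc (Suc n)) c"
    by (rule T.Q_cases)
  let ?D = "frag_extend (\<lambda>(x, p). frag_of (x, d (Suc n) p))"
  have "T.cls (Suc n) z = T.cls (Suc n) (?D c)" using U(2) c bd by simp
  then have zD: "z - ?D c \<in> T.H (Suc n)" by (simp add: T.cls_eq_iff)
  have kD: "Poly_Mapping.keys (?D c) \<subseteq> carrier X \<times> carrier (P (Suc n))" if "Poly_Mapping.keys c \<subseteq> carrier X \<times> carrier (P (Suc (Suc n)))" for c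
    by (rule order_trans[OF keys_frag_extend]) (use that linear_mapD(1)[OF d] in \<open>auto dest!: subsetD\<close>)
  let ?ev = "frag_eval G (\<lambda>(x, p). \<Theta> x p)"
  have "?ev (?D c) = \<zero>\<^bsub>G\<^esub>"
    using c(1)
  proof (induction rule: free_Abelian_group_induct[consumes 1])
    case 1
    show ?case using ev.frag_eval_H[OF T.H_zero] by simp
  next
    case (2 x y)
    then show ?case unfolding frag_extend_diff G.frag_eval_diff[OF ev.img kD[OF 2(1)] kD[OF 2(2)]]
      by (simp add: G.minus_eq)
  next
    case (3 a)
    then show ?case using \<Theta>(5) linear_mapD(1)[OF d] by (auto simp: G.frag_eval_of)
  qed
  moreover have "?ev z = ?ev (?D c)"
  proof -
    have "?ev z \<ominus>\<^bsub>G\<^esub> ?ev (?D c) = \<zero>\<^bsub>G\<^esub>"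
      using ev.frag_eval_H[OF zD] G.frag_eval_diff[OF ev.img z kD[OF c(1)]] by simp
    then show ?thesis
      by (rule G.minus_eq_zeroD)
        (use hom_in_carrier[OF G.frag_eval_hom[OF ev.img]] z kD[OF c(1)] in auto)
  qed
  ultimately show False using nz by simp
qed

section \<open>A nonvanishing criterion for Hochschild homology\<close>

definition linear_form :: "('k, 'u) ring_scheme \<Rightarrow> ('k, 'l, 'v) module_scheme \<Rightarrow> ('l \<Rightarrow> 'k) \<Rightarrow> bool" where
  "linear_form K L f \<longleftrightarrow> (\<forall>x\<in>carrier L. f x \<in> carrier K) \<and>
     (\<forall>x\<in>carrier L. \<forall>y\<in>carrier L. f (x \<oplus>\<^bsub>L\<^esub> y) = f x \<oplus>\<^bsub>K\<^esub> f y) \<and>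
     (\<forall>c\<in>carrier K. \<forall>x\<in>carrier L. f (c \<odot>\<^bsub>L\<^esub> x) = c \<otimes>\<^bsub>K\<^esub> f x)"

lemma linear_formD:
  assumes "linear_form K L f"
  shows "x \<in> carrier L \<Longrightarrow> f x \<in> carrier K"
    "x \<in> carrier L \<Longrightarrow> y \<in> carrier L \<Longrightarrow> f (x \<oplus>\<^bsub>L\<^esub> y) = f x \<oplus>\<^bsub>K\<^esub> f y"
    "c \<in> carrier K \<Longrightarrow> x \<in> carrier L \<Longrightarrow> f (c \<odot>\<^bsub>L\<^esub> x) = c \<otimes>\<^bsub>K\<^esub> f x"
  using assms by (auto simp: linear_form_def)

definition bilinear_form :: "('k, 'u) ring_scheme \<Rightarrow> ('k, 'b, 'v) module_scheme \<Rightarrow> ('k, 'a, 'w) module_scheme \<Rightarrow>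
    ('b \<Rightarrow> 'a \<Rightarrow> 'k) \<Rightarrow> bool" where
  "bilinear_form K B A \<beta> \<longleftrightarrow> (\<forall>u\<in>carrier B. linear_form K A (\<beta> u)) \<and>
     (\<forall>u\<in>carrier A. linear_form K B (\<lambda>v. \<beta> v u))"

lemma bilinear_formD:
  assumes "bilinear_form K B A \<beta>"
  shows "u \<in> carrier B \<Longrightarrow> linear_form K A (\<beta> u)" "u' \<in> carrier A \<Longrightarrow> linear_form K B (\<lambda>v. \<beta> v u')"
    "u \<in> carrier B \<Longrightarrow> u' \<in> carrier A \<Longrightarrow> \<beta> u u' \<in> carrier K"
  using assms by (auto simp: bilinear_form_def linear_form_def)

lemma linear_form_closure:
  assumes A: "k_algebra K A"
  shows "linear_form K A f \<Longrightarrow> linear_form K A g \<Longrightarrow> linear_form K A (\<lambda>x. f x \<oplus>\<^bsub>K\<^esub> g x)"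
    "linear_form K A f \<Longrightarrow> c \<in> carrier K \<Longrightarrow> linear_form K A (\<lambda>x. c \<otimes>\<^bsub>K\<^esub> f x)"
    "linear_form K A f \<Longrightarrow> a \<in> carrier A \<Longrightarrow> linear_form K A (\<lambda>x. f (a \<otimes>\<^bsub>A\<^esub> x))"
    "linear_form K A f \<Longrightarrow> a \<in> carrier A \<Longrightarrow> linear_form K A (\<lambda>x. f (x \<otimes>\<^bsub>A\<^esub> a))"
proof -
  interpret K: field K by (rule k_algebraD(1)[OF A])
  interpret A: ring A by (rule k_algebraD(2)[OF A])
  interpret module K A by (rule k_algebraD(3)[OF A])
  show "linear_form K A f \<Longrightarrow> linear_form K A g \<Longrightarrow> linear_form K A (\<lambda>x. f x \<oplus>\<^bsub>K\<^esub> g x)"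
    by (auto simp: linear_form_def K.a_ac K.r_distr)
  show "linear_form K A f \<Longrightarrow> c \<in> carrier K \<Longrightarrow> linear_form K A (\<lambda>x. c \<otimes>\<^bsub>K\<^esub> f x)"
    by (auto simp: linear_form_def K.r_distr K.m_lcomm)
  show "linear_form K A f \<Longrightarrow> a \<in> carrier A \<Longrightarrow> linear_form K A (\<lambda>x. f (a \<otimes>\<^bsub>A\<^esub> x))"
    by (auto simp: linear_form_def A.r_distr k_algebraD(4,5)[OF A])
  show "linear_form K A f \<Longrightarrow> a \<in> carrier A \<Longrightarrow> linear_form K A (\<lambda>x. f (x \<otimes>\<^bsub>A\<^esub> a))"
    by (auto simp: linear_form_def A.l_distr k_algebraD(4,5)[OF A])
qed

text \<open>The elements are extensional functions, so that agreement on \<open>D\<close> is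
  equality; this is why all operations restrict their results to \<open>D\<close>.\<close>

lemma function_abelian_group:
  assumes "abelian_group K" and C: "C \<subseteq> D \<rightarrow>\<^sub>E carrier K"
    and z: "(\<lambda>x\<in>D. \<zero>\<^bsub>K\<^esub>) \<in> C" and a: "\<And>f g. f \<in> C \<Longrightarrow> g \<in> C \<Longrightarrow> (\<lambda>x\<in>D. f x \<oplus>\<^bsub>K\<^esub> g x) \<in> C"
    and m: "\<And>f. f \<in> C \<Longrightarrow> (\<lambda>x\<in>D. \<ominus>\<^bsub>K\<^esub> f x) \<in> C"
    and X: "carrier X = C" "\<zero>\<^bsub>X\<^esub> = (\<lambda>x\<in>D. \<zero>\<^bsub>K\<^esub>)" "\<And>f g. f \<oplus>\<^bsub>X\<^esub> g = (\<lambda>x\<in>D. f x \<oplus>\<^bsub>K\<^esub> g x)"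
  shows "abelian_group X"
proof -
  interpret abelian_group K by fact
  have v: "f x \<in> carrier K" if "f \<in> C" "x \<in> D" for f x using that C by auto
  have e: "f = (\<lambda>x\<in>D. f x)" if "f \<in> C" for f
    using that C by (metis PiE_restrict subsetD)
  show ?thesis
  proof (rule abelian_groupI; unfold X)
    fix f assume f: "f \<in> C"
    show "(\<lambda>x\<in>D. (\<lambda>x\<in>D. \<zero>\<^bsub>K\<^esub>) x \<oplus>\<^bsub>K\<^esub> f x) = f"
      by (subst (2) e[OF f]) (auto simp: v[OF f] intro!: restrict_ext)
    show "\<exists>g\<in>C. (\<lambda>x\<in>D. g x \<oplus>\<^bsub>K\<^esub> f x) = (\<lambda>x\<in>D. \<zero>\<^bsub>K\<^esub>)"
      by (rule bexI[OF _ m[OF f]]) (auto simp: v[OF f] l_neg intro!: restrict_ext)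
  qed (auto simp: z a v a_ac intro!: restrict_ext)
qed

text \<open>\<open>\<sigma>\<close> is the projection of \<open>\<Lambda>\<close> onto the
  subalgebra \<open>C\<close>, written as an endomorphism of \<open>L\<close> so that
  \<open>C\<close> needs no type of its own. A \<open>C\<close>-bimodule becomes one over
  \<open>\<Lambda>\<close> by acting through \<open>\<sigma>\<close>.\<close>

locale split_algebra = enveloping K L
  for K :: "('k, 'u) ring_scheme" and L :: "('k, 'l) module" +
  fixes \<sigma> :: "'l \<Rightarrow> 'l"
  assumes \<sigma>_closed [simp]: "x \<in> carrier L \<Longrightarrow> \<sigma> x \<in> carrier L"
    and \<sigma>_add: "x \<in> carrier L \<Longrightarrow> y \<in> carrier L \<Longrightarrow> \<sigma> (x \<oplus>\<^bsub>L\<^esub> y) = \<sigma> x \<oplus>\<^bsub>L\<^esub> \<sigma> y"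
    and \<sigma>_mult: "x \<in> carrier L \<Longrightarrow> y \<in> carrier L \<Longrightarrow> \<sigma> (x \<otimes>\<^bsub>L\<^esub> y) = \<sigma> x \<otimes>\<^bsub>L\<^esub> \<sigma> y"
    and \<sigma>_one [simp]: "\<sigma> \<one>\<^bsub>L\<^esub> = \<one>\<^bsub>L\<^esub>"
    and \<sigma>_smult: "c \<in> carrier K \<Longrightarrow> x \<in> carrier L \<Longrightarrow> \<sigma> (c \<odot>\<^bsub>L\<^esub> x) = c \<odot>\<^bsub>L\<^esub> \<sigma> x"
begin

abbreviation "lin \<equiv> linear_form K L"
abbreviation "bil \<equiv> bilinear_form K L L"

lemma bimodI: "is_bimodule K L L X \<Longrightarrow> bimod K L L X"
  by (intro bimod.intro two_algebras.intro bimod_axioms.intro alg)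

lemmas alg_simps = k_algebraD(4,5)[OF alg]

lemma lin_zero: "lin (\<lambda>_. \<zero>\<^bsub>K\<^esub>)" by (simp add: linear_form_def)
lemmas lin_add = linear_form_closure(1)[OF alg]
lemmas lin_scale = linear_form_closure(2)[OF alg]
lemmas lin_mult_l = linear_form_closure(3)[OF alg]
lemmas lin_mult_r = linear_form_closure(4)[OF alg]
lemma lin_uminus: "lin f \<Longrightarrow> lin (\<lambda>x. \<ominus>\<^bsub>K\<^esub> f x)"
  by (auto simp: linear_form_def K.minus_add K.r_minus)
lemma lin_scale': "lin f \<Longrightarrow> c \<in> carrier K \<Longrightarrow> lin (\<lambda>x. f x \<otimes>\<^bsub>K\<^esub> c)"
  by (auto simp: linear_form_def K.l_distr K.m_assoc)
lemma lin_cong: "(\<And>x. x \<in> carrier L \<Longrightarrow> f x = g x) \<Longrightarrow> lin f \<longleftrightarrow> lin g"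
  by (auto simp: linear_form_def)
lemma lin_at_zero: "lin f \<Longrightarrow> f \<zero>\<^bsub>L\<^esub> = \<zero>\<^bsub>K\<^esub>"
  by (rule additive_zero[OF L.is_abelian_group K.is_abelian_group]) (auto simp: linear_form_def)

text \<open>The \<open>K\<close>-dual of \<open>L\<close>, acted on through \<open>\<sigma>\<close>.
  It is the last target of the shifting, because bimodule maps from \<open>P n\<close> to a dual of
  \<open>L\<close> amount to functionals on the tensor product of \<open>L\<close> and
  \<open>P n\<close> over \<open>R\<close>.\<close>

definition lin_bimodule :: "('l, 'l, 'l \<Rightarrow> 'k) bimodule" where
  "lin_bimodule = \<lparr>carrier = {r \<in> extensional (carrier L). lin r}, monoid.mult = undefined, one = undefined,
     zero = (\<lambda>x\<in>carrier L. \<zero>\<^bsub>K\<^esub>), add = (\<lambda>r s. \<lambda>x\<in>carrier L. r x \<oplus>\<^bsub>K\<^esub> s x),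
     lact = (\<lambda>l r. \<lambda>x\<in>carrier L. r (x \<otimes>\<^bsub>L\<^esub> \<sigma> l)), ract = (\<lambda>r l. \<lambda>x\<in>carrier L. r (\<sigma> l \<otimes>\<^bsub>L\<^esub> x))\<rparr>"

text \<open>The dual of \<open>L \<otimes> L\<close> with its inner actions. One may think of
  \<open>r (u, v)\<close> as a form in \<open>u x v\<close>, where \<open>L\<close> acts on the
  place \<open>x\<close> through \<open>\<sigma>\<close>; the outer variables stay free for
  contraction with the neighbouring letters.\<close>

definition bil_bimodule :: "('l, 'l, 'l \<times> 'l \<Rightarrow> 'k) bimodule" where
  "bil_bimodule = \<lparr>carrier = {r \<in> extensional (carrier L \<times> carrier L). bil (\<lambda>u v. r (u, v))},
     monoid.mult = undefined, one = undefined,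
     zero = (\<lambda>z\<in>carrier L \<times> carrier L. \<zero>\<^bsub>K\<^esub>), add = (\<lambda>r s. \<lambda>z\<in>carrier L \<times> carrier L. r z \<oplus>\<^bsub>K\<^esub> s z),
     lact = (\<lambda>l r. \<lambda>z\<in>carrier L \<times> carrier L. r (fst z \<otimes>\<^bsub>L\<^esub> \<sigma> l, snd z)),
     ract = (\<lambda>r l. \<lambda>z\<in>carrier L \<times> carrier L. r (fst z, \<sigma> l \<otimes>\<^bsub>L\<^esub> snd z))\<rparr>"

lemma lin_restrict: "lin (\<lambda>x\<in>carrier L. f x) \<longleftrightarrow> lin f"
  by (rule lin_cong) simp

lemma bil_if: "bil (\<lambda>u v. if u \<in> carrier L \<and> v \<in> carrier L then f u v else c) \<longleftrightarrow> bil f"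
  unfolding bilinear_form_def by (intro conj_cong ball_cong lin_cong refl) auto

lemma bil_zero: "bil (\<lambda>_ _. \<zero>\<^bsub>K\<^esub>)"
  by (simp add: bilinear_form_def lin_zero)
lemma bil_add: "bil \<beta> \<Longrightarrow> bil \<gamma> \<Longrightarrow> bil (\<lambda>u v. \<beta> u v \<oplus>\<^bsub>K\<^esub> \<gamma> u v)"
  by (simp add: bilinear_form_def lin_add)
lemma bil_uminus: "bil \<beta> \<Longrightarrow> bil (\<lambda>u v. \<ominus>\<^bsub>K\<^esub> \<beta> u v)"
  by (simp add: bilinear_form_def lin_uminus)
lemma bil_mult:
  assumes "bil \<beta>" "a \<in> carrier L"
  shows "bil (\<lambda>u v. \<beta> (u \<otimes>\<^bsub>L\<^esub> a) v)" "bil (\<lambda>u v. \<beta> (a \<otimes>\<^bsub>L\<^esub> u) v)"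
    "bil (\<lambda>u v. \<beta> u (v \<otimes>\<^bsub>L\<^esub> a))" "bil (\<lambda>u v. \<beta> u (a \<otimes>\<^bsub>L\<^esub> v))"
  using assms lin_mult_l[OF _ assms(2)] lin_mult_r[OF _ assms(2)]
    lin_mult_l[of "\<lambda>v. \<beta> v u" a for u] lin_mult_r[of "\<lambda>v. \<beta> v u" a for u] by (simp_all add: bilinear_form_def)

lemma \<sigma>_ground: "c \<in> carrier K \<Longrightarrow> \<sigma> (c \<odot>\<^bsub>L\<^esub> \<one>\<^bsub>L\<^esub>) = c \<odot>\<^bsub>L\<^esub> \<one>\<^bsub>L\<^esub>"
  by (simp add: \<sigma>_smult)

lemma central_ground: "c \<in> carrier K \<Longrightarrow> x \<in> carrier L \<Longrightarrow>
    x \<otimes>\<^bsub>L\<^esub> (c \<odot>\<^bsub>L\<^esub> \<one>\<^bsub>L\<^esub>) = c \<odot>\<^bsub>L\<^esub> x"  "c \<in> carrier K \<Longrightarrow> x \<in> carrier L \<Longrightarrow>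
    (c \<odot>\<^bsub>L\<^esub> \<one>\<^bsub>L\<^esub>) \<otimes>\<^bsub>L\<^esub> x = c \<odot>\<^bsub>L\<^esub> x"
  by (simp_all add: alg_simps)

lemma ext_eqI: "r \<in> extensional D \<Longrightarrow> (\<And>x. x \<in> D \<Longrightarrow> f x = r x) \<Longrightarrow> (\<lambda>x\<in>D. f x) = r"
  by (rule extensionalityI[of _ D]) auto

lemma lin_bimod: "bimod K L L lin_bimodule"
proof -
  have "abelian_group lin_bimodule"
    by (rule function_abelian_group[OF K.is_abelian_group, where C = "{r \<in> extensional (carrier L). lin r}" and D = "carrier L"])
      (auto simp: lin_bimodule_def lin_restrict lin_zero lin_add lin_uminus linear_formD(1) PiE_def)
  then have "is_bimodule K L L lin_bimodule"
    by (intro is_bimoduleI)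
      (auto simp: lin_bimodule_def L.ring_axioms lin_restrict lin_mult_l lin_mult_r \<sigma>_add \<sigma>_mult \<sigma>_ground
        L.r_distr L.l_distr linear_formD(2) L.m_assoc central_ground intro!: restrict_ext ext_eqI)
  then show ?thesis by (rule bimodI)
qed

lemma bil_bimod: "bimod K L L bil_bimodule"
proof -
  have d: "\<beta> (u \<oplus>\<^bsub>L\<^esub> u') v = \<beta> u v \<oplus>\<^bsub>K\<^esub> \<beta> u' v" "\<beta> v (u \<oplus>\<^bsub>L\<^esub> u') = \<beta> v u \<oplus>\<^bsub>K\<^esub> \<beta> v u'"
    "c \<in> carrier K \<Longrightarrow> \<beta> (c \<odot>\<^bsub>L\<^esub> u) v = c \<otimes>\<^bsub>K\<^esub> \<beta> u v" "c \<in> carrier K \<Longrightarrow> \<beta> v (c \<odot>\<^bsub>L\<^esub> u) = c \<otimes>\<^bsub>K\<^esub> \<beta> v u"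
    if "bil \<beta>" "u \<in> carrier L" "u' \<in> carrier L" "v \<in> carrier L" for \<beta> u u' v c
    using that linear_formD[OF bilinear_formD(1)[OF that(1,4)]] linear_formD[OF bilinear_formD(2)[OF that(1,4)]] by auto
  have "abelian_group bil_bimodule"
    by (rule function_abelian_group[OF K.is_abelian_group, where
        C = "{r \<in> extensional (carrier L \<times> carrier L). bil (\<lambda>u v. r (u, v))}" and D = "carrier L \<times> carrier L"])
      (auto simp: bil_bimodule_def bil_if PiE_def bil_zero bil_add bil_uminus bilinear_formD(3)[of K L L "\<lambda>u v. r (u, v)" for r])
  then have "is_bimodule K L L bil_bimodule"
    by (intro is_bimoduleI)
      (auto simp: bil_bimodule_def L.ring_axioms bil_if bil_add \<sigma>_add \<sigma>_mult \<sigma>_ground L.r_distr L.l_distr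
        d[of "\<lambda>u v. r (u, v)" for r]
        L.m_assoc central_ground bil_mult[of "\<lambda>u v. r (u, v)" for r] intro!: restrict_ext ext_eqI)
  then show ?thesis by (rule bimodI)
qed

lemma regular_bimod: "bimod K L L (regular_bimodule L)"
proof -
  have "abelian_group (regular_bimodule L)"
    by (rule abelian_group_transfer[OF L.is_abelian_group]) (simp_all add: regular_bimodule_def)
  then have "is_bimodule K L L (regular_bimodule L)"
    by (intro is_bimoduleI)
      (auto simp: regular_bimodule_def L.ring_axioms L.l_distr L.r_distr L.m_assoc central_ground)
  then show ?thesis by (rule bimodI)
qed

lemma right_regular:
  defines "X \<equiv> bimodule_as_right_module (regular_bimodule L)"
  assumes x: "x \<in> carrier L"
  shows "(\<lambda>r. r \<odot>\<^bsub>X\<^esub> x) \<in> hom E.Q (add_monoid L)"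
    and "l \<in> carrier L \<Longrightarrow> l' \<in> carrier L \<Longrightarrow> env l l' \<odot>\<^bsub>X\<^esub> x = l' \<otimes>\<^bsub>L\<^esub> x \<otimes>\<^bsub>L\<^esub> l"
proof -
  interpret rg: bimod K L L "regular_bimodule L" by (rule regular_bimod)
  interpret b: balanced_map "carrier L \<times> carrier (op_ring L)" "tensor_rels K L (\<lambda>b k. k \<odot>\<^bsub>L\<^esub> b) (op_ring L) (smult L)"
    "regular_bimodule L" "\<lambda>(b, a). ract (regular_bimodule L) (lact (regular_bimodule L) a x) b"
    by (rule E.tensor_balanced_map)
      (use x rg.X.abelian_group_axioms in \<open>auto simp: regular_bimodule_def L.l_distr L.r_distr L.m_assoc alg_simps\<close>)
  show "(\<lambda>r. r \<odot>\<^bsub>X\<^esub> x) \<in> hom E.Q (add_monoid L)"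
    using b.tensor_eval_hom unfolding X_def
    by (simp add: bimodule_as_right_module_def regular_bimodule_def hom_def Pi_def)
  show "env l l' \<odot>\<^bsub>X\<^esub> x = l' \<otimes>\<^bsub>L\<^esub> x \<otimes>\<^bsub>L\<^esub> l" if "l \<in> carrier L" "l' \<in> carrier L"
    using b.tensor_eval_of[of "(l, l')"] that unfolding X_def
    by (simp add: bimodule_as_right_module_def env_def) (simp add: regular_bimodule_def)
qed

end

text \<open>\<open>T k \<beta>\<close> evaluates the bilinear form \<open>\<beta>\<close> on the coordinate in \<open>L p\<^sub>k \<otimes> q\<^sub>k L\<close> of an element; \<open>j k\<close>
  has the coordinate \<open>p\<^sub>k \<otimes> a\<^sub>k\<close>. The indices are positions in a periodic word.\<close>

locale cyclic_word = split_algebra K L \<sigma>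
  for K :: "('k, 'u) ring_scheme" and L :: "('k, 'l) module" and \<sigma> +
  fixes T :: "nat \<Rightarrow> ('l \<Rightarrow> 'l \<Rightarrow> 'k) \<Rightarrow> 'l \<Rightarrow> 'k" and j p a :: "nat \<Rightarrow> 'l" and \<mu> :: "nat \<Rightarrow> 'l \<Rightarrow> 'k" and per :: nat
  assumes T_closed: "bil \<beta> \<Longrightarrow> l \<in> carrier L \<Longrightarrow> T k \<beta> l \<in> carrier K"
    and T_add: "bil \<beta> \<Longrightarrow> l \<in> carrier L \<Longrightarrow> l' \<in> carrier L \<Longrightarrow> T k \<beta> (l \<oplus>\<^bsub>L\<^esub> l') = T k \<beta> l \<oplus>\<^bsub>K\<^esub> T k \<beta> l'"
    and T_mult: "bil \<beta> \<Longrightarrow> l \<in> carrier L \<Longrightarrow> l' \<in> carrier L \<Longrightarrow> T k \<beta> (l \<otimes>\<^bsub>L\<^esub> l') =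
        T k (\<lambda>u v. \<beta> (\<sigma> l \<otimes>\<^bsub>L\<^esub> u) v) l' \<oplus>\<^bsub>K\<^esub> T k (\<lambda>u v. \<beta> u (v \<otimes>\<^bsub>L\<^esub> \<sigma> l')) l"
    and T_ground: "bil \<beta> \<Longrightarrow> c \<in> carrier K \<Longrightarrow> T k \<beta> (c \<odot>\<^bsub>L\<^esub> \<one>\<^bsub>L\<^esub>) = \<zero>\<^bsub>K\<^esub>"
    and T_add_form: "bil \<beta> \<Longrightarrow> bil \<gamma> \<Longrightarrow> l \<in> carrier L \<Longrightarrow>
        T k (\<lambda>u v. \<beta> u v \<oplus>\<^bsub>K\<^esub> \<gamma> u v) l = T k \<beta> l \<oplus>\<^bsub>K\<^esub> T k \<gamma> l"
    and T_scale_form: "bil \<beta> \<Longrightarrow> c \<in> carrier K \<Longrightarrow> l \<in> carrier L \<Longrightarrow>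
        T k (\<lambda>u v. c \<otimes>\<^bsub>K\<^esub> \<beta> u v) l = c \<otimes>\<^bsub>K\<^esub> T k \<beta> l"
    and T_cong: "bil \<beta> \<Longrightarrow> (\<And>u v. u \<in> carrier L \<Longrightarrow> v \<in> carrier L \<Longrightarrow> \<beta> u v = \<gamma> u v) \<Longrightarrow> l \<in> carrier L \<Longrightarrow>
        T k \<beta> l = T k \<gamma> l"
    and T_j: "bil \<beta> \<Longrightarrow> T k \<beta> (j k) = \<beta> (p k) (a k)"
    and T_0_j: "bil \<beta> \<Longrightarrow> 0 < k \<Longrightarrow> k < per \<Longrightarrow> T 0 \<beta> (j k) = \<zero>\<^bsub>K\<^esub>"
    and j_closed [simp]: "j k \<in> carrier L" and p_closed [simp]: "p k \<in> carrier L" and a_closed [simp]: "a k \<in> carrier L"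
    and \<sigma>_j: "\<sigma> (j k) = \<zero>\<^bsub>L\<^esub>" and j_j: "j k \<otimes>\<^bsub>L\<^esub> j k' = \<zero>\<^bsub>L\<^esub>"
    and \<mu>_lin: "lin (\<mu> k)" and \<mu>_one: "\<mu> k (a k \<otimes>\<^bsub>L\<^esub> p (Suc k)) = \<one>\<^bsub>K\<^esub>"
    and j_periodic: "j (k + per) = j k" and p_periodic: "p (k + per) = p k" and per: "even per" "0 < per"
begin

lemma \<mu>_closed [simp]: "x \<in> carrier L \<Longrightarrow> \<mu> k x \<in> carrier K"
  by (rule linear_formD(1)[OF \<mu>_lin])

text \<open>At the letter \<open>j (Suc k)\<close> this is \<open>\<mu> k (x p) r (a, y)\<close>,
  with \<open>p \<otimes> a\<close> the coordinate of the letter: its head is contracted with what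
  comes before, its tail is handed to the form \<open>r\<close> that belongs to the rest of the
  word.\<close>

definition prepend :: "nat \<Rightarrow> 'l \<Rightarrow> ('l \<times> 'l \<Rightarrow> 'k) \<Rightarrow> ('l \<times> 'l \<Rightarrow> 'k)" where
  "prepend k l r = (\<lambda>z\<in>carrier L \<times> carrier L. T (Suc k) (\<lambda>u v. \<mu> k (fst z \<otimes>\<^bsub>L\<^esub> u) \<otimes>\<^bsub>K\<^esub> r (v, snd z)) l)"

text \<open>At the letter \<open>j 0\<close> this is \<open>r (a, x p)\<close>: both ends of the
  word are joined through the letter, and \<open>x\<close> sits at the seam.\<close>

definition closing :: "'l \<Rightarrow> ('l \<times> 'l \<Rightarrow> 'k) \<Rightarrow> ('l \<Rightarrow> 'k)" where
  "closing l r = (\<lambda>x\<in>carrier L. T 0 (\<lambda>u v. r (v, x \<otimes>\<^bsub>L\<^esub> u)) l)"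

lemma bil_swap: "bil (\<lambda>u v. \<beta> u v) \<Longrightarrow> bil (\<lambda>u v. \<beta> v u)"
  by (auto simp: bilinear_form_def)

lemma bil_prod: "lin f \<Longrightarrow> lin g \<Longrightarrow> bil (\<lambda>u v. f u \<otimes>\<^bsub>K\<^esub> g v)"
  by (simp add: bilinear_form_def linear_formD(1) lin_scale lin_scale')

lemma bilD:
  assumes "bil (\<lambda>u v. r (u, v))"
  shows "v \<in> carrier L \<Longrightarrow> lin (\<lambda>u. r (u, v))" "v \<in> carrier L \<Longrightarrow> lin (\<lambda>u. r (v, u))"
    "u \<in> carrier L \<Longrightarrow> v \<in> carrier L \<Longrightarrow> r (u, v) \<in> carrier K"
  using assms by (auto simp: bilinear_form_def linear_form_def)

lemma prepend_form: "bil (\<lambda>u v. r (u, v)) \<Longrightarrow> x \<in> carrier L \<Longrightarrow> y \<in> carrier L \<Longrightarrow>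
    bil (\<lambda>u v. \<mu> k (x \<otimes>\<^bsub>L\<^esub> u) \<otimes>\<^bsub>K\<^esub> r (v, y))"
  by (intro bil_prod lin_mult_l \<mu>_lin bilD)

lemma closing_form: "bil (\<lambda>u v. r (u, v)) \<Longrightarrow> x \<in> carrier L \<Longrightarrow> bil (\<lambda>u v. r (v, x \<otimes>\<^bsub>L\<^esub> u))"
  by (rule bil_swap) (rule bil_mult(4))

lemmas \<mu>_D = linear_formD(2,3)[OF \<mu>_lin]

text \<open>The decompositions of forms needed below hold only on the carrier of \<open>L\<close>,
  so linearity of \<open>T\<close> in the form has to be combined with
  \<open>T_cong\<close>.\<close>

lemma T_eqI_add:
  assumes "bil \<beta>" "bil \<gamma>" "l \<in> carrier L" "\<And>u v. u \<in> carrier L \<Longrightarrow> v \<in> carrier L \<Longrightarrow> \<delta> u v = \<beta> u v \<oplus>\<^bsub>K\<^esub> \<gamma> u v"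
  shows "T k \<delta> l = T k \<beta> l \<oplus>\<^bsub>K\<^esub> T k \<gamma> l"
  using T_cong[OF bil_add[OF assms(1,2)] assms(4)[symmetric] assms(3)] T_add_form[OF assms(1-3)] by simp

lemma T_eqI_scale:
  assumes "bil \<beta>" "c \<in> carrier K" "l \<in> carrier L" "\<And>u v. u \<in> carrier L \<Longrightarrow> v \<in> carrier L \<Longrightarrow> \<delta> u v = c \<otimes>\<^bsub>K\<^esub> \<beta> u v"
  shows "T k \<delta> l = c \<otimes>\<^bsub>K\<^esub> T k \<beta> l"
proof -
  have "bil (\<lambda>u v. c \<otimes>\<^bsub>K\<^esub> \<beta> u v)" using assms(1,2) by (simp add: bilinear_form_def lin_scale)
  from T_cong[OF this assms(4)[symmetric] assms(3)] T_scale_form[OF assms(1-3)] show ?thesis by simp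
qed

text \<open>\<open>T_mult\<close> supplies the cocycle identity. The term whose letter comes from
  the right factor becomes the left action on the result, the term whose letter comes from the left
  factor becomes the action on \<open>r\<close>. The right action only touches the second variable,
  which stays outside the contraction.\<close>

lemma prepend_extension: "bimodule_extension K L bil_bimodule bil_bimodule (prepend k)"
proof -
  have b: "bil (\<lambda>u v. T (Suc k) (\<lambda>u' v'. \<mu> k (u \<otimes>\<^bsub>L\<^esub> u') \<otimes>\<^bsub>K\<^esub> r (v', v)) l)"
    if l: "l \<in> carrier L" and r: "bil (\<lambda>u v. r (u, v))" for l r
  proof -
    note f = prepend_form[OF r]
    note rD = bilD[OF r] linear_formD(2,3)[OF bilD(2)[OF r]]
    show ?thesis
      unfolding bilinear_form_def linear_form_def
    proof (intro conjI ballI)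
      fix x y z assume "x \<in> carrier L" "y \<in> carrier L" "z \<in> carrier L"
      then show "T (Suc k) (\<lambda>u' v'. \<mu> k (x \<otimes>\<^bsub>L\<^esub> u') \<otimes>\<^bsub>K\<^esub> r (v', y \<oplus>\<^bsub>L\<^esub> z)) l =
          T (Suc k) (\<lambda>u' v'. \<mu> k (x \<otimes>\<^bsub>L\<^esub> u') \<otimes>\<^bsub>K\<^esub> r (v', y)) l \<oplus>\<^bsub>K\<^esub> T (Suc k) (\<lambda>u' v'. \<mu> k (x \<otimes>\<^bsub>L\<^esub> u') \<otimes>\<^bsub>K\<^esub> r (v', z)) l"
        "T (Suc k) (\<lambda>u' v'. \<mu> k ((y \<oplus>\<^bsub>L\<^esub> z) \<otimes>\<^bsub>L\<^esub> u') \<otimes>\<^bsub>K\<^esub> r (v', x)) l =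
          T (Suc k) (\<lambda>u' v'. \<mu> k (y \<otimes>\<^bsub>L\<^esub> u') \<otimes>\<^bsub>K\<^esub> r (v', x)) l \<oplus>\<^bsub>K\<^esub> T (Suc k) (\<lambda>u' v'. \<mu> k (z \<otimes>\<^bsub>L\<^esub> u') \<otimes>\<^bsub>K\<^esub> r (v', x)) l"
        using l rD by (auto intro!: T_eqI_add f simp: K.r_distr K.l_distr L.l_distr \<mu>_D)
    next
      fix c x y assume "x \<in> carrier L" "y \<in> carrier L" "c \<in> carrier K"
      then show "T (Suc k) (\<lambda>u' v'. \<mu> k (x \<otimes>\<^bsub>L\<^esub> u') \<otimes>\<^bsub>K\<^esub> r (v', c \<odot>\<^bsub>L\<^esub> y)) l =
          c \<otimes>\<^bsub>K\<^esub> T (Suc k) (\<lambda>u' v'. \<mu> k (x \<otimes>\<^bsub>L\<^esub> u') \<otimes>\<^bsub>K\<^esub> r (v', y)) l"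
        "T (Suc k) (\<lambda>u' v'. \<mu> k ((c \<odot>\<^bsub>L\<^esub> y) \<otimes>\<^bsub>L\<^esub> u') \<otimes>\<^bsub>K\<^esub> r (v', x)) l =
          c \<otimes>\<^bsub>K\<^esub> T (Suc k) (\<lambda>u' v'. \<mu> k (y \<otimes>\<^bsub>L\<^esub> u') \<otimes>\<^bsub>K\<^esub> r (v', x)) l"
        using l rD by (auto intro!: T_eqI_scale f simp: K.m_ac alg_simps \<mu>_D)
    qed (use l f T_closed in auto)
  qed
  show ?thesis
  proof (intro bimodule_extension.intro bil_bimod enveloping_axioms bimodule_extension_axioms.intro)
    fix l r assume l: "l \<in> carrier L" and r: "r \<in> carrier bil_bimodule"
    then have br: "bil (\<lambda>u v. r (u, v))" by (simp add: bil_bimodule_def)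
    note rD = bilD[OF br]
    show "prepend k l r \<in> carrier bil_bimodule"
      using b[OF l br] by (simp add: prepend_def bil_bimodule_def bil_if)
    show "prepend k (l \<oplus>\<^bsub>L\<^esub> l') r = prepend k l r \<oplus>\<^bsub>bil_bimodule\<^esub> prepend k l' r" if "l' \<in> carrier L" for l'
      using that l prepend_form[OF br] by (auto simp: prepend_def bil_bimodule_def T_add intro!: restrict_ext)
    show "prepend k l (r \<oplus>\<^bsub>bil_bimodule\<^esub> r') = prepend k l r \<oplus>\<^bsub>bil_bimodule\<^esub> prepend k l r'"
      if r': "r' \<in> carrier bil_bimodule" for r'
    proof -
      have br': "bil (\<lambda>u v. r' (u, v))" using r' by (simp add: bil_bimodule_def)
      show ?thesis using l prepend_form[OF br] prepend_form[OF br'] rD bilD[OF br']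
        by (auto simp: prepend_def bil_bimodule_def K.r_distr intro!: restrict_ext T_eqI_add)
    qed
    show "prepend k l (ract bil_bimodule r l') = ract bil_bimodule (prepend k l r) l'" if l': "l' \<in> carrier L" for l'
      using l l' prepend_form[OF br] by (auto simp: prepend_def bil_bimodule_def intro!: restrict_ext T_cong[symmetric])
    show "prepend k (l \<otimes>\<^bsub>L\<^esub> l') r = lact bil_bimodule l (prepend k l' r) \<oplus>\<^bsub>bil_bimodule\<^esub> prepend k l (lact bil_bimodule l' r)"
      if l': "l' \<in> carrier L" for l'
    proof -
      have "T (Suc k) (\<lambda>u v. \<mu> k (x \<otimes>\<^bsub>L\<^esub> u) \<otimes>\<^bsub>K\<^esub> r (v, y)) (l \<otimes>\<^bsub>L\<^esub> l') =
          T (Suc k) (\<lambda>u v. \<mu> k (x \<otimes>\<^bsub>L\<^esub> \<sigma> l \<otimes>\<^bsub>L\<^esub> u) \<otimes>\<^bsub>K\<^esub> r (v, y)) l' \<oplus>\<^bsub>K\<^esub>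
          T (Suc k) (\<lambda>u v. \<mu> k (x \<otimes>\<^bsub>L\<^esub> u) \<otimes>\<^bsub>K\<^esub> lact bil_bimodule l' r (v, y)) l"
        if xy: "x \<in> carrier L" "y \<in> carrier L" for x y
      proof -
        have f': "bil (\<lambda>u v. \<mu> k (x \<otimes>\<^bsub>L\<^esub> u) \<otimes>\<^bsub>K\<^esub> r (v \<otimes>\<^bsub>L\<^esub> \<sigma> l', y))"
          using bil_mult(3)[OF prepend_form[OF br xy], of "\<sigma> l'"] l' by simp
        show ?thesis unfolding T_mult[OF prepend_form[OF br xy] l l']
          by (intro arg_cong2[where f = "\<lambda>x y. x \<oplus>\<^bsub>K\<^esub> y"] T_cong[OF bil_mult(2)[OF prepend_form[OF br xy]]] T_cong[OF f'])
            (use l l' xy in \<open>auto simp: bil_bimodule_def L.m_assoc\<close>)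
      qed
      then show ?thesis using l l'
        by (auto simp: prepend_def bil_bimodule_def cong: if_cong intro!: restrict_ext)
    qed
  next
    fix c r assume c: "c \<in> carrier K" and r: "r \<in> carrier bil_bimodule"
    then have br: "bil (\<lambda>u v. r (u, v))" by (simp add: bil_bimodule_def)
    show "prepend k (c \<odot>\<^bsub>L\<^esub> \<one>\<^bsub>L\<^esub>) r = \<zero>\<^bsub>bil_bimodule\<^esub>"
      using c prepend_form[OF br] by (auto simp: prepend_def bil_bimodule_def T_ground intro!: restrict_ext)
  qed
qed

text \<open>The same use of \<open>T_mult\<close> as for \<open>prepend\<close>, except that both
  halves of the letter are fed to the single form \<open>r\<close>; the left action now multiplies
  the element at the seam.\<close>

lemma closing_extension: "bimodule_extension K L bil_bimodule lin_bimodule closing"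
proof (intro bimodule_extension.intro bil_bimod lin_bimod enveloping_axioms bimodule_extension_axioms.intro)
  fix l r assume l: "l \<in> carrier L" and r: "r \<in> carrier bil_bimodule"
  then have br: "bil (\<lambda>u v. r (u, v))" by (simp add: bil_bimodule_def)
  note f = closing_form[OF br]
  note rD = bilD[OF br] linear_formD(2,3)[OF bilD(2)[OF br]]
  have "lin (\<lambda>x. T 0 (\<lambda>u v. r (v, x \<otimes>\<^bsub>L\<^esub> u)) l)"
    unfolding linear_form_def
  proof (intro conjI ballI)
    fix x y assume "x \<in> carrier L" "y \<in> carrier L"
    then show "T 0 (\<lambda>u v. r (v, (x \<oplus>\<^bsub>L\<^esub> y) \<otimes>\<^bsub>L\<^esub> u)) l =
        T 0 (\<lambda>u v. r (v, x \<otimes>\<^bsub>L\<^esub> u)) l \<oplus>\<^bsub>K\<^esub> T 0 (\<lambda>u v. r (v, y \<otimes>\<^bsub>L\<^esub> u)) l"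
      using l rD by (auto intro!: T_eqI_add f simp: L.l_distr)
  next
    fix c x assume "c \<in> carrier K" "x \<in> carrier L"
    then show "T 0 (\<lambda>u v. r (v, (c \<odot>\<^bsub>L\<^esub> x) \<otimes>\<^bsub>L\<^esub> u)) l = c \<otimes>\<^bsub>K\<^esub> T 0 (\<lambda>u v. r (v, x \<otimes>\<^bsub>L\<^esub> u)) l"
      using l rD by (auto intro!: T_eqI_scale f simp: alg_simps)
  qed (use l f T_closed in auto)
  then show "closing l r \<in> carrier lin_bimodule" by (simp add: closing_def lin_bimodule_def lin_restrict)
  show "closing (l \<oplus>\<^bsub>L\<^esub> l') r = closing l r \<oplus>\<^bsub>lin_bimodule\<^esub> closing l' r" if "l' \<in> carrier L" for l'
    using that l f by (auto simp: closing_def lin_bimodule_def T_add intro!: restrict_ext)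
  show "closing l (r \<oplus>\<^bsub>bil_bimodule\<^esub> r') = closing l r \<oplus>\<^bsub>lin_bimodule\<^esub> closing l r'"
    if r': "r' \<in> carrier bil_bimodule" for r'
  proof -
    have br': "bil (\<lambda>u v. r' (u, v))" using r' by (simp add: bil_bimodule_def)
    show ?thesis using l f closing_form[OF br']
      by (auto simp: closing_def lin_bimodule_def bil_bimodule_def intro!: restrict_ext T_eqI_add)
  qed
  show "closing l (ract bil_bimodule r l') = ract lin_bimodule (closing l r) l'" if l': "l' \<in> carrier L" for l'
    using l l' f by (auto simp: closing_def lin_bimodule_def bil_bimodule_def L.m_assoc intro!: restrict_ext T_cong[symmetric])
  show "closing (l \<otimes>\<^bsub>L\<^esub> l') r = lact lin_bimodule l (closing l' r) \<oplus>\<^bsub>lin_bimodule\<^esub> closing l (lact bil_bimodule l' r)"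
    if l': "l' \<in> carrier L" for l'
  proof -
    have "T 0 (\<lambda>u v. r (v, x \<otimes>\<^bsub>L\<^esub> u)) (l \<otimes>\<^bsub>L\<^esub> l') =
        T 0 (\<lambda>u v. r (v, x \<otimes>\<^bsub>L\<^esub> \<sigma> l \<otimes>\<^bsub>L\<^esub> u)) l' \<oplus>\<^bsub>K\<^esub> T 0 (\<lambda>u v. lact bil_bimodule l' r (v, x \<otimes>\<^bsub>L\<^esub> u)) l"
      if x: "x \<in> carrier L" for x
    proof -
      have f': "bil (\<lambda>u v. r (v \<otimes>\<^bsub>L\<^esub> \<sigma> l', x \<otimes>\<^bsub>L\<^esub> u))"
        using bil_mult(3)[OF f[OF x], of "\<sigma> l'"] l' by simp
      show ?thesis unfolding T_mult[OF f[OF x] l l']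
        by (intro arg_cong2[where f = "\<lambda>x y. x \<oplus>\<^bsub>K\<^esub> y"] T_cong[OF bil_mult(2)[OF f[OF x]]] T_cong[OF f'])
          (use l l' x in \<open>auto simp: bil_bimodule_def L.m_assoc\<close>)
    qed
    then show ?thesis using l l'
      by (auto simp: closing_def lin_bimodule_def intro!: restrict_ext)
  qed
next
  fix c r assume c: "c \<in> carrier K" and r: "r \<in> carrier bil_bimodule"
  then have br: "bil (\<lambda>u v. r (u, v))" by (simp add: bil_bimodule_def)
  show "closing (c \<odot>\<^bsub>L\<^esub> \<one>\<^bsub>L\<^esub>) r = \<zero>\<^bsub>lin_bimodule\<^esub>"
    using c closing_form[OF br] by (auto simp: closing_def lin_bimodule_def T_ground intro!: restrict_ext)
qed

end

subsection \<open>The cycle of a periodic word\<close>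

lemma alternating_telescope:
  fixes Y :: "nat \<Rightarrow> 'a \<Rightarrow>\<^sub>0 int"
  shows "(\<Sum>k<m. frag_cmul ((- 1) ^ k) (Y (Suc k) + Y k)) = Y 0 - frag_cmul ((- 1) ^ m) (Y m)"
  by (induction m) (auto simp: frag_cmul_distrib2)

locale cyclic_word_resolution = cyclic_word K L \<sigma> T j p a \<mu> per
  for K :: "('k, 'u) ring_scheme" and L :: "('k, 'l) module" and \<sigma> T j p a \<mu> per +
  fixes P :: "nat \<Rightarrow> (('l \<times> 'l \<Rightarrow>\<^sub>0 int) set, 'p) module" and d :: "nat \<Rightarrow> 'p \<Rightarrow> 'p" and \<epsilon> :: "'p \<Rightarrow> 'l"
  assumes resolution: "hochschild_resolution K L P d \<epsilon>"
begin

abbreviation "Lm \<equiv> bimodule_as_left_module (regular_bimodule L)"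

lemma proj: "projective_module R (P n)"
  and P_mod: "left_module R (P n)"
  and d_lin: "linear_map R (P (Suc n)) (P n) (d n)"
  and \<epsilon>_lin: "linear_map R (P 0) Lm \<epsilon>"
  and \<epsilon>_surj: "\<epsilon> ` carrier (P 0) = carrier L"
  and exact_0: "{x \<in> carrier (P 0). \<epsilon> x = \<zero>\<^bsub>L\<^esub>} = d 0 ` carrier (P 1)"
  and exact_Suc: "{x \<in> carrier (P (Suc n)). d n x = \<zero>\<^bsub>P n\<^esub>} = d (Suc n) ` carrier (P (Suc (Suc n)))"
  using resolution
  by (auto simp: hochschild_resolution_def projective_resolution_def projective_module_def regular_bimodule_def)

sublocale P: left_module R "P n" for n by (rule P_mod)

lemma act_zero: "x \<in> carrier (P n) \<Longrightarrow> \<zero>\<^bsub>R\<^esub> \<odot>\<^bsub>P n\<^esub> x = \<zero>\<^bsub>P n\<^esub>"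
  using P.smult_l_distr[where n = n, of "\<zero>\<^bsub>R\<^esub>" "\<zero>\<^bsub>R\<^esub>" x] P.smult_closed[where n = n, of "\<zero>\<^bsub>R\<^esub>" x]
    P.M.add.l_cancel_one'[where n = n] by fastforce

text \<open>The index is the degree of the target: \<open>sg n\<close> is the sign
  \<open>(-1)^(n+1)\<close> that belongs to the boundary of \<open>w (Suc n)\<close>.\<close>

definition sg :: "nat \<Rightarrow> 'l \<Rightarrow> 'l" where
  "sg n x = (if odd n then x else \<ominus>\<^bsub>L\<^esub> x)"

lemma sg_closed [simp]: "x \<in> carrier L \<Longrightarrow> sg n x \<in> carrier L"
  by (simp add: sg_def)

text \<open>The element chosen for \<open>w (Suc n) k\<close> depends on \<open>k\<close> only through data that are periodic in \<open>k\<close>,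
  so that \<open>w n\<close> is periodic; the sign in its boundary is carried by \<open>sg n\<close>.\<close>

definition w0 :: 'p where "w0 = (SOME w. w \<in> carrier (P 0) \<and> \<epsilon> w = \<one>\<^bsub>L\<^esub>)"

primrec w :: "nat \<Rightarrow> nat \<Rightarrow> 'p" where
  "w 0 k = w0"
| "w (Suc n) k = (SOME x. x \<in> carrier (P (Suc n)) \<and>
     d n x = env (j k) \<one>\<^bsub>L\<^esub> \<odot>\<^bsub>P n\<^esub> w n (Suc k) \<oplus>\<^bsub>P n\<^esub> env \<one>\<^bsub>L\<^esub> (sg n (j (k + n))) \<odot>\<^bsub>P n\<^esub> w n k)"

declare w.simps(2) [simp del]

lemma w0: "w0 \<in> carrier (P 0)" "\<epsilon> w0 = \<one>\<^bsub>L\<^esub>"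
proof -
  have "\<exists>w. w \<in> carrier (P 0) \<and> \<epsilon> w = \<one>\<^bsub>L\<^esub>" using \<epsilon>_surj L.one_closed by (metis imageE)
  from someI_ex[OF this] show "w0 \<in> carrier (P 0)" "\<epsilon> w0 = \<one>\<^bsub>L\<^esub>" unfolding w0_def by auto
qed

lemma \<epsilon>_env: "x \<in> carrier (P 0) \<Longrightarrow> l \<in> carrier L \<Longrightarrow> l' \<in> carrier L \<Longrightarrow>
    \<epsilon> (env l l' \<odot>\<^bsub>P 0\<^esub> x) = l \<otimes>\<^bsub>L\<^esub> \<epsilon> x \<otimes>\<^bsub>L\<^esub> l'"
  using linear_mapD(3)[OF \<epsilon>_lin, of "env l l'" x] linear_mapD(1)[OF \<epsilon>_lin, of x]
    action_env[OF regular_bimod, of "\<epsilon> x" l l'] by (simp add: regular_bimodule_def)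

lemma sg_mult: "sg n (j k) \<otimes>\<^bsub>L\<^esub> sg m (j k') = \<zero>\<^bsub>L\<^esub>"
  by (auto simp: sg_def L.l_minus L.r_minus j_j)

lemma sg_add: "x \<in> carrier L \<Longrightarrow> sg n x \<oplus>\<^bsub>L\<^esub> sg (Suc n) x = \<zero>\<^bsub>L\<^esub>"
  by (auto simp: sg_def L.l_neg L.r_neg)

text \<open>The element prescribed as boundary of \<open>w (Suc n) k\<close> is a cycle, since the
  outer terms contain a product of two letters and the mixed terms cancel; exactness then gives the
  preimage that the choice in \<open>w\<close> requires. Membership in two adjacent degrees is
  carried along for the induction.\<close>

lemma w_step:
  "w n k \<in> carrier (P n) \<and> w (Suc n) k \<in> carrier (P (Suc n)) \<and>
   d n (w (Suc n) k) = env (j k) \<one>\<^bsub>L\<^esub> \<odot>\<^bsub>P n\<^esub> w n (Suc k) \<oplus>\<^bsub>P n\<^esub> env \<one>\<^bsub>L\<^esub> (sg n (j (k + n))) \<odot>\<^bsub>P n\<^esub> w n k"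
proof (induction n arbitrary: k)
  case 0
  let ?y = "env (j k) \<one>\<^bsub>L\<^esub> \<odot>\<^bsub>P 0\<^esub> w0 \<oplus>\<^bsub>P 0\<^esub> env \<one>\<^bsub>L\<^esub> (sg 0 (j k)) \<odot>\<^bsub>P 0\<^esub> w0"
  have c: "env (j k) \<one>\<^bsub>L\<^esub> \<odot>\<^bsub>P 0\<^esub> w0 \<in> carrier (P 0)" "env \<one>\<^bsub>L\<^esub> (sg 0 (j k)) \<odot>\<^bsub>P 0\<^esub> w0 \<in> carrier (P 0)"
    using w0 by (auto intro!: P.smult_closed)
  have "\<epsilon> ?y = \<zero>\<^bsub>L\<^esub>"
    using linear_mapD(2)[OF \<epsilon>_lin c] w0 by (simp add: \<epsilon>_env regular_bimodule_def sg_def L.r_neg)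
  then have "?y \<in> d 0 ` carrier (P 1)" using c exact_0 P.M.add.m_closed[where n = 0] by auto
  then have "\<exists>x. x \<in> carrier (P (Suc 0)) \<and> d 0 x = ?y" by auto
  from someI_ex[OF this] show ?case using w0 by (simp add: w.simps(2))
next
  case (Suc n)
  let ?e = "\<lambda>k. env (j k) \<one>\<^bsub>L\<^esub>" and ?f = "\<lambda>n k. env \<one>\<^bsub>L\<^esub> (sg n (j k))"
  let ?y = "?e k \<odot>\<^bsub>P (Suc n)\<^esub> w (Suc n) (Suc k) \<oplus>\<^bsub>P (Suc n)\<^esub> ?f (Suc n) (k + Suc n) \<odot>\<^bsub>P (Suc n)\<^esub> w (Suc n) k"
  note IH = Suc.IH[of k] Suc.IH[of "Suc k"] Suc.IH[of "Suc (Suc k)"]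
  have wc: "w n k \<in> carrier (P n)" "w n (Suc k) \<in> carrier (P n)" "w n (Suc (Suc k)) \<in> carrier (P n)"
    "w (Suc n) k \<in> carrier (P (Suc n))" "w (Suc n) (Suc k) \<in> carrier (P (Suc n))" using IH by auto
  have ec: "?e i \<in> carrier R" "?f m i \<in> carrier R" for i m by auto
  have "d n ?y = ?e k \<odot>\<^bsub>P n\<^esub> d n (w (Suc n) (Suc k)) \<oplus>\<^bsub>P n\<^esub> ?f (Suc n) (k + Suc n) \<odot>\<^bsub>P n\<^esub> d n (w (Suc n) k)"
    using linear_mapD(2,3)[OF d_lin] wc ec by (simp add: P.smult_closed)
  also have "\<dots> = ((?e k \<otimes>\<^bsub>R\<^esub> ?e (Suc k)) \<odot>\<^bsub>P n\<^esub> w n (Suc (Suc k)) \<oplus>\<^bsub>P n\<^esub> (?e k \<otimes>\<^bsub>R\<^esub> ?f n (Suc k + n)) \<odot>\<^bsub>P n\<^esub> w n (Suc k)) \<oplus>\<^bsub>P n\<^esub>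
      ((?f (Suc n) (k + Suc n) \<otimes>\<^bsub>R\<^esub> ?e k) \<odot>\<^bsub>P n\<^esub> w n (Suc k) \<oplus>\<^bsub>P n\<^esub> (?f (Suc n) (k + Suc n) \<otimes>\<^bsub>R\<^esub> ?f n (k + n)) \<odot>\<^bsub>P n\<^esub> w n k)"
    using IH wc ec by (simp add: P.smult_r_distr P.smult_assoc P.smult_closed)
  also have "?e k \<otimes>\<^bsub>R\<^esub> ?e (Suc k) = \<zero>\<^bsub>R\<^esub>" by (simp add: env_mult j_j env_zero)
  also have "?f (Suc n) (k + Suc n) \<otimes>\<^bsub>R\<^esub> ?f n (k + n) = \<zero>\<^bsub>R\<^esub>" by (simp add: env_mult sg_mult env_zero)
  \<comment> \<open>The mixed terms multiply \<open>w n (Suc k)\<close> by the same letters on both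
    sides, with the signs of two consecutive degrees, so they cancel.\<close>
  also have "?e k \<otimes>\<^bsub>R\<^esub> ?f n (Suc k + n) = env (j k) (sg n (j (k + Suc n)))" by (simp add: env_mult)
  also have "?f (Suc n) (k + Suc n) \<otimes>\<^bsub>R\<^esub> ?e k = env (j k) (sg (Suc n) (j (k + Suc n)))" by (simp add: env_mult)
  also have "(\<zero>\<^bsub>R\<^esub> \<odot>\<^bsub>P n\<^esub> w n (Suc (Suc k)) \<oplus>\<^bsub>P n\<^esub> env (j k) (sg n (j (k + Suc n))) \<odot>\<^bsub>P n\<^esub> w n (Suc k)) \<oplus>\<^bsub>P n\<^esub>
      (env (j k) (sg (Suc n) (j (k + Suc n))) \<odot>\<^bsub>P n\<^esub> w n (Suc k) \<oplus>\<^bsub>P n\<^esub> \<zero>\<^bsub>R\<^esub> \<odot>\<^bsub>P n\<^esub> w n k) =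
      (env (j k) (sg n (j (k + Suc n))) \<oplus>\<^bsub>R\<^esub> env (j k) (sg (Suc n) (j (k + Suc n)))) \<odot>\<^bsub>P n\<^esub> w n (Suc k)"
    using wc ec by (simp add: act_zero P.smult_l_distr P.smult_closed)
  also have "env (j k) (sg n (j (k + Suc n))) \<oplus>\<^bsub>R\<^esub> env (j k) (sg (Suc n) (j (k + Suc n))) = \<zero>\<^bsub>R\<^esub>"
    by (subst env_add_r[symmetric]) (simp_all add: sg_add env_zero)
  also have "\<zero>\<^bsub>R\<^esub> \<odot>\<^bsub>P n\<^esub> w n (Suc k) = \<zero>\<^bsub>P n\<^esub>" by (rule act_zero) (rule wc)
  finally have "?y \<in> {x \<in> carrier (P (Suc n)). d n x = \<zero>\<^bsub>P n\<^esub>}"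
    using wc ec by (simp add: P.smult_closed P.M.add.m_closed)
  then have "\<exists>x. x \<in> carrier (P (Suc (Suc n))) \<and> d (Suc n) x = ?y" unfolding exact_Suc by auto
  from someI_ex[OF this] show ?case using wc by (simp add: w.simps(2)[of "Suc n"])
qed

lemma w_closed: "w n k \<in> carrier (P n)" using w_step by blast

lemma w_periodic: "w n (k + per) = w n k"
proof (induction n arbitrary: k)
  case (Suc n)
  have "j (k + per + n) = j (k + n)" using j_periodic[of "k + n"] by (simp add: ac_simps)
  with Suc[of k] Suc[of "Suc k"] j_periodic[of k] show ?case by (simp add: w.simps(2))
qed simp

lemma j_periodic': "j (k + m * per) = j k"
  by (induction m) (simp, metis add.assoc add.commute j_periodic mult_Suc)
lemma p_periodic': "p (k + m * per) = p k"
  by (induction m) (simp, metis add.assoc add.commute p_periodic mult_Suc)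

lemma lact_j: "u \<in> carrier bil_bimodule \<Longrightarrow> lact bil_bimodule (j k) u = \<zero>\<^bsub>bil_bimodule\<^esub>"
  "u' \<in> carrier lin_bimodule \<Longrightarrow> lact lin_bimodule (j k) u' = \<zero>\<^bsub>lin_bimodule\<^esub>"
  "u \<in> carrier bil_bimodule \<Longrightarrow> ract bil_bimodule u (sg n (j k)) = \<zero>\<^bsub>bil_bimodule\<^esub>"
  "u' \<in> carrier lin_bimodule \<Longrightarrow> ract lin_bimodule u' (sg n (j k)) = \<zero>\<^bsub>lin_bimodule\<^esub>"
proof -
  have s: "\<sigma> (sg n (j k)) = \<zero>\<^bsub>L\<^esub>"
  proof -
    have "\<sigma> (\<ominus>\<^bsub>L\<^esub> j k) = \<zero>\<^bsub>L\<^esub>"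
      using \<sigma>_add[of "\<ominus>\<^bsub>L\<^esub> j k" "j k"] \<sigma>_j \<sigma>_ground[of "\<zero>\<^bsub>K\<^esub>"]
      by (simp add: L.l_neg KL.smult_l_null)
    then show ?thesis by (simp add: sg_def \<sigma>_j)
  qed
  show "u \<in> carrier bil_bimodule \<Longrightarrow> lact bil_bimodule (j k) u = \<zero>\<^bsub>bil_bimodule\<^esub>"
    "u \<in> carrier bil_bimodule \<Longrightarrow> ract bil_bimodule u (sg n (j k)) = \<zero>\<^bsub>bil_bimodule\<^esub>"
    using lin_at_zero[OF bilD(1)[of u]] lin_at_zero[OF bilD(2)[of u]]
    by (auto simp: bil_bimodule_def \<sigma>_j s intro!: restrict_ext)
  show "u' \<in> carrier lin_bimodule \<Longrightarrow> lact lin_bimodule (j k) u' = \<zero>\<^bsub>lin_bimodule\<^esub>"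
    "u' \<in> carrier lin_bimodule \<Longrightarrow> ract lin_bimodule u' (sg n (j k)) = \<zero>\<^bsub>lin_bimodule\<^esub>"
    by (auto simp: lin_bimodule_def \<sigma>_j s lin_at_zero intro!: restrict_ext)
qed

text \<open>\<open>w m k\<close> spells the \<open>m\<close> letters from position \<open>k\<close>
  on. Here the word always ends at position \<open>n\<close> and grows to the left, so its start
  \<open>Suc n - m\<close> moves down as the degree goes up. The first variable is filled with the
  tail of the letter just before the word; prepending that letter contributes a factor
  \<open>1\<close> by \<open>\<mu>_one\<close>, which keeps the value the same in all
  degrees.\<close>

lemma bil_comparison:
  assumes "m \<le> n"
  shows "\<exists>\<alpha>. linear_map R (P m) (bimodule_as_left_module bil_bimodule) \<alpha> \<and>
     (\<forall>q\<in>carrier (P (Suc m)). \<alpha> (d m q) = \<zero>\<^bsub>bil_bimodule\<^esub>) \<and>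
     (\<forall>x\<in>carrier L. \<alpha> (w m (Suc n - m)) (a (n - m), x) = \<mu> n (a n \<otimes>\<^bsub>L\<^esub> x))"
  using assms
proof (induction m)
  case 0
  \<comment> \<open>In degree zero the word is empty and \<open>\<epsilon>\<close> fills the middle
    place of the form \<open>\<mu> n\<close>; at \<open>w0\<close> the middle place is the
    unit.\<close>
  let ?f = "\<lambda>l. \<lambda>z\<in>carrier L \<times> carrier L. \<mu> n (fst z \<otimes>\<^bsub>L\<^esub> \<sigma> l \<otimes>\<^bsub>L\<^esub> snd z)"
  have bil: "bil (\<lambda>u v. \<mu> n (u \<otimes>\<^bsub>L\<^esub> \<sigma> l \<otimes>\<^bsub>L\<^esub> v))" if "l \<in> carrier L" for l
    using that lin_mult_l[OF \<mu>_lin] lin_mult_r[OF lin_mult_r[OF \<mu>_lin]] by (simp add: bilinear_form_def)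
  have f: "linear_map R Lm (bimodule_as_left_module bil_bimodule) ?f"
    by (rule linear_map_of_bimodule_map[OF regular_bimod bil_bimod])
      (auto simp: bil_bimodule_def regular_bimodule_def bil_if bil \<sigma>_add \<sigma>_mult L.l_distr L.r_distr \<mu>_D L.m_assoc
        intro!: restrict_ext)
  have "?f (\<epsilon> (d 0 q)) = \<zero>\<^bsub>bil_bimodule\<^esub>" if "q \<in> carrier (P 1)" for q
  proof -
    have "\<epsilon> (d 0 q) = \<zero>\<^bsub>L\<^esub>" using exact_0 that by blast
    moreover have "\<sigma> \<zero>\<^bsub>L\<^esub> = \<zero>\<^bsub>L\<^esub>" using \<sigma>_ground[of "\<zero>\<^bsub>K\<^esub>"] by (simp add: KL.smult_l_null)
    ultimately show ?thesis by (auto simp: bil_bimodule_def lin_at_zero[OF \<mu>_lin] intro!: restrict_ext)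
  qed
  then show ?case
    by (intro exI[of _ "\<lambda>x. ?f (\<epsilon> x)"] conjI ballI linear_map_comp[OF \<epsilon>_lin f]) (simp_all add: w0)
next
  case (Suc m)
  then obtain \<alpha> where \<alpha>: "linear_map R (P m) (bimodule_as_left_module bil_bimodule) \<alpha>"
    "\<And>q. q \<in> carrier (P (Suc m)) \<Longrightarrow> \<alpha> (d m q) = \<zero>\<^bsub>bil_bimodule\<^esub>"
    "\<And>x. x \<in> carrier L \<Longrightarrow> \<alpha> (w m (Suc n - m)) (a (n - m), x) = \<mu> n (a n \<otimes>\<^bsub>L\<^esub> x)" by auto
  define k where "k = n - Suc m"
  have k: "n - m = Suc k" "Suc n - m = Suc (Suc k)" "Suc n - Suc m = Suc k" using Suc.prems by (auto simp: k_def)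
  interpret ext: bimodule_extension K L bil_bimodule bil_bimodule "prepend k" by (rule prepend_extension)
  obtain \<alpha>' where \<alpha>': "linear_map R (P (Suc m)) (bimodule_as_left_module bil_bimodule) \<alpha>'"
    "\<And>p. p \<in> carrier (P (Suc m)) \<Longrightarrow> d m p = \<zero>\<^bsub>P m\<^esub> \<Longrightarrow> \<alpha>' p = \<zero>\<^bsub>bil_bimodule\<^esub>"
    "\<And>p l l' w w'. \<lbrakk>p \<in> carrier (P (Suc m)); w \<in> carrier (P m); w' \<in> carrier (P m); l \<in> carrier L; l' \<in> carrier L;
        \<And>u. u \<in> carrier bil_bimodule \<Longrightarrow> lact bil_bimodule l u = \<zero>\<^bsub>bil_bimodule\<^esub>;
        \<And>u. u \<in> carrier bil_bimodule \<Longrightarrow> ract bil_bimodule u l' = \<zero>\<^bsub>bil_bimodule\<^esub>;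
        d m p = env l \<one>\<^bsub>L\<^esub> \<odot>\<^bsub>P m\<^esub> w \<oplus>\<^bsub>P m\<^esub> env \<one>\<^bsub>L\<^esub> l' \<odot>\<^bsub>P m\<^esub> w'\<rbrakk> \<Longrightarrow> \<alpha>' p = prepend k l (\<alpha> w)"
    using ext.shift[OF proj P_mod d_lin \<alpha>(1,2)] by blast
  have "\<alpha>' (d (Suc m) q) = \<zero>\<^bsub>bil_bimodule\<^esub>" if "q \<in> carrier (P (Suc (Suc m)))" for q
    using \<alpha>'(2) exact_Suc[of m] that by blast
  moreover have "\<alpha>' (w (Suc m) (Suc k)) (a k, x) = \<mu> n (a n \<otimes>\<^bsub>L\<^esub> x)" if x: "x \<in> carrier L" for x
  proof -
    have eq: "\<alpha>' (w (Suc m) (Suc k)) = prepend k (j (Suc k)) (\<alpha> (w m (Suc (Suc k))))"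
      by (rule \<alpha>'(3)[OF w_closed w_closed w_closed[of m "Suc k"] j_closed sg_closed[OF j_closed] lact_j(1,3)])
        (use w_step[of m "Suc k"] in auto)
    let ?r = "\<alpha> (w m (Suc (Suc k)))"
    have r: "bil (\<lambda>u v. ?r (u, v))" using linear_mapD(1)[OF \<alpha>(1) w_closed] by (simp add: bil_bimodule_def)
    have "\<alpha>' (w (Suc m) (Suc k)) (a k, x) = \<mu> k (a k \<otimes>\<^bsub>L\<^esub> p (Suc k)) \<otimes>\<^bsub>K\<^esub> ?r (a (Suc k), x)"
      unfolding eq prepend_def using x T_j[OF prepend_form[OF r a_closed x]] by simp
    also have "\<dots> = \<mu> n (a n \<otimes>\<^bsub>L\<^esub> x)" using \<alpha>(3)[OF x] x by (simp add: k \<mu>_one)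
    finally show ?thesis .
  qed
  ultimately show ?case using \<alpha>'(1) by (auto simp: k k_def[symmetric])
qed

theorem HH_nontrivial:
  assumes "0 < m"
  shows "\<not> trivial_group (HH K L P d (m * per))"
proof -
  \<comment> \<open>The class lives two degrees above \<open>n\<close>: the form
    \<open>\<gamma>\<close> below is defined in degree \<open>Suc n\<close>, and closing the word
    raises the degree once more.\<close>
  define n where "n = m * per - 2"
  have n: "m * per = Suc (Suc n)"
  proof -
    have "2 \<le> per" using per by (metis One_nat_def Suc_leI even_zero le_neq_implies_less nat_neq_iff numeral_2_eq_2 odd_one)
    with assms have "2 \<le> m * per" by (metis One_nat_def Suc_leI mult_le_mono mult_1)
    then show ?thesis by (simp add: n_def)
  qed
  \<comment> \<open>In the top degree \<open>sg (Suc n)\<close> is thus the identity, and the signs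
    of the cycle come from the alternating sum alone.\<close>
  have odd: "odd (Suc n)" "odd (Suc n + 0)" using per n by (metis even_Suc even_mult_iff, metis add_0_right even_Suc even_mult_iff)
  obtain \<beta> where \<beta>: "linear_map R (P n) (bimodule_as_left_module bil_bimodule) \<beta>"
    "\<And>q. q \<in> carrier (P (Suc n)) \<Longrightarrow> \<beta> (d n q) = \<zero>\<^bsub>bil_bimodule\<^esub>"
    "\<And>x. x \<in> carrier L \<Longrightarrow> \<beta> (w n 2) (a 1, x) = \<mu> (Suc n) (a (Suc n) \<otimes>\<^bsub>L\<^esub> x)"
    using bil_comparison[of n "Suc n"] by (auto simp: numeral_2_eq_2)
  obtain \<gamma> where \<gamma>: "linear_map R (P (Suc n)) (bimodule_as_left_module bil_bimodule) \<gamma>"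
    "\<And>q. q \<in> carrier (P (Suc (Suc n))) \<Longrightarrow> \<gamma> (d (Suc n) q) = \<zero>\<^bsub>bil_bimodule\<^esub>"
    "\<And>x. x \<in> carrier L \<Longrightarrow> \<gamma> (w (Suc n) 1) (a 0, x) = \<mu> (Suc n) (a (Suc n) \<otimes>\<^bsub>L\<^esub> x)"
    using bil_comparison[of "Suc n" "Suc n"] by auto
  interpret ext: bimodule_extension K L bil_bimodule lin_bimodule closing by (rule closing_extension)
  obtain \<alpha> where \<alpha>: "linear_map R (P (Suc (Suc n))) (bimodule_as_left_module lin_bimodule) \<alpha>"
    "\<And>p. p \<in> carrier (P (Suc (Suc n))) \<Longrightarrow> d (Suc n) p = \<zero>\<^bsub>P (Suc n)\<^esub> \<Longrightarrow> \<alpha> p = \<zero>\<^bsub>lin_bimodule\<^esub>"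
    "\<And>p l l' w w'. \<lbrakk>p \<in> carrier (P (Suc (Suc n))); w \<in> carrier (P (Suc n)); w' \<in> carrier (P (Suc n)); l \<in> carrier L; l' \<in> carrier L;
        \<And>u. u \<in> carrier lin_bimodule \<Longrightarrow> lact lin_bimodule l u = \<zero>\<^bsub>lin_bimodule\<^esub>;
        \<And>u. u \<in> carrier lin_bimodule \<Longrightarrow> ract lin_bimodule u l' = \<zero>\<^bsub>lin_bimodule\<^esub>;
        d (Suc n) p = env l \<one>\<^bsub>L\<^esub> \<odot>\<^bsub>P (Suc n)\<^esub> w \<oplus>\<^bsub>P (Suc n)\<^esub> env \<one>\<^bsub>L\<^esub> l' \<odot>\<^bsub>P (Suc n)\<^esub> w'\<rbrakk> \<Longrightarrow> \<alpha> p = closing l (\<gamma> w)"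
    using ext.shift[OF proj P_mod d_lin \<gamma>(1,2)] by blast
  have \<alpha>_lin: "\<alpha> q \<in> extensional (carrier L)" "lin (\<alpha> q)" if "q \<in> carrier (P (Suc (Suc n)))" for q
    using linear_mapD(1)[OF \<alpha>(1) that] by (simp_all add: lin_bimodule_def)
  have \<alpha>w: "\<alpha> (w (Suc (Suc n)) k) = closing (j k) (\<gamma> (w (Suc n) (Suc k)))" for k
    by (rule \<alpha>(3)[OF w_closed w_closed w_closed[of "Suc n" k] j_closed sg_closed[OF j_closed] lact_j(2,4)])
      (use w_step[of "Suc n" k] in auto)
  have \<gamma>b: "bil (\<lambda>u v. \<gamma> (w (Suc n) k) (u, v))" for k
    using linear_mapD(1)[OF \<gamma>(1) w_closed] by (simp add: bil_bimodule_def)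
  \<comment> \<open>The form is evaluated at \<open>\<sigma> x\<close>, not at \<open>x\<close>: the
    actions on \<open>lin_bimodule\<close> go through \<open>\<sigma>\<close>, and this makes the
    pairing balanced over \<open>R\<close>.\<close>
  let ?\<Theta> = "\<lambda>x q. \<alpha> q (\<sigma> x)"
  have \<Theta>0: "?\<Theta> \<one>\<^bsub>L\<^esub> (w (Suc (Suc n)) 0) = \<one>\<^bsub>K\<^esub>"
  proof -
    \<comment> \<open>Closing the word pairs \<open>a (Suc n)\<close> with \<open>p 0\<close>. The
      degree is a multiple of the period, so this head is \<open>p (Suc (Suc n))\<close> and
      \<open>\<mu>_one\<close> applies once more.\<close>
    have "p (Suc (Suc n)) = p 0" using p_periodic'[of 0 m] n by simp
    then show ?thesis
      unfolding \<alpha>w closing_def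
      using T_j[OF closing_form[OF \<gamma>b L.one_closed], of 0 1] \<gamma>(3)[of "p 0"] \<mu>_one[of "Suc n"] by simp
  qed
  have \<Theta>k: "?\<Theta> \<one>\<^bsub>L\<^esub> (w (Suc (Suc n)) k) = \<zero>\<^bsub>K\<^esub>" if "0 < k" "k < per" for k
    unfolding \<alpha>w closing_def using T_0_j[OF closing_form[OF \<gamma>b L.one_closed] that] by simp
  let ?X = "bimodule_as_right_module (regular_bimodule L)"
  have X [simp]: "carrier ?X = carrier L" "\<And>x y. x \<oplus>\<^bsub>?X\<^esub> y = x \<oplus>\<^bsub>L\<^esub> y" "\<zero>\<^bsub>?X\<^esub> = \<zero>\<^bsub>L\<^esub>"
    by (simp_all add: bimodule_as_right_module_def regular_bimodule_def)
  have X_group: "abelian_group ?X" by (rule abelian_group_transfer[OF L.is_abelian_group]) simp_all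
  have X_closed: "r \<odot>\<^bsub>?X\<^esub> x \<in> carrier ?X" if "r \<in> carrier R" "x \<in> carrier ?X" for r x
    using hom_in_carrier[OF right_regular(1), of x r] that by (simp add: R_simps)
  \<comment> \<open>These are the signed rotations of the word. The number of terms is left variable
    because values on partial sums are computed by induction; the cycle is the case
    \<open>per\<close>.\<close>
  let ?z = "\<lambda>M. \<Sum>k<M. frag_cmul ((- 1) ^ k) (frag_of (\<one>\<^bsub>L\<^esub>, w (Suc (Suc n)) k))"
  have kz: "Poly_Mapping.keys (?z M) \<subseteq> carrier L \<times> carrier (P (Suc (Suc n)))" for M
    using keys_sum[of "\<lambda>k. frag_cmul ((- 1) ^ k) (frag_of (\<one>\<^bsub>L\<^esub>, w (Suc (Suc n)) k))" "{..<M}"] w_closed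
    by (fastforce dest: subsetD[OF keys_cmul])
  have "\<not> trivial_group (Tor R ?X P d (Suc (Suc n)))"
  proof (rule Tor_nontrivial[where P = P and d = d and n = "Suc n" and \<Theta> = ?\<Theta> and z = "?z per",
        OF X_group X_closed P_mod d_lin K.is_abelian_group])
    fix x q assume "x \<in> carrier ?X" "q \<in> carrier (P (Suc (Suc n)))"
    then show "?\<Theta> x q \<in> carrier K" using linear_formD(1)[OF \<alpha>_lin(2)] by simp
  next
    fix x x' q assume "x \<in> carrier ?X" "x' \<in> carrier ?X" "q \<in> carrier (P (Suc (Suc n)))"
    then show "?\<Theta> (x \<oplus>\<^bsub>?X\<^esub> x') q = ?\<Theta> x q \<oplus>\<^bsub>K\<^esub> ?\<Theta> x' q"
      using linear_formD(2)[OF \<alpha>_lin(2)] by (simp add: \<sigma>_add)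
  next
    fix x q q' assume "x \<in> carrier ?X" "q \<in> carrier (P (Suc (Suc n)))" "q' \<in> carrier (P (Suc (Suc n)))"
    then show "?\<Theta> x (q \<oplus>\<^bsub>P (Suc (Suc n))\<^esub> q') = ?\<Theta> x q \<oplus>\<^bsub>K\<^esub> ?\<Theta> x q'"
      using linear_mapD(2)[OF \<alpha>(1)] by (simp add: lin_bimodule_def)
  next
    fix x r q assume x: "x \<in> carrier ?X" and r: "r \<in> carrier R" and q: "q \<in> carrier (P (Suc (Suc n)))"
    have "(\<lambda>y. \<alpha> q (\<sigma> y)) \<in> hom (add_monoid L) (add_monoid K)"
      using linear_formD(1,2)[OF \<alpha>_lin(2)[OF q]] by (auto simp: hom_def \<sigma>_add)
    from hom_compose[OF right_regular(1) this, of x] x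
    have h1: "(\<lambda>r. \<alpha> q (\<sigma> (r \<odot>\<^bsub>?X\<^esub> x))) \<in> hom E.Q (add_monoid K)" by (simp add: o_def)
    have h2: "(\<lambda>r. \<alpha> (r \<odot>\<^bsub>P (Suc (Suc n))\<^esub> q) (\<sigma> x)) \<in> hom E.Q (add_monoid K)"
    proof (rule homI)
      fix r assume "r \<in> carrier E.Q"
      then show "\<alpha> (r \<odot>\<^bsub>P (Suc (Suc n))\<^esub> q) (\<sigma> x) \<in> carrier (add_monoid K)"
        using linear_formD(1)[OF \<alpha>_lin(2)[OF P.smult_closed[OF _ q]]] x by (simp add: R_simps)
    next
      fix r s assume "r \<in> carrier E.Q" "s \<in> carrier E.Q"
      then have rs: "r \<in> carrier R" "s \<in> carrier R" by (simp_all add: R_simps)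
      have "\<alpha> ((r \<oplus>\<^bsub>R\<^esub> s) \<odot>\<^bsub>P (Suc (Suc n))\<^esub> q) (\<sigma> x) =
          \<alpha> (r \<odot>\<^bsub>P (Suc (Suc n))\<^esub> q) (\<sigma> x) \<oplus>\<^bsub>K\<^esub> \<alpha> (s \<odot>\<^bsub>P (Suc (Suc n))\<^esub> q) (\<sigma> x)"
        using rs x q linear_mapD(2)[OF \<alpha>(1)] by (simp add: P.smult_l_distr P.smult_closed lin_bimodule_def)
      then show "\<alpha> ((r \<otimes>\<^bsub>E.Q\<^esub> s) \<odot>\<^bsub>P (Suc (Suc n))\<^esub> q) (\<sigma> x) =
          \<alpha> (r \<odot>\<^bsub>P (Suc (Suc n))\<^esub> q) (\<sigma> x) \<otimes>\<^bsub>add_monoid K\<^esub> \<alpha> (s \<odot>\<^bsub>P (Suc (Suc n))\<^esub> q) (\<sigma> x)"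
        unfolding R_simps by simp
    qed
    show "?\<Theta> (r \<odot>\<^bsub>?X\<^esub> x) q = ?\<Theta> x (r \<odot>\<^bsub>P (Suc (Suc n))\<^esub> q)"
    proof (rule E.Q_hom_eq[OF h1 h2 K.add.is_group])
      show "r \<in> carrier E.Q" using r unfolding R_simps .
      fix s assume "s \<in> carrier L \<times> carrier (op_ring L)"
      then obtain l l' where s: "s = (l, l')" and l: "l \<in> carrier L" "l' \<in> carrier L" by auto
      have "env l l' \<odot>\<^bsub>?X\<^esub> x = l' \<otimes>\<^bsub>L\<^esub> x \<otimes>\<^bsub>L\<^esub> l" using right_regular(2) x l by simp
      moreover have "\<alpha> (env l l' \<odot>\<^bsub>P (Suc (Suc n))\<^esub> q) = ract lin_bimodule (lact lin_bimodule l (\<alpha> q)) l'"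
        using linear_mapD(1,3)[OF \<alpha>(1)] action_env[OF lin_bimod _ l] l q by simp
      ultimately show "\<alpha> q (\<sigma> (E.cls (frag_of s) \<odot>\<^bsub>?X\<^esub> x)) = \<alpha> (E.cls (frag_of s) \<odot>\<^bsub>P (Suc (Suc n))\<^esub> q) (\<sigma> x)"
        unfolding s env_def[symmetric] using l x by (simp add: lin_bimodule_def \<sigma>_mult L.m_assoc)
    qed
  next
    fix x q assume x: "x \<in> carrier ?X" and q: "q \<in> carrier (P (Suc (Suc (Suc n))))"
    have "d (Suc (Suc n)) q \<in> carrier (P (Suc (Suc n)))" "d (Suc n) (d (Suc (Suc n)) q) = \<zero>\<^bsub>P (Suc n)\<^esub>"
      using exact_Suc[of "Suc n"] q by auto
    from \<alpha>(2)[OF this] show "?\<Theta> x (d (Suc (Suc n)) q) = \<zero>\<^bsub>K\<^esub>" using x by (simp add: lin_bimodule_def)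
  next
    show "Poly_Mapping.keys (?z per) \<subseteq> carrier ?X \<times> carrier (P (Suc (Suc n)))" using kz by simp
  next
    interpret T: tensor_data R ?X "\<lambda>x r. r \<odot>\<^bsub>?X\<^esub> x" "P (Suc n)" "smult (P (Suc n))"
      using X_group X_closed P_mod by (rule tensor_data_Tor)
    \<comment> \<open>Modulo the period \<open>k + Suc n\<close> is \<open>k - 1\<close>, so the
      entry in \<open>L\<close> is the letter preceding the word spelled by
      \<open>w (Suc n) k\<close>. Moving either outer letter of a rotation across the tensor sign
      gives a chain of this kind, which makes neighbouring rotations share a term.\<close>
    let ?Y = "\<lambda>k. frag_of (j (k + Suc n), w (Suc n) k)"
    have e: "frag_of (\<one>\<^bsub>L\<^esub>, d (Suc n) (w (Suc (Suc n)) k)) - (?Y (Suc k) + ?Y k) \<in> T.H" for k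
    proof -
      let ?u = "env (j k) \<one>\<^bsub>L\<^esub> \<odot>\<^bsub>P (Suc n)\<^esub> w (Suc n) (Suc k)"
      let ?v = "env \<one>\<^bsub>L\<^esub> (j (k + Suc n)) \<odot>\<^bsub>P (Suc n)\<^esub> w (Suc n) k"
      have dw: "d (Suc n) (w (Suc (Suc n)) k) = ?u \<oplus>\<^bsub>P (Suc n)\<^esub> ?v"
        using w_step[of "Suc n" k] odd by (simp add: sg_def)
      have c: "?u \<in> carrier (P (Suc n))" "?v \<in> carrier (P (Suc n))" by (auto intro!: P.smult_closed w_closed)
      have jk: "j (Suc k + Suc n) = j k" using j_periodic'[of k m] n by simp
      have "T.pure \<one>\<^bsub>L\<^esub> (?u \<oplus>\<^bsub>P (Suc n)\<^esub> ?v) = T.pure \<one>\<^bsub>L\<^esub> ?u \<otimes>\<^bsub>T.Q\<^esub> T.pure \<one>\<^bsub>L\<^esub> ?v"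
        by (rule T.pure_add_r) (use c in simp_all)
      also have "T.pure \<one>\<^bsub>L\<^esub> ?u = T.pure (j k) (w (Suc n) (Suc k))"
        using T.pure_balanced[of "\<one>\<^bsub>L\<^esub>" "env (j k) \<one>\<^bsub>L\<^esub>" "w (Suc n) (Suc k)"] w_closed right_regular(2)[of "\<one>\<^bsub>L\<^esub>" "j k" "\<one>\<^bsub>L\<^esub>"] by simp
      also have "T.pure \<one>\<^bsub>L\<^esub> ?v = T.pure (j (k + Suc n)) (w (Suc n) k)"
        using T.pure_balanced[of "\<one>\<^bsub>L\<^esub>" "env \<one>\<^bsub>L\<^esub> (j (k + Suc n))" "w (Suc n) k"] w_closed
          right_regular(2)[of "\<one>\<^bsub>L\<^esub>" "\<one>\<^bsub>L\<^esub>" "j (k + Suc n)"] by simp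
      also have "T.pure (j k) (w (Suc n) (Suc k)) \<otimes>\<^bsub>T.Q\<^esub> T.pure (j (k + Suc n)) (w (Suc n) k) = T.cls (?Y (Suc k) + ?Y k)"
        unfolding jk by (rule T.cls_add[symmetric]) (simp_all add: w_closed)
      finally show ?thesis unfolding dw T.cls_eq_iff .
    qed
    have "frag_extend (\<lambda>(x, p). frag_of (x, d (Suc n) p)) (?z per) =
        (\<Sum>k<per. frag_cmul ((- 1) ^ k) (frag_of (\<one>\<^bsub>L\<^esub>, d (Suc n) (w (Suc (Suc n)) k))))"
      by (simp add: frag_extend_sum frag_extend_cmul o_def)
    also have "\<dots> = (\<Sum>k<per. frag_cmul ((- 1) ^ k) (frag_of (\<one>\<^bsub>L\<^esub>, d (Suc n) (w (Suc (Suc n)) k)) - (?Y (Suc k) + ?Y k)) +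
        frag_cmul ((- 1) ^ k) (?Y (Suc k) + ?Y k))"
      by (intro sum.cong refl) (simp only: frag_cmul_distrib2[symmetric] diff_add_cancel)
    also have "\<dots> = (\<Sum>k<per. frag_cmul ((- 1) ^ k) (frag_of (\<one>\<^bsub>L\<^esub>, d (Suc n) (w (Suc (Suc n)) k)) - (?Y (Suc k) + ?Y k))) +
        (?Y 0 - frag_cmul ((- 1) ^ per) (?Y per))"
      unfolding sum.distrib alternating_telescope[of ?Y] ..
    \<comment> \<open>Both ends of the telescope are the same chain by periodicity, and they have
      the same sign because the period is even.\<close>
    also have "?Y 0 - frag_cmul ((- 1) ^ per) (?Y per) = 0"
      using per w_periodic[of "Suc n" 0] j_periodic[of "Suc n"] by (simp add: add.commute)
    finally have eq: "frag_extend (\<lambda>(x, p). frag_of (x, d (Suc n) p)) (?z per) =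
        (\<Sum>k<per. frag_cmul ((- 1) ^ k) (frag_of (\<one>\<^bsub>L\<^esub>, d (Suc n) (w (Suc (Suc n)) k)) - (?Y (Suc k) + ?Y k)))" by simp
    have "(\<Sum>k<M. frag_cmul ((- 1) ^ k) (frag_of (\<one>\<^bsub>L\<^esub>, d (Suc n) (w (Suc (Suc n)) k)) - (?Y (Suc k) + ?Y k))) \<in> T.H" for M
      by (induction M) (simp_all only: lessThan_0 sum.empty T.H_zero sum.lessThan_Suc T.H_add T.H_frag_cmul e)
    with eq show "frag_extend (\<lambda>(x, p). frag_of (x, d (Suc n) p)) (?z per) \<in> T.H" by simp
  next
    have img: "(\<lambda>(x, q). ?\<Theta> x q) ` (carrier L \<times> carrier (P (Suc (Suc n)))) \<subseteq> carrier K"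
      using linear_formD(1)[OF \<alpha>_lin(2)] by auto
    note hom = K.frag_eval_hom[OF img]
    have of: "frag_eval K (\<lambda>(x, q). ?\<Theta> x q) (frag_of (\<one>\<^bsub>L\<^esub>, w (Suc (Suc n)) k)) = ?\<Theta> \<one>\<^bsub>L\<^esub> (w (Suc (Suc n)) k)" for k
      using linear_formD(1)[OF \<alpha>_lin(2)[OF w_closed]] by (subst K.frag_eval_of) auto
    \<comment> \<open>The rotation \<open>k = 0\<close> has value \<open>1\<close> and the others
      have value \<open>0\<close>, so every nonempty partial sum already takes the final
      value.\<close>
    have "0 < M \<Longrightarrow> M \<le> per \<Longrightarrow> frag_eval K (\<lambda>(x, q). ?\<Theta> x q) (?z M) = \<one>\<^bsub>K\<^esub>" for M
    proof (induction M)
      case (Suc M)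
      show ?case
      proof (cases "M = 0")
        case True
        then show ?thesis using of[of 0] \<Theta>0 by simp
      next
        case False
        let ?g = "frag_of (\<one>\<^bsub>L\<^esub>, w (Suc (Suc n)) M)"
        have k: "Poly_Mapping.keys ?g \<subseteq> carrier L \<times> carrier (P (Suc (Suc n)))" using w_closed by simp
        have z: "frag_eval K (\<lambda>(x, q). ?\<Theta> x q) ?g = \<zero>\<^bsub>K\<^esub>" using of[of M] \<Theta>k[of M] Suc.prems False by simp
        have IH: "frag_eval K (\<lambda>(x, q). ?\<Theta> x q) (?z M) = \<one>\<^bsub>K\<^esub>" using Suc False by simp
        show ?thesis
        proof (cases "even M")
          case True
          then show ?thesis using hom_mult[OF hom, of "?z M" ?g] kz[of M] k z IH by simp
        next
          case False
          then have "?z (Suc M) = ?z M - ?g" by simp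
          then show ?thesis using K.frag_eval_diff[OF img kz[of M] k] z IH by (simp add: K.minus_eq)
        qed
      qed
    qed simp
    then show "frag_eval K (\<lambda>(x, q). ?\<Theta> x q) (?z per) \<noteq> \<zero>\<^bsub>K\<^esub>" using per by simp
  qed
  then show ?thesis unfolding HH_def n .
qed

end

section \<open>Coordinates on projective bimodules\<close>

lemma (in tensor_data) tensor_endomap_rels:
  assumes f: "\<And>x. x \<in> carrier X \<Longrightarrow> f x \<in> carrier X"
      "\<And>x x'. x \<in> carrier X \<Longrightarrow> x' \<in> carrier X \<Longrightarrow> f (x \<oplus>\<^bsub>X\<^esub> x') = f x \<oplus>\<^bsub>X\<^esub> f x'"
      "\<And>x r. x \<in> carrier X \<Longrightarrow> r \<in> carrier R \<Longrightarrow> f (xr x r) = xr (f x) r"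
    and g: "\<And>y. y \<in> carrier Y \<Longrightarrow> g y \<in> carrier Y"
      "\<And>y y'. y \<in> carrier Y \<Longrightarrow> y' \<in> carrier Y \<Longrightarrow> g (y \<oplus>\<^bsub>Y\<^esub> y') = g y \<oplus>\<^bsub>Y\<^esub> g y'"
      "\<And>y r. y \<in> carrier Y \<Longrightarrow> r \<in> carrier R \<Longrightarrow> g (yl r y) = yl r (g y)"
  defines "h \<equiv> presented_map (carrier X \<times> carrier Y) (tensor_rels R X xr Y yl) (\<lambda>(x, y). (f x, g y))"
  shows "h \<in> hom Q Q" "x \<in> carrier X \<Longrightarrow> y \<in> carrier Y \<Longrightarrow> h (pure x y) = pure (f x) (g y)"
proof -
  have cl: "(case s of (x, y) \<Rightarrow> (f x, g y)) \<in> carrier X \<times> carrier Y" if "s \<in> carrier X \<times> carrier Y" for s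
    using that f(1) g(1) by auto
  have rel: "frag_extend (frag_of \<circ> (\<lambda>(x, y). (f x, g y))) r \<in> H" if "r \<in> tensor_rels R X xr Y yl" for r
  proof (rule Rel_in_H)
    show "frag_extend (frag_of \<circ> (\<lambda>(x, y). (f x, g y))) r \<in> tensor_rels R X xr Y yl"
      using that unfolding tensor_rels_def Un_iff mem_Collect_eq
    proof (elim disjE exE conjE, goal_cases)
      case (1 x x' y)
      then show ?case using f g by (intro disjI1 exI[of _ "f x"] exI[of _ "f x'"] exI[of _ "g y"]) (simp add: frag_extend_diff)
    next
      case (2 x y y')
      then show ?case using f g
        by (intro disjI2 disjI1 exI[of _ "f x"] exI[of _ "g y"] exI[of _ "g y'"]) (simp add: frag_extend_diff)
    next
      case (3 x r' y)
      then show ?case using f g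
        by (intro disjI2 exI[of _ "f x"] exI[of _ "g y"] exI[of _ r']) (simp add: frag_extend_diff)
    qed
  qed
  show "h \<in> hom Q Q" unfolding h_def by (rule presented_map_hom[OF presentation_axioms cl rel])
  show "h (pure x y) = pure (f x) (g y)" if "x \<in> carrier X" "y \<in> carrier Y"
    using presented_map_of[OF presentation_axioms cl rel, of "(x, y)"] that by (simp add: h_def)
qed

locale tensor_bimodule_data = tensor_data R X "ract X" Y "lact Y"
  for R :: "('r, 'u) ring_scheme" and X :: "('b, 'r, 'x) bimodule" and Y :: "('r, 'a, 'y) bimodule"
begin

abbreviation "XY \<equiv> tensor_bimodule R X Y"

lemma XY_simps: "carrier XY = carrier Q" "\<zero>\<^bsub>XY\<^esub> = \<one>\<^bsub>Q\<^esub>" "u \<oplus>\<^bsub>XY\<^esub> v = u \<otimes>\<^bsub>Q\<^esub> v"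
  by (simp_all add: tensor_bimodule_def tensor_group_def Let_def)

lemma XY_lact:
  assumes "\<And>x. x \<in> carrier X \<Longrightarrow> lact X b x \<in> carrier X"
      "\<And>x x'. x \<in> carrier X \<Longrightarrow> x' \<in> carrier X \<Longrightarrow> lact X b (x \<oplus>\<^bsub>X\<^esub> x') = lact X b x \<oplus>\<^bsub>X\<^esub> lact X b x'"
      "\<And>x r. x \<in> carrier X \<Longrightarrow> r \<in> carrier R \<Longrightarrow> lact X b (ract X x r) = ract X (lact X b x) r"
  shows "lact XY b \<in> hom Q Q" "x \<in> carrier X \<Longrightarrow> y \<in> carrier Y \<Longrightarrow> lact XY b (pure x y) = pure (lact X b x) y"
  using tensor_endomap_rels[OF assms, of "\<lambda>y. y"]
  by (simp_all add: tensor_bimodule_def tensor_group_def Let_def)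

lemma XY_ract:
  assumes "\<And>x. x \<in> carrier Y \<Longrightarrow> ract Y x a \<in> carrier Y"
      "\<And>x x'. x \<in> carrier Y \<Longrightarrow> x' \<in> carrier Y \<Longrightarrow> ract Y (x \<oplus>\<^bsub>Y\<^esub> x') a = ract Y x a \<oplus>\<^bsub>Y\<^esub> ract Y x' a"
      "\<And>x r. x \<in> carrier Y \<Longrightarrow> r \<in> carrier R \<Longrightarrow> ract Y (lact Y r x) a = lact Y r (ract Y x a)"
  shows "(\<lambda>u. ract XY u a) \<in> hom Q Q" "x \<in> carrier X \<Longrightarrow> y \<in> carrier Y \<Longrightarrow> ract XY (pure x y) a = pure x (ract Y y a)"
  using tensor_endomap_rels[OF _ _ _ assms, of "\<lambda>x. x"]
  by (simp_all add: tensor_bimodule_def tensor_group_def Let_def)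

end

text \<open>An intrinsic description of \<open>\<Oplus>\<^sub>x B l\<^sub>x \<otimes> r\<^sub>x A\<close>: it is generated by the
  elements \<open>gen x = l\<^sub>x \<otimes> r\<^sub>x\<close>, and \<open>T x \<beta>\<close> is the map induced by the bilinear form \<open>\<beta>\<close> on the summand
  of index \<open>x\<close>.\<close>

locale coordinates = bimod K B A X
  for K :: "('k, 'u) ring_scheme" and B :: "('k, 'b, 'v) module_scheme" and A :: "('k, 'a, 'w) module_scheme"
    and X :: "('b, 'a, 'm, 'y) bimodule_scheme" +
  fixes I :: "'i set" and l :: "'i \<Rightarrow> 'b" and r :: "'i \<Rightarrow> 'a" and gen :: "'i \<Rightarrow> 'm"
    and T :: "'i \<Rightarrow> ('b \<Rightarrow> 'a \<Rightarrow> 'k) \<Rightarrow> 'm \<Rightarrow> 'k"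
  assumes I_finite: "finite I"
    and gen_closed: "x \<in> I \<Longrightarrow> gen x \<in> carrier X"
    and l_closed: "x \<in> I \<Longrightarrow> l x \<in> carrier B" and r_closed: "x \<in> I \<Longrightarrow> r x \<in> carrier A"
    and gen_l: "x \<in> I \<Longrightarrow> lact X (l x) (gen x) = gen x" and gen_r: "x \<in> I \<Longrightarrow> ract X (gen x) (r x) = gen x"
    and span: "subgroup H (add_monoid X) \<Longrightarrow>
        (\<And>x b a. x \<in> I \<Longrightarrow> b \<in> carrier B \<Longrightarrow> a \<in> carrier A \<Longrightarrow> ract X (lact X b (gen x)) a \<in> H) \<Longrightarrow> carrier X \<subseteq> H"
    and T_closed: "x \<in> I \<Longrightarrow> bilinear_form K B A \<beta> \<Longrightarrow> m \<in> carrier X \<Longrightarrow> T x \<beta> m \<in> carrier K"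
    and T_add: "x \<in> I \<Longrightarrow> bilinear_form K B A \<beta> \<Longrightarrow> m \<in> carrier X \<Longrightarrow> m' \<in> carrier X \<Longrightarrow>
        T x \<beta> (m \<oplus>\<^bsub>X\<^esub> m') = T x \<beta> m \<oplus>\<^bsub>K\<^esub> T x \<beta> m'"
    and T_lact: "x \<in> I \<Longrightarrow> bilinear_form K B A \<beta> \<Longrightarrow> m \<in> carrier X \<Longrightarrow> b \<in> carrier B \<Longrightarrow>
        T x \<beta> (lact X b m) = T x (\<lambda>u v. \<beta> (b \<otimes>\<^bsub>B\<^esub> u) v) m"
    and T_ract: "x \<in> I \<Longrightarrow> bilinear_form K B A \<beta> \<Longrightarrow> m \<in> carrier X \<Longrightarrow> a \<in> carrier A \<Longrightarrow>
        T x \<beta> (ract X m a) = T x (\<lambda>u v. \<beta> u (v \<otimes>\<^bsub>A\<^esub> a)) m"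
    and T_add_form: "x \<in> I \<Longrightarrow> bilinear_form K B A \<beta> \<Longrightarrow> bilinear_form K B A \<gamma> \<Longrightarrow> m \<in> carrier X \<Longrightarrow>
        T x (\<lambda>u v. \<beta> u v \<oplus>\<^bsub>K\<^esub> \<gamma> u v) m = T x \<beta> m \<oplus>\<^bsub>K\<^esub> T x \<gamma> m"
    and T_scale_form: "x \<in> I \<Longrightarrow> bilinear_form K B A \<beta> \<Longrightarrow> c \<in> carrier K \<Longrightarrow> m \<in> carrier X \<Longrightarrow>
        T x (\<lambda>u v. c \<otimes>\<^bsub>K\<^esub> \<beta> u v) m = c \<otimes>\<^bsub>K\<^esub> T x \<beta> m"
    and T_cong: "x \<in> I \<Longrightarrow> bilinear_form K B A \<beta> \<Longrightarrow> (\<And>u v. u \<in> carrier B \<Longrightarrow> v \<in> carrier A \<Longrightarrow> \<beta> u v = \<gamma> u v) \<Longrightarrow>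
        m \<in> carrier X \<Longrightarrow> T x \<beta> m = T x \<gamma> m"
    and T_gen: "x \<in> I \<Longrightarrow> y \<in> I \<Longrightarrow> bilinear_form K B A \<beta> \<Longrightarrow> T x \<beta> (gen y) = (if x = y then \<beta> (l x) (r x) else \<zero>\<^bsub>K\<^esub>)"

section \<open>Coordinates for direct sums of bimodules \<open>B g \<otimes> e A\<close>\<close>

context two_algebras begin

lemma bilinear_form_closure:
  "bilinear_form K B A \<beta> \<Longrightarrow> bilinear_form K B A \<gamma> \<Longrightarrow> bilinear_form K B A (\<lambda>u v. \<beta> u v \<oplus>\<^bsub>K\<^esub> \<gamma> u v)"
  "bilinear_form K B A \<beta> \<Longrightarrow> c \<in> carrier K \<Longrightarrow> bilinear_form K B A (\<lambda>u v. c \<otimes>\<^bsub>K\<^esub> \<beta> u v)"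
  "bilinear_form K B A \<beta> \<Longrightarrow> b \<in> carrier B \<Longrightarrow> bilinear_form K B A (\<lambda>u v. \<beta> (b \<otimes>\<^bsub>B\<^esub> u) v)"
  "bilinear_form K B A \<beta> \<Longrightarrow> a \<in> carrier A \<Longrightarrow> bilinear_form K B A (\<lambda>u v. \<beta> u (v \<otimes>\<^bsub>A\<^esub> a))"
  using linear_form_closure(1,2)[OF alg_A] linear_form_closure(1,2)[OF alg_B]
    linear_form_closure(3)[OF alg_B, of "\<lambda>v. \<beta> v u" b for u] linear_form_closure(4)[OF alg_A]
  by (simp_all add: bilinear_form_def)

lemma bilinear_form_cong:
  "(\<And>u v. u \<in> carrier B \<Longrightarrow> v \<in> carrier A \<Longrightarrow> \<beta> u v = \<gamma> u v) \<Longrightarrow> bilinear_form K B A \<beta> \<longleftrightarrow> bilinear_form K B A \<gamma>"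
  by (auto simp: bilinear_form_def linear_form_def)

lemma ideal_tensor_data:
  assumes g: "g \<in> carrier B" and e: "e \<in> carrier A"
  shows "tensor_bimodule_data K (left_ideal_bimodule B g) (right_ideal_bimodule A e)"
proof -
  have s: "k \<odot>\<^bsub>B\<^esub> (b \<otimes>\<^bsub>B\<^esub> g) = (k \<odot>\<^bsub>B\<^esub> b) \<otimes>\<^bsub>B\<^esub> g" "k \<odot>\<^bsub>A\<^esub> (e \<otimes>\<^bsub>A\<^esub> a) = e \<otimes>\<^bsub>A\<^esub> (k \<odot>\<^bsub>A\<^esub> a)"
    if "k \<in> carrier K" "b \<in> carrier B" "a \<in> carrier A" for k b a
    using that g e k_algebraD(4)[OF alg_B] k_algebraD(5)[OF alg_A] by simp_all
  have "abelian_group (left_ideal_bimodule B g)"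
  proof (rule abelian_groupI; simp add: left_ideal_bimodule_def; (elim exE conjE)?; hypsubst?)
    fix x y assume "x \<in> carrier B" "y \<in> carrier B"
    then show "\<exists>b. x \<otimes>\<^bsub>B\<^esub> g \<oplus>\<^bsub>B\<^esub> y \<otimes>\<^bsub>B\<^esub> g = b \<otimes>\<^bsub>B\<^esub> g \<and> b \<in> carrier B"
      using g by (intro exI[of _ "x \<oplus>\<^bsub>B\<^esub> y"]) (simp add: B.l_distr)
  next
    show "\<exists>b. \<zero>\<^bsub>B\<^esub> = b \<otimes>\<^bsub>B\<^esub> g \<and> b \<in> carrier B" using g by (intro exI[of _ "\<zero>\<^bsub>B\<^esub>"]) simp
  next
    fix b assume "b \<in> carrier B"
    then show "\<exists>y. (\<exists>b. y = b \<otimes>\<^bsub>B\<^esub> g \<and> b \<in> carrier B) \<and> y \<oplus>\<^bsub>B\<^esub> b \<otimes>\<^bsub>B\<^esub> g = \<zero>\<^bsub>B\<^esub>"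
      using g by (intro exI[of _ "(\<ominus>\<^bsub>B\<^esub> b) \<otimes>\<^bsub>B\<^esub> g"]) (auto simp: B.l_distr[symmetric] B.l_neg)
  qed (use g in \<open>simp_all add: B.a_ac\<close>)
  moreover have "abelian_group (right_ideal_bimodule A e)"
  proof (rule abelian_groupI; simp add: right_ideal_bimodule_def; (elim exE conjE)?; hypsubst?)
    fix x y assume "x \<in> carrier A" "y \<in> carrier A"
    then show "\<exists>a. e \<otimes>\<^bsub>A\<^esub> x \<oplus>\<^bsub>A\<^esub> e \<otimes>\<^bsub>A\<^esub> y = e \<otimes>\<^bsub>A\<^esub> a \<and> a \<in> carrier A"
      using e by (intro exI[of _ "x \<oplus>\<^bsub>A\<^esub> y"]) (simp add: A.r_distr)
  next
    show "\<exists>a. \<zero>\<^bsub>A\<^esub> = e \<otimes>\<^bsub>A\<^esub> a \<and> a \<in> carrier A" using e by (intro exI[of _ "\<zero>\<^bsub>A\<^esub>"]) simp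
  next
    fix a assume "a \<in> carrier A"
    then show "\<exists>y. (\<exists>a. y = e \<otimes>\<^bsub>A\<^esub> a \<and> a \<in> carrier A) \<and> y \<oplus>\<^bsub>A\<^esub> e \<otimes>\<^bsub>A\<^esub> a = \<zero>\<^bsub>A\<^esub>"
      using e by (intro exI[of _ "e \<otimes>\<^bsub>A\<^esub> (\<ominus>\<^bsub>A\<^esub> a)"]) (auto simp: A.r_distr[symmetric] A.l_neg)
  qed (use e in \<open>simp_all add: A.a_ac\<close>)
  moreover have "ract (left_ideal_bimodule B g) u k \<in> carrier (left_ideal_bimodule B g)"
    if u: "u \<in> carrier (left_ideal_bimodule B g)" "k \<in> carrier K" for u k
  proof -
    obtain b where "b \<in> carrier B" "u = b \<otimes>\<^bsub>B\<^esub> g" using u by (auto simp: left_ideal_bimodule_def)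
    then show ?thesis using s(1)[of k b e] u e by (auto simp: left_ideal_bimodule_def)
  qed
  moreover have "lact (right_ideal_bimodule A e) k u \<in> carrier (right_ideal_bimodule A e)"
    if u: "u \<in> carrier (right_ideal_bimodule A e)" "k \<in> carrier K" for u k
  proof -
    obtain a where "a \<in> carrier A" "u = e \<otimes>\<^bsub>A\<^esub> a" using u by (auto simp: right_ideal_bimodule_def)
    then show ?thesis using s(2)[of k g a] u g by (auto simp: right_ideal_bimodule_def)
  qed
  ultimately show ?thesis
    unfolding tensor_bimodule_data_def tensor_data_def tensor_data_axioms_def by blast
qed

text \<open>Everything is pulled back along the isomorphism \<open>\<phi>\<close> to the components
  of the direct sum. \<open>gen x\<close> is the preimage of \<open>l x \<otimes> r x\<close> placed
  in the summand \<open>x\<close>; idempotency of \<open>l x\<close> and \<open>r x\<close> is what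
  makes them fix it. \<open>T x \<beta>\<close> evaluates the component at \<open>x\<close> by the
  universal property of the tensor product.\<close>

lemma standard_coordinates:
  assumes X: "is_bimodule K B A X" and F: "finite F" "\<And>g. g \<in> F \<Longrightarrow> idempotent B g"
    and E: "finite E" "\<And>e. e \<in> E \<Longrightarrow> idempotent A e"
    and iso: "bimodule_isomorphic B A X (standard_projective_bimodule K B A F E m)"
  shows "\<exists>gen T. coordinates K B A X {(g, e, i). g \<in> F \<and> e \<in> E \<and> i < m g e} fst (fst \<circ> snd) gen T"
proof -
  interpret X: bimod K B A X using X by (intro bimod.intro two_algebras_axioms bimod_axioms.intro)
  define I where "I = {(g, e, i). g \<in> F \<and> e \<in> E \<and> i < m g e}"
  define S where "S = standard_projective_bimodule K B A F E m"
  define l :: "'b \<times> 'a \<times> nat \<Rightarrow> 'b" where "l = fst"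
  define r :: "'b \<times> 'a \<times> nat \<Rightarrow> 'a" where "r = fst \<circ> snd"
  let ?L = "\<lambda>x. left_ideal_bimodule B (l x)" and ?R = "\<lambda>x. right_ideal_bimodule A (r x)"
  have lr: "l x \<in> carrier B" "r x \<in> carrier A" "l x \<otimes>\<^bsub>B\<^esub> l x = l x" "r x \<otimes>\<^bsub>A\<^esub> r x = r x" if "x \<in> I" for x
    using that F E by (auto simp: I_def l_def r_def idempotent_def)
  have finI: "finite I"
  proof -
    have "I \<subseteq> (SIGMA g:F. SIGMA e:E. {..<m g e})" by (auto simp: I_def)
    then show ?thesis by (rule finite_subset) (use F E in auto)
  qed
  have td: "tensor_bimodule_data K (?L x) (?R x)" if "x \<in> I" for x
    using ideal_tensor_data lr[OF that] by blast
  define Q where "Q x = tensor_group K (?L x) (ract (?L x)) (?R x) (lact (?R x))" for x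
  define pr where "pr x b a = presented_class (carrier (?L x) \<times> carrier (?R x))
      (tensor_rels K (?L x) (ract (?L x)) (?R x) (lact (?R x))) (frag_of (b, a))" for x b a
  have S: "carrier S = (\<Pi>\<^sub>E x\<in>I. carrier (Q x))" "u \<oplus>\<^bsub>S\<^esub> v = (\<lambda>x\<in>I. u x \<otimes>\<^bsub>Q x\<^esub> v x)"
    "lact S b u = (\<lambda>x\<in>I. lact (tensor_bimodule K (?L x) (?R x)) b (u x))"
    "ract S u a = (\<lambda>x\<in>I. ract (tensor_bimodule K (?L x) (?R x)) (u x) a)" for u v b a
    unfolding S_def standard_projective_bimodule_def I_def[symmetric] bimodule_sum_def Q_def l_def r_def
    by (auto simp: tensor_bimodule_def Let_def split_beta intro!: PiE_cong restrict_ext)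
  have Lc: "u \<in> carrier (?L x) \<longleftrightarrow> (\<exists>b\<in>carrier B. u = b \<otimes>\<^bsub>B\<^esub> l x)"
    "u' \<in> carrier (?R x) \<longleftrightarrow> (\<exists>a\<in>carrier A. u' = r x \<otimes>\<^bsub>A\<^esub> a)"
    "lact (?L x) b u = b \<otimes>\<^bsub>B\<^esub> u" "ract (?R x) u' a = u' \<otimes>\<^bsub>A\<^esub> a"
    "u \<oplus>\<^bsub>?L x\<^esub> v = u \<oplus>\<^bsub>B\<^esub> v" "u' \<oplus>\<^bsub>?R x\<^esub> v' = u' \<oplus>\<^bsub>A\<^esub> v'"
    "ract (?L x) u c = c \<odot>\<^bsub>B\<^esub> u" "lact (?R x) c u' = c \<odot>\<^bsub>A\<^esub> u'" for x u u' b a v v' c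
    by (auto simp: left_ideal_bimodule_def right_ideal_bimodule_def)
  have Lsub: "u \<in> carrier B" if "u \<in> carrier (?L x)" "x \<in> I" for u x using that(1) lr[OF that(2)] by (auto simp: Lc)
  have Rsub: "u \<in> carrier A" if "u \<in> carrier (?R x)" "x \<in> I" for u x using that(1) lr[OF that(2)] by (auto simp: Lc)
  have Qx: "Q x = presented_group (carrier (?L x) \<times> carrier (?R x)) (tensor_rels K (?L x) (ract (?L x)) (?R x) (lact (?R x)))" for x
    by (simp add: Q_def tensor_group_def)
  have Qg: "comm_group (Q x)" if "x \<in> I" for x
  proof -
    interpret tensor_bimodule_data K "?L x" "?R x" by (rule td[OF that])
    show ?thesis unfolding Qx by (rule comm_group_Q)
  qed
  have Qgr: "group (Q x)" if "x \<in> I" for x using Qg[OF that] comm_group.axioms(2) by blast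
  have prc: "pr x u v \<in> carrier (Q x)" if "x \<in> I" "u \<in> carrier (?L x)" "v \<in> carrier (?R x)" for x u v
  proof -
    interpret tensor_bimodule_data K "?L x" "?R x" by (rule td[OF that(1)])
    show ?thesis unfolding Qx pr_def using that(2,3) by (rule pure_closed)
  qed
  have Qind: "U \<in> Z"
    if "x \<in> I" "U \<in> carrier (Q x)" "subgroup Z (Q x)" "\<And>b a. b \<in> carrier B \<Longrightarrow> a \<in> carrier A \<Longrightarrow> pr x (b \<otimes>\<^bsub>B\<^esub> l x) (r x \<otimes>\<^bsub>A\<^esub> a) \<in> Z"
    for x U Z
  proof -
    interpret tensor_bimodule_data K "?L x" "?R x" by (rule td[OF that(1)])
    have "pure u v \<in> Z" if "u \<in> carrier (?L x)" "v \<in> carrier (?R x)" for u v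
      using that \<open>\<And>b a. b \<in> carrier B \<Longrightarrow> a \<in> carrier A \<Longrightarrow> pr x (b \<otimes>\<^bsub>B\<^esub> l x) (r x \<otimes>\<^bsub>A\<^esub> a) \<in> Z\<close>
      by (auto simp: Lc pr_def)
    then have "carrier (Q x) \<subseteq> Z" using that(3) unfolding Qx by (intro Q_generated) auto
    with that(2) show ?thesis by blast
  qed
  have la: "lact (tensor_bimodule K (?L x) (?R x)) b \<in> hom (Q x) (Q x)"
      "lact (tensor_bimodule K (?L x) (?R x)) b (pr x u v) = pr x (b \<otimes>\<^bsub>B\<^esub> u) v"
    if x: "x \<in> I" and b: "b \<in> carrier B" and u: "u \<in> carrier (?L x)" "v \<in> carrier (?R x)" for x b u v
  proof -
    interpret tensor_bimodule_data K "?L x" "?R x" by (rule td[OF x])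
    have c: "lact (?L x) b y \<in> carrier (?L x)" if "y \<in> carrier (?L x)" for y
      using that b lr[OF x] by (auto simp: Lc B.m_assoc[symmetric] intro!: bexI)
    note * = XY_lact[of b, OF c]
    show "lact (tensor_bimodule K (?L x) (?R x)) b \<in> hom (Q x) (Q x)"
      unfolding Qx by (rule *(1)) (use b x Lsub in \<open>auto simp: Lc(5,3,7) B.r_distr k_algebraD(5)[OF alg_B]\<close>)
    show "lact (tensor_bimodule K (?L x) (?R x)) b (pr x u v) = pr x (b \<otimes>\<^bsub>B\<^esub> u) v"
      unfolding pr_def Lc(3)[of x b u, symmetric]
      by (rule *(2)) (use b x Lsub u in \<open>auto simp: Lc(5,3,7) B.r_distr k_algebraD(5)[OF alg_B]\<close>)
  qed
  have ra: "(\<lambda>U. ract (tensor_bimodule K (?L x) (?R x)) U a) \<in> hom (Q x) (Q x)"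
      "ract (tensor_bimodule K (?L x) (?R x)) (pr x u v) a = pr x u (v \<otimes>\<^bsub>A\<^esub> a)"
    if x: "x \<in> I" and a: "a \<in> carrier A" and u: "u \<in> carrier (?L x)" "v \<in> carrier (?R x)" for x a u v
  proof -
    interpret tensor_bimodule_data K "?L x" "?R x" by (rule td[OF x])
    have c: "ract (?R x) y a \<in> carrier (?R x)" if "y \<in> carrier (?R x)" for y
      using that a lr[OF x] by (auto simp: Lc A.m_assoc intro!: bexI)
    note * = XY_ract[of a, OF c]
    show "(\<lambda>U. ract (tensor_bimodule K (?L x) (?R x)) U a) \<in> hom (Q x) (Q x)"
      unfolding Qx by (rule *(1)) (use a x Rsub in \<open>auto simp: Lc(6,4,8) A.l_distr k_algebraD(4)[OF alg_A]\<close>)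
    show "ract (tensor_bimodule K (?L x) (?R x)) (pr x u v) a = pr x u (v \<otimes>\<^bsub>A\<^esub> a)"
      unfolding pr_def Lc(4)[of x v a, symmetric]
      by (rule *(2)) (use a x Rsub u in \<open>auto simp: Lc(6,4,8) A.l_distr k_algebraD(4)[OF alg_A]\<close>)
  qed
  obtain \<phi> where bij: "bij_betw \<phi> (carrier X) (carrier S)"
    and \<phi>: "\<And>x y. x \<in> carrier X \<Longrightarrow> y \<in> carrier X \<Longrightarrow> \<phi> (x \<oplus>\<^bsub>X\<^esub> y) = \<phi> x \<oplus>\<^bsub>S\<^esub> \<phi> y"
      "\<And>b x. b \<in> carrier B \<Longrightarrow> x \<in> carrier X \<Longrightarrow> \<phi> (lact X b x) = lact S b (\<phi> x)"
      "\<And>a x. a \<in> carrier A \<Longrightarrow> x \<in> carrier X \<Longrightarrow> \<phi> (ract X x a) = ract S (\<phi> x) a"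
    using iso unfolding bimodule_isomorphic_def S_def by blast
  have \<phi>S: "\<phi> y \<in> carrier S" if "y \<in> carrier X" for y using bij that by (auto simp: bij_betw_def)
  have \<phi>c: "\<phi> y x \<in> carrier (Q x)" if "y \<in> carrier X" "x \<in> I" for x y using \<phi>S[OF that(1)] that(2) S(1) by auto
  have \<phi>_hom: "(\<lambda>y. \<phi> y x) \<in> hom (add_monoid X) (Q x)" if "x \<in> I" for x
    using that \<phi>c \<phi>(1) by (auto simp: hom_def S)
  have inj: "y = z" if "y \<in> carrier X" "z \<in> carrier X" "\<And>x. x \<in> I \<Longrightarrow> \<phi> y x = \<phi> z x" for y z
  proof -
    have "\<phi> y = \<phi> z" using \<phi>S[OF that(1)] \<phi>S[OF that(2)] that(3) unfolding S(1) by (rule PiE_ext)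
    then show ?thesis using bij that by (auto simp: bij_betw_def inj_on_def)
  qed
  define \<psi> where "\<psi> = inv_into (carrier X) \<phi>"
  have \<psi>: "\<psi> u \<in> carrier X" "\<phi> (\<psi> u) = u" if "u \<in> carrier S" for u
    using that bij unfolding \<psi>_def by (auto simp: bij_betw_def inv_into_into f_inv_into_f)
  define sgl where "sgl x U = (\<lambda>y\<in>I. if y = x then U else \<one>\<^bsub>Q y\<^esub>)" for x U
  have Q1: "\<one>\<^bsub>Q y\<^esub> \<in> carrier (Q y)" if "y \<in> I" for y using Qgr[OF that] by (simp add: group.is_monoid monoid.one_closed)
  have sglS: "sgl x U \<in> carrier S" if "x \<in> I" "U \<in> carrier (Q x)" for x U
    using that Q1 by (auto simp: S sgl_def)
  define gen where "gen x = \<psi> (sgl x (pr x (l x) (r x)))" for x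
  define T where "T x \<beta> y = tensor_eval K (\<lambda>(u, v). \<beta> u v) (\<phi> y x)" for x \<beta> y
  have lL: "l x \<in> carrier (?L x)" "r x \<in> carrier (?R x)" if "x \<in> I" for x
    using lr[OF that] by (force simp: Lc)+
  have genc: "gen x \<in> carrier X" if "x \<in> I" for x
    unfolding gen_def using that by (intro \<psi> sglS prc lL)
  have \<phi>gen: "\<phi> (gen x) y = (if y = x then pr x (l x) (r x) else \<one>\<^bsub>Q y\<^esub>)" if "x \<in> I" "y \<in> I" for x y
    unfolding gen_def using \<psi>(2)[OF sglS[OF that(1) prc[OF that(1) lL[OF that(1)]]]] that(2) by (simp add: sgl_def)
  have one_la: "lact (tensor_bimodule K (?L y) (?R y)) b \<one>\<^bsub>Q y\<^esub> = \<one>\<^bsub>Q y\<^esub>" if "y \<in> I" "b \<in> carrier B" for y b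
    using hom_one[OF la(1)[OF that lL[OF that(1)]] Qgr[OF that(1)] Qgr[OF that(1)]] .
  have one_ra: "ract (tensor_bimodule K (?L y) (?R y)) \<one>\<^bsub>Q y\<^esub> a = \<one>\<^bsub>Q y\<^esub>" if "y \<in> I" "a \<in> carrier A" for y a
    using hom_one[OF ra(1)[OF that lL[OF that(1)]] Qgr[OF that(1)] Qgr[OF that(1)]] .
  \<comment> \<open>The actions of \<open>B\<close> and \<open>A\<close> are homomorphisms on every
    component, so they keep an element supported in a single summand and multiply its tensor from
    outside.\<close>
  have \<phi>bga: "\<phi> (ract X (lact X b (gen x)) a) y = (if y = x then pr x (b \<otimes>\<^bsub>B\<^esub> l x) (r x \<otimes>\<^bsub>A\<^esub> a) else \<one>\<^bsub>Q y\<^esub>)"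
    if "x \<in> I" "y \<in> I" "b \<in> carrier B" "a \<in> carrier A" for x y b a
  proof -
    have bl: "b \<otimes>\<^bsub>B\<^esub> l x \<in> carrier (?L x)" using that by (auto simp: Lc)
    show ?thesis
      using that \<phi>gen[OF that(1,2)] genc[OF that(1)] la(2)[OF that(1,3) lL[OF that(1)]] ra(2)[OF that(1,4) bl lL(2)[OF that(1)]]
      by (simp add: \<phi> S one_la one_ra)
  qed
  have te: "tensor_eval K (\<lambda>(u, v). \<beta> u v) \<in> hom (Q x) (add_monoid K)"
      "u \<in> carrier (?L x) \<Longrightarrow> v \<in> carrier (?R x) \<Longrightarrow> tensor_eval K (\<lambda>(u, v). \<beta> u v) (pr x u v) = \<beta> u v"
    if x: "x \<in> I" and \<beta>: "bilinear_form K B A \<beta>" for x \<beta> u v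
  proof -
    interpret td: tensor_bimodule_data K "?L x" "?R x" by (rule td[OF x])
    note D = linear_formD[OF bilinear_formD(1)[OF \<beta>]] linear_formD[OF bilinear_formD(2)[OF \<beta>]]
    interpret balanced_map "carrier (?L x) \<times> carrier (?R x)" "tensor_rels K (?L x) (ract (?L x)) (?R x) (lact (?R x))"
        K "\<lambda>(u, v). \<beta> u v"
      by (rule td.tensor_balanced_map[OF K.is_abelian_group])
        (use x in \<open>auto simp: Lc(5-8) bilinear_formD(3)[OF \<beta>] D dest!: Lsub Rsub\<close>)
    show "tensor_eval K (\<lambda>(u, v). \<beta> u v) \<in> hom (Q x) (add_monoid K)" unfolding Qx by (rule tensor_eval_hom)
    show "tensor_eval K (\<lambda>(u, v). \<beta> u v) (pr x u v) = \<beta> u v" if "u \<in> carrier (?L x)" "v \<in> carrier (?R x)"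
      using tensor_eval_of[of "(u, v)"] that by (simp add: pr_def)
  qed
  \<comment> \<open>The laws that compare two expressions in \<open>T\<close> become equalities of
    homomorphisms from \<open>Q x\<close> to \<open>K\<close>, to be tested on pure tensors.\<close>
  have Qeq: "h U = h' U" if x: "x \<in> I" and h: "h \<in> hom (Q x) (add_monoid K)" "h' \<in> hom (Q x) (add_monoid K)"
    and e: "\<And>u v. u \<in> carrier (?L x) \<Longrightarrow> v \<in> carrier (?R x) \<Longrightarrow> h (pr x u v) = h' (pr x u v)" and U: "U \<in> carrier (Q x)"
    for x h h' U
  proof -
    interpret td: tensor_bimodule_data K "?L x" "?R x" by (rule td[OF x])
    show ?thesis
      by (rule td.Q_hom_eq[OF h(1)[unfolded Qx] h(2)[unfolded Qx] K.add.is_group _ U[unfolded Qx]])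
        (use e in \<open>auto simp: pr_def\<close>)
  qed
  have "coordinates K B A X I l r gen T"
  proof (intro coordinates.intro coordinates_axioms.intro X.bimod_axioms finI genc lr(1,2))
    fix x assume x: "x \<in> I"
    have L: "lact X (l x) (gen x) \<in> carrier X" "ract X (gen x) (r x) \<in> carrier X" using genc lr x by auto
    have "\<phi> (lact X (l x) (gen x)) y = \<phi> (gen x) y" if "y \<in> I" for y
      using \<phi>bga[OF x that lr(1)[OF x] A.one_closed] \<phi>gen[OF x that] L lr[OF x] by simp
    then show "lact X (l x) (gen x) = gen x" by (intro inj L genc x)
    have "\<phi> (ract X (gen x) (r x)) y = \<phi> (gen x) y" if "y \<in> I" for y
      using \<phi>bga[OF x that B.one_closed lr(2)[OF x]] \<phi>gen[OF x that] L lr[OF x] genc[OF x] by simp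
    then show "ract X (gen x) (r x) = gen x" by (intro inj L genc x)
  next
    fix H assume H: "subgroup H (add_monoid X)"
      and g: "\<And>x b a. x \<in> I \<Longrightarrow> b \<in> carrier B \<Longrightarrow> a \<in> carrier A \<Longrightarrow> ract X (lact X b (gen x)) a \<in> H"
    interpret H: subgroup H "add_monoid X" by (rule H)
    have Hz: "\<zero>\<^bsub>X\<^esub> \<in> H" and Ha: "\<And>u v. u \<in> H \<Longrightarrow> v \<in> H \<Longrightarrow> u \<oplus>\<^bsub>X\<^esub> v \<in> H"
      and Hm: "\<And>u. u \<in> H \<Longrightarrow> \<ominus>\<^bsub>X\<^esub> u \<in> H" and Hs: "\<And>u. u \<in> H \<Longrightarrow> u \<in> carrier X"
      using H.one_closed H.m_closed H.m_inv_closed H.subset by (auto simp: a_inv_def)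
    have \<phi>z: "\<phi> \<zero>\<^bsub>X\<^esub> x = \<one>\<^bsub>Q x\<^esub>" if "x \<in> I" for x
      using hom_one[OF \<phi>_hom[OF that] X.X.add.is_group Qgr[OF that]] by simp
    have \<phi>m: "\<phi> (\<ominus>\<^bsub>X\<^esub> u) x = inv\<^bsub>Q x\<^esub> (\<phi> u x)" if "x \<in> I" "u \<in> carrier X" for x u
      using group_hom.hom_inv[of "add_monoid X" "Q x" "\<lambda>y. \<phi> y x" u] \<phi>_hom[OF that(1)] X.X.add.is_group Qgr[OF that(1)] that(2)
      by (simp add: group_hom_def group_hom_axioms_def a_inv_def)
    have \<phi>a: "\<phi> (u \<oplus>\<^bsub>X\<^esub> v) x = \<phi> u x \<otimes>\<^bsub>Q x\<^esub> \<phi> v x" if "x \<in> I" "u \<in> carrier X" "v \<in> carrier X" for x u v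
      using that by (simp add: \<phi> S)
    \<comment> \<open>The values that occur at \<open>x\<close> in elements of \<open>H\<close> with
      all other components trivial form a subgroup of \<open>Q x\<close>; it contains the generating
      tensors by the hypothesis on \<open>H\<close>.\<close>
    have sgl: "\<exists>u\<in>H. \<forall>y\<in>I. \<phi> u y = (if y = x then U else \<one>\<^bsub>Q y\<^esub>)" if x: "x \<in> I" and U: "U \<in> carrier (Q x)" for x U
    proof -
      interpret Qx: group "Q x" by (rule Qgr[OF x])
      let ?V = "{U \<in> carrier (Q x). \<exists>u\<in>H. \<forall>y\<in>I. \<phi> u y = (if y = x then U else \<one>\<^bsub>Q y\<^esub>)}"
      have "subgroup ?V (Q x)"
      proof
        show "\<one>\<^bsub>Q x\<^esub> \<in> ?V"
          using x by (auto intro!: bexI[OF _ Hz] Q1 simp: \<phi>z)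
      next
        fix U assume "U \<in> ?V"
        then obtain u where u: "U \<in> carrier (Q x)" "u \<in> H" "\<forall>y\<in>I. \<phi> u y = (if y = x then U else \<one>\<^bsub>Q y\<^esub>)" by blast
        have "\<phi> (\<ominus>\<^bsub>X\<^esub> u) y = (if y = x then inv\<^bsub>Q x\<^esub> U else \<one>\<^bsub>Q y\<^esub>)" if "y \<in> I" for y
          using \<phi>m[OF that Hs[OF u(2)]] u(3) that monoid.inv_one[OF group.is_monoid[OF Qgr[OF that]]] by auto
        with u Hm[OF u(2)] show "inv\<^bsub>Q x\<^esub> U \<in> ?V" by blast
      next
        fix U V assume "U \<in> ?V"
          "V \<in> ?V"
        then obtain u v where u: "U \<in> carrier (Q x)" "u \<in> H" "\<forall>y\<in>I. \<phi> u y = (if y = x then U else \<one>\<^bsub>Q y\<^esub>)"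
          and v: "V \<in> carrier (Q x)" "v \<in> H" "\<forall>y\<in>I. \<phi> v y = (if y = x then V else \<one>\<^bsub>Q y\<^esub>)" by blast
        have "\<phi> (u \<oplus>\<^bsub>X\<^esub> v) y = (if y = x then U \<otimes>\<^bsub>Q x\<^esub> V else \<one>\<^bsub>Q y\<^esub>)" if "y \<in> I" for y
          using \<phi>a[OF that Hs[OF u(2)] Hs[OF v(2)]] u(3) v(3) that Qgr[OF that] by (auto simp: group.is_monoid monoid.l_one[OF _ Q1])
        with u v Ha[OF u(2) v(2)] show "U \<otimes>\<^bsub>Q x\<^esub> V \<in> ?V" by blast
      qed auto
      then have "U \<in> ?V"
      proof (rule Qind[OF x U])
        fix b a assume b: "b \<in> carrier B" and a: "a \<in> carrier A"
        then have "pr x (b \<otimes>\<^bsub>B\<^esub> l x) (r x \<otimes>\<^bsub>A\<^esub> a) \<in> carrier (Q x)" by (intro prc x) (auto simp: Lc)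
        moreover have "\<forall>y\<in>I. \<phi> (ract X (lact X b (gen x)) a) y =
            (if y = x then pr x (b \<otimes>\<^bsub>B\<^esub> l x) (r x \<otimes>\<^bsub>A\<^esub> a) else \<one>\<^bsub>Q y\<^esub>)"
          using \<phi>bga[OF x _ b a] by blast
        ultimately show "pr x (b \<otimes>\<^bsub>B\<^esub> l x) (r x \<otimes>\<^bsub>A\<^esub> a)
            \<in> ?V"
          using g[OF x b a] by blast
      qed
      then show ?thesis by blast
    qed
    show "carrier X \<subseteq> H"
    proof
      fix z assume z: "z \<in> carrier X"
      \<comment> \<open>Elements supported in single summands are added up one index at a time until
        the sum agrees with \<open>z\<close> in every component.\<close>
      have "\<exists>u\<in>H. \<forall>y\<in>I. \<phi> u y = (if y \<in> J then \<phi> z y else \<one>\<^bsub>Q y\<^esub>)" if "finite J" "J \<subseteq> I" for J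
        using that
      proof (induction J rule: finite_induct)
        case empty
        show ?case by (intro bexI[OF _ Hz]) (simp add: \<phi>z)
      next
        case (insert x J)
        then obtain u where u: "u \<in> H" "\<forall>y\<in>I. \<phi> u y = (if y \<in> J then \<phi> z y else \<one>\<^bsub>Q y\<^esub>)" by auto
        obtain v where v: "v \<in> H" "\<forall>y\<in>I. \<phi> v y = (if y = x then \<phi> z x else \<one>\<^bsub>Q y\<^esub>)"
          using sgl[of x "\<phi> z x"] \<phi>c[OF z, of x] insert.prems by blast
        have "\<phi> (u \<oplus>\<^bsub>X\<^esub> v) y = (if y \<in> insert x J then \<phi> z y else \<one>\<^bsub>Q y\<^esub>)" if y: "y \<in> I" for y
        proof -
          interpret Qy: group "Q y" by (rule Qgr[OF y])
          show ?thesis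
            using \<phi>a[OF y Hs[OF u(1)] Hs[OF v(1)]] u(2) v(2) y insert.hyps Qy.l_one[OF \<phi>c[OF z y]]
              Qy.r_one[OF \<phi>c[OF z y]] Qy.l_one[OF Qy.one_closed] by auto
        qed
        with Ha[OF u(1) v(1)] show ?case by blast
      qed
      from this[OF finI subset_refl] obtain u where "u \<in> H" "\<forall>y\<in>I. \<phi> u y = \<phi> z y" by auto
      with inj[OF Hs z, of u] show "z \<in> H" by auto
    qed
  next
    fix x \<beta> y assume x: "x \<in> I" and \<beta>: "bilinear_form K B A \<beta>" and y: "y \<in> carrier X"
    show "T x \<beta> y \<in> carrier K" unfolding T_def using hom_in_carrier[OF te(1)[OF x \<beta>] \<phi>c[OF y x]] by simp
    show "T x \<beta> (y \<oplus>\<^bsub>X\<^esub> y') = T x \<beta> y \<oplus>\<^bsub>K\<^esub> T x \<beta> y'" if y': "y' \<in> carrier X" for y'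
      unfolding T_def using hom_mult[OF te(1)[OF x \<beta>] \<phi>c[OF y x] \<phi>c[OF y' x]] y y' x by (simp add: \<phi> S)
    show "T x \<beta> (lact X b y) = T x (\<lambda>u v. \<beta> (b \<otimes>\<^bsub>B\<^esub> u) v) y" if b: "b \<in> carrier B" for b
    proof -
      have \<beta>': "bilinear_form K B A (\<lambda>u v. \<beta> (b \<otimes>\<^bsub>B\<^esub> u) v)" by (rule bilinear_form_closure(3)[OF \<beta> b])
      have "tensor_eval K (\<lambda>(u, v). \<beta> u v) (lact (tensor_bimodule K (?L x) (?R x)) b U) =
          tensor_eval K (\<lambda>(u, v). \<beta> (b \<otimes>\<^bsub>B\<^esub> u) v) U" if U: "U \<in> carrier (Q x)" for U
      proof (rule Qeq[OF x _ te(1)[OF x \<beta>'] _ U])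
        show "(\<lambda>U. tensor_eval K (\<lambda>(u, v). \<beta> u v) (lact (tensor_bimodule K (?L x) (?R x)) b U)) \<in> hom (Q x) (add_monoid K)"
          using hom_compose[OF la(1)[OF x b lL[OF x]] te(1)[OF x \<beta>]] by (simp add: o_def)
        fix u v assume u: "u \<in> carrier (?L x)" "v \<in> carrier (?R x)"
        then have "b \<otimes>\<^bsub>B\<^esub> u \<in> carrier (?L x)" using b lr[OF x] by (auto simp: Lc B.m_assoc[symmetric] intro!: bexI)
        then show "tensor_eval K (\<lambda>(u, v). \<beta> u v) (lact (tensor_bimodule K (?L x) (?R x)) b (pr x u v)) =
            tensor_eval K (\<lambda>(u, v). \<beta> (b \<otimes>\<^bsub>B\<^esub> u) v) (pr x u v)"
          using te(2)[OF x \<beta>] te(2)[OF x \<beta>' u] la(2)[OF x b u] u by simp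
      qed
      from this[OF \<phi>c[OF y x]] show ?thesis using b x y by (simp add: T_def \<phi> S)
    qed
    show "T x \<beta> (ract X y a) = T x (\<lambda>u v. \<beta> u (v \<otimes>\<^bsub>A\<^esub> a)) y" if a: "a \<in> carrier A" for a
    proof -
      have \<beta>': "bilinear_form K B A (\<lambda>u v. \<beta> u (v \<otimes>\<^bsub>A\<^esub> a))" by (rule bilinear_form_closure(4)[OF \<beta> a])
      have "tensor_eval K (\<lambda>(u, v). \<beta> u v) (ract (tensor_bimodule K (?L x) (?R x)) U a) =
          tensor_eval K (\<lambda>(u, v). \<beta> u (v \<otimes>\<^bsub>A\<^esub> a)) U" if U: "U \<in> carrier (Q x)" for U
      proof (rule Qeq[OF x _ te(1)[OF x \<beta>'] _ U])
        show "(\<lambda>U. tensor_eval K (\<lambda>(u, v). \<beta> u v) (ract (tensor_bimodule K (?L x) (?R x)) U a)) \<in> hom (Q x) (add_monoid K)"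
          using hom_compose[OF ra(1)[OF x a lL[OF x]] te(1)[OF x \<beta>]] by (simp add: o_def)
        fix u v assume u: "u \<in> carrier (?L x)" "v \<in> carrier (?R x)"
        then have "v \<otimes>\<^bsub>A\<^esub> a \<in> carrier (?R x)" using a lr[OF x] by (auto simp: Lc A.m_assoc intro!: bexI)
        then show "tensor_eval K (\<lambda>(u, v). \<beta> u v) (ract (tensor_bimodule K (?L x) (?R x)) (pr x u v) a) =
            tensor_eval K (\<lambda>(u, v). \<beta> u (v \<otimes>\<^bsub>A\<^esub> a)) (pr x u v)"
          using te(2)[OF x \<beta>] te(2)[OF x \<beta>' u] ra(2)[OF x a u] u by simp
      qed
      from this[OF \<phi>c[OF y x]] show ?thesis using a x y by (simp add: T_def \<phi> S)
    qed
    show "T x (\<lambda>u v. \<beta> u v \<oplus>\<^bsub>K\<^esub> \<gamma> u v) y = T x \<beta> y \<oplus>\<^bsub>K\<^esub> T x \<gamma> y" if \<gamma>: "bilinear_form K B A \<gamma>" for \<gamma>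
      unfolding T_def
    proof (rule Qeq[OF x te(1)[OF x bilinear_form_closure(1)[OF \<beta> \<gamma>]] _ _ \<phi>c[OF y x]])
      show "(\<lambda>U. tensor_eval K (\<lambda>(u, v). \<beta> u v) U \<oplus>\<^bsub>K\<^esub> tensor_eval K (\<lambda>(u, v). \<gamma> u v) U) \<in> hom (Q x) (add_monoid K)"
        using te(1)[OF x \<beta>] te(1)[OF x \<gamma>] by (auto simp: hom_def Pi_iff K.a_ac)
    qed (simp add: te(2)[OF x] \<beta> \<gamma> bilinear_form_closure(1))
    show "T x (\<lambda>u v. c \<otimes>\<^bsub>K\<^esub> \<beta> u v) y = c \<otimes>\<^bsub>K\<^esub> T x \<beta> y" if c: "c \<in> carrier K" for c
      unfolding T_def
    proof (rule Qeq[OF x te(1)[OF x bilinear_form_closure(2)[OF \<beta> c]] _ _ \<phi>c[OF y x]])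
      show "(\<lambda>U. c \<otimes>\<^bsub>K\<^esub> tensor_eval K (\<lambda>(u, v). \<beta> u v) U) \<in> hom (Q x) (add_monoid K)"
        using te(1)[OF x \<beta>] c by (auto simp: hom_def Pi_iff K.r_distr)
    qed (simp add: te(2)[OF x] \<beta> c bilinear_form_closure(2))
    show "T x \<beta> y = T x \<gamma> y" if e: "\<And>u v. u \<in> carrier B \<Longrightarrow> v \<in> carrier A \<Longrightarrow> \<beta> u v = \<gamma> u v" for \<gamma>
    proof -
      have \<gamma>: "bilinear_form K B A \<gamma>" using \<beta> bilinear_form_cong[of \<beta> \<gamma>] e by blast
      show ?thesis unfolding T_def
        by (rule Qeq[OF x te(1)[OF x \<beta>] te(1)[OF x \<gamma>] _ \<phi>c[OF y x]])
          (use Lsub Rsub x in \<open>simp add: te(2)[OF x] \<beta> \<gamma> e\<close>)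
    qed
  next
    fix x y \<beta> assume x: "x \<in> I" and y: "y \<in> I" and \<beta>: "bilinear_form K B A \<beta>"
    show "T x \<beta> (gen y) = (if x = y then \<beta> (l x) (r x) else \<zero>\<^bsub>K\<^esub>)"
      using \<phi>gen[OF y x] te(2)[OF x \<beta> lL[OF x]] hom_one[OF te(1)[OF x \<beta>] Qgr[OF x] K.add.is_group] by (auto simp: T_def)
  qed
  then show ?thesis unfolding I_def l_def r_def by blast
qed

end

section \<open>Tensor powers\<close>

locale tensor_power_data = T: abelian_group T
  for A :: "('a, 'v) ring_scheme" and T :: "('a, 'a, 't) bimodule" and n :: nat +
  assumes lact_closed: "a \<in> carrier A \<Longrightarrow> x \<in> carrier T \<Longrightarrow> lact T a x \<in> carrier T"
    and lact_add: "a \<in> carrier A \<Longrightarrow> x \<in> carrier T \<Longrightarrow> y \<in> carrier T \<Longrightarrow> lact T a (x \<oplus>\<^bsub>T\<^esub> y) = lact T a x \<oplus>\<^bsub>T\<^esub> lact T a y"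
    and ract_closed: "a \<in> carrier A \<Longrightarrow> x \<in> carrier T \<Longrightarrow> ract T x a \<in> carrier T"
    and ract_add: "a \<in> carrier A \<Longrightarrow> x \<in> carrier T \<Longrightarrow> y \<in> carrier T \<Longrightarrow> ract T (x \<oplus>\<^bsub>T\<^esub> y) a = ract T x a \<oplus>\<^bsub>T\<^esub> ract T y a"
    and lact_ract: "a \<in> carrier A \<Longrightarrow> b \<in> carrier A \<Longrightarrow> x \<in> carrier T \<Longrightarrow> lact T a (ract T x b) = ract T (lact T a x) b"
begin

abbreviation "gens \<equiv> tensor_power_gens T n"
abbreviation "rels \<equiv> tensor_power_rels A T n"
abbreviation "Z \<equiv> tensor_power A T n"

lemma gens_append: "us @ vs \<in> gens \<longleftrightarrow> length us + length vs = n \<and> set us \<subseteq> carrier T \<and> set vs \<subseteq> carrier T"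
  by (auto simp: tensor_power_gens_def)

sublocale presentation gens rels
proof
  have k: "Poly_Mapping.keys (frag_of a - frag_of b - frag_of c) \<subseteq> S" if "a \<in> S" "b \<in> S" "c \<in> S"
    for a b c :: "'t list" and S
    using that keys_diff[of "frag_of a - frag_of b" "frag_of c"] keys_diff[of "frag_of a" "frag_of b"] by auto
  have k': "Poly_Mapping.keys (frag_of a - frag_of b) \<subseteq> S" if "a \<in> S" "b \<in> S"
    for a b :: "'t list" and S
    using that keys_diff[of "frag_of a" "frag_of b"] by auto
  show "rels \<subseteq> carrier (free_Abelian_group gens)"
    unfolding tensor_power_rels_def
    by (intro Un_least subsetI; unfold mem_Collect_eq; elim exE conjE; hypsubst;
        unfold carrier_free_Abelian_group_iff)
      (intro k k'; simp add: gens_append lact_closed ract_closed)+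
qed

abbreviation "word xs \<equiv> cls (frag_of xs)"

lemma word_closed: "xs \<in> gens \<Longrightarrow> word xs \<in> carrier Q" by (rule cls_of_closed)

lemma rel_add:
  assumes "us @ [x] @ vs \<in> gens" "y \<in> carrier T"
  shows "frag_of (us @ [x \<oplus>\<^bsub>T\<^esub> y] @ vs) - frag_of (us @ [x] @ vs) - frag_of (us @ [y] @ vs) \<in> H"
  using assms by (intro Rel_in_H) (unfold tensor_power_rels_def, blast)

lemma rel_balanced:
  assumes "us @ [x, y] @ vs \<in> gens" "a \<in> carrier A"
  shows "frag_of (us @ [ract T x a, y] @ vs) - frag_of (us @ [x, lact T a y] @ vs) \<in> H"
  using assms by (intro Rel_in_H) (unfold tensor_power_rels_def, blast)

lemma rels_cases:
  assumes "r \<in> rels"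
  obtains us x y vs where "us @ [x] @ vs \<in> gens" "y \<in> carrier T"
      "r = frag_of (us @ [x \<oplus>\<^bsub>T\<^esub> y] @ vs) - frag_of (us @ [x] @ vs) - frag_of (us @ [y] @ vs)"
    | us x a y vs where "us @ [x, y] @ vs \<in> gens" "a \<in> carrier A"
      "r = frag_of (us @ [ract T x a, y] @ vs) - frag_of (us @ [x, lact T a y] @ vs)"
  using assms unfolding tensor_power_rels_def by blast

lemma word_add:
  assumes "us @ [x] @ vs \<in> gens" "y \<in> carrier T"
  shows "word (us @ [x \<oplus>\<^bsub>T\<^esub> y] @ vs) = word (us @ [x] @ vs) \<otimes>\<^bsub>Q\<^esub> word (us @ [y] @ vs)"
proof -
  have "word (us @ [x \<oplus>\<^bsub>T\<^esub> y] @ vs) = cls (frag_of (us @ [x] @ vs) + frag_of (us @ [y] @ vs))"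
    unfolding cls_eq_iff using rel_add[OF assms] by (simp add: algebra_simps)
  then show ?thesis using assms by (simp add: cls_add gens_append)
qed

lemma word_balanced:
  assumes "us @ [x, y] @ vs \<in> gens" "a \<in> carrier A"
  shows "word (us @ [ract T x a, y] @ vs) = word (us @ [x, lact T a y] @ vs)"
  unfolding cls_eq_iff by (rule rel_balanced[OF assms])

lemma word_zero:
  assumes "us @ [\<zero>\<^bsub>T\<^esub>] @ vs \<in> gens"
  shows "word (us @ [\<zero>\<^bsub>T\<^esub>] @ vs) = \<one>\<^bsub>Q\<^esub>"
proof -
  interpret group Q by (rule group_Q)
  show ?thesis using word_add[OF assms T.zero_closed] word_closed[OF assms] by simp
qed

text \<open>For the other letters held fixed, a word is additive in each letter, so the letters that
  keep it inside \<open>Y\<close> form a subgroup; it contains \<open>X\<close>, hence every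
  letter.\<close>

lemma words_generate:
  assumes Y: "subgroup Y Q" and X: "X \<subseteq> carrier T"
    and gen: "\<And>V. subgroup V (add_monoid T) \<Longrightarrow> X \<subseteq> V \<Longrightarrow> carrier T \<subseteq> V"
    and words: "\<And>xs. length xs = n \<Longrightarrow> set xs \<subseteq> X \<Longrightarrow> word xs \<in> Y"
  shows "carrier Q \<subseteq> Y"
proof (rule Q_generated[OF Y])
  interpret Q: group Q by (rule group_Q)
  interpret Y: subgroup Y Q by (rule Y)
  \<comment> \<open>The letters of \<open>us\<close> are already confined to \<open>X\<close>, those
    of \<open>vs\<close> are arbitrary; the induction frees them one by one.\<close>
  have "word (us @ vs) \<in> Y" if "length us + length vs = n" "set us \<subseteq> X" "set vs \<subseteq> carrier T" for us vs
    using that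
  proof (induction vs arbitrary: us)
    case Nil
    then show ?case using words by simp
  next
    case (Cons v vs)
    have g: "us @ [y] @ vs \<in> gens" if "y \<in> carrier T" for y using Cons.prems X that by (auto simp: tensor_power_gens_def)
    have add: "word (us @ [x \<oplus>\<^bsub>T\<^esub> y] @ vs) = word (us @ [x] @ vs) \<otimes>\<^bsub>Q\<^esub> word (us @ [y] @ vs)"
      if "x \<in> carrier T" "y \<in> carrier T" for x y using word_add[OF g] that by blast
    have "subgroup {y \<in> carrier T. word (us @ [y] @ vs) \<in> Y} (add_monoid T)"
    proof
      fix y assume "y \<in> {y \<in> carrier T. word (us @ [y] @ vs) \<in> Y}"
      then have y: "y \<in> carrier T" "word (us @ [y] @ vs) \<in> Y" by auto
      have "word (us @ [\<ominus>\<^bsub>T\<^esub> y] @ vs) \<otimes>\<^bsub>Q\<^esub> word (us @ [y] @ vs) = \<one>\<^bsub>Q\<^esub>"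
        using add[of "\<ominus>\<^bsub>T\<^esub> y" y] y word_zero[OF g] by (simp add: T.l_neg)
      then have "word (us @ [\<ominus>\<^bsub>T\<^esub> y] @ vs) = inv\<^bsub>Q\<^esub> word (us @ [y] @ vs)"
        using y word_closed[OF g] by (intro Q.inv_equality[symmetric]) auto
      then show "inv\<^bsub>add_monoid T\<^esub> y \<in> {y \<in> carrier T. word (us @ [y] @ vs) \<in> Y}"
        using y Y.m_inv_closed by (auto simp: a_inv_def)
    qed (use add Y.m_closed word_zero[OF g] Y.one_closed in auto)
    moreover have "X \<subseteq> {y \<in> carrier T. word (us @ [y] @ vs) \<in> Y}"
      using Cons.IH[of "us @ [y]" for y] Cons.prems X by auto
    ultimately have "carrier T \<subseteq> {y \<in> carrier T. word (us @ [y] @ vs) \<in> Y}" by (rule gen)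
    then show ?case using Cons.prems by auto
  qed
  from this[of "[]"] show "word s \<in> Y" if "s \<in> gens" for s using that by (auto simp: tensor_power_gens_def)
qed

lemma Z_simps: "carrier Z = carrier Q" "\<zero>\<^bsub>Z\<^esub> = \<one>\<^bsub>Q\<^esub>" "u \<oplus>\<^bsub>Z\<^esub> v = u \<otimes>\<^bsub>Q\<^esub> v"
  by (simp_all add: tensor_power_def Let_def)

lemma Z_group: "abelian_group Z"
proof -
  interpret Q: comm_group Q by (rule comm_group_Q)
  show ?thesis
    by (rule abelian_groupI; unfold Z_simps) (auto simp: Q.m_ac intro: Q.l_inv_ex)
qed

text \<open>The outer action respects the relations: one that does not involve the first letter
  keeps its form, and one that does is turned into a relation again by additivity or by
  \<open>lact_ract\<close>.\<close>

lemma Z_lact: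
  assumes a: "a \<in> carrier A" and n: "n \<noteq> 0"
  shows "lact Z a \<in> hom Q Q" "x # xs \<in> gens \<Longrightarrow> lact Z a (word (x # xs)) = word (lact T a x # xs)"
proof -
  let ?f = "\<lambda>xs. lact T a (hd xs) # tl xs"
  have cl: "?f s \<in> gens" if "s \<in> gens" for s
    using that n a lact_closed by (cases s) (auto simp: tensor_power_gens_def)
  have rel: "frag_extend (frag_of \<circ> ?f) r \<in> H" if "r \<in> rels" for r
    using that
  proof (cases rule: rels_cases)
    case (1 us x y vs)
    have c: "x \<in> carrier T" "set us \<subseteq> carrier T" using 1(1) by (auto simp: gens_append)
    show ?thesis
    proof (cases us)
      case Nil
      have "[] @ [lact T a x] @ vs \<in> gens" "lact T a y \<in> carrier T"
        using 1 Nil a by (auto simp: tensor_power_gens_def lact_closed)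
      from rel_add[OF this] show ?thesis unfolding 1(3) using Nil a c 1(2) by (simp add: frag_extend_diff lact_add)
    next
      case (Cons u us')
      have "(lact T a u # us') @ [x] @ vs \<in> gens"
        using 1 Cons a by (auto simp: tensor_power_gens_def lact_closed)
      from rel_add[OF this 1(2)] show ?thesis unfolding 1(3) using Cons by (simp add: frag_extend_diff)
    qed
  next
    case (2 us x b y vs)
    have c: "x \<in> carrier T" using 2(1) by (auto simp: gens_append)
    show ?thesis
    proof (cases us)
      case Nil
      have "[] @ [lact T a x, y] @ vs \<in> gens"
        using 2 Nil a by (auto simp: tensor_power_gens_def lact_closed)
      from rel_balanced[OF this 2(2)] show ?thesis unfolding 2(3) using Nil a c 2(2) by (simp add: frag_extend_diff lact_ract)
    next
      case (Cons u us')
      have "(lact T a u # us') @ [x, y] @ vs \<in> gens"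
        using 2 Cons a by (auto simp: tensor_power_gens_def lact_closed)
      from rel_balanced[OF this 2(2)] show ?thesis unfolding 2(3) using Cons by (simp add: frag_extend_diff)
    qed
  qed
  show "lact Z a \<in> hom Q Q"
    using presented_map_hom[OF presentation_axioms cl rel] by (simp add: tensor_power_def Let_def)
  show "lact Z a (word (x # xs)) = word (lact T a x # xs)" if "x # xs \<in> gens"
    using presented_map_of[OF presentation_axioms cl rel that] by (simp add: tensor_power_def Let_def)
qed

text \<open>The mirror image of \<open>Z_lact\<close>, with the case distinction made at the last
  letter.\<close>

lemma Z_ract:
  assumes a: "a \<in> carrier A" and n: "n \<noteq> 0"
  shows "(\<lambda>z. ract Z z a) \<in> hom Q Q" "xs @ [x] \<in> gens \<Longrightarrow> ract Z (word (xs @ [x])) a = word (xs @ [ract T x a])"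
proof -
  let ?f = "\<lambda>xs. butlast xs @ [ract T (last xs) a]"
  have cl: "?f s \<in> gens" if "s \<in> gens" for s
    using that n a ract_closed by (cases s rule: rev_cases) (auto simp: tensor_power_gens_def)
  have rel: "frag_extend (frag_of \<circ> ?f) r \<in> H" if "r \<in> rels" for r
    using that
  proof (cases rule: rels_cases)
    case (1 us x y vs)
    have c: "x \<in> carrier T" using 1(1) by (auto simp: gens_append)
    show ?thesis
    proof (cases vs rule: rev_cases)
      case Nil
      have "us @ [ract T x a] @ [] \<in> gens" "ract T y a \<in> carrier T"
        using 1 Nil a by (auto simp: tensor_power_gens_def ract_closed)
      from rel_add[OF this] show ?thesis unfolding 1(3) using Nil a c 1(2) by (simp add: frag_extend_diff ract_add)
    next
      case (snoc vs' v)
      have "us @ [x] @ (vs' @ [ract T v a]) \<in> gens"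
        using 1 snoc a by (auto simp: tensor_power_gens_def ract_closed)
      from rel_add[OF this 1(2)] show ?thesis unfolding 1(3) using snoc by (simp add: frag_extend_diff butlast_append)
    qed
  next
    case (2 us x b y vs)
    have c: "y \<in> carrier T" using 2(1) by (auto simp: gens_append)
    show ?thesis
    proof (cases vs rule: rev_cases)
      case Nil
      have "us @ [x, ract T y a] @ [] \<in> gens"
        using 2 Nil a by (auto simp: tensor_power_gens_def ract_closed)
      from rel_balanced[OF this 2(2)] show ?thesis unfolding 2(3) using Nil a c 2(2)
        by (simp add: frag_extend_diff lact_ract butlast_append)
    next
      case (snoc vs' v)
      have "us @ [x, y] @ (vs' @ [ract T v a]) \<in> gens"
        using 2 snoc a by (auto simp: tensor_power_gens_def ract_closed)
      from rel_balanced[OF this 2(2)] show ?thesis unfolding 2(3) using snoc by (simp add: frag_extend_diff butlast_append)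
    qed
  qed
  show "(\<lambda>z. ract Z z a) \<in> hom Q Q"
    using presented_map_hom[OF presentation_axioms cl rel] by (simp add: tensor_power_def Let_def)
  show "ract Z (word (xs @ [x])) a = word (xs @ [ract T x a])" if "xs @ [x] \<in> gens"
    using presented_map_of[OF presentation_axioms cl rel that] by (simp add: tensor_power_def Let_def)
qed

lemma subgroup_Z: "subgroup Y (add_monoid Z) \<longleftrightarrow> subgroup Y Q"
  by (simp add: subgroup_def m_inv_def Z_simps)

lemma trivial_quotient_self:
  assumes "comm_group G" shows "trivial_group (G Mod carrier G)"
proof -
  interpret comm_group G by fact
  have "carrier (G Mod carrier G) = {carrier G}"
    using coset_join2[OF _ subgroup_self] one_closed by (auto simp: FactGroup_def RCOSETS_def)
  moreover have "group (G Mod carrier G)"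
    by (rule normal.factorgroup_is_group[OF subgroup_imp_normal[OF subgroup_self]])
  ultimately show ?thesis by (simp add: trivial_group_def FactGroup_def)
qed

text \<open>If a word has the form \<open>z a\<close> and \<open>a z\<close> is zero, then it is
  minus the commutator \<open>a z - z a\<close>. It is enough to have this for words in the
  generators, since the commutators generate a subgroup.\<close>

lemma H_zero_trivial:
  assumes n: "n \<noteq> 0" and X: "X \<subseteq> carrier T"
    and gen: "\<And>V. subgroup V (add_monoid T) \<Longrightarrow> X \<subseteq> V \<Longrightarrow> carrier T \<subseteq> V"
    and words: "\<And>xs. length xs = n \<Longrightarrow> set xs \<subseteq> X \<Longrightarrow> word xs = \<one>\<^bsub>Q\<^esub> \<or>
       (\<exists>a\<in>carrier A. \<exists>ys x. xs = ys @ [ract T x a] \<and> x \<in> carrier T \<and> lact Z a (word (ys @ [x])) = \<one>\<^bsub>Q\<^esub>)"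
  shows "trivial_group (H_zero A Z)"
proof -
  interpret Z: abelian_group Z by (rule Z_group)
  let ?C = "{lact Z a z \<ominus>\<^bsub>Z\<^esub> ract Z z a | a z. a \<in> carrier A \<and> z \<in> carrier Z}"
  have C: "?C \<subseteq> carrier Z"
    using hom_in_carrier[OF Z_lact(1)[OF _ n]] hom_in_carrier[OF Z_ract(1)[OF _ n]]
    by (auto simp: Z_simps(1) intro!: Z.minus_closed[unfolded Z_simps(1)])
  have Y: "subgroup (generate (add_monoid Z) ?C) (add_monoid Z)"
    by (rule Z.add.generate_is_subgroup) (use C in simp)
  have "carrier Q \<subseteq> generate (add_monoid Z) ?C"
  proof (rule words_generate[OF _ X gen])
    show "subgroup (generate (add_monoid Z) ?C) Q" using Y unfolding subgroup_Z .
    fix xs assume xs: "length xs = n" "set xs \<subseteq> X"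
    from words[OF xs] show "word xs \<in> generate (add_monoid Z) ?C"
    proof (elim disjE bexE exE conjE)
      assume "word xs = \<one>\<^bsub>Q\<^esub>"
      then show ?thesis using subgroup.one_closed[OF Y] by (simp add: Z_simps)
    next
      fix a ys x assume a: "a \<in> carrier A" and e: "xs = ys @ [ract T x a]" and x: "x \<in> carrier T"
        and l: "lact Z a (word (ys @ [x])) = \<one>\<^bsub>Q\<^esub>"
      have g: "ys @ [x] \<in> gens" using xs X e x by (auto simp: tensor_power_gens_def)
      have w: "word xs \<in> carrier Z"
        unfolding Z_simps using xs X by (intro word_closed) (auto simp: tensor_power_gens_def)
      have "lact Z a (word (ys @ [x])) \<ominus>\<^bsub>Z\<^esub> ract Z (word (ys @ [x])) a = \<zero>\<^bsub>Z\<^esub> \<ominus>\<^bsub>Z\<^esub> word xs"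
        unfolding l Z_ract(2)[OF a n g] e by (simp add: Z_simps)
      also have "\<dots> = \<ominus>\<^bsub>Z\<^esub> word xs" using w by (simp add: Z.minus_eq)
      finally have "\<ominus>\<^bsub>Z\<^esub> word xs \<in> ?C"
        using a word_closed[OF g] unfolding Z_simps(1) mem_Collect_eq by metis
      then have "\<ominus>\<^bsub>Z\<^esub> word xs \<in> generate (add_monoid Z) ?C" by (rule generate.incl)
      from subgroup.m_inv_closed[OF Y this] show ?thesis using w by (simp add: a_inv_def[symmetric])
    qed
  qed auto
  moreover have "generate (add_monoid Z) ?C \<subseteq> carrier Z" using subgroup.subset[OF Y] by simp
  ultimately have "generate (add_monoid Z) ?C = carrier (add_monoid Z)" by (auto simp: Z_simps(1))
  then show ?thesis unfolding H_zero_def using trivial_quotient_self[OF Z.a_comm_group] by simp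
qed

lemma power_trivial:
  assumes X: "X \<subseteq> carrier T"
    and gen: "\<And>V. subgroup V (add_monoid T) \<Longrightarrow> X \<subseteq> V \<Longrightarrow> carrier T \<subseteq> V"
    and words: "\<And>xs. length xs = n \<Longrightarrow> set xs \<subseteq> X \<Longrightarrow> word xs = \<one>\<^bsub>Q\<^esub>"
  shows "trivial_group (add_monoid Z)"
proof -
  interpret Z: abelian_group Z by (rule Z_group)
  have "carrier Q \<subseteq> {\<one>\<^bsub>Q\<^esub>}"
    by (rule words_generate[OF _ X gen]) (use words group.triv_subgroup[OF group_Q] in auto)
  then show ?thesis unfolding trivial_group_def
    using Z.add.is_group group.is_monoid[OF group_Q] monoid.one_closed by (fastforce simp: Z_simps)
qed

end

section \<open>Words in \<open>N \<otimes> M\<close> and paths in the quiver\<close>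

locale composable = two_algebras K B A + N: coordinates K A B N IN f h genN TN + M: coordinates K B A M IM g e genM TM
  for K :: "('k, 'u) ring_scheme" and A :: "('k, 'a, 'v) module_scheme" and B :: "('k, 'b, 'w) module_scheme"
    and N :: "('a, 'b, 'n) bimodule" and IN :: "'i set" and f h genN TN
    and M :: "('b, 'a, 'm) bimodule" and IM :: "'j set" and g e genM TM
begin

sublocale NM: tensor_bimodule_data B N M
  by (unfold_locales) (auto simp: N.ract_closed M.lact_closed)

abbreviation "T \<equiv> tensor_bimodule B N M"

definition linked_NM :: "'i \<Rightarrow> 'j \<Rightarrow> bool" where
  "linked_NM x y \<longleftrightarrow> (\<exists>b\<in>carrier B. h x \<otimes>\<^bsub>B\<^esub> b \<otimes>\<^bsub>B\<^esub> g y \<noteq> \<zero>\<^bsub>B\<^esub>)"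

definition linked_MN :: "'j \<Rightarrow> 'i \<Rightarrow> bool" where
  "linked_MN y x \<longleftrightarrow> (\<exists>a\<in>carrier A. e y \<otimes>\<^bsub>A\<^esub> a \<otimes>\<^bsub>A\<^esub> f x \<noteq> \<zero>\<^bsub>A\<^esub>)"

definition quiver :: "('i \<times> 'i) set" where
  "quiver = {(x, x'). x \<in> IN \<and> x' \<in> IN \<and> (\<exists>y\<in>IM. linked_NM x y \<and> linked_MN y x')}"

lemma T_lact:
  assumes "a \<in> carrier A"
  shows "lact T a \<in> hom NM.Q NM.Q"
    "x \<in> carrier N \<Longrightarrow> y \<in> carrier M \<Longrightarrow> lact T a (NM.pure x y) = NM.pure (lact N a x) y"
  using NM.XY_lact(1)[of a] NM.XY_lact(2)[of a x y] assms by (auto simp: N.lact_add_r N.lact_ract)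

lemma T_ract:
  assumes "a \<in> carrier A"
  shows "(\<lambda>u. ract T u a) \<in> hom NM.Q NM.Q"
    "x \<in> carrier N \<Longrightarrow> y \<in> carrier M \<Longrightarrow> ract T (NM.pure x y) a = NM.pure x (ract M y a)"
  using NM.XY_ract(1)[of a] NM.XY_ract(2)[of a x y] assms by (auto simp: M.ract_add_l M.lact_ract)

sublocale tp: tensor_power_data A T n for n
proof -
  interpret Q: comm_group NM.Q by (rule NM.comm_group_Q)
  have "abelian_group T"
    by (rule abelian_groupI; unfold NM.XY_simps) (auto simp: Q.m_ac intro: Q.l_inv_ex)
  moreover have "lact T a (ract T u b) = ract T (lact T a u) b"
    if "a \<in> carrier A" "b \<in> carrier A" "u \<in> carrier NM.Q" for a b u
  proof (rule NM.Q_hom_eq[OF _ _ Q.is_group _ that(3)])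
    show "(\<lambda>u. lact T a (ract T u b)) \<in> hom NM.Q NM.Q" "(\<lambda>u. ract T (lact T a u) b) \<in> hom NM.Q NM.Q"
      using hom_compose[OF T_ract(1)[OF that(2)] T_lact(1)[OF that(1)]]
        hom_compose[OF T_lact(1)[OF that(1)] T_ract(1)[OF that(2)]] by (simp_all add: o_def)
  qed (use that in \<open>auto simp: T_lact T_ract N.lact_closed M.ract_closed\<close>)
  ultimately show "tensor_power_data A T"
    using hom_in_carrier[OF T_lact(1)] hom_in_carrier[OF T_ract(1)] hom_mult[OF T_lact(1)] hom_mult[OF T_ract(1)]
    by (intro tensor_power_data.intro tensor_power_data_axioms.intro) (auto simp: NM.XY_simps)
qed

text \<open>Coefficients from \<open>B\<close> between the two generators are all collected on the
  left factor, which balancedness permits; the coefficients from \<open>A\<close> stay at the two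
  ends, where neighbouring letters can exchange them.\<close>

definition elt :: "'a \<Rightarrow> 'i \<Rightarrow> 'b \<Rightarrow> 'j \<Rightarrow> 'a \<Rightarrow> ('n \<times> 'm \<Rightarrow>\<^sub>0 int) set" where
  "elt a x b y a' = NM.pure (lact N a (ract N (genN x) b)) (ract M (genM y) a')"

lemma elt_closed: "\<lbrakk>a \<in> carrier A; x \<in> IN; b \<in> carrier B; y \<in> IM; a' \<in> carrier A\<rbrakk> \<Longrightarrow> elt a x b y a' \<in> carrier T"
  unfolding elt_def NM.XY_simps by (intro NM.pure_closed) (auto intro: N.gen_closed M.gen_closed)

definition elts :: "('n \<times> 'm \<Rightarrow>\<^sub>0 int) set set" where
  "elts = {elt a x b y a' | a x b y a'. a \<in> carrier A \<and> x \<in> IN \<and> b \<in> carrier B \<and> y \<in> IM \<and> a' \<in> carrier A}"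

lemma elts_closed: "elts \<subseteq> carrier T"
  unfolding elts_def using elt_closed by blast

lemma T_group: "subgroup V (add_monoid T) \<longleftrightarrow> subgroup V NM.Q"
  by (simp add: subgroup_def m_inv_def NM.XY_simps)

lemma subgroup_of_hom:
  assumes "group G" "group H" "u \<in> hom G H" "subgroup V H"
  shows "subgroup {x \<in> carrier G. u x \<in> V} G"
proof -
  interpret group_hom G H u using assms by (simp add: group_hom_def group_hom_axioms_def)
  interpret V: subgroup V H by fact
  show ?thesis by unfold_locales (auto simp: V.m_closed V.m_inv_closed)
qed

lemma elts_generate:
  assumes "subgroup V (add_monoid T)" "elts \<subseteq> V"
  shows "carrier T \<subseteq> V"
  unfolding NM.XY_simps
proof (rule NM.Q_generated)
  show V: "subgroup V NM.Q" using assms(1) by (simp add: T_group)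
  have hom_l: "(\<lambda>u. NM.pure u v) \<in> hom (add_monoid N) NM.Q" if "v \<in> carrier M" for v
    using that NM.pure_add_l NM.pure_closed by (auto simp: hom_def)
  have hom_r: "(\<lambda>v. NM.pure u v) \<in> hom (add_monoid M) NM.Q" if "u \<in> carrier N" for u
    using that NM.pure_add_r NM.pure_closed by (auto simp: hom_def)
  \<comment> \<open>The right factor is reduced to generators first, its left coefficient being
    moved over to the factor in \<open>N\<close>; the left factor follows below.\<close>
  have 1: "NM.pure (ract N (lact N a (genN x)) b) v \<in> V"
    if "x \<in> IN" "a \<in> carrier A" "b \<in> carrier B" "v \<in> carrier M" for x a b v
  proof -
    let ?u = "ract N (lact N a (genN x)) b"
    have u: "?u \<in> carrier N" using that N.gen_closed by auto
    have "carrier M \<subseteq> {v \<in> carrier (add_monoid M). NM.pure ?u v \<in> V}"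
    proof (rule M.span[OF subgroup_of_hom[OF M.X.add.is_group NM.group_Q hom_r[OF u] V]])
      fix y b' a' assume y: "y \<in> IM" and b': "b' \<in> carrier B" and a': "a' \<in> carrier A"
      have "NM.pure ?u (ract M (lact M b' (genM y)) a') = NM.pure (ract N ?u b') (ract M (genM y) a')"
        using NM.pure_balanced[OF u b', of "ract M (genM y) a'"] y a' b' M.gen_closed by (simp add: M.lact_ract)
      also have "ract N ?u b' = lact N a (ract N (genN x) (b \<otimes>\<^bsub>B\<^esub> b'))"
        using that b' N.gen_closed by (simp add: N.ract_mult N.lact_ract)
      finally have "NM.pure ?u (ract M (lact M b' (genM y)) a') \<in> elts"
        unfolding elts_def elt_def using that y b' a' by (intro CollectI) (metis B.m_closed)
      then show "ract M (lact M b' (genM y)) a' \<in> {v \<in> carrier (add_monoid M). NM.pure ?u v \<in> V}"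
        using assms(2) y b' a' M.gen_closed by auto
    qed
    with that(4) show ?thesis by auto
  qed
  fix s assume "s \<in> carrier N \<times> carrier M"
  then obtain u v where s: "s = (u, v)" and u: "u \<in> carrier N" and v: "v \<in> carrier M" by auto
  have "carrier N \<subseteq> {u \<in> carrier (add_monoid N). NM.pure u v \<in> V}"
    by (rule N.span[OF subgroup_of_hom[OF N.X.add.is_group NM.group_Q hom_l[OF v] V]])
      (use 1 v N.gen_closed in auto)
  with u show "NM.cls (frag_of s) \<in> V" unfolding s by auto
qed

text \<open>The generators absorb \<open>h x\<close> and \<open>g y\<close>, so the coefficient
  \<open>b\<close> between them may be replaced by \<open>h x b g y\<close>, which is zero without a
  link.\<close>

lemma elt_zero:
  assumes "a \<in> carrier A" "x \<in> IN" "b \<in> carrier B" "y \<in> IM" "a' \<in> carrier A" "\<not> linked_NM x y"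
  shows "elt a x b y a' = \<zero>\<^bsub>T\<^esub>"
proof -
  note c = assms N.gen_closed[OF assms(2)] M.gen_closed[OF assms(4)] N.r_closed[OF assms(2)] M.l_closed[OF assms(4)]
  have "ract M (genM y) a' = lact M (g y) (ract M (genM y) a')"
    using c M.gen_l[OF assms(4)] by (simp add: M.lact_ract[symmetric])
  then have "elt a x b y a' = NM.pure (lact N a (ract N (genN x) b)) (lact M (g y) (ract M (genM y) a'))"
    by (simp add: elt_def)
  also have "\<dots> = NM.pure (ract N (lact N a (ract N (genN x) b)) (g y)) (ract M (genM y) a')"
    using NM.pure_balanced[of "lact N a (ract N (genN x) b)" "g y" "ract M (genM y) a'"] c by simp
  also have "ract N (lact N a (ract N (genN x) b)) (g y) = lact N a (ract N (genN x) (h x \<otimes>\<^bsub>B\<^esub> b \<otimes>\<^bsub>B\<^esub> g y))"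
    using c N.gen_r[OF assms(2)] by (simp add: N.lact_ract N.ract_mult)
  also have "h x \<otimes>\<^bsub>B\<^esub> b \<otimes>\<^bsub>B\<^esub> g y = \<zero>\<^bsub>B\<^esub>" using assms by (auto simp: linked_NM_def)
  finally show ?thesis using c by (simp add: N.zero_ract N.lact_zero NM.pure_zero_l NM.XY_simps)
qed

text \<open>A coefficient is taken out of a letter together with the idempotent that the generator
  absorbs. When it meets a neighbouring letter, the product of the two coefficients lies in
  \<open>e y A f x\<close>, the space that decides about a link.\<close>

lemma elt_split:
  assumes "a \<in> carrier A" "x \<in> IN" "b \<in> carrier B" "y \<in> IM" "a' \<in> carrier A"
  shows "elt a x b y a' = ract T (elt a x b y \<one>\<^bsub>A\<^esub>) (e y \<otimes>\<^bsub>A\<^esub> a')"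
    "elt a x b y a' = lact T (a \<otimes>\<^bsub>A\<^esub> f x) (elt \<one>\<^bsub>A\<^esub> x b y a')"
proof -
  note c = assms N.gen_closed[OF assms(2)] M.gen_closed[OF assms(4)] N.l_closed[OF assms(2)] M.r_closed[OF assms(4)]
  show "elt a x b y a' = ract T (elt a x b y \<one>\<^bsub>A\<^esub>) (e y \<otimes>\<^bsub>A\<^esub> a')"
    using c M.gen_r[OF assms(4)] by (simp add: elt_def T_ract M.ract_mult)
  show "elt a x b y a' = lact T (a \<otimes>\<^bsub>A\<^esub> f x) (elt \<one>\<^bsub>A\<^esub> x b y a')"
    using c N.gen_l[OF assms(2)] by (simp add: elt_def T_lact N.lact_mult N.lact_ract[symmetric])
qed

lemma lact_elt_zero:
  assumes "a \<in> carrier A" "x \<in> IN" "b \<in> carrier B" "y' \<in> IM" "a' \<in> carrier A" "c \<in> carrier A" "y \<in> IM" "\<not> linked_MN y x"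
  shows "lact T (e y \<otimes>\<^bsub>A\<^esub> c) (elt a x b y' a') = \<zero>\<^bsub>T\<^esub>"
proof -
  note cl = assms N.gen_closed[OF assms(2)] M.gen_closed[OF assms(4)] N.l_closed[OF assms(2)] M.r_closed[OF assms(7)]
  have "lact T (e y \<otimes>\<^bsub>A\<^esub> c) (elt a x b y' a') =
      NM.pure (lact N (e y \<otimes>\<^bsub>A\<^esub> (c \<otimes>\<^bsub>A\<^esub> a) \<otimes>\<^bsub>A\<^esub> f x) (ract N (genN x) b)) (ract M (genM y') a')"
    using cl N.gen_l[OF assms(2)] by (simp add: elt_def T_lact N.lact_mult N.lact_ract[symmetric])
  also have "e y \<otimes>\<^bsub>A\<^esub> (c \<otimes>\<^bsub>A\<^esub> a) \<otimes>\<^bsub>A\<^esub> f x = \<zero>\<^bsub>A\<^esub>" using cl by (auto simp: linked_MN_def)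
  finally show ?thesis using cl by (simp add: N.zero_lact NM.pure_zero_l NM.XY_simps)
qed

text \<open>Without a link inside a letter the letter is zero. Without a link between two
  neighbours, the right coefficient of the first can be moved across the tensor sign, where it kills
  the second.\<close>

lemma word_path:
  assumes xs: "length xs = n" "set xs \<subseteq> elts" and nz: "tp.word n xs \<noteq> \<one>\<^bsub>tp.Q n\<^esub>"
  obtains a x b y a' where
    "\<And>i. i < n \<Longrightarrow> a i \<in> carrier A \<and> x i \<in> IN \<and> b i \<in> carrier B \<and> y i \<in> IM \<and> a' i \<in> carrier A \<and>
        xs ! i = elt (a i) (x i) (b i) (y i) (a' i) \<and> linked_NM (x i) (y i)"
    "\<And>i. Suc i < n \<Longrightarrow> linked_MN (y i) (x (Suc i))"
proof -
  have "\<forall>i<n. \<exists>a x b y a'. a \<in> carrier A \<and> x \<in> IN \<and> b \<in> carrier B \<and> y \<in> IM \<and> a' \<in> carrier A \<and> xs ! i = elt a x b y a'"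
  proof (intro allI impI)
    fix i assume "i < n"
    then have "xs ! i \<in> elts" using xs nth_mem by blast
    then show "\<exists>a x b y a'. a \<in> carrier A \<and> x \<in> IN \<and> b \<in> carrier B \<and> y \<in> IM \<and> a' \<in> carrier A \<and> xs ! i = elt a x b y a'"
      unfolding elts_def by blast
  qed
  then obtain a x b y a' where q: "\<And>i. i < n \<Longrightarrow> a i \<in> carrier A \<and> x i \<in> IN \<and> b i \<in> carrier B \<and> y i \<in> IM \<and> a' i \<in> carrier A \<and>
      xs ! i = elt (a i) (x i) (b i) (y i) (a' i)" by metis
  have xsT: "set xs \<subseteq> carrier T" using xs elts_closed by blast
  have sub: "set (take i xs) \<subseteq> carrier T" "set (drop i xs) \<subseteq> carrier T" for i
    using xsT set_take_subset set_drop_subset by fast+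
  have 1: "linked_NM (x i) (y i)" if i: "i < n" for i
  proof (rule ccontr)
    assume "\<not> linked_NM (x i) (y i)"
    then have z: "xs ! i = \<zero>\<^bsub>T\<^esub>" using q[OF i] elt_zero by simp
    have "xs = take i xs @ [\<zero>\<^bsub>T\<^esub>] @ drop (Suc i) xs" using id_take_nth_drop[of i xs] i xs z by simp
    moreover have "take i xs @ [\<zero>\<^bsub>T\<^esub>] @ drop (Suc i) xs \<in> tensor_power_gens T n"
      using i xs sub by (simp add: tp.gens_append)
    ultimately show False using nz tp.word_zero by metis
  qed
  have 2: "linked_MN (y i) (x (Suc i))" if i: "Suc i < n" for i
  proof (rule ccontr)
    assume nl: "\<not> linked_MN (y i) (x (Suc i))"
    have i': "i < n" using i by simp
    let ?u = "elt (a i) (x i) (b i) (y i) \<one>\<^bsub>A\<^esub>" and ?c = "e (y i) \<otimes>\<^bsub>A\<^esub> a' i"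
    have c: "?c \<in> carrier A" using q[OF i'] M.r_closed by auto
    have u: "?u \<in> carrier T" using q[OF i'] elt_closed by simp
    have v: "xs ! Suc i \<in> carrier T" using q[OF i] elt_closed by simp
    have e1: "xs ! i = ract T ?u ?c"
      using q[OF i'] elt_split(1)[of "a i" "x i" "b i" "y i" "a' i"] by simp
    have e2: "lact T ?c (xs ! Suc i) = \<zero>\<^bsub>T\<^esub>" using q[OF i] q[OF i'] nl lact_elt_zero by simp
    have xe: "xs = take i xs @ [ract T ?u ?c, xs ! Suc i] @ drop (Suc (Suc i)) xs"
    proof -
      have "xs = take i xs @ xs ! i # xs ! Suc i # drop (Suc (Suc i)) xs"
        using id_take_nth_drop[of i xs] Cons_nth_drop_Suc[of "Suc i" xs] i xs(1) by simp
      then show ?thesis unfolding e1[symmetric] by simp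
    qed
    have g: "take i xs @ [?u, xs ! Suc i] @ drop (Suc (Suc i)) xs \<in> tensor_power_gens T n"
      "(take i xs @ [?u]) @ [\<zero>\<^bsub>T\<^esub>] @ drop (Suc (Suc i)) xs \<in> tensor_power_gens T n"
      using i xs sub u v by (auto simp: tp.gens_append)
    have "tp.word n xs = tp.word n (take i xs @ [?u, lact T ?c (xs ! Suc i)] @ drop (Suc (Suc i)) xs)"
      by (subst xe) (rule tp.word_balanced[OF g(1) c])
    also have "\<dots> = \<one>\<^bsub>tp.Q n\<^esub>" using tp.word_zero[OF g(2)] unfolding e2 by simp
    finally show False using nz by simp
  qed
  show ?thesis using q 1 2 by (intro that[of a x b y a']) auto
qed

lemma path_trancl:
  assumes "\<And>i. Suc i < n \<Longrightarrow> (x i, x (Suc i)) \<in> r" "i < j" "j < n"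
  shows "(x i, x j) \<in> r\<^sup>+"
  using assms(2,3)
proof (induction j)
  case (Suc j)
  show ?case
  proof (cases "i = j")
    case True
    then show ?thesis using assms(1)[of j] Suc.prems by auto
  next
    case False
    then have "(x i, x j) \<in> r\<^sup>+" using Suc by simp
    then show ?thesis using assms(1)[of j] Suc.prems by (meson trancl.trancl_into_trancl)
  qed
qed simp

lemma acyclic_H_zero:
  assumes "acyclic quiver" "0 < n"
  shows "trivial_group (H_zero A (tensor_power A T n))"
proof (rule tp.H_zero_trivial[OF _ elts_closed elts_generate])
  show "n \<noteq> 0" using assms by simp
  fix xs assume xs: "length xs = n" "set xs \<subseteq> elts"
  show "tp.word n xs = \<one>\<^bsub>tp.Q n\<^esub> \<or> (\<exists>a\<in>carrier A. \<exists>ys u. xs = ys @ [ract T u a] \<and> u \<in> carrier T \<and>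
      lact (tensor_power A T n) a (tp.word n (ys @ [u])) = \<one>\<^bsub>tp.Q n\<^esub>)"
  proof (cases "tp.word n xs = \<one>\<^bsub>tp.Q n\<^esub>")
    case False
    then obtain a x b y a' where q: "\<And>i. i < n \<Longrightarrow> a i \<in> carrier A \<and> x i \<in> IN \<and> b i \<in> carrier B \<and> y i \<in> IM \<and> a' i \<in> carrier A \<and>
        xs ! i = elt (a i) (x i) (b i) (y i) (a' i) \<and> linked_NM (x i) (y i)"
      and l: "\<And>i. Suc i < n \<Longrightarrow> linked_MN (y i) (x (Suc i))"
      using word_path[OF xs] by metis
    obtain m where m: "n = Suc m" using assms(2) by (cases n) auto
    have step: "(x i, x (Suc i)) \<in> quiver" if "Suc i < n" for i
      using q[of i] q[of "Suc i"] l[OF that] that by (auto simp: quiver_def)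
    \<comment> \<open>The word is a path from \<open>x 0\<close> to \<open>x m\<close>; a link from
      its last letter back to its first would close a loop.\<close>
    have nl: "\<not> linked_MN (y m) (x 0)"
    proof
      assume "linked_MN (y m) (x 0)"
      then have "(x m, x 0) \<in> quiver" using q[of m] q[of 0] m by (auto simp: quiver_def)
      moreover have "(x 0, x m) \<in> quiver\<^sup>*"
      proof (cases "m = 0")
        case False
        then show ?thesis using path_trancl[where x = x and n = n and i = 0 and j = m, OF step] m by (auto intro: trancl_into_rtrancl)
      qed simp
      ultimately show False using assms(1) by (meson acyclic_def rtrancl_into_trancl1)
    qed
    let ?u = "elt (a m) (x m) (b m) (y m) \<one>\<^bsub>A\<^esub>" and ?c = "e (y m) \<otimes>\<^bsub>A\<^esub> a' m"
    have c: "?c \<in> carrier A" using q[of m] M.r_closed m by auto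
    have u: "?u \<in> carrier T" using q[of m] elt_closed m by simp
    have split: "xs = take m xs @ [ract T ?u ?c]"
    proof -
      have "xs ! m = ract T ?u ?c"
        using q[of m] elt_split(1)[of "a m" "x m" "b m" "y m" "a' m"] m by simp
      moreover have "xs = take m xs @ [xs ! m]"
        using id_take_nth_drop[of m xs] m xs(1) by simp
      ultimately show ?thesis by simp
    qed
    \<comment> \<open>The coefficient taken from the last letter kills the first letter. In a word
      of length one these are the same letter, so it is the stripped letter \<open>?u\<close> that
      must be killed.\<close>
    have "\<exists>v vs. take m xs @ [?u] = v # vs \<and> v \<in> carrier T \<and> lact T ?c v = \<zero>\<^bsub>T\<^esub>"
    proof (cases m)
      case 0
      have "lact T ?c ?u = \<zero>\<^bsub>T\<^esub>" by (rule lact_elt_zero) (use q[of m] m 0 nl in auto)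
      then show ?thesis using u 0 by simp
    next
      case (Suc k)
      have "lact T ?c (xs ! 0) = \<zero>\<^bsub>T\<^esub>" using lact_elt_zero[of "a 0" "x 0" "b 0" "y 0" "a' 0" "a' m" "y m"] q[of 0] q[of m] m nl by simp
      moreover have "take m xs @ [?u] = xs ! 0 # (drop 1 (take m xs) @ [?u])"
        using Suc m xs by (cases xs) auto
      moreover have "xs ! 0 \<in> carrier T" using q[of 0] elt_closed m by simp
      ultimately show ?thesis by blast
    qed
    then obtain v vs where v: "take m xs @ [?u] = v # vs" "v \<in> carrier T" "lact T ?c v = \<zero>\<^bsub>T\<^esub>" by blast
    have gens: "v # vs \<in> tensor_power_gens T n"
      unfolding v(1)[symmetric] using m xs u elts_closed set_take_subset[of m xs] by (auto simp: tp.gens_append)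
    then have z: "[] @ [\<zero>\<^bsub>T\<^esub>] @ vs \<in> tensor_power_gens T n" by (auto simp: tensor_power_gens_def)
    have "lact (tensor_power A T n) ?c (tp.word n (take m xs @ [?u])) = tp.word n ([] @ [\<zero>\<^bsub>T\<^esub>] @ vs)"
      unfolding v(1) using tp.Z_lact(2)[OF c _ gens] m v(3) by simp
    also have "\<dots> = \<one>\<^bsub>tp.Q n\<^esub>" by (rule tp.word_zero[OF z])
    finally show ?thesis using split c u by blast
  qed simp
qed

text \<open>A nonzero word with more than \<open>card IN\<close> letters would pass through some
  vertex twice, and the part in between would be a loop.\<close>

lemma acyclic_power:
  assumes "acyclic quiver" "card IN < n"
  shows "trivial_group (add_monoid (tensor_power A T n))"
proof (rule tp.power_trivial[OF elts_closed elts_generate])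
  fix xs assume xs: "length xs = n" "set xs \<subseteq> elts"
  show "tp.word n xs = \<one>\<^bsub>tp.Q n\<^esub>"
  proof (rule ccontr)
    assume "tp.word n xs \<noteq> \<one>\<^bsub>tp.Q n\<^esub>"
    then obtain a x b y a' where q: "\<And>i. i < n \<Longrightarrow> a i \<in> carrier A \<and> x i \<in> IN \<and> b i \<in> carrier B \<and> y i \<in> IM \<and> a' i \<in> carrier A \<and>
        xs ! i = elt (a i) (x i) (b i) (y i) (a' i) \<and> linked_NM (x i) (y i)"
      and l: "\<And>i. Suc i < n \<Longrightarrow> linked_MN (y i) (x (Suc i))"
      using word_path[OF xs] by metis
    have step: "(x i, x (Suc i)) \<in> quiver" if "Suc i < n" for i
      using q[of i] q[of "Suc i"] l[OF that] that by (auto simp: quiver_def)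
    have "\<not> inj_on x {..<n}"
    proof
      assume "inj_on x {..<n}"
      then have "card {..<n} \<le> card IN" using q N.I_finite by (intro card_inj_on_le[of x]) auto
      then show False using assms(2) by simp
    qed
    then obtain i j where "i < n" "j < n" "i < j" "x i = x j" unfolding inj_on_def by (metis lessThan_iff nat_neq_iff)
    then show False using path_trancl[where x = x and n = n and i = i and j = j, OF step] assms(1) by (auto simp: acyclic_def)
  qed
qed auto

end

section \<open>Null-square algebras\<close>

definition submodule_on :: "('k, 'u) ring_scheme \<Rightarrow> ('k, 'a, 'v) module_scheme \<Rightarrow> 'a set \<Rightarrow> bool" where
  "submodule_on K A U \<longleftrightarrow> U \<subseteq> carrier A \<and> \<zero>\<^bsub>A\<^esub> \<in> U \<and> (\<forall>x\<in>U. \<forall>y\<in>U. x \<oplus>\<^bsub>A\<^esub> y \<in> U) \<and>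
     (\<forall>c\<in>carrier K. \<forall>x\<in>U. c \<odot>\<^bsub>A\<^esub> x \<in> U)"

text \<open>The form is the coordinate along \<open>a\<close> for the decomposition of \<open>A\<close> into the line through \<open>a\<close> and a
  submodule that is maximal among those not containing \<open>a\<close>.\<close>

lemma exists_linear_form:
  assumes "field K" "module K A" and a: "a \<in> carrier A" "a \<noteq> \<zero>\<^bsub>A\<^esub>"
  shows "\<exists>\<nu>. linear_form K A \<nu> \<and> \<nu> a = \<one>\<^bsub>K\<^esub>"
proof -
  interpret K: field K by fact
  interpret A: module K A by fact
  let ?C = "{U. submodule_on K A U \<and> a \<notin> U}"
  have "\<exists>U\<in>?C. \<forall>X\<in>?C. U \<subseteq> X \<longrightarrow> X = U"
  proof (rule subset_Zorn_nonempty)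
    have "{\<zero>\<^bsub>A\<^esub>} \<in> ?C" using a by (auto simp: submodule_on_def)
    then show "?C \<noteq> {}" by blast
  next
    fix c assume c: "c \<noteq> {}" "subset.chain ?C c"
    have comp: "U \<subseteq> V \<or> V \<subseteq> U" if "U \<in> c" "V \<in> c" for U V
      using c(2) that by (auto simp: subset.chain_def)
    have sub: "submodule_on K A U" "a \<notin> U" if "U \<in> c" for U using c(2) that by (auto simp: subset.chain_def)
    have add: "x \<oplus>\<^bsub>A\<^esub> y \<in> \<Union>c" if xy: "x \<in> \<Union>c" "y \<in> \<Union>c" for x y
    proof -
      obtain U V where "U \<in> c" "V \<in> c" "x \<in> U" "y \<in> V" using xy by blast
      then have "\<exists>W\<in>c. x \<in> W \<and> y \<in> W" using comp[of U V] by blast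
      then obtain W where W: "W \<in> c" "x \<in> W" "y \<in> W" by blast
      then have "x \<oplus>\<^bsub>A\<^esub> y \<in> W" using sub(1)[OF W(1)] by (simp add: submodule_on_def)
      with W(1) show ?thesis by blast
    qed
    have "submodule_on K A (\<Union>c)"
      unfolding submodule_on_def using add c(1) sub unfolding submodule_on_def by blast
    then show "\<Union>c \<in> ?C" using sub by blast
  qed
  then obtain U where U: "submodule_on K A U" "a \<notin> U"
    and max: "\<And>X. submodule_on K A X \<Longrightarrow> a \<notin> X \<Longrightarrow> U \<subseteq> X \<Longrightarrow> X = U" by blast
  have Uc: "U \<subseteq> carrier A" "\<zero>\<^bsub>A\<^esub> \<in> U" and Ua: "\<And>x y. x \<in> U \<Longrightarrow> y \<in> U \<Longrightarrow> x \<oplus>\<^bsub>A\<^esub> y \<in> U"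
    and Us: "\<And>c x. c \<in> carrier K \<Longrightarrow> x \<in> U \<Longrightarrow> c \<odot>\<^bsub>A\<^esub> x \<in> U"
    using U(1) by (auto simp: submodule_on_def)
  \<comment> \<open>If \<open>x\<close> lies outside \<open>U\<close>, then by maximality adjoining
    it to \<open>U\<close> brings in \<open>a\<close>; the resulting equation is solved for
    \<open>x\<close>.\<close>
  have dec: "\<exists>c\<in>carrier K. \<exists>u\<in>U. x = u \<oplus>\<^bsub>A\<^esub> c \<odot>\<^bsub>A\<^esub> a" if x: "x \<in> carrier A" for x
  proof (cases "x \<in> U")
    case True
    then show ?thesis using Uc a by (intro bexI[of _ "\<zero>\<^bsub>K\<^esub>"] bexI[of _ x]) auto
  next
    case False
    let ?X = "{u \<oplus>\<^bsub>A\<^esub> k \<odot>\<^bsub>A\<^esub> x | u k. u \<in> U \<and> k \<in> carrier K}"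
    have UX: "U \<subseteq> ?X"
    proof
      fix u assume u: "u \<in> U"
      then have "u = u \<oplus>\<^bsub>A\<^esub> \<zero>\<^bsub>K\<^esub> \<odot>\<^bsub>A\<^esub> x" using Uc x by auto
      with u show "u \<in> ?X" by blast
    qed
    have xX: "x \<in> ?X"
    proof -
      have "x = \<zero>\<^bsub>A\<^esub> \<oplus>\<^bsub>A\<^esub> \<one>\<^bsub>K\<^esub> \<odot>\<^bsub>A\<^esub> x" using x by simp
      then show ?thesis using Uc(2) by blast
    qed
    have "submodule_on K A ?X"
      unfolding submodule_on_def
    proof (intro conjI ballI)
      show "?X \<subseteq> carrier A" using Uc x by auto
      show "\<zero>\<^bsub>A\<^esub> \<in> ?X" using UX Uc by blast
    next
      fix y z assume "y \<in> ?X" "z \<in> ?X"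
      then obtain u k v l where y: "y = u \<oplus>\<^bsub>A\<^esub> k \<odot>\<^bsub>A\<^esub> x" "u \<in> U" "k \<in> carrier K"
        and z: "z = v \<oplus>\<^bsub>A\<^esub> l \<odot>\<^bsub>A\<^esub> x" "v \<in> U" "l \<in> carrier K" by blast
      have "y \<oplus>\<^bsub>A\<^esub> z = (u \<oplus>\<^bsub>A\<^esub> v) \<oplus>\<^bsub>A\<^esub> (k \<oplus>\<^bsub>K\<^esub> l) \<odot>\<^bsub>A\<^esub> x"
        using y z Uc x by (simp add: A.smult_l_distr A.a_ac subset_iff)
      then show "y \<oplus>\<^bsub>A\<^esub> z \<in> ?X" using Ua[OF y(2) z(2)] y z by blast
    next
      fix c y assume c: "c \<in> carrier K" and "y \<in> ?X"
      then obtain u k where y: "y = u \<oplus>\<^bsub>A\<^esub> k \<odot>\<^bsub>A\<^esub> x" "u \<in> U" "k \<in> carrier K" by blast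
      have "c \<odot>\<^bsub>A\<^esub> y = c \<odot>\<^bsub>A\<^esub> u \<oplus>\<^bsub>A\<^esub> (c \<otimes>\<^bsub>K\<^esub> k) \<odot>\<^bsub>A\<^esub> x"
        using y c Uc x by (simp add: A.smult_r_distr A.smult_assoc1 subset_iff)
      then show "c \<odot>\<^bsub>A\<^esub> y \<in> ?X" using Us[OF c y(2)] y c by blast
    qed
    moreover have "?X \<noteq> U" using xX False by blast
    ultimately have "a \<in> ?X" using max[of ?X] UX by blast
    then obtain u k where u: "a = u \<oplus>\<^bsub>A\<^esub> k \<odot>\<^bsub>A\<^esub> x" "u \<in> U" "k \<in> carrier K" by blast
    have "k \<noteq> \<zero>\<^bsub>K\<^esub>"
    proof
      assume "k = \<zero>\<^bsub>K\<^esub>"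
      then have "a = u" using u x Uc by auto
      with u U(2) show False by simp
    qed
    then have k: "inv\<^bsub>K\<^esub> k \<in> carrier K" "inv\<^bsub>K\<^esub> k \<otimes>\<^bsub>K\<^esub> k = \<one>\<^bsub>K\<^esub>" using u(3) K.field_Units by auto
    have uc: "u \<in> carrier A" using u Uc by blast
    let ?v = "(\<ominus>\<^bsub>K\<^esub> (inv\<^bsub>K\<^esub> k)) \<odot>\<^bsub>A\<^esub> u"
    have "?v \<oplus>\<^bsub>A\<^esub> inv\<^bsub>K\<^esub> k \<odot>\<^bsub>A\<^esub> a = (?v \<oplus>\<^bsub>A\<^esub> inv\<^bsub>K\<^esub> k \<odot>\<^bsub>A\<^esub> u) \<oplus>\<^bsub>A\<^esub> (inv\<^bsub>K\<^esub> k \<otimes>\<^bsub>K\<^esub> k) \<odot>\<^bsub>A\<^esub> x"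
      unfolding u(1) using k(1) uc x u(3) by (simp add: A.smult_r_distr A.smult_assoc1 A.a_assoc)
    also have "?v \<oplus>\<^bsub>A\<^esub> inv\<^bsub>K\<^esub> k \<odot>\<^bsub>A\<^esub> u = \<zero>\<^bsub>A\<^esub>"
      using k(1) uc by (simp add: A.smult_l_distr[symmetric] K.l_neg)
    finally have "x = ?v \<oplus>\<^bsub>A\<^esub> inv\<^bsub>K\<^esub> k \<odot>\<^bsub>A\<^esub> a" using k x by simp
    then show ?thesis using Us[OF _ u(2), of "\<ominus>\<^bsub>K\<^esub> (inv\<^bsub>K\<^esub> k)"] k(1) by blast
  qed
  \<comment> \<open>Two different coefficients would put a nonzero multiple of \<open>a\<close>, and
    hence \<open>a\<close> itself, into \<open>U\<close>.\<close>
  have uniq: "c = c'" if "c \<in> carrier K" "c' \<in> carrier K" "u \<in> U" "u' \<in> U"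
    "u \<oplus>\<^bsub>A\<^esub> c \<odot>\<^bsub>A\<^esub> a = u' \<oplus>\<^bsub>A\<^esub> c' \<odot>\<^bsub>A\<^esub> a" for c c' u u'
  proof (rule ccontr)
    assume ne: "c \<noteq> c'"
    let ?k = "c \<oplus>\<^bsub>K\<^esub> \<ominus>\<^bsub>K\<^esub> c'"
    have cs: "u \<in> carrier A" "u' \<in> carrier A" using that Uc by auto
    have "?k \<noteq> \<zero>\<^bsub>K\<^esub>" using ne that K.minus_eq_zeroD[of c c'] by (auto simp: K.minus_eq)
    then have k: "inv\<^bsub>K\<^esub> ?k \<in> carrier K" "inv\<^bsub>K\<^esub> ?k \<otimes>\<^bsub>K\<^esub> ?k = \<one>\<^bsub>K\<^esub>" using that K.field_Units by auto
    have "u \<oplus>\<^bsub>A\<^esub> ?k \<odot>\<^bsub>A\<^esub> a = (u \<oplus>\<^bsub>A\<^esub> c \<odot>\<^bsub>A\<^esub> a) \<oplus>\<^bsub>A\<^esub> (\<ominus>\<^bsub>K\<^esub> c') \<odot>\<^bsub>A\<^esub> a"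
      using that(1,2) cs a by (simp add: A.smult_l_distr A.a_assoc)
    also have "\<dots> = u' \<oplus>\<^bsub>A\<^esub> (c' \<odot>\<^bsub>A\<^esub> a \<oplus>\<^bsub>A\<^esub> (\<ominus>\<^bsub>K\<^esub> c') \<odot>\<^bsub>A\<^esub> a)"
      unfolding that(5) using that(1,2) cs a by (simp add: A.a_assoc)
    also have "c' \<odot>\<^bsub>A\<^esub> a \<oplus>\<^bsub>A\<^esub> (\<ominus>\<^bsub>K\<^esub> c') \<odot>\<^bsub>A\<^esub> a = \<zero>\<^bsub>A\<^esub>"
      using that a by (simp add: A.smult_l_distr[symmetric] K.r_neg)
    finally have e: "u \<oplus>\<^bsub>A\<^esub> ?k \<odot>\<^bsub>A\<^esub> a = u'" using cs by simp
    have "(\<ominus>\<^bsub>K\<^esub> \<one>\<^bsub>K\<^esub>) \<odot>\<^bsub>A\<^esub> u \<oplus>\<^bsub>A\<^esub> u' = ?k \<odot>\<^bsub>A\<^esub> a"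
      unfolding e[symmetric] using cs that(1,2) a by (simp add: A.smult_l_minus A.a_assoc[symmetric] A.l_neg)
    then have "?k \<odot>\<^bsub>A\<^esub> a \<in> U" using Ua[OF Us[of "\<ominus>\<^bsub>K\<^esub> \<one>\<^bsub>K\<^esub>" u] that(4)] that by simp
    from Us[OF k(1) this] have "a \<in> U"
      using A.smult_assoc1[OF k(1) _ a(1), of ?k] that k a by simp
    with U(2) show False ..
  qed
  define \<nu> where "\<nu> x = (THE c. c \<in> carrier K \<and> (\<exists>u\<in>U. x = u \<oplus>\<^bsub>A\<^esub> c \<odot>\<^bsub>A\<^esub> a))" for x
  have \<nu>: "\<nu> (u \<oplus>\<^bsub>A\<^esub> c \<odot>\<^bsub>A\<^esub> a) = c" if "c \<in> carrier K" "u \<in> U" for c u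
    unfolding \<nu>_def using that uniq by (intro the_equality) blast+
  have "linear_form K A \<nu>"
    unfolding linear_form_def
  proof (intro conjI ballI)
    fix x assume "x \<in> carrier A"
    then show "\<nu> x \<in> carrier K" using dec \<nu> by metis
  next
    fix x y assume x: "x \<in> carrier A" and y: "y \<in> carrier A"
    obtain c u where c: "c \<in> carrier K" "u \<in> U" "x = u \<oplus>\<^bsub>A\<^esub> c \<odot>\<^bsub>A\<^esub> a" using dec[OF x] by blast
    obtain c' u' where c': "c' \<in> carrier K" "u' \<in> U" "y = u' \<oplus>\<^bsub>A\<^esub> c' \<odot>\<^bsub>A\<^esub> a" using dec[OF y] by blast
    have "x \<oplus>\<^bsub>A\<^esub> y = (u \<oplus>\<^bsub>A\<^esub> u') \<oplus>\<^bsub>A\<^esub> (c \<oplus>\<^bsub>K\<^esub> c') \<odot>\<^bsub>A\<^esub> a"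
      using c c' Uc a by (simp add: A.smult_l_distr A.a_ac subset_iff)
    then show "\<nu> (x \<oplus>\<^bsub>A\<^esub> y) = \<nu> x \<oplus>\<^bsub>K\<^esub> \<nu> y"
      using \<nu>[of "c \<oplus>\<^bsub>K\<^esub> c'" "u \<oplus>\<^bsub>A\<^esub> u'"] \<nu>[OF c(1,2)] \<nu>[OF c'(1,2)] c c' Ua by simp
  next
    fix k x assume k: "k \<in> carrier K" and x: "x \<in> carrier A"
    obtain c u where c: "c \<in> carrier K" "u \<in> U" "x = u \<oplus>\<^bsub>A\<^esub> c \<odot>\<^bsub>A\<^esub> a" using dec[OF x] by blast
    have "k \<odot>\<^bsub>A\<^esub> x = k \<odot>\<^bsub>A\<^esub> u \<oplus>\<^bsub>A\<^esub> (k \<otimes>\<^bsub>K\<^esub> c) \<odot>\<^bsub>A\<^esub> a"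
      using c k Uc a by (simp add: A.smult_r_distr A.smult_assoc1 subset_iff)
    then show "\<nu> (k \<odot>\<^bsub>A\<^esub> x) = k \<otimes>\<^bsub>K\<^esub> \<nu> x"
      using \<nu>[of "k \<otimes>\<^bsub>K\<^esub> c" "k \<odot>\<^bsub>A\<^esub> u"] \<nu>[OF c(1,2)] c k Us by simp
  qed
  moreover have "\<nu> a = \<one>\<^bsub>K\<^esub>" using \<nu>[of "\<one>\<^bsub>K\<^esub>" "\<zero>\<^bsub>A\<^esub>"] Uc a by simp
  ultimately show ?thesis by blast
qed

section \<open>The null-square algebra and its coordinates\<close>

locale null_square = composable K A B N IN f h genN TN M IM g e genM TM
  for K :: "('k, 'u) ring_scheme" and A :: "('k, 'a) module" and B :: "('k, 'b) module"
    and N :: "('a, 'b, 'n) bimodule" and IN :: "'i set" and f h genN TN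
    and M :: "('b, 'a, 'm) bimodule" and IM :: "'j set" and g e genM TM
begin

abbreviation "L \<equiv> null_square_algebra A B M N"

lemma L_simps:
  "carrier L = carrier A \<times> carrier N \<times> carrier M \<times> carrier B"
  "(a, n, m, b) \<otimes>\<^bsub>L\<^esub> (a', n', m', b') =
     (a \<otimes>\<^bsub>A\<^esub> a', lact N a n' \<oplus>\<^bsub>N\<^esub> ract N n b', ract M m a' \<oplus>\<^bsub>M\<^esub> lact M b m', b \<otimes>\<^bsub>B\<^esub> b')"
  "\<one>\<^bsub>L\<^esub> = (\<one>\<^bsub>A\<^esub>, \<zero>\<^bsub>N\<^esub>, \<zero>\<^bsub>M\<^esub>, \<one>\<^bsub>B\<^esub>)" "\<zero>\<^bsub>L\<^esub> = (\<zero>\<^bsub>A\<^esub>, \<zero>\<^bsub>N\<^esub>, \<zero>\<^bsub>M\<^esub>, \<zero>\<^bsub>B\<^esub>)"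
  "(a, n, m, b) \<oplus>\<^bsub>L\<^esub> (a', n', m', b') = (a \<oplus>\<^bsub>A\<^esub> a', n \<oplus>\<^bsub>N\<^esub> n', m \<oplus>\<^bsub>M\<^esub> m', b \<oplus>\<^bsub>B\<^esub> b')"
  "c \<odot>\<^bsub>L\<^esub> (a, n, m, b) = (c \<odot>\<^bsub>A\<^esub> a, lact N (c \<odot>\<^bsub>A\<^esub> \<one>\<^bsub>A\<^esub>) n, lact M (c \<odot>\<^bsub>B\<^esub> \<one>\<^bsub>B\<^esub>) m, c \<odot>\<^bsub>B\<^esub> b)"
  by (simp_all add: null_square_algebra_def)

lemmas act_simps = N.lact_add_l N.lact_add_r N.ract_add_l N.ract_add_r N.lact_mult N.ract_mult N.lact_ract
  M.lact_add_l M.lact_add_r M.ract_add_l M.ract_add_r M.lact_mult M.ract_mult M.lact_ract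
  N.lact_zero N.ract_zero N.zero_lact N.zero_ract M.lact_zero M.ract_zero M.zero_lact M.zero_ract

lemma ring_L: "ring L"
proof (rule ringI)
  show "abelian_group L"
  proof (rule abelian_groupI)
    fix x assume "x \<in> carrier L"
    then obtain a n m b where x: "x = (a, n, m, b)" "a \<in> carrier A" "n \<in> carrier N" "m \<in> carrier M" "b \<in> carrier B"
      by (auto simp: L_simps)
    then show "\<exists>y\<in>carrier L. y \<oplus>\<^bsub>L\<^esub> x = \<zero>\<^bsub>L\<^esub>"
      by (intro bexI[of _ "(\<ominus>\<^bsub>A\<^esub> a, \<ominus>\<^bsub>N\<^esub> n, \<ominus>\<^bsub>M\<^esub> m, \<ominus>\<^bsub>B\<^esub> b)"])
        (auto simp: L_simps A.l_neg B.l_neg N.X.l_neg M.X.l_neg)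
  qed (auto simp: L_simps A.a_ac B.a_ac N.X.a_ac M.X.a_ac)
  show "Group.monoid L"
    by (rule monoidI) (auto simp: L_simps A.m_assoc B.m_assoc act_simps N.X.a_assoc M.X.a_assoc)
qed (auto simp: L_simps A.l_distr A.r_distr B.l_distr B.r_distr act_simps N.X.a_ac M.X.a_ac)

lemma ground_mult:
  "c \<in> carrier K \<Longrightarrow> a \<in> carrier A \<Longrightarrow> c \<odot>\<^bsub>A\<^esub> a = (c \<odot>\<^bsub>A\<^esub> \<one>\<^bsub>A\<^esub>) \<otimes>\<^bsub>A\<^esub> a"
  "c \<in> carrier K \<Longrightarrow> a \<in> carrier A \<Longrightarrow> a \<otimes>\<^bsub>A\<^esub> (c \<odot>\<^bsub>A\<^esub> \<one>\<^bsub>A\<^esub>) = (c \<odot>\<^bsub>A\<^esub> \<one>\<^bsub>A\<^esub>) \<otimes>\<^bsub>A\<^esub> a"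
  "c \<in> carrier K \<Longrightarrow> b \<in> carrier B \<Longrightarrow> c \<odot>\<^bsub>B\<^esub> b = (c \<odot>\<^bsub>B\<^esub> \<one>\<^bsub>B\<^esub>) \<otimes>\<^bsub>B\<^esub> b"
  "c \<in> carrier K \<Longrightarrow> b \<in> carrier B \<Longrightarrow> b \<otimes>\<^bsub>B\<^esub> (c \<odot>\<^bsub>B\<^esub> \<one>\<^bsub>B\<^esub>) = (c \<odot>\<^bsub>B\<^esub> \<one>\<^bsub>B\<^esub>) \<otimes>\<^bsub>B\<^esub> b"
  using k_algebraD(4,5)[OF alg_A] k_algebraD(4,5)[OF alg_B] by simp_all

lemma ground_add:
  "c \<in> carrier K \<Longrightarrow> c' \<in> carrier K \<Longrightarrow> (c \<oplus>\<^bsub>K\<^esub> c') \<odot>\<^bsub>A\<^esub> \<one>\<^bsub>A\<^esub> = c \<odot>\<^bsub>A\<^esub> \<one>\<^bsub>A\<^esub> \<oplus>\<^bsub>A\<^esub> c' \<odot>\<^bsub>A\<^esub> \<one>\<^bsub>A\<^esub>"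
  "c \<in> carrier K \<Longrightarrow> c' \<in> carrier K \<Longrightarrow> (c \<oplus>\<^bsub>K\<^esub> c') \<odot>\<^bsub>B\<^esub> \<one>\<^bsub>B\<^esub> = c \<odot>\<^bsub>B\<^esub> \<one>\<^bsub>B\<^esub> \<oplus>\<^bsub>B\<^esub> c' \<odot>\<^bsub>B\<^esub> \<one>\<^bsub>B\<^esub>"
  "c \<in> carrier K \<Longrightarrow> c' \<in> carrier K \<Longrightarrow> (c \<otimes>\<^bsub>K\<^esub> c') \<odot>\<^bsub>A\<^esub> \<one>\<^bsub>A\<^esub> = (c \<odot>\<^bsub>A\<^esub> \<one>\<^bsub>A\<^esub>) \<otimes>\<^bsub>A\<^esub> (c' \<odot>\<^bsub>A\<^esub> \<one>\<^bsub>A\<^esub>)"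
  "c \<in> carrier K \<Longrightarrow> c' \<in> carrier K \<Longrightarrow> (c \<otimes>\<^bsub>K\<^esub> c') \<odot>\<^bsub>B\<^esub> \<one>\<^bsub>B\<^esub> = (c \<odot>\<^bsub>B\<^esub> \<one>\<^bsub>B\<^esub>) \<otimes>\<^bsub>B\<^esub> (c' \<odot>\<^bsub>B\<^esub> \<one>\<^bsub>B\<^esub>)"
  using k_algebraD(4)[OF alg_A] k_algebraD(4)[OF alg_B]
  by (simp_all add: KA.smult_l_distr KB.smult_l_distr KA.smult_assoc1 KB.smult_assoc1)

text \<open>Scalars act on \<open>N\<close> and \<open>M\<close> from the left, through multiples of
  the unit. Their compatibility with right factors of a product rests on the agreement of the two
  actions of \<open>K\<close> on a bimodule.\<close>

lemma k_algebra_L: "k_algebra K L"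
proof -
  interpret L: ring L by (rule ring_L)
  have "lact N (c \<odot>\<^bsub>A\<^esub> (c' \<odot>\<^bsub>A\<^esub> \<one>\<^bsub>A\<^esub>)) n = lact N (c \<odot>\<^bsub>A\<^esub> \<one>\<^bsub>A\<^esub>) (lact N (c' \<odot>\<^bsub>A\<^esub> \<one>\<^bsub>A\<^esub>) n)"
    if "c \<in> carrier K" "c' \<in> carrier K" "n \<in> carrier N" for c c' n
    using that by (subst ground_mult(1)) (simp_all add: N.lact_mult)
  moreover have "lact M (c \<odot>\<^bsub>B\<^esub> (c' \<odot>\<^bsub>B\<^esub> \<one>\<^bsub>B\<^esub>)) m = lact M (c \<odot>\<^bsub>B\<^esub> \<one>\<^bsub>B\<^esub>) (lact M (c' \<odot>\<^bsub>B\<^esub> \<one>\<^bsub>B\<^esub>) m)"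
    if "c \<in> carrier K" "c' \<in> carrier K" "m \<in> carrier M" for c c' m
    using that by (subst ground_mult(3)) (simp_all add: M.lact_mult)
  ultimately have "module K L"
    by (intro moduleI[OF K.is_cring L.is_abelian_group]) (auto simp: L_simps KA.smult_l_distr KB.smult_l_distr KA.smult_r_distr KB.smult_r_distr
      KA.smult_assoc1 KB.smult_assoc1 act_simps ground_add)
  moreover have "(c \<odot>\<^bsub>L\<^esub> x) \<otimes>\<^bsub>L\<^esub> y = c \<odot>\<^bsub>L\<^esub> (x \<otimes>\<^bsub>L\<^esub> y) \<and> x \<otimes>\<^bsub>L\<^esub> (c \<odot>\<^bsub>L\<^esub> y) = c \<odot>\<^bsub>L\<^esub> (x \<otimes>\<^bsub>L\<^esub> y)"
    if c: "c \<in> carrier K" and xy: "x \<in> carrier L" "y \<in> carrier L" for c x y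
  proof -
    obtain a n m b where x: "x = (a, n, m, b)" "a \<in> carrier A" "n \<in> carrier N" "m \<in> carrier M" "b \<in> carrier B"
      using xy(1) by (auto simp: L_simps)
    obtain a' n' m' b' where y: "y = (a', n', m', b')" "a' \<in> carrier A" "n' \<in> carrier N" "m' \<in> carrier M" "b' \<in> carrier B"
      using xy(2) by (auto simp: L_simps)
    note alg = k_algebraD(4,5)[OF alg_A] k_algebraD(4,5)[OF alg_B]
    have "lact N a (lact N (c \<odot>\<^bsub>A\<^esub> \<one>\<^bsub>A\<^esub>) n') = lact N (c \<odot>\<^bsub>A\<^esub> \<one>\<^bsub>A\<^esub>) (lact N a n')"
      "lact M b (lact M (c \<odot>\<^bsub>B\<^esub> \<one>\<^bsub>B\<^esub>) m') = lact M (c \<odot>\<^bsub>B\<^esub> \<one>\<^bsub>B\<^esub>) (lact M b m')"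
      using c x y N.lact_mult[symmetric] M.lact_mult[symmetric] by (simp_all add: ground_mult(2,4))
    moreover have "lact N (c \<odot>\<^bsub>A\<^esub> a) n' = lact N (c \<odot>\<^bsub>A\<^esub> \<one>\<^bsub>A\<^esub>) (lact N a n')"
      "lact M (c \<odot>\<^bsub>B\<^esub> b) m' = lact M (c \<odot>\<^bsub>B\<^esub> \<one>\<^bsub>B\<^esub>) (lact M b m')"
      using c x y by (subst ground_mult, simp_all add: act_simps)+
    moreover have "ract N n (c \<odot>\<^bsub>B\<^esub> b') = lact N (c \<odot>\<^bsub>A\<^esub> \<one>\<^bsub>A\<^esub>) (ract N n b')"
      "ract M m (c \<odot>\<^bsub>A\<^esub> a') = lact M (c \<odot>\<^bsub>B\<^esub> \<one>\<^bsub>B\<^esub>) (ract M m a')"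
      using c x y
      by (subst N.ract_smult M.ract_smult,
          simp_all add: N.lact_ground[symmetric] M.lact_ground[symmetric] N.lact_ract M.lact_ract)+
    ultimately show ?thesis
      unfolding x(1) y(1) L_simps prod.inject
      using c x(2-) y(2-) by (simp add: alg N.lact_add_r N.lact_ract M.lact_add_r M.lact_ract)
  qed
  ultimately show ?thesis using ring_L K.field_axioms by (simp add: k_algebra_def)
qed

definition \<sigma> :: "'a \<times> 'n \<times> 'm \<times> 'b \<Rightarrow> 'a \<times> 'n \<times> 'm \<times> 'b" where
  "\<sigma> = (\<lambda>(a, n, m, b). (a, \<zero>\<^bsub>N\<^esub>, \<zero>\<^bsub>M\<^esub>, b))"

definition \<iota>A :: "'a \<Rightarrow> 'a \<times> 'n \<times> 'm \<times> 'b" where "\<iota>A a = (a, \<zero>\<^bsub>N\<^esub>, \<zero>\<^bsub>M\<^esub>, \<zero>\<^bsub>B\<^esub>)"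
definition \<iota>B :: "'b \<Rightarrow> 'a \<times> 'n \<times> 'm \<times> 'b" where "\<iota>B b = (\<zero>\<^bsub>A\<^esub>, \<zero>\<^bsub>N\<^esub>, \<zero>\<^bsub>M\<^esub>, b)"

lemma \<iota>_lin: "linear_form K L u \<Longrightarrow> linear_form K A (\<lambda>a. u (\<iota>A a))" "linear_form K L u \<Longrightarrow> linear_form K B (\<lambda>b. u (\<iota>B b))"
proof -
  have "\<iota>A (a \<oplus>\<^bsub>A\<^esub> a') = \<iota>A a \<oplus>\<^bsub>L\<^esub> \<iota>A a'" "\<iota>B (b \<oplus>\<^bsub>B\<^esub> b') = \<iota>B b \<oplus>\<^bsub>L\<^esub> \<iota>B b'" for a a' b b'
    by (simp_all add: \<iota>A_def \<iota>B_def L_simps)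
  moreover have "\<iota>A (c \<odot>\<^bsub>A\<^esub> a) = c \<odot>\<^bsub>L\<^esub> \<iota>A a" "\<iota>B (c \<odot>\<^bsub>B\<^esub> b) = c \<odot>\<^bsub>L\<^esub> \<iota>B b" if "c \<in> carrier K" for c a b
    using that by (simp_all add: \<iota>A_def \<iota>B_def L_simps act_simps KA.smult_r_null KB.smult_r_null)
  moreover have "a \<in> carrier A \<Longrightarrow> \<iota>A a \<in> carrier L" "b \<in> carrier B \<Longrightarrow> \<iota>B b \<in> carrier L" for a b
    by (simp_all add: \<iota>A_def \<iota>B_def L_simps)
  ultimately show "linear_form K L u \<Longrightarrow> linear_form K A (\<lambda>a. u (\<iota>A a))" "linear_form K L u \<Longrightarrow> linear_form K B (\<lambda>b. u (\<iota>B b))"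
    by (simp_all add: linear_form_def)
qed

lemma \<iota>_closed: "a \<in> carrier A \<Longrightarrow> \<iota>A a \<in> carrier L" "b \<in> carrier B \<Longrightarrow> \<iota>B b \<in> carrier L"
  by (simp_all add: \<iota>A_def \<iota>B_def L_simps)

lemma \<iota>_mult:
  "l \<in> carrier L \<Longrightarrow> u \<in> carrier A \<Longrightarrow> \<sigma> l \<otimes>\<^bsub>L\<^esub> \<iota>A u = \<iota>A (fst l \<otimes>\<^bsub>A\<^esub> u)"
  "l \<in> carrier L \<Longrightarrow> u \<in> carrier A \<Longrightarrow> \<iota>A u \<otimes>\<^bsub>L\<^esub> \<sigma> l = \<iota>A (u \<otimes>\<^bsub>A\<^esub> fst l)"
  "l \<in> carrier L \<Longrightarrow> v \<in> carrier B \<Longrightarrow> \<sigma> l \<otimes>\<^bsub>L\<^esub> \<iota>B v = \<iota>B (snd (snd (snd l)) \<otimes>\<^bsub>B\<^esub> v)"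
  "l \<in> carrier L \<Longrightarrow> v \<in> carrier B \<Longrightarrow> \<iota>B v \<otimes>\<^bsub>L\<^esub> \<sigma> l = \<iota>B (v \<otimes>\<^bsub>B\<^esub> snd (snd (snd l)))"
  by (auto simp: L_simps \<sigma>_def \<iota>A_def \<iota>B_def act_simps)

lemma bil_restrict:
  assumes "bilinear_form K L L \<beta>"
  shows "bilinear_form K A B (\<lambda>u v. \<beta> (\<iota>A u) (\<iota>B v))" "bilinear_form K B A (\<lambda>u v. \<beta> (\<iota>B u) (\<iota>A v))"
  using assms \<iota>_lin(1)[of "\<lambda>u. \<beta> u v" for v] \<iota>_lin(2)[of "\<lambda>u. \<beta> u v" for v] \<iota>_lin[of "\<beta> v" for v]
  by (simp_all add: bilinear_form_def \<iota>_closed)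

text \<open>The index runs over the summands of both bimodules, since the word alternates between
  them. A form on \<open>L\<close> is restricted to the two diagonal corners in which the halves of
  the respective summand lie.\<close>

definition TL :: "'i + 'j \<Rightarrow> ('a \<times> 'n \<times> 'm \<times> 'b \<Rightarrow> 'a \<times> 'n \<times> 'm \<times> 'b \<Rightarrow> 'k) \<Rightarrow> 'a \<times> 'n \<times> 'm \<times> 'b \<Rightarrow> 'k" where
  "TL z \<beta> l = (case z of
      Inl x \<Rightarrow> TN x (\<lambda>u v. \<beta> (\<iota>A u) (\<iota>B v)) (fst (snd l))
    | Inr y \<Rightarrow> TM y (\<lambda>u v. \<beta> (\<iota>B u) (\<iota>A v)) (fst (snd (snd l))))"

text \<open>The third claim is the derivation rule: an off-diagonal entry of a product is a sum of
  two terms, in each of which one factor supplies the off-diagonal entry and the other acts by its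
  diagonal. The fourth says that coordinates vanish on diagonal matrices.\<close>

lemma TL:
  assumes z: "z \<in> IN <+> IM" and \<beta>: "bilinear_form K L L \<beta>" and l: "l \<in> carrier L"
  shows "TL z \<beta> l \<in> carrier K"
    "l' \<in> carrier L \<Longrightarrow> TL z \<beta> (l \<oplus>\<^bsub>L\<^esub> l') = TL z \<beta> l \<oplus>\<^bsub>K\<^esub> TL z \<beta> l'"
    "l' \<in> carrier L \<Longrightarrow> TL z \<beta> (l \<otimes>\<^bsub>L\<^esub> l') =
        TL z (\<lambda>u v. \<beta> (\<sigma> l \<otimes>\<^bsub>L\<^esub> u) v) l' \<oplus>\<^bsub>K\<^esub> TL z (\<lambda>u v. \<beta> u (v \<otimes>\<^bsub>L\<^esub> \<sigma> l')) l"
    "\<sigma> l = l \<Longrightarrow> TL z \<beta> l = \<zero>\<^bsub>K\<^esub>"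
    "bilinear_form K L L \<gamma> \<Longrightarrow> TL z (\<lambda>u v. \<beta> u v \<oplus>\<^bsub>K\<^esub> \<gamma> u v) l = TL z \<beta> l \<oplus>\<^bsub>K\<^esub> TL z \<gamma> l"
    "c \<in> carrier K \<Longrightarrow> TL z (\<lambda>u v. c \<otimes>\<^bsub>K\<^esub> \<beta> u v) l = c \<otimes>\<^bsub>K\<^esub> TL z \<beta> l"
    "(\<And>u v. u \<in> carrier L \<Longrightarrow> v \<in> carrier L \<Longrightarrow> \<beta> u v = \<gamma> u v) \<Longrightarrow> TL z \<beta> l = TL z \<gamma> l"
proof -
  note \<beta>' = bil_restrict[OF \<beta>]
  obtain a n m b where le: "l = (a, n, m, b)" "a \<in> carrier A" "n \<in> carrier N" "m \<in> carrier M" "b \<in> carrier B"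
    using l by (auto simp: L_simps)
  have TN0: "TN x (\<lambda>u v. \<beta> (\<iota>A u) (\<iota>B v)) \<zero>\<^bsub>N\<^esub> = \<zero>\<^bsub>K\<^esub>" if "x \<in> IN" for x
    by (rule additive_zero[OF N.X.abelian_group_axioms K.is_abelian_group])
      (use that N.T_closed[OF _ \<beta>'(1)] N.T_add[OF _ \<beta>'(1)] in auto)
  have TM0: "TM y (\<lambda>u v. \<beta> (\<iota>B u) (\<iota>A v)) \<zero>\<^bsub>M\<^esub> = \<zero>\<^bsub>K\<^esub>" if "y \<in> IM" for y
    by (rule additive_zero[OF M.X.abelian_group_axioms K.is_abelian_group])
      (use that M.T_closed[OF _ \<beta>'(2)] M.T_add[OF _ \<beta>'(2)] in auto)
  show "TL z \<beta> l \<in> carrier K" using z le \<beta>' N.T_closed M.T_closed by (auto simp: TL_def)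
  show "TL z \<beta> (l \<oplus>\<^bsub>L\<^esub> l') = TL z \<beta> l \<oplus>\<^bsub>K\<^esub> TL z \<beta> l'" if "l' \<in> carrier L"
    using z le \<beta>' that N.T_add M.T_add by (auto simp: TL_def L_simps)
  show "\<sigma> l = l \<Longrightarrow> TL z \<beta> l = \<zero>\<^bsub>K\<^esub>" using z le TN0 TM0 by (auto simp: TL_def \<sigma>_def)
  show "TL z (\<lambda>u v. \<beta> u v \<oplus>\<^bsub>K\<^esub> \<gamma> u v) l = TL z \<beta> l \<oplus>\<^bsub>K\<^esub> TL z \<gamma> l" if "bilinear_form K L L \<gamma>"
    using z le \<beta>' bil_restrict[OF that] N.T_add_form M.T_add_form by (auto simp: TL_def)
  show "TL z (\<lambda>u v. c \<otimes>\<^bsub>K\<^esub> \<beta> u v) l = c \<otimes>\<^bsub>K\<^esub> TL z \<beta> l" if "c \<in> carrier K"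
    using z le \<beta>' that N.T_scale_form M.T_scale_form by (auto simp: TL_def)
  show "TL z \<beta> l = TL z \<gamma> l" if "\<And>u v. u \<in> carrier L \<Longrightarrow> v \<in> carrier L \<Longrightarrow> \<beta> u v = \<gamma> u v"
  proof (cases z)
    case (Inl x)
    show ?thesis unfolding Inl TL_def le
      by (simp, rule N.T_cong[OF _ \<beta>'(1) _ le(3)]) (use z Inl that \<iota>_closed in \<open>blast | simp\<close>)+
  next
    case (Inr y)
    show ?thesis unfolding Inr TL_def le
      by (simp, rule M.T_cong[OF _ \<beta>'(2) _ le(4)]) (use z Inr that \<iota>_closed in \<open>blast | simp\<close>)+
  qed
  show "TL z \<beta> (l \<otimes>\<^bsub>L\<^esub> l') =
      TL z (\<lambda>u v. \<beta> (\<sigma> l \<otimes>\<^bsub>L\<^esub> u) v) l' \<oplus>\<^bsub>K\<^esub> TL z (\<lambda>u v. \<beta> u (v \<otimes>\<^bsub>L\<^esub> \<sigma> l')) l" if l': "l' \<in> carrier L"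
  proof -
    obtain a' n' m' b' where le': "l' = (a', n', m', b')" "a' \<in> carrier A" "n' \<in> carrier N" "m' \<in> carrier M" "b' \<in> carrier B"
      using l' by (auto simp: L_simps)
    show ?thesis
    proof (cases z)
      case (Inl x)
      then have x: "x \<in> IN" using z by auto
      have "TL z \<beta> (l \<otimes>\<^bsub>L\<^esub> l') = TN x (\<lambda>u v. \<beta> (\<iota>A u) (\<iota>B v)) (lact N a n') \<oplus>\<^bsub>K\<^esub> TN x (\<lambda>u v. \<beta> (\<iota>A u) (\<iota>B v)) (ract N n b')"
        unfolding le le' Inl TL_def using le le' N.T_add[OF x \<beta>'(1)] by (simp add: L_simps)
      also have "TN x (\<lambda>u v. \<beta> (\<iota>A u) (\<iota>B v)) (lact N a n') = TN x (\<lambda>u v. \<beta> (\<iota>A (a \<otimes>\<^bsub>A\<^esub> u)) (\<iota>B v)) n'"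
        by (rule N.T_lact[OF x \<beta>'(1) le'(3) le(2)])
      also have "\<dots> = TN x (\<lambda>u v. \<beta> (\<sigma> l \<otimes>\<^bsub>L\<^esub> \<iota>A u) (\<iota>B v)) n'"
        by (rule N.T_cong[OF x N.bilinear_form_closure(3)[OF \<beta>'(1) le(2)] _ le'(3)]) (use l le in \<open>simp add: \<iota>_mult\<close>)
      also have "TN x (\<lambda>u v. \<beta> (\<iota>A u) (\<iota>B v)) (ract N n b') = TN x (\<lambda>u v. \<beta> (\<iota>A u) (\<iota>B (v \<otimes>\<^bsub>B\<^esub> b'))) n"
        by (rule N.T_ract[OF x \<beta>'(1) le(3) le'(5)])
      also have "\<dots> = TN x (\<lambda>u v. \<beta> (\<iota>A u) (\<iota>B v \<otimes>\<^bsub>L\<^esub> \<sigma> l')) n"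
        by (rule N.T_cong[OF x N.bilinear_form_closure(4)[OF \<beta>'(1) le'(5)] _ le(3)]) (use l' le' in \<open>simp add: \<iota>_mult\<close>)
      finally show ?thesis unfolding Inl TL_def using le le' by simp
    next
      case (Inr y)
      then have y: "y \<in> IM" using z by auto
      have "TL z \<beta> (l \<otimes>\<^bsub>L\<^esub> l') = TM y (\<lambda>u v. \<beta> (\<iota>B u) (\<iota>A v)) (ract M m a') \<oplus>\<^bsub>K\<^esub> TM y (\<lambda>u v. \<beta> (\<iota>B u) (\<iota>A v)) (lact M b m')"
        unfolding le le' Inr TL_def using le le' M.T_add[OF y \<beta>'(2)] by (simp add: L_simps)
      also have "TM y (\<lambda>u v. \<beta> (\<iota>B u) (\<iota>A v)) (lact M b m') = TM y (\<lambda>u v. \<beta> (\<iota>B (b \<otimes>\<^bsub>B\<^esub> u)) (\<iota>A v)) m'"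
        by (rule M.T_lact[OF y \<beta>'(2) le'(4) le(5)])
      also have "\<dots> = TM y (\<lambda>u v. \<beta> (\<sigma> l \<otimes>\<^bsub>L\<^esub> \<iota>B u) (\<iota>A v)) m'"
        by (rule M.T_cong[OF y bilinear_form_closure(3)[OF \<beta>'(2) le(5)] _ le'(4)]) (use l le in \<open>simp add: \<iota>_mult\<close>)
      also have "TM y (\<lambda>u v. \<beta> (\<iota>B u) (\<iota>A v)) (ract M m a') = TM y (\<lambda>u v. \<beta> (\<iota>B u) (\<iota>A (v \<otimes>\<^bsub>A\<^esub> a'))) m"
        by (rule M.T_ract[OF y \<beta>'(2) le(4) le'(2)])
      also have "\<dots> = TM y (\<lambda>u v. \<beta> (\<iota>B u) (\<iota>A v \<otimes>\<^bsub>L\<^esub> \<sigma> l')) m"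
        by (rule M.T_cong[OF y bilinear_form_closure(4)[OF \<beta>'(2) le'(2)] _ le(4)]) (use l' le' in \<open>simp add: \<iota>_mult\<close>)
      finally have eq: "TL z \<beta> (l \<otimes>\<^bsub>L\<^esub> l') = TM y (\<lambda>u v. \<beta> (\<iota>B u) (\<iota>A v \<otimes>\<^bsub>L\<^esub> \<sigma> l')) m \<oplus>\<^bsub>K\<^esub>
          TM y (\<lambda>u v. \<beta> (\<sigma> l \<otimes>\<^bsub>L\<^esub> \<iota>B u) (\<iota>A v)) m'" .
      \<comment> \<open>In the entry from \<open>M\<close> the term with the right action comes
        first. The summands have to be exchanged, for which both must be known to lie in
        \<open>K\<close>.\<close>
      have "TM y (\<lambda>u v. \<beta> (\<iota>B u) (\<iota>A v \<otimes>\<^bsub>L\<^esub> \<sigma> l')) m \<in> carrier K"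
        "TM y (\<lambda>u v. \<beta> (\<sigma> l \<otimes>\<^bsub>L\<^esub> \<iota>B u) (\<iota>A v)) m' \<in> carrier K"
      proof -
        have "bilinear_form K B A (\<lambda>u v. \<beta> (\<iota>B u) (\<iota>A v \<otimes>\<^bsub>L\<^esub> \<sigma> l'))"
          using bilinear_form_closure(4)[OF \<beta>'(2) le'(2)] l' le'
          by (subst bilinear_form_cong[of _ "\<lambda>u v. \<beta> (\<iota>B u) (\<iota>A (v \<otimes>\<^bsub>A\<^esub> a'))"]) (simp_all add: \<iota>_mult)
        then show "TM y (\<lambda>u v. \<beta> (\<iota>B u) (\<iota>A v \<otimes>\<^bsub>L\<^esub> \<sigma> l')) m \<in> carrier K" using M.T_closed[OF y] le by blast
        have "bilinear_form K B A (\<lambda>u v. \<beta> (\<sigma> l \<otimes>\<^bsub>L\<^esub> \<iota>B u) (\<iota>A v))"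
          using bilinear_form_closure(3)[OF \<beta>'(2) le(5)] l le
          by (subst bilinear_form_cong[of _ "\<lambda>u v. \<beta> (\<iota>B (b \<otimes>\<^bsub>B\<^esub> u)) (\<iota>A v)"]) (simp_all add: \<iota>_mult)
        then show "TM y (\<lambda>u v. \<beta> (\<sigma> l \<otimes>\<^bsub>L\<^esub> \<iota>B u) (\<iota>A v)) m' \<in> carrier K" using M.T_closed[OF y] le' by blast
      qed
      with eq show ?thesis unfolding Inr TL_def using le le' by (simp add: K.a_comm)
    qed
  qed
qed

end

context null_square begin

lemma TN_zero:
  "x \<in> IN \<Longrightarrow> bilinear_form K A B \<beta> \<Longrightarrow> TN x \<beta> \<zero>\<^bsub>N\<^esub> = \<zero>\<^bsub>K\<^esub>"
  by (rule additive_zero[OF N.X.abelian_group_axioms K.is_abelian_group]) (auto intro: N.T_closed N.T_add)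

lemma TN_gen_ract:
  assumes "x \<in> IN" "x' \<in> IN" "b \<in> carrier B" "bilinear_form K A B \<beta>"
  shows "TN x \<beta> (ract N (genN x') b) = (if x = x' then \<beta> (f x) (h x \<otimes>\<^bsub>B\<^esub> b) else \<zero>\<^bsub>K\<^esub>)"
  using N.T_ract[OF assms(1,4) N.gen_closed[OF assms(2)] assms(3)]
    N.T_gen[OF assms(1,2) N.bilinear_form_closure(4)[OF assms(4,3)]] by simp

lemma TM_gen_ract:
  assumes "y \<in> IM" "a \<in> carrier A" "bilinear_form K B A \<beta>"
  shows "TM y \<beta> (ract M (genM y) a) = \<beta> (g y) (e y \<otimes>\<^bsub>A\<^esub> a)"
  using M.T_ract[OF assms(1,3) M.gen_closed[OF assms(1)] assms(2)]
    M.T_gen[OF assms(1,1) bilinear_form_closure(4)[OF assms(3,2)]] by simp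

text \<open>A loop of least length through a vertex returns to that vertex only at its end. This is
  what later singles out one rotation of the word.\<close>

lemma quiver_loop:
  assumes "\<not> acyclic quiver"
  obtains s :: "nat \<Rightarrow> 'i" and l :: nat where "0 < l" "s l = s 0" "\<And>i. i < l \<Longrightarrow> (s i, s (Suc i)) \<in> quiver"
    "\<And>i. 0 < i \<Longrightarrow> i < l \<Longrightarrow> s i \<noteq> s 0"
proof -
  obtain x where "(x, x) \<in> quiver\<^sup>+" using assms by (auto simp: acyclic_def)
  then have ex: "\<exists>n. 0 < n \<and> (x, x) \<in> quiver ^^ n" by (auto simp: trancl_power)
  define l where "l = (LEAST n. 0 < n \<and> (x, x) \<in> quiver ^^ n)"
  have l: "0 < l" "(x, x) \<in> quiver ^^ l" using LeastI_ex[OF ex] by (auto simp: l_def)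
  have least: "(x, x) \<notin> quiver ^^ i" if "0 < i" "i < l" for i
    using not_less_Least[of i "\<lambda>n. 0 < n \<and> (x, x) \<in> quiver ^^ n"] that by (auto simp: l_def)
  obtain s where s: "s 0 = x" "s l = x" "\<forall>i<l. (s i, s (Suc i)) \<in> quiver" using l(2) unfolding relpow_fun_conv by blast
  have "s i \<noteq> s 0" if "0 < i" "i < l" for i
  proof
    assume "s i = s 0"
    then have "(x, x) \<in> quiver ^^ i" unfolding relpow_fun_conv using s that by (intro exI[of _ s]) auto
    with least[OF that] show False ..
  qed
  with s l show ?thesis by (intro that[of l s]) auto
qed

theorem HH_nontrivial_of_loop:
  assumes res: "hochschild_resolution K L P d \<epsilon>" and "\<not> acyclic quiver"
  shows "\<exists>l>0. \<forall>m>0. \<not> trivial_group (HH K L P d (m * l))"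
proof -
  obtain s :: "nat \<Rightarrow> 'i" and l where l: "0 < l" and s: "s l = s 0" "\<And>i. i < l \<Longrightarrow> (s i, s (Suc i)) \<in> quiver"
    "\<And>i. 0 < i \<Longrightarrow> i < l \<Longrightarrow> s i \<noteq> s 0" using quiver_loop[OF assms(2)] by metis
  have sI: "s i \<in> IN" if "i < l" for i using s(2)[OF that] by (auto simp: quiver_def)
  \<comment> \<open>Each edge yields a summand of \<open>M\<close> and nonzero elements of
    \<open>h B g\<close> and \<open>e A f\<close>. Their middle factors become the coefficients of
    the letters, and linear forms with value \<open>1\<close> on them become the
    contractions.\<close>
  have "\<exists>y b a \<nu> \<nu>'. y \<in> IM \<and> b \<in> carrier B \<and> a \<in> carrier A \<and>
      linear_form K B \<nu> \<and> \<nu> (h (s i) \<otimes>\<^bsub>B\<^esub> b \<otimes>\<^bsub>B\<^esub> g y) = \<one>\<^bsub>K\<^esub> \<and>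
      linear_form K A \<nu>' \<and> \<nu>' (e y \<otimes>\<^bsub>A\<^esub> a \<otimes>\<^bsub>A\<^esub> f (s (Suc i))) = \<one>\<^bsub>K\<^esub>" if i: "i < l" for i
  proof -
    have sq: "(s i, s (Suc i)) \<in> quiver" by (rule s(2)[OF i])
    then obtain y b a where y: "y \<in> IM" and b: "b \<in> carrier B" "h (s i) \<otimes>\<^bsub>B\<^esub> b \<otimes>\<^bsub>B\<^esub> g y \<noteq> \<zero>\<^bsub>B\<^esub>"
      and a: "a \<in> carrier A" "e y \<otimes>\<^bsub>A\<^esub> a \<otimes>\<^bsub>A\<^esub> f (s (Suc i)) \<noteq> \<zero>\<^bsub>A\<^esub>"
      unfolding quiver_def linked_NM_def linked_MN_def by blast
    have "s i \<in> IN" "s (Suc i) \<in> IN" using sq by (auto simp: quiver_def)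
    then have c: "h (s i) \<otimes>\<^bsub>B\<^esub> b \<otimes>\<^bsub>B\<^esub> g y \<in> carrier B" "e y \<otimes>\<^bsub>A\<^esub> a \<otimes>\<^bsub>A\<^esub> f (s (Suc i)) \<in> carrier A"
      using y a b N.r_closed N.l_closed M.r_closed M.l_closed by auto
    obtain \<nu> where "linear_form K B \<nu>" "\<nu> (h (s i) \<otimes>\<^bsub>B\<^esub> b \<otimes>\<^bsub>B\<^esub> g y) = \<one>\<^bsub>K\<^esub>"
      using exists_linear_form[OF K.field_axioms KB.module_axioms c(1) b(2)] by blast
    moreover obtain \<nu>' where "linear_form K A \<nu>'" "\<nu>' (e y \<otimes>\<^bsub>A\<^esub> a \<otimes>\<^bsub>A\<^esub> f (s (Suc i))) = \<one>\<^bsub>K\<^esub>"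
      using exists_linear_form[OF K.field_axioms KA.module_axioms c(2) a(2)] by blast
    ultimately show ?thesis using y a(1) b(1) by blast
  qed
  \<comment> \<open>The bound on \<open>i\<close> is moved inside the existential quantifiers so
    that choice gives functions of all \<open>i\<close>.\<close>
  then have "\<forall>i. \<exists>y b a \<nu> \<nu>'. i < l \<longrightarrow> y \<in> IM \<and> b \<in> carrier B \<and> a \<in> carrier A \<and>
      linear_form K B \<nu> \<and> \<nu> (h (s i) \<otimes>\<^bsub>B\<^esub> b \<otimes>\<^bsub>B\<^esub> g y) = \<one>\<^bsub>K\<^esub> \<and>
      linear_form K A \<nu>' \<and> \<nu>' (e y \<otimes>\<^bsub>A\<^esub> a \<otimes>\<^bsub>A\<^esub> f (s (Suc i))) = \<one>\<^bsub>K\<^esub>" by blast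
  then obtain y b a \<nu> \<nu>' where ya: "\<forall>i. i < l \<longrightarrow> y i \<in> IM \<and> b i \<in> carrier B \<and> a i \<in> carrier A \<and>
      linear_form K B (\<nu> i) \<and> \<nu> i (h (s i) \<otimes>\<^bsub>B\<^esub> b i \<otimes>\<^bsub>B\<^esub> g (y i)) = \<one>\<^bsub>K\<^esub> \<and>
      linear_form K A (\<nu>' i) \<and> \<nu>' i (e (y i) \<otimes>\<^bsub>A\<^esub> a i \<otimes>\<^bsub>A\<^esub> f (s (Suc i))) = \<one>\<^bsub>K\<^esub>"
    unfolding choice_iff by blast
  \<comment> \<open>Each edge of the loop is spelled by two letters, one from \<open>N\<close> at an
    even position and one from \<open>M\<close> at the next; \<open>q k\<close> is the edge to which
    letter \<open>k\<close> belongs. The period of the word is therefore twice the length of the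
    loop.\<close>
  define q where "q k = k div 2 mod l" for k :: nat
  have q: "q k < l" for k using l by (simp add: q_def)
  have q_per: "q (k + 2 * l) = q k" for k by (simp add: q_def)
  have q_even: "q (Suc k) = q k" if "even k" for k using that by (simp add: q_def)
  \<comment> \<open>The equation holds only after applying \<open>s\<close>: at the end of the loop
    \<open>q\<close> jumps back to \<open>0\<close> while \<open>Suc (q k)\<close> is
    \<open>l\<close>, and \<open>s\<close> has the same value at both.\<close>
  have q_odd: "s (q (Suc k)) = s (Suc (q k))" if "odd k" for k
  proof -
    have "Suc k div 2 = Suc (k div 2)" using that by presburger
    then show ?thesis using s(1) by (auto simp: q_def mod_Suc)
  qed
  have sq: "s (q k) \<in> IN" "y (q k) \<in> IM" "b (q k) \<in> carrier B" "a (q k) \<in> carrier A" for k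
    using sI[OF q] ya[rule_format, OF q] by blast+
  have cl: "f (s (q k)) \<in> carrier A" "h (s (q k)) \<in> carrier B" "g (y (q k)) \<in> carrier B" "e (y (q k)) \<in> carrier A"
    "genN (s (q k)) \<in> carrier N" "genM (y (q k)) \<in> carrier M" for k
    using N.l_closed[OF sq(1)] N.r_closed[OF sq(1)] M.l_closed[OF sq(2)] M.r_closed[OF sq(2)]
      N.gen_closed[OF sq(1)] M.gen_closed[OF sq(2)] by auto
  define z where "z k = (if even k then Inl (s (q k)) else Inr (y (q k)))" for k
  have z: "z k \<in> IN <+> IM" for k using sq by (auto simp: z_def)
  \<comment> \<open>The coefficient of a letter is put on its right, so the head \<open>pp k\<close>
    of its coordinate is a bare idempotent and the coefficient is part of the tail
    \<open>aa k\<close>.\<close>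
  define jj where "jj k = (if even k then (\<zero>\<^bsub>A\<^esub>, ract N (genN (s (q k))) (b (q k)), \<zero>\<^bsub>M\<^esub>, \<zero>\<^bsub>B\<^esub>)
      else (\<zero>\<^bsub>A\<^esub>, \<zero>\<^bsub>N\<^esub>, ract M (genM (y (q k))) (a (q k)), \<zero>\<^bsub>B\<^esub>))" for k
  define pp where "pp k = (if even k then \<iota>A (f (s (q k))) else \<iota>B (g (y (q k))))" for k
  define aa where "aa k = (if even k then \<iota>B (h (s (q k)) \<otimes>\<^bsub>B\<^esub> b (q k)) else \<iota>A (e (y (q k)) \<otimes>\<^bsub>A\<^esub> a (q k)))" for k
  \<comment> \<open>The product of \<open>aa k\<close> and \<open>pp (Suc k)\<close> lies in the
    corner \<open>B\<close> for even \<open>k\<close> and in the corner \<open>A\<close> for odd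
    \<open>k\<close>; there it is the element on which the chosen form is \<open>1\<close>.\<close>
  define \<mu> :: "nat \<Rightarrow> 'a \<times> 'n \<times> 'm \<times> 'b \<Rightarrow> 'k"
    where "\<mu> k u = (if even k then \<nu> (q k) (snd (snd (snd u))) else \<nu>' (q k) (fst u))" for k u
  have "ring (enveloping_algebra K L)"
    using res by (simp add: hochschild_resolution_def projective_resolution_def left_module_def)
  then interpret enveloping K L by (intro enveloping.intro k_algebra_L)
  interpret split_algebra K L \<sigma>
    by unfold_locales (auto simp: L_simps \<sigma>_def act_simps)
  interpret cyclic_word_resolution K L \<sigma> "\<lambda>k. TL (z k)" jj pp aa \<mu> "2 * l" P d \<epsilon>
  proof unfold_locales
    fix k k'
    show "jj k \<in> carrier L" "pp k \<in> carrier L" "aa k \<in> carrier L"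
      using sq cl by (auto simp: jj_def pp_def aa_def L_simps(1) \<iota>_closed[unfolded L_simps(1)])
    show "\<sigma> (jj k) = \<zero>\<^bsub>L\<^esub>" by (simp add: \<sigma>_def jj_def L_simps)
    show "jj k \<otimes>\<^bsub>L\<^esub> jj k' = \<zero>\<^bsub>L\<^esub>" using sq cl by (auto simp: jj_def L_simps act_simps)
    show "linear_form K L (\<mu> k)"
      using ya[rule_format, OF q[of k]] by (auto simp: linear_form_def \<mu>_def L_simps)
    show "jj (k + 2 * l) = jj k" "pp (k + 2 * l) = pp k" by (simp_all add: jj_def pp_def q_per)
    show "\<mu> k (aa k \<otimes>\<^bsub>L\<^esub> pp (Suc k)) = \<one>\<^bsub>K\<^esub>"
    proof (cases "even k")
      case True
      then show ?thesis using ya[rule_format, OF q[of k]] sq cl q_even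
        by (simp add: \<mu>_def aa_def pp_def \<iota>B_def L_simps)
    next
      case False
      then show ?thesis using ya[rule_format, OF q[of k]] sq cl q_odd[OF False]
        by (simp add: \<mu>_def aa_def pp_def \<iota>A_def L_simps)
    qed
    fix \<beta> assume \<beta>: "bil \<beta>"
    show "TL (z k) \<beta> (jj k) = \<beta> (pp k) (aa k)"
      using TN_gen_ract[OF sq(1) sq(1) sq(3) bil_restrict(1)[OF \<beta>]] TM_gen_ract[OF sq(2) sq(4) bil_restrict(2)[OF \<beta>]]
      by (simp add: TL_def z_def jj_def pp_def aa_def)
    \<comment> \<open>At an odd position the entry in \<open>N\<close> is zero. At an even one the
      letter lies in a different summand of \<open>N\<close>, because the loop has not yet returned
      to \<open>s 0\<close>.\<close>
    show "TL (z 0) \<beta> (jj k) = \<zero>\<^bsub>K\<^esub>" if "0 < k" "k < 2 * l"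
    proof (cases "even k")
      case True
      then have "q k = k div 2" "0 < k div 2" "k div 2 < l" using that by (auto simp: q_def elim!: evenE)
      then have ne: "s (q 0) \<noteq> s (q k)" using s(3)[of "q k"] by (auto simp: q_def)
      show ?thesis using TN_gen_ract[OF sq(1)[of 0] sq(1)[of k] sq(3)[of k] bil_restrict(1)[OF \<beta>]] True ne
        by (simp add: TL_def z_def jj_def)
    next
      case False
      then show ?thesis using TN_zero[OF sq(1)[of 0] bil_restrict(1)[OF \<beta>]] by (simp add: TL_def z_def jj_def)
    qed
    show "TL (z k) \<beta> (c \<odot>\<^bsub>L\<^esub> \<one>\<^bsub>L\<^esub>) = \<zero>\<^bsub>K\<^esub>" if c: "c \<in> carrier K" for c
      by (rule TL(4)[OF z \<beta>]) (use c in \<open>simp_all add: \<sigma>_def L_simps act_simps\<close>)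
    fix u assume u: "u \<in> carrier L"
    show "TL (z k) \<beta> u \<in> carrier K" by (rule TL(1)[OF z \<beta> u])
    show "TL (z k) \<beta> (u \<oplus>\<^bsub>L\<^esub> v) = TL (z k) \<beta> u \<oplus>\<^bsub>K\<^esub> TL (z k) \<beta> v"
      "TL (z k) \<beta> (u \<otimes>\<^bsub>L\<^esub> v) = TL (z k) (\<lambda>x y. \<beta> (\<sigma> u \<otimes>\<^bsub>L\<^esub> x) y) v \<oplus>\<^bsub>K\<^esub>
        TL (z k) (\<lambda>x y. \<beta> x (y \<otimes>\<^bsub>L\<^esub> \<sigma> v)) u" if "v \<in> carrier L" for v
      by (rule TL(2)[OF z \<beta> u that], rule TL(3)[OF z \<beta> u that])
    show "TL (z k) (\<lambda>x y. c \<otimes>\<^bsub>K\<^esub> \<beta> x y) u = c \<otimes>\<^bsub>K\<^esub> TL (z k) \<beta> u" if "c \<in> carrier K" for c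
      by (rule TL(6)[OF z \<beta> u that])
    fix \<gamma>
    show "TL (z k) (\<lambda>x y. \<beta> x y \<oplus>\<^bsub>K\<^esub> \<gamma> x y) u = TL (z k) \<beta> u \<oplus>\<^bsub>K\<^esub> TL (z k) \<gamma> u" if "bil \<gamma>"
      by (rule TL(5)[OF z \<beta> u that])
    show "TL (z k) \<beta> u = TL (z k) \<gamma> u" if "\<And>x y. x \<in> carrier L \<Longrightarrow> y \<in> carrier L \<Longrightarrow> \<beta> x y = \<gamma> x y"
      by (rule TL(7)[OF z \<beta> u that])
  qed (simp_all add: l res)
  show ?thesis using HH_nontrivial l by (intro exI[of _ "2 * l"]) auto
qed

end

theorem theorem4p4:
  fixes K :: "'k ring"
    and A :: "('k, 'a) module" and B :: "('k, 'b) module"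
    and M :: "('b, 'a, 'm) bimodule" and N :: "('a, 'b, 'n) bimodule"
    and E :: "'a set" and F :: "'b set"
    and mult_M :: "'b \<Rightarrow> 'a \<Rightarrow> nat" and mult_N :: "'a \<Rightarrow> 'b \<Rightarrow> nat"
    and L :: "('k, 'a \<times> 'n \<times> 'm \<times> 'b) module"
    and P :: "nat \<Rightarrow> ((('a \<times> 'n \<times> 'm \<times> 'b) \<times> ('a \<times> 'n \<times> 'm \<times> 'b) \<Rightarrow>\<^sub>0 int) set, 'p) module"
    and d :: "nat \<Rightarrow> 'p \<Rightarrow> 'p"
    and \<epsilon> :: "'p \<Rightarrow> 'a \<times> 'n \<times> 'm \<times> 'b"
  assumes "perfect_field K"
    and "finite_dimensional_algebra K A" and "basic_algebra A"
    and "finite_dimensional_algebra K B" and "basic_algebra B"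
    and "null_square_projective K A B M N"
    and "complete_primitive_orthogonal_idempotents A E"
    and "complete_primitive_orthogonal_idempotents B F"
    and "bimodule_isomorphic B A M (standard_projective_bimodule K B A F E mult_M)"
    and "bimodule_isomorphic A B N (standard_projective_bimodule K A B E F mult_N)"
    and "L = null_square_algebra A B M N"
    and "hochschild_resolution K L P d \<epsilon>"
    and "\<exists>n0. \<forall>n\<ge>n0. trivial_group (HH K L P d n)"
  shows "(\<forall>n>0. trivial_group (H_zero A (tensor_power A (tensor_bimodule B N M) n))) \<and>
         (\<exists>n0. \<forall>n\<ge>n0. trivial_group (add_monoid (tensor_power A (tensor_bimodule B N M) n)))"
proof -
  have algs: "k_algebra K A" "k_algebra K B" and bimods: "is_bimodule K B A M" "is_bimodule K A B N"
    using assms(6) by (auto simp: null_square_projective_def projective_bimodule_def)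
  have E: "finite E" "\<And>e. e \<in> E \<Longrightarrow> idempotent A e" and F: "finite F" "\<And>g. g \<in> F \<Longrightarrow> idempotent B g"
    using assms(7,8) by (auto simp: complete_primitive_orthogonal_idempotents_def primitive_idempotent_def)
  interpret BA: two_algebras K B A by (intro two_algebras.intro algs)
  interpret AB: two_algebras K A B by (intro two_algebras.intro algs)
  obtain genM TM where M: "coordinates K B A M {(g, e, i). g \<in> F \<and> e \<in> E \<and> i < mult_M g e} fst (fst \<circ> snd) genM TM"
    using BA.standard_coordinates[OF bimods(1) F E assms(9)] by blast
  obtain genN TN where N: "coordinates K A B N {(g, e, i). g \<in> E \<and> e \<in> F \<and> i < mult_N g e} fst (fst \<circ> snd) genN TN"
    using AB.standard_coordinates[OF bimods(2) E F assms(10)] by blast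
  interpret null_square K A B N "{(g, e, i). g \<in> E \<and> e \<in> F \<and> i < mult_N g e}" fst "fst \<circ> snd" genN TN
    M "{(g, e, i). g \<in> F \<and> e \<in> E \<and> i < mult_M g e}" fst "fst \<circ> snd" genM TM
    by (intro null_square.intro composable.intro M N BA.two_algebras_axioms)
  have "acyclic quiver"
  proof (rule ccontr)
    assume "\<not> acyclic quiver"
    then obtain l where l: "0 < l" "\<And>m. 0 < m \<Longrightarrow> \<not> trivial_group (HH K L P d (m * l))"
      using HH_nontrivial_of_loop[of P d \<epsilon>] assms(11,12) by blast
    obtain n0 where n0: "\<And>n. n0 \<le> n \<Longrightarrow> trivial_group (HH K L P d n)" using assms(13) by blast
    \<comment> \<open>The multiplier \<open>Suc n0\<close> is positive and carries the degree past
      the bound.\<close>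
    have "n0 \<le> Suc n0 * l" using l(1) by (cases l) auto
    with n0 l(2)[of "Suc n0"] show False by blast
  qed
  then show ?thesis using acyclic_H_zero acyclic_power Suc_le_eq by blast
qed

end
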